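(* Let $\underline Q\subset\underline Q^f$ be a skewed-gentle polarized quiver with a fringing, and $\mathbf x,\mathbf y\in\mathrm{Adm}(\underline Q)$. Write $\tau=\tau_{\underline Q}$ and $\tau_f=\tau_{\underline Q^f}$. (a) If $\mathbf y$ is not projective, the map $$\mathcal T_{\underline Q}(\mathbf x,\tau\mathbf y)\to\mathcal K_{\underline Q^f}(\tau_f\mathbf x,\tau_f\mathbf y),\qquad (G,\phi_q,\phi_s)\mapsto(\iota G,\pi_{\mathbf x}\phi_q,\sigma_{\mathbf y}\phi_s)$$ is a bijection from the (equivalence classes of) H-triples for $(\mathbf x,\tau\mathbf y)$ to the (equivalence classes of) K-triples for $(\tau_f\mathbf x,\tau_f\mathbf y)$, which respects the types. If $\mathbf y$ is projective, then $\mathcal K_{\underline Q^f}(\tau_f\mathbf x,\tau_f\mathbf y)=\emptyset$. (b) If $\mathbf y$ is not projective, there is a natural bijection between the set $\mathcal R_{\underline Q}(\mathbf x,\tau\mathbf y)$ of real h-lines from $\mathbf x$ to $\tau\mathbf y$ and the set of kisses from $\tau_f\mathbf x$ to $\tau_f\mathbf y$ (i.e. the kisses of $H_{\underline Q^f}(\tau_f\mathbf x,\tau_f\mathbf y)$).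
   Context: **Polarized quivers.** A skewed-gentle polarized quiver $\underline Q$ consists of finite sets $Q_0$ (vertices) and $Q_1=Q_1^{sp}\sqcup Q_1^{ord}$ (special and ordinary arrows) and injective maps $\underline s=(s,s_1),\ \underline t=(t,t_1):Q_1\to Q_0\times\{-1,1\}$, such that every special arrow is a loop $\varepsilon$ with $s_1(\varepsilon)=t_1(\varepsilon)=-1$, and such that there are only finitely many admissible paths, i.e. sequences of arrows $\alpha_1\cdots\alpha_l$ with $\underline s(\alpha_k)=-\underline t(\alpha_{k+1})$, where $-(i,\rho):=(i,-\rho)$. At each vertex $i$ there is at most one special loop, denoted $\varepsilon_i$; $Q_0^{sp}$ is the set of vertices with a special loop, $Q_0^{ord}=Q_0\setminus Q_0^{sp}$. A homomorphism of polarized quivers is a quiver homomorphism preserving $s_1,t_1$ and sending special arrows to special arrows; it is strict if it also sends ordinary arrows to ordinary arrows. **Letters and words.** The letters of $\underline Q$ are: direct letters $\alpha$ and inverse letters $\alpha^{-1}$ for $\alpha\in Q_1^{ord}$, with $\underline s(\alpha^{-1})=\underline t(\alpha)$, $\underline t(\alpha^{-1})=\underline s(\alpha)$; a special letter $\varepsilon_i^*=(\varepsilon_i^* )^{-1}$ for $i\in Q_0^{sp}$, with $\underline s=\underline t=(i,-1)$; and for each $(i,\rho)\in Q_0\times\{-1,1\}$ not of the form $(i,-1)$ with $i\in Q_0^{sp}$, a trivial letter $\mathbf 1_{i,\rho}$ with $\underline t=(i,\rho)$, $\underline s=*$, and its inverse $\mathbf 1_{i,\rho}^{-1}$ with $\underline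 s=(i,\rho)$, $\underline t=*$. Distinct letters are comparable iff they have the same $\underline t\in Q_0\times\{-1,1\}$, and then $\alpha<\mathbf 1_{i,\rho}<\beta^{-1}$. A word is a sequence of letters $w_0\cdots w_n$ with $\underline s(w_k)=-\underline t(w_{k+1})\in Q_0\times\{-1,1\}$; $\mathbf w_{[k]}:=w_0\cdots w_k$, $\mathbf w^{[k]}:=w_k\cdots w_n$, $\mathbf w^{-1}:=w_n^{-1}\cdots w_0^{-1}$. Finite or right-infinite words are compared lexicographically. A string is a word beginning with an inverse trivial letter and ending with a trivial letter. A band is a nonempty word $\mathbf w$ with $\mathbf w\mathbf w$ a word; it is primitive if not a proper power, and a primitive band is symmetric if its inverse is one of its rotations $\mathbf w^{[k+1]}\mathbf w_{[k]}$. **Admissible words.** $\underline{\widehat Q}$ is the gentle polarized quiver with the same vertices, arrows and $\underline s,\underline t$ as $\underline Q$, but with all arrows ordinary; so for $i\in Q_0^{sp}$ it has letters $\varepsilon_i\prec\mathbf 1_{i,-1}\prec\varepsilon_i^{-1}$ (its order is written $\prec$); $\mathbf 1_{i,-1}^{\pm1}$ with $i\in Q_0^{sp}$ are called punctured. $F$ maps words of $\underline{\widehat Q}$ to words of $\underline Q$ letterwise, $\varepsilon_i^{\pm1},\mathbf 1_{i,-1}^{\pm1}\mapsto\varepsilon_i^*$ ($i\in Q_0^{sp}$), other letters fixed. A string $x_0\cdots x_l$ of $\underline{\widehat Q}$ has type $(a,b)\in\{u,p\}^2$, $a=p$ (resp. $b=p$) iff $x_0$ (resp. $x_l$) is punctured;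 bands have type $(b)$. The completion $\overline{\mathbf x}$ is $F(\mathbf x)$ for types $(u,u)$ and $(b)$; $F(\mathbf x)F(x_{l-1}^{-1}\cdots x_0^{-1})$ for $(u,p)$; $F(x_l^{-1}\cdots x_1^{-1})F(\mathbf x)$ for $(p,u)$; $F(\mathbf x)F(x_{l-1}^{-1}\cdots x_1^{-1})$ for $(p,p)$. A string $\mathbf x=x_0\cdots x_n$ of $\underline{\widehat Q}$ is admissible if for all $0<k<n$ with $F(x_k)$ special one has $\mathbf x_{[k-1]}^{-1}\ne\mathbf x^{[k+1]}$ and $x_k$ is direct iff $\mathbf x_{[k-1]}^{-1}\succ\mathbf x^{[k+1]}$, and, for type $(p,p)$, $\overline{\mathbf x}$ is a primitive band. A band $\mathbf x=x_0\cdots x_n$ of $\underline{\widehat Q}$ is admissible if for all $k$ with $F(x_k)$ special, $\mathbf z:=\mathbf x^{[k+1]}\mathbf x_{[k-1]}$ satisfies $\mathbf z^{-1}\neq\mathbf z$ and $x_k$ is direct iff $\mathbf z^{-1}\succ\mathbf z$, and $F(\mathbf x)$ is a primitive asymmetric band. $\mathrm{Adm}(\underline Q)$ is the set of admissible strings and bands. For every string $\mathbf w$ of $\underline Q$ there is an admissible string with completion $\mathbf w$: exactly one, of type $(u,u)$, if $\mathbf w\neq\mathbf w^{-1}$, and exactly two, of types $(u,p)$ and $(p,u)$ and inverse to each other, if $\mathbf w=\mathbf w^{-1}$. **The operator $\tau_{\underline Q}$.** For a trivial letter $\mathbf 1_{i,\rho}$ let $\mathrm{St}_{(i,\rho)}(\underline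 Q)$ be the set of strings of $\underline Q$ with first letter $\mathbf 1_{i,\rho}^{-1}$, linearly ordered lexicographically, with maximal element $\mathbf 1_{i,\rho}^{-1}\mathbf w^{\max}_{i,\rho}$. For a non-maximal $\mathbf w\in\mathrm{St}_{(i,\rho)}(\underline Q)$ let $\mathbf w[1]$ be its immediate successor, and let $[1]\mathbf w:=(\mathbf w^{-1}[1])^{-1}$ when defined. The projective strings are $(\mathbf w^{\max}_{i,-\rho})^{-1}\mathbf w^{\max}_{i,\rho}$ for $i\in Q_0^{ord}$, $\rho=\pm1$, and $(\mathbf w')^{-1}\varepsilon_i^*\mathbf w'$ for $i\in Q_0^{sp}$, where $\mathbf w^{\max}_{i,1}=\varepsilon_i^*\mathbf w'$. For a non-projective string $\mathbf w$, $\tau_{\underline Q}(\mathbf w):=[1](\mathbf w[1])$ or $([1]\mathbf w)[1]$, whichever is defined (at least one is, and they agree if both are). For $\mathbf x\in\mathrm{Adm}(\underline Q)$ of type $(p,p)$ or $(b)$, $\tau_{\underline Q}(\mathbf x):=\mathbf x$. For other $\mathbf x$, $\mathbf x$ is called projective if $\overline{\mathbf x}$ is a projective string; if not projective, $\tau_{\underline Q}(\mathbf x)$ is the admissible string of the same type as $\mathbf x$ with completion $\tau_{\underline Q}(\overline{\mathbf x})$. **Fringing.** An inclusion $\underline Q\subset\underline Q^f$ of skewed-gentle polarized quivers is a fringing if (1) for each $i\in Q_0$ the number of arrows of $\underline Q^f$ starting at $i$ plus the number of arrows of $\underline Q^f$ ending at $i$ is $4$; (2) each arrow $\alpha\in Q_1^f\setminus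 Q_1$ either has $s(\alpha)\in Q_0$ and $\underline t(\alpha)\in(Q_0^f\setminus Q_0)\times\{+1\}$, or has $\underline s(\alpha)\in(Q_0^f\setminus Q_0)\times\{+1\}$ and $t(\alpha)\in Q_0$. One has $\mathrm{Adm}(\underline Q)\subset\mathrm{Adm}(\underline Q^f)$, and no element of $\mathrm{Adm}(\underline Q)$ is projective for $\underline Q^f$; $\iota:\underline Q\to\underline Q^f$ is the inclusion. **The quivers $H(\mathbf x)$.** For an admissible string $\mathbf x=x_0\cdots x_n$, $H(\mathbf x)$ has vertices $1,\dots,n$, for $1\le i\le n-1$ an ordinary arrow $\nu_i$, which is $i+1\to i$ with $G_{\mathbf x}(\nu_i)=x_i$ if $x_i$ is direct, and $i\to i+1$ with $G_{\mathbf x}(\nu_i)=x_i^{-1}$ if $x_i$ is inverse; a special loop $\eta_0$ at $1$ iff $x_0$ is punctured, and a special loop $\eta_1$ at $n$ iff $x_n$ is punctured, sent by $G_{\mathbf x}$ to the special loop of $\underline Q$ at $s(x_0)$ resp. $t(x_n)$. $G_{\mathbf x}(i)=t(x_i)$. For an admissible band $x_0\cdots x_n$, $H(\mathbf x)$ is a cycle with vertices $0,\dots,n$ and ordinary arrows $\nu_i$ ($0\le i\le n$) between $i$ and $i+1$ (mod $n+1$) oriented and mapped by the same rule, $G_{\mathbf x}(i)=t(x_i)$. The polarization of arrows of $H(\mathbf x)$ is that of their images. A boundary vertex of a quiver $H$ is a vertex with at most one incident arrow (a loop counted once). **Reading words.** $\overline{\overline{\mathbf x}}$ is the word $\overline{\mathbf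 x}$ if $\mathbf x$ is a string not of type $(p,p)$, and the bi-infinite periodic word $\cdots\overline{\mathbf x}\,\overline{\mathbf x}\,\overline{\mathbf x}\cdots$ otherwise; its letters are indexed such that $\overline{\overline x}_k=F(x_k)$ for the letters of $\mathbf x$ itself (in the periodic cases the copy of $\overline{\mathbf x}$ starting at index $0$). For a vertex $i$ of $H(\mathbf x)$ and $\rho\in\{-1,1\}$, $\overline{\overline{\mathbf x}}(i,\rho)$ is $\overline{\overline x}_i\overline{\overline x}_{i+1}\cdots$ if $t_1(\overline{\overline x}_i)=\rho$, and $\overline{\overline x}_{i-1}^{-1}\overline{\overline x}_{i-2}^{-1}\cdots$ if $t_1(\overline{\overline x}_i)=-\rho$. **Real h-lines and kisses.** $H_{\underline Q}(\mathbf x,\mathbf y)$ has vertices $(j,i)\in H_0(\mathbf y)\times H_0(\mathbf x)$ with $G_{\mathbf y}(j)=G_{\mathbf x}(i)$ and arrows: $H_{1,+}$: $(\beta,\alpha)_+:(s\beta,s\alpha)\to(t\beta,t\alpha)$ for $\beta,\alpha$ both ordinary or both special with $G_{\mathbf y}(\beta)=G_{\mathbf x}(\alpha)$; $H_{1,\times}$: $(\nu,\mu)_\times:(t\nu,s\mu)\to(s\nu,t\mu)$ for $\nu,\mu$ ordinary with $G_{\mathbf y}(\nu)=G_{\mathbf x}(\mu)\in Q_1^{sp}$; $H_{1,o}$: $(\nu,\eta)_\ominus:(t\nu,s\eta)\to(s\nu,t\eta)$ for $\nu$ ordinary in $H(\mathbf y)$, $\eta$ special in $H(\mathbf x)$,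 $G_{\mathbf y}(\nu)=G_{\mathbf x}(\eta)$, and $(\eta,\mu)_\oplus:(s\eta,s\mu)\to(t\eta,t\mu)$ for $\eta$ special in $H(\mathbf y)$, $\mu$ ordinary in $H(\mathbf x)$, $G_{\mathbf y}(\eta)=G_{\mathbf x}(\mu)$. A vertex $(j,i)$ is red if for some $\rho\in\{-1,1\}$ the first letter of $\overline{\overline{\mathbf y}}(j,\rho)$ is strictly larger than that of $\overline{\overline{\mathbf x}}(i,\rho)$; orange if it is the target of an arrow in $H_{1,\times}$; purple if it is the target of an arrow in $H_{1,o}$. A real h-line is a connected component, without red, orange or purple vertices, of the subquiver with all vertices and the arrows $H_{1,+}$; $\mathcal R_{\underline Q}(\mathbf x,\mathbf y)$ is the set of these. A real h-line is a kiss if for none of its endpoints $(j,i)$ (boundary vertices of the component as a quiver) is $j$ a boundary vertex of $H(\mathbf y)$ or $i$ a boundary vertex of $H(\mathbf x)$. **Windings and triples.** A skewed-gentle polarized quiver $\underline H$ is hereditary if its underlying graph is of type $\mathsf A_n$ (path), $\mathsf D'_n$ (path with a loop at one end), $\widetilde{\mathsf A}_n$ (cycle) or $\widetilde{\mathsf D}'_n$ (path with a loop at each end), all loops are special, and $s_1(\alpha)=-t_1(\beta)$ for any two different arrows with $s(\alpha)=t(\beta)$. For homomorphisms $G:\underline H\to\underline Q$, $G':\underline H'\to\underline Q$ with $\underline H,\underline H'$ hereditary, a morphism $\phi:G\to G'$ is a strict homomorphism $\phi:\underline H\to\underline H'$ with $G'\phi=G$. A winding of $\underline Q$ is a homomorphism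 $G:\underline H(G)\to\underline Q$ with $\underline H(G)$ hereditary such that, if $\underline H(G)$ is of type $\widetilde{\mathsf A}$ or $\widetilde{\mathsf D}'$, every morphism of windings starting in $G$ is an isomorphism. Properties of a morphism $\phi:G\to G'$, $G:\underline H\to\underline Q$, $G':\underline H'\to\underline Q$: (q) if $j$ is a boundary vertex of $\underline H$ and $\alpha'$ an ordinary arrow of $\underline H'$ with $t(\alpha')=\phi(j)$, then $\alpha'=\phi(\alpha)$ for some $\alpha$; (s) if $j$ is a boundary vertex of $\underline H$ and $\beta'$ an ordinary arrow of $\underline H'$ with $s(\beta')=\phi(j)$, then $\beta'=\phi(\beta)$ for some $\beta$; (K) if $j$ is a boundary vertex of $\underline H$, then $\phi(j)$ is not a boundary vertex of $\underline H'$. An H-triple for $(\mathbf x,\mathbf y)$ (over $\underline Q$) is $(G,\phi_q,\phi_s)$ with $G$ a winding, $\phi_q:G\to G_{\mathbf x}$ with (q), $\phi_s:G\to G_{\mathbf y}$ with (s), such that a vertex $j$ of $\underline H(G)$ carries a special loop whenever both $\phi_q(j)$ and $\phi_s(j)$ do. It is a K-triple if $\phi_q,\phi_s$ both have (K). $(G,\phi_q,\phi_s)$ and $(G',\phi_q',\phi_s')$ are equivalent if there is an isomorphism of windings $\psi:G\to G'$ with $\phi_q=\phi_q'\psi$, $\phi_s=\phi_s'\psi$. $\mathcal T_{\underline Q}(\mathbf x,\mathbf y)$ resp. $\mathcal K_{\underline Q}(\mathbf x,\mathbf y)$ denote the sets of equivalence classes of H-triples resp. K-triples; the type of a triple is the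 type of $\underline H(G)$. **The embeddings $\pi_{\mathbf x}$, $\sigma_{\mathbf y}$.** For $\mathbf x$ of type $(p,p)$ or $(b)$, $\tau\mathbf x=\tau_f\mathbf x=\mathbf x$ and $\pi_{\mathbf x}=\sigma_{\mathbf x}=\mathrm{id}$. Otherwise $\tau_f\mathbf x$ arises from $\mathbf x$ by replacing at each unpunctured end the trivial letter by a cohook (at the right end: $\mathbf 1_{j,\sigma}$ is replaced by $\alpha^{-1}\beta_1\cdots\beta_m\mathbf 1$ with $\alpha^{-1}$ the inverse letter of $\underline Q^f$ with $\underline t(\alpha^{-1})=(j,\sigma)$ followed by the longest possible sequence of non-inverse letters, ending at a vertex of $Q^f_0\setminus Q_0$), so $\underline H(\mathbf x)$ is identified with a full subquiver of $\underline H(\tau_f\mathbf x)$, and $\pi_{\mathbf x}:\iota G_{\mathbf x}\to G_{\tau_f\mathbf x}$ is this inclusion. For $\mathbf y$ not projective, at each unpunctured end $\tau\mathbf y$ arises from $\mathbf y$ either by adding a cohook in $\underline Q$, in which case $\tau_f\mathbf y$ has at this end exactly one further (fringe) arrow, or by removing a hook (at the right end: a final piece $\beta'\alpha_1'^{-1}\cdots\alpha_h'^{-1}$, with $\beta'$ an ordinary direct letter), in which case $\tau_f\mathbf y$ has at this end the removed hook followed by a fringe arrow; thus $\underline H(\tau\mathbf y)$ is identified with a full subquiver of $\underline H(\tau_f\mathbf y)$, and $\sigma_{\mathbf y}:\iota G_{\tau\mathbf y}\to G_{\tau_f\mathbf y}$ is this inclusion. *)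

theory Defs
  imports Main
begin

section \<open>Skewed-gentle polarized quivers\<close>

text \<open>Signs are the integers \<open>-1\<close> and \<open>1\<close>; \<open>pso\<close> and \<open>pta\<close> are the polarized source and
  target maps (written s and t with an underline in the literature), with values in
  \<open>Q\<^sub>0 \<times> {-1, 1}\<close> on the arrows of a skewed-gentle polarized quiver.\<close>

record ('v, 'a) pquiver =
  verts :: "'v set"
  sparr :: "'a set"
  ordarr :: "'a set"
  pso :: "'a \<Rightarrow> 'v \<times> int"
  pta :: "'a \<Rightarrow> 'v \<times> int"

definition arrs :: "('v, 'a) pquiver \<Rightarrow> 'a set" where
  "arrs Q = sparr Q \<union> ordarr Q"

definition src :: "('v, 'a) pquiver \<Rightarrow> 'a \<Rightarrow> 'v" where "src Q a = fst (pso Q a)"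
definition spol :: "('v, 'a) pquiver \<Rightarrow> 'a \<Rightarrow> int" where "spol Q a = snd (pso Q a)"
definition tgt :: "('v, 'a) pquiver \<Rightarrow> 'a \<Rightarrow> 'v" where "tgt Q a = fst (pta Q a)"
definition tpol :: "('v, 'a) pquiver \<Rightarrow> 'a \<Rightarrow> int" where "tpol Q a = snd (pta Q a)"

definition opp :: "'v \<times> int \<Rightarrow> 'v \<times> int" where
  "opp p = (fst p, - snd p)"

definition adm_path :: "('v, 'a) pquiver \<Rightarrow> 'a list \<Rightarrow> bool" where
  "adm_path Q p \<longleftrightarrow> set p \<subseteq> arrs Q \<and>
     (\<forall>k. Suc k < length p \<longrightarrow> pso Q (p ! k) = opp (pta Q (p ! Suc k)))"

definition skewed_gentle :: "('v, 'a) pquiver \<Rightarrow> bool" where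
  "skewed_gentle Q \<longleftrightarrow>
     finite (verts Q) \<and> finite (sparr Q) \<and> finite (ordarr Q) \<and> sparr Q \<inter> ordarr Q = {} \<and>
     pso Q ` arrs Q \<subseteq> verts Q \<times> {-1, 1} \<and> pta Q ` arrs Q \<subseteq> verts Q \<times> {-1, 1} \<and>
     inj_on (pso Q) (arrs Q) \<and> inj_on (pta Q) (arrs Q) \<and>
     (\<forall>e\<in>sparr Q. src Q e = tgt Q e \<and> spol Q e = -1 \<and> tpol Q e = -1) \<and>
     finite {p. adm_path Q p}"

definition spverts :: "('v, 'a) pquiver \<Rightarrow> 'v set" where
  "spverts Q = src Q ` sparr Q"

definition sploop :: "('v, 'a) pquiver \<Rightarrow> 'v \<Rightarrow> 'a" where
  "sploop Q i = (THE e. e \<in> sparr Q \<and> src Q e = i)"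

text \<open>A vertex with at most one incident arrow; loops count once.\<close>

definition boundary :: "('v, 'a) pquiver \<Rightarrow> 'v \<Rightarrow> bool" where
  "boundary H j \<longleftrightarrow> j \<in> verts H \<and> card {a \<in> arrs H. src H a = j \<or> tgt H a = j} \<le> 1"

text \<open>The inclusion of \<open>Q\<close> into \<open>Qf\<close> is an inclusion of sets of vertices, of special arrows and
  of ordinary arrows, compatible with the polarized source and target maps.\<close>

definition fringing :: "('v, 'a) pquiver \<Rightarrow> ('v, 'a) pquiver \<Rightarrow> bool" where
  "fringing Q Qf \<longleftrightarrow>
     skewed_gentle Q \<and> skewed_gentle Qf \<and>
     verts Q \<subseteq> verts Qf \<and> sparr Q \<subseteq> sparr Qf \<and> ordarr Q \<subseteq> ordarr Qf \<and>
     (\<forall>a\<in>arrs Q. pso Qf a = pso Q a \<and> pta Qf a = pta Q a) \<and>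
     (\<forall>i\<in>verts Q. card {a \<in> arrs Qf. src Qf a = i} + card {a \<in> arrs Qf. tgt Qf a = i} = 4) \<and>
     (\<forall>a\<in>arrs Qf - arrs Q.
        src Qf a \<in> verts Q \<and> pta Qf a \<in> (verts Qf - verts Q) \<times> {1} \<or>
        pso Qf a \<in> (verts Qf - verts Q) \<times> {1} \<and> tgt Qf a \<in> verts Q)"


section \<open>Letters and words\<close>

text \<open>\<open>Dir\<close> and \<open>Inv\<close> are direct and inverse letters, \<open>Spl i\<close> is the special letter
  \<open>\<epsilon>\<^sub>i\<^sup>*\<close>, \<open>Tr i \<rho>\<close> the trivial letter at \<open>(i, \<rho>)\<close> and \<open>TrI i \<rho>\<close> its
  inverse. The value \<open>None\<close> of the polarized source or target of a letter is the symbol \<open>*\<close>.\<close>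

datatype ('v, 'a) letter = Dir 'a | Inv 'a | Spl 'v | Tr 'v int | TrI 'v int

fun lso :: "('v, 'a) pquiver \<Rightarrow> ('v, 'a) letter \<Rightarrow> ('v \<times> int) option" where
  "lso Q (Dir a) = Some (pso Q a)"
| "lso Q (Inv a) = Some (pta Q a)"
| "lso Q (Spl i) = Some (i, -1)"
| "lso Q (Tr i r) = None"
| "lso Q (TrI i r) = Some (i, r)"

fun lta :: "('v, 'a) pquiver \<Rightarrow> ('v, 'a) letter \<Rightarrow> ('v \<times> int) option" where
  "lta Q (Dir a) = Some (pta Q a)"
| "lta Q (Inv a) = Some (pso Q a)"
| "lta Q (Spl i) = Some (i, -1)"
| "lta Q (Tr i r) = Some (i, r)"
| "lta Q (TrI i r) = None"

fun linv :: "('v, 'a) letter \<Rightarrow> ('v, 'a) letter" where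
  "linv (Dir a) = Inv a"
| "linv (Inv a) = Dir a"
| "linv (Spl i) = Spl i"
| "linv (Tr i r) = TrI i r"
| "linv (TrI i r) = Tr i r"

definition letters :: "('v, 'a) pquiver \<Rightarrow> ('v, 'a) letter set" where
  "letters Q = Dir ` ordarr Q \<union> Inv ` ordarr Q \<union> Spl ` spverts Q \<union>
     {l. \<exists>i\<in>verts Q. \<exists>r\<in>{-1, 1}. \<not> (i \<in> spverts Q \<and> r = -1) \<and> (l = Tr i r \<or> l = TrI i r)}"

text \<open>Letters with the same polarized target are ordered as direct < trivial < inverse. (A special
  letter is the only letter with its polarized target, so its rank is irrelevant.)\<close>

fun lrank :: "('v, 'a) letter \<Rightarrow> nat" where
  "lrank (Dir a) = 0"
| "lrank (Inv a) = 2"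
| "lrank _ = 1"

definition lless :: "('v, 'a) pquiver \<Rightarrow> ('v, 'a) letter \<Rightarrow> ('v, 'a) letter \<Rightarrow> bool" where
  "lless Q a b \<longleftrightarrow> lta Q a \<noteq> None \<and> lta Q a = lta Q b \<and> lrank a < lrank b"

type_synonym ('v, 'a) word = "('v, 'a) letter list"

definition is_word :: "('v, 'a) pquiver \<Rightarrow> ('v, 'a) word \<Rightarrow> bool" where
  "is_word Q w \<longleftrightarrow> set w \<subseteq> letters Q \<and>
     (\<forall>k. Suc k < length w \<longrightarrow>
        (\<exists>p q. lso Q (w ! k) = Some p \<and> lta Q (w ! Suc k) = Some q \<and> p = opp q))"

definition winv :: "('v, 'a) word \<Rightarrow> ('v, 'a) word" where
  "winv w = rev (map linv w)"

definition wless :: "('v, 'a) pquiver \<Rightarrow> ('v, 'a) word \<Rightarrow> ('v, 'a) word \<Rightarrow> bool" where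
  "wless Q v w \<longleftrightarrow>
     (\<exists>k. k < length v \<and> k < length w \<and> take k v = take k w \<and> lless Q (v ! k) (w ! k))"

definition is_string :: "('v, 'a) pquiver \<Rightarrow> ('v, 'a) word \<Rightarrow> bool" where
  "is_string Q w \<longleftrightarrow> w \<noteq> [] \<and> is_word Q w \<and> (\<exists>i r. hd w = TrI i r) \<and> (\<exists>i r. last w = Tr i r)"

definition is_band :: "('v, 'a) pquiver \<Rightarrow> ('v, 'a) word \<Rightarrow> bool" where
  "is_band Q w \<longleftrightarrow> w \<noteq> [] \<and> is_word Q (w @ w)"

definition primitive_band :: "('v, 'a) pquiver \<Rightarrow> ('v, 'a) word \<Rightarrow> bool" where
  "primitive_band Q w \<longleftrightarrow> is_band Q w \<and> \<not> (\<exists>v m. m \<ge> 2 \<and> w = concat (replicate m v))"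

definition symmetric_band :: "('v, 'a) word \<Rightarrow> bool" where
  "symmetric_band w \<longleftrightarrow> (\<exists>k<length w. winv w = drop (Suc k) w @ take (Suc k) w)"


section \<open>Admissible words\<close>

definition hat :: "('v, 'a) pquiver \<Rightarrow> ('v, 'a) pquiver" where
  "hat Q = Q\<lparr>sparr := {}, ordarr := arrs Q\<rparr>"

fun Flet :: "('v, 'a) pquiver \<Rightarrow> ('v, 'a) letter \<Rightarrow> ('v, 'a) letter" where
  "Flet Q (Dir a) = (if a \<in> sparr Q then Spl (src Q a) else Dir a)"
| "Flet Q (Inv a) = (if a \<in> sparr Q then Spl (src Q a) else Inv a)"
| "Flet Q (Spl i) = Spl i"
| "Flet Q (Tr i r) = (if i \<in> spverts Q \<and> r = -1 then Spl i else Tr i r)"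
| "Flet Q (TrI i r) = (if i \<in> spverts Q \<and> r = -1 then Spl i else TrI i r)"

definition Fword :: "('v, 'a) pquiver \<Rightarrow> ('v, 'a) word \<Rightarrow> ('v, 'a) word" where
  "Fword Q w = map (Flet Q) w"

definition is_spl :: "('v, 'a) letter \<Rightarrow> bool" where "is_spl l \<longleftrightarrow> (\<exists>i. l = Spl i)"
definition is_dir :: "('v, 'a) letter \<Rightarrow> bool" where "is_dir l \<longleftrightarrow> (\<exists>a. l = Dir a)"

text \<open>Whether the first (last) letter is punctured. A string of \<open>hat Q\<close> has type \<open>(a, b)\<close> with
  \<open>a = p\<close> iff \<open>lpunct\<close> and \<open>b = p\<close> iff \<open>rpunct\<close>; both are false for bands.\<close>

definition lpunct :: "('v, 'a) pquiver \<Rightarrow> ('v, 'a) word \<Rightarrow> bool" where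
  "lpunct Q x \<longleftrightarrow> (\<exists>i\<in>spverts Q. hd x = TrI i (-1))"

definition rpunct :: "('v, 'a) pquiver \<Rightarrow> ('v, 'a) word \<Rightarrow> bool" where
  "rpunct Q x \<longleftrightarrow> (\<exists>i\<in>spverts Q. last x = Tr i (-1))"

definition completion :: "('v, 'a) pquiver \<Rightarrow> ('v, 'a) word \<Rightarrow> ('v, 'a) word" where
  "completion Q x =
     (if lpunct Q x then
        (if rpunct Q x then Fword Q x @ Fword Q (winv (butlast (tl x)))
         else Fword Q (winv (tl x)) @ Fword Q x)
      else
        (if rpunct Q x then Fword Q x @ Fword Q (winv (butlast x))
         else Fword Q x))"

definition adm_string :: "('v, 'a) pquiver \<Rightarrow> ('v, 'a) word \<Rightarrow> bool" where
  "adm_string Q x \<longleftrightarrow> is_string (hat Q) x \<and>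
     (\<forall>k. 0 < k \<and> k < length x - 1 \<and> is_spl (Flet Q (x ! k)) \<longrightarrow>
        winv (take k x) \<noteq> drop (Suc k) x \<and>
        (is_dir (x ! k) \<longleftrightarrow> wless (hat Q) (drop (Suc k) x) (winv (take k x)))) \<and>
     (lpunct Q x \<and> rpunct Q x \<longrightarrow> primitive_band Q (completion Q x))"

definition adm_band :: "('v, 'a) pquiver \<Rightarrow> ('v, 'a) word \<Rightarrow> bool" where
  "adm_band Q x \<longleftrightarrow> is_band (hat Q) x \<and>
     (\<forall>k<length x. is_spl (Flet Q (x ! k)) \<longrightarrow>
        (let z = drop (Suc k) x @ take k x in
           winv z \<noteq> z \<and> (is_dir (x ! k) \<longleftrightarrow> wless (hat Q) z (winv z)))) \<and>
     primitive_band Q (Fword Q x) \<and> \<not> symmetric_band (Fword Q x)"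

definition Adm :: "('v, 'a) pquiver \<Rightarrow> ('v, 'a) word set" where
  "Adm Q = {x. adm_string Q x \<or> adm_band Q x}"

text \<open>The admissible words of type \<open>(p, p)\<close> or \<open>(b)\<close>.\<close>

definition closed_type :: "('v, 'a) pquiver \<Rightarrow> ('v, 'a) word \<Rightarrow> bool" where
  "closed_type Q x \<longleftrightarrow> is_band (hat Q) x \<or> lpunct Q x \<and> rpunct Q x"


section \<open>The operator tau\<close>

definition St :: "('v, 'a) pquiver \<Rightarrow> 'v \<Rightarrow> int \<Rightarrow> ('v, 'a) word set" where
  "St Q i r = {w. is_string Q w \<and> hd w = TrI i r}"

definition is_max :: "('v, 'a) pquiver \<Rightarrow> ('v, 'a) word \<Rightarrow> bool" where
  "is_max Q w \<longleftrightarrow> (\<exists>i r. w \<in> St Q i r \<and> (\<forall>v\<in>St Q i r. \<not> wless Q w v))"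

definition wmax :: "('v, 'a) pquiver \<Rightarrow> 'v \<Rightarrow> int \<Rightarrow> ('v, 'a) word" where
  "wmax Q i r = (THE u. TrI i r # u \<in> St Q i r \<and> is_max Q (TrI i r # u))"

definition is_succ :: "('v, 'a) pquiver \<Rightarrow> ('v, 'a) word \<Rightarrow> ('v, 'a) word \<Rightarrow> bool" where
  "is_succ Q w w' \<longleftrightarrow> (\<exists>i r. w \<in> St Q i r \<and> w' \<in> St Q i r \<and> wless Q w w' \<and>
     \<not> (\<exists>v\<in>St Q i r. wless Q w v \<and> wless Q v w'))"

text \<open>\<open>rsucc Q w\<close> and \<open>lsucc Q w\<close> are \<open>w[1]\<close> and \<open>[1]w\<close>, with \<open>None\<close> for undefined.\<close>

definition rsucc :: "('v, 'a) pquiver \<Rightarrow> ('v, 'a) word \<Rightarrow> ('v, 'a) word option" where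
  "rsucc Q w = (if is_max Q w then None else Some (THE w'. is_succ Q w w'))"

definition lsucc :: "('v, 'a) pquiver \<Rightarrow> ('v, 'a) word \<Rightarrow> ('v, 'a) word option" where
  "lsucc Q w = map_option winv (rsucc Q (winv w))"

definition proj_string :: "('v, 'a) pquiver \<Rightarrow> ('v, 'a) word \<Rightarrow> bool" where
  "proj_string Q w \<longleftrightarrow>
     (\<exists>i\<in>verts Q - spverts Q. \<exists>r\<in>{-1, 1}. w = winv (wmax Q i (- r)) @ wmax Q i r) \<or>
     (\<exists>i\<in>spverts Q. \<exists>w'. wmax Q i 1 = Spl i # w' \<and> w = winv w' @ [Spl i] @ w')"

definition tau_string :: "('v, 'a) pquiver \<Rightarrow> ('v, 'a) word \<Rightarrow> ('v, 'a) word" where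
  "tau_string Q w =
     (case Option.bind (rsucc Q w) (lsucc Q) of
        Some v \<Rightarrow> v
      | None \<Rightarrow> the (Option.bind (lsucc Q w) (rsucc Q)))"

definition projective :: "('v, 'a) pquiver \<Rightarrow> ('v, 'a) word \<Rightarrow> bool" where
  "projective Q x \<longleftrightarrow> \<not> closed_type Q x \<and> proj_string Q (completion Q x)"

definition tau :: "('v, 'a) pquiver \<Rightarrow> ('v, 'a) word \<Rightarrow> ('v, 'a) word" where
  "tau Q x = (if closed_type Q x then x else
     (THE z. adm_string Q z \<and> lpunct Q z = lpunct Q x \<and> rpunct Q z = rpunct Q x \<and>
             completion Q z = tau_string Q (completion Q x)))"


section \<open>Homomorphisms, hereditary quivers and windings\<close>

text \<open>A homomorphism is a pair of maps, on vertices and on arrows. Only the values on the vertices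
  and arrows of the domain are relevant.\<close>

type_synonym ('v, 'a, 'w, 'b) qmap = "('v \<Rightarrow> 'w) \<times> ('a \<Rightarrow> 'b)"

definition qcomp :: "('w, 'b, 'u, 'c) qmap \<Rightarrow> ('v, 'a, 'w, 'b) qmap \<Rightarrow> ('v, 'a, 'u, 'c) qmap" where
  "qcomp g f = (fst g \<circ> fst f, snd g \<circ> snd f)"

definition qmap_eq :: "('v, 'a) pquiver \<Rightarrow> ('v, 'a, 'w, 'b) qmap \<Rightarrow> ('v, 'a, 'w, 'b) qmap \<Rightarrow> bool" where
  "qmap_eq H f g \<longleftrightarrow> (\<forall>i\<in>verts H. fst f i = fst g i) \<and> (\<forall>a\<in>arrs H. snd f a = snd g a)"

definition pq_hom :: "('v, 'a) pquiver \<Rightarrow> ('w, 'b) pquiver \<Rightarrow> ('v, 'a, 'w, 'b) qmap \<Rightarrow> bool" where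
  "pq_hom H Q f \<longleftrightarrow>
     fst f ` verts H \<subseteq> verts Q \<and> snd f ` arrs H \<subseteq> arrs Q \<and> snd f ` sparr H \<subseteq> sparr Q \<and>
     (\<forall>a\<in>arrs H. src Q (snd f a) = fst f (src H a) \<and> tgt Q (snd f a) = fst f (tgt H a) \<and>
        spol Q (snd f a) = spol H a \<and> tpol Q (snd f a) = tpol H a)"

definition strict_hom :: "('v, 'a) pquiver \<Rightarrow> ('w, 'b) pquiver \<Rightarrow> ('v, 'a, 'w, 'b) qmap \<Rightarrow> bool" where
  "strict_hom H Q f \<longleftrightarrow> pq_hom H Q f \<and> snd f ` ordarr H \<subseteq> ordarr Q"

text \<open>Types of the underlying graphs; the parameter counts the vertices. \<open>TyA\<close>: path, \<open>TyD\<close>: path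
  with a loop at one end, \<open>TyAt\<close>: cycle, \<open>TyDt\<close>: path with a loop at each end.\<close>

datatype gtype = TyA nat | TyD nat | TyAt nat | TyDt nat

definition joins :: "('v, 'a) pquiver \<Rightarrow> 'a \<Rightarrow> 'v \<Rightarrow> 'v \<Rightarrow> bool" where
  "joins H a u v \<longleftrightarrow> {src H a, tgt H a} = {u, v}"

definition linear_on :: "('v, 'a) pquiver \<Rightarrow> nat \<Rightarrow> (nat \<Rightarrow> 'v) \<Rightarrow> (nat \<Rightarrow> 'a) \<Rightarrow> bool" where
  "linear_on H n v e \<longleftrightarrow> n \<ge> 1 \<and> bij_betw v {1..n} (verts H) \<and> inj_on e {1..<n} \<and>
     (\<forall>k\<in>{1..<n}. joins H (e k) (v k) (v (Suc k)))"

fun has_gtype :: "('v, 'a) pquiver \<Rightarrow> gtype \<Rightarrow> bool" where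
  "has_gtype H (TyA n) = (\<exists>v e. linear_on H n v e \<and> arrs H = e ` {1..<n})"
| "has_gtype H (TyD n) = (\<exists>v e l. linear_on H n v e \<and> arrs H = e ` {1..<n} \<union> {l} \<and>
     src H l = v n \<and> tgt H l = v n)"
| "has_gtype H (TyAt n) = (n \<ge> 2 \<and> (\<exists>v e. bij_betw v {1..n} (verts H) \<and> bij_betw e {1..n} (arrs H) \<and>
     (\<forall>k\<in>{1..n}. joins H (e k) (v k) (v (if k < n then Suc k else 1)))))"
| "has_gtype H (TyDt n) = (n \<ge> 2 \<and> (\<exists>v e l l'. linear_on H n v e \<and> arrs H = e ` {1..<n} \<union> {l, l'} \<and>
     src H l = v 1 \<and> tgt H l = v 1 \<and> src H l' = v n \<and> tgt H l' = v n))"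

definition hereditary :: "('v, 'a) pquiver \<Rightarrow> bool" where
  "hereditary H \<longleftrightarrow> skewed_gentle H \<and> (\<exists>ty. has_gtype H ty) \<and>
     (\<forall>a\<in>arrs H. src H a = tgt H a \<longrightarrow> a \<in> sparr H) \<and>
     (\<forall>a\<in>arrs H. \<forall>b\<in>arrs H. a \<noteq> b \<and> src H a = tgt H b \<longrightarrow> spol H a = - tpol H b)"

text \<open>\<open>is_mor H G H' G' f\<close>: \<open>f\<close> is a morphism from \<open>G\<close> (with domain \<open>H\<close>) to \<open>G'\<close> (with domain \<open>H'\<close>).\<close>

definition is_mor :: "('v, 'a) pquiver \<Rightarrow> ('v, 'a, 'u, 'c) qmap \<Rightarrow>
    ('w, 'b) pquiver \<Rightarrow> ('w, 'b, 'u, 'c) qmap \<Rightarrow> ('v, 'a, 'w, 'b) qmap \<Rightarrow> bool" where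
  "is_mor H G H' G' f \<longleftrightarrow> strict_hom H H' f \<and> qmap_eq H (qcomp G' f) G"

definition is_iso :: "('v, 'a) pquiver \<Rightarrow> ('v, 'a, 'u, 'c) qmap \<Rightarrow>
    ('w, 'b) pquiver \<Rightarrow> ('w, 'b, 'u, 'c) qmap \<Rightarrow> ('v, 'a, 'w, 'b) qmap \<Rightarrow> bool" where
  "is_iso H G H' G' f \<longleftrightarrow> is_mor H G H' G' f \<and>
     (\<exists>g. is_mor H' G' H G g \<and> qmap_eq H (qcomp g f) (id, id) \<and> qmap_eq H' (qcomp f g) (id, id))"

text \<open>Hereditary quivers are finite, so that up to isomorphism their vertices and arrows may be
  taken to be natural numbers.\<close>

definition winding :: "('v, 'a) pquiver \<Rightarrow> (nat, nat) pquiver \<Rightarrow> (nat, nat, 'v, 'a) qmap \<Rightarrow> bool" where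
  "winding Q H G \<longleftrightarrow> hereditary H \<and> pq_hom H Q G \<and>
     ((\<exists>n. has_gtype H (TyAt n) \<or> has_gtype H (TyDt n)) \<longrightarrow>
       (\<forall>(H' :: (nat, nat) pquiver) G' f.
          hereditary H' \<and> pq_hom H' Q G' \<and> is_mor H G H' G' f \<longrightarrow> is_iso H G H' G' f))"


section \<open>The quiver of an admissible word\<close>

datatype harrow = Nu nat | Eta0 | Eta1

fun arrow_of :: "('v, 'a) letter \<Rightarrow> 'a" where
  "arrow_of (Dir a) = a"
| "arrow_of (Inv a) = a"
| "arrow_of _ = undefined"

text \<open>\<open>Gx Q x\<close> is the homomorphism from \<open>Hx Q x\<close> to \<open>Q\<close>. The vertex \<open>hnext Q x i\<close> is the one that
  \<open>Nu i\<close> joins to \<open>i\<close>.\<close>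

definition hnext :: "('v, 'a) pquiver \<Rightarrow> ('v, 'a) word \<Rightarrow> nat \<Rightarrow> nat" where
  "hnext Q x i = (if is_string (hat Q) x then Suc i else Suc i mod length x)"

definition Gx :: "('v, 'a) pquiver \<Rightarrow> ('v, 'a) word \<Rightarrow> (nat, harrow, 'v, 'a) qmap" where
  "Gx Q x =
     (\<lambda>i. fst (the (lta Q (x ! i))),
      \<lambda>h. case h of
            Nu i \<Rightarrow> arrow_of (x ! i)
          | Eta0 \<Rightarrow> sploop Q (fst (the (lso Q (hd x))))
          | Eta1 \<Rightarrow> sploop Q (fst (the (lta Q (last x)))))"

definition Hx :: "('v, 'a) pquiver \<Rightarrow> ('v, 'a) word \<Rightarrow> (nat, harrow) pquiver" where
  "Hx Q x =
     \<lparr>verts = (if is_string (hat Q) x then {1..length x - 1} else {0..<length x}),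
      sparr = (if lpunct Q x then {Eta0} else {}) \<union> (if rpunct Q x then {Eta1} else {}),
      ordarr = (if is_string (hat Q) x then Nu ` {1..<length x - 1} else Nu ` {0..<length x}),
      pso = (\<lambda>h. (case h of
               Nu i \<Rightarrow> if is_dir (x ! i) then hnext Q x i else i
             | Eta0 \<Rightarrow> 1
             | Eta1 \<Rightarrow> length x - 1, spol Q (snd (Gx Q x) h))),
      pta = (\<lambda>h. (case h of
               Nu i \<Rightarrow> if is_dir (x ! i) then i else hnext Q x i
             | Eta0 \<Rightarrow> 1
             | Eta1 \<Rightarrow> length x - 1, tpol Q (snd (Gx Q x) h)))\<rparr>"


section \<open>Real h-lines and kisses\<close>

text \<open>The letters of the doubly overlined word, indexed by integers; \<open>None\<close> outside of the range of
  indices. The copy of \<open>x\<close> inside its completion starts at position \<open>length x - 1\<close> for the type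
  \<open>(p, u)\<close> and at position \<open>0\<close> otherwise.\<close>

definition bbar :: "('v, 'a) pquiver \<Rightarrow> ('v, 'a) word \<Rightarrow> int \<Rightarrow> ('v, 'a) letter option" where
  "bbar Q x k =
     (let w = completion Q x; m = (if lpunct Q x then int (length x) - 1 else 0) in
      if closed_type Q x then Some (w ! nat (k mod int (length w)))
      else if 0 \<le> k + m \<and> k + m < int (length w) then Some (w ! nat (k + m)) else None)"

text \<open>The \<open>m\<close>-th letter of the (finite or infinite) word read off from the vertex \<open>i\<close> in
  direction \<open>\<rho>\<close>.\<close>

definition reading :: "('v, 'a) pquiver \<Rightarrow> ('v, 'a) word \<Rightarrow> nat \<Rightarrow> int \<Rightarrow> nat \<Rightarrow> ('v, 'a) letter option" where
  "reading Q x i r m =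
     (if snd (the (lta Q (the (bbar Q x (int i))))) = r
      then bbar Q x (int i + int m)
      else map_option linv (bbar Q x (int i - 1 - int m)))"

definition hl_verts :: "('v, 'a) pquiver \<Rightarrow> ('v, 'a) word \<Rightarrow> ('v, 'a) word \<Rightarrow> (nat \<times> nat) set" where
  "hl_verts Q x y = {(j, i). j \<in> verts (Hx Q y) \<and> i \<in> verts (Hx Q x) \<and> fst (Gx Q y) j = fst (Gx Q x) i}"

text \<open>The sets of arrows of \<open>H\<^sub>Q(x, y)\<close> of the various kinds, an arrow being given by its first
  component in \<open>H(y)\<close> and its second component in \<open>H(x)\<close>.\<close>

definition hl_plus :: "('v, 'a) pquiver \<Rightarrow> ('v, 'a) word \<Rightarrow> ('v, 'a) word \<Rightarrow> (harrow \<times> harrow) set" where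
  "hl_plus Q x y = {(b, a).
     (b \<in> ordarr (Hx Q y) \<and> a \<in> ordarr (Hx Q x) \<or> b \<in> sparr (Hx Q y) \<and> a \<in> sparr (Hx Q x)) \<and>
     snd (Gx Q y) b = snd (Gx Q x) a}"

definition hl_cross :: "('v, 'a) pquiver \<Rightarrow> ('v, 'a) word \<Rightarrow> ('v, 'a) word \<Rightarrow> (harrow \<times> harrow) set" where
  "hl_cross Q x y = {(b, a). b \<in> ordarr (Hx Q y) \<and> a \<in> ordarr (Hx Q x) \<and>
     snd (Gx Q y) b = snd (Gx Q x) a \<and> snd (Gx Q x) a \<in> sparr Q}"

definition hl_ominus :: "('v, 'a) pquiver \<Rightarrow> ('v, 'a) word \<Rightarrow> ('v, 'a) word \<Rightarrow> (harrow \<times> harrow) set" where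
  "hl_ominus Q x y = {(b, e). b \<in> ordarr (Hx Q y) \<and> e \<in> sparr (Hx Q x) \<and>
     snd (Gx Q y) b = snd (Gx Q x) e}"

definition hl_oplus :: "('v, 'a) pquiver \<Rightarrow> ('v, 'a) word \<Rightarrow> ('v, 'a) word \<Rightarrow> (harrow \<times> harrow) set" where
  "hl_oplus Q x y = {(e, a). e \<in> sparr (Hx Q y) \<and> a \<in> ordarr (Hx Q x) \<and>
     snd (Gx Q y) e = snd (Gx Q x) a}"

definition plus_src :: "('v, 'a) pquiver \<Rightarrow> ('v, 'a) word \<Rightarrow> ('v, 'a) word \<Rightarrow> harrow \<times> harrow \<Rightarrow> nat \<times> nat" where
  "plus_src Q x y c = (src (Hx Q y) (fst c), src (Hx Q x) (snd c))"

definition plus_tgt :: "('v, 'a) pquiver \<Rightarrow> ('v, 'a) word \<Rightarrow> ('v, 'a) word \<Rightarrow> harrow \<times> harrow \<Rightarrow> nat \<times> nat" where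
  "plus_tgt Q x y c = (tgt (Hx Q y) (fst c), tgt (Hx Q x) (snd c))"

definition red :: "('v, 'a) pquiver \<Rightarrow> ('v, 'a) word \<Rightarrow> ('v, 'a) word \<Rightarrow> nat \<times> nat \<Rightarrow> bool" where
  "red Q x y p \<longleftrightarrow> (\<exists>r\<in>{-1, 1}.
     lless Q (the (reading Q x (snd p) r 0)) (the (reading Q y (fst p) r 0)))"

definition orange :: "('v, 'a) pquiver \<Rightarrow> ('v, 'a) word \<Rightarrow> ('v, 'a) word \<Rightarrow> nat \<times> nat \<Rightarrow> bool" where
  "orange Q x y p \<longleftrightarrow> (\<exists>(b, a)\<in>hl_cross Q x y. p = (src (Hx Q y) b, tgt (Hx Q x) a))"

definition purple :: "('v, 'a) pquiver \<Rightarrow> ('v, 'a) word \<Rightarrow> ('v, 'a) word \<Rightarrow> nat \<times> nat \<Rightarrow> bool" where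
  "purple Q x y p \<longleftrightarrow>
     (\<exists>(b, e)\<in>hl_ominus Q x y. p = (src (Hx Q y) b, tgt (Hx Q x) e)) \<or>
     (\<exists>(e, a)\<in>hl_oplus Q x y. p = (tgt (Hx Q y) e, tgt (Hx Q x) a))"

definition hl_conn :: "('v, 'a) pquiver \<Rightarrow> ('v, 'a) word \<Rightarrow> ('v, 'a) word \<Rightarrow> ((nat \<times> nat) \<times> (nat \<times> nat)) set" where
  "hl_conn Q x y = {(p, q). p \<in> hl_verts Q x y \<and> q \<in> hl_verts Q x y \<and>
     (p, q) \<in> (let E = (\<lambda>c. (plus_src Q x y c, plus_tgt Q x y c)) ` hl_plus Q x y in (E \<union> E\<inverse>)\<^sup>*)}"

text \<open>A connected component is given by its set of vertices.\<close>

definition real_hlines :: "('v, 'a) pquiver \<Rightarrow> ('v, 'a) word \<Rightarrow> ('v, 'a) word \<Rightarrow> (nat \<times> nat) set set" where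
  "real_hlines Q x y = {C \<in> hl_verts Q x y // hl_conn Q x y.
     \<forall>p\<in>C. \<not> red Q x y p \<and> \<not> orange Q x y p \<and> \<not> purple Q x y p}"

definition hl_endpoint :: "('v, 'a) pquiver \<Rightarrow> ('v, 'a) word \<Rightarrow> ('v, 'a) word \<Rightarrow> nat \<times> nat \<Rightarrow> bool" where
  "hl_endpoint Q x y p \<longleftrightarrow>
     card {c \<in> hl_plus Q x y. plus_src Q x y c = p \<or> plus_tgt Q x y c = p} \<le> 1"

definition kisses :: "('v, 'a) pquiver \<Rightarrow> ('v, 'a) word \<Rightarrow> ('v, 'a) word \<Rightarrow> (nat \<times> nat) set set" where
  "kisses Q x y = {C \<in> real_hlines Q x y. \<forall>(j, i)\<in>C. hl_endpoint Q x y (j, i) \<longrightarrow>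
     \<not> boundary (Hx Q y) j \<and> \<not> boundary (Hx Q x) i}"


section \<open>H-triples and K-triples\<close>

definition prop_q :: "('v, 'a) pquiver \<Rightarrow> ('w, 'b) pquiver \<Rightarrow> ('v, 'a, 'w, 'b) qmap \<Rightarrow> bool" where
  "prop_q H H' f \<longleftrightarrow> (\<forall>j a'. boundary H j \<and> a' \<in> ordarr H' \<and> tgt H' a' = fst f j \<longrightarrow>
     (\<exists>a\<in>arrs H. a' = snd f a))"

definition prop_s :: "('v, 'a) pquiver \<Rightarrow> ('w, 'b) pquiver \<Rightarrow> ('v, 'a, 'w, 'b) qmap \<Rightarrow> bool" where
  "prop_s H H' f \<longleftrightarrow> (\<forall>j b'. boundary H j \<and> b' \<in> ordarr H' \<and> src H' b' = fst f j \<longrightarrow>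
     (\<exists>b\<in>arrs H. b' = snd f b))"

definition prop_K :: "('v, 'a) pquiver \<Rightarrow> ('w, 'b) pquiver \<Rightarrow> ('v, 'a, 'w, 'b) qmap \<Rightarrow> bool" where
  "prop_K H H' f \<longleftrightarrow> (\<forall>j. boundary H j \<longrightarrow> \<not> boundary H' (fst f j))"

text \<open>The component \<open>hquiv\<close> is the hereditary quiver on which the winding \<open>wind\<close> is defined.\<close>

record ('v, 'a) triple =
  hquiv :: "(nat, nat) pquiver"
  wind :: "(nat, nat, 'v, 'a) qmap"
  phiq :: "(nat, nat, nat, harrow) qmap"
  phis :: "(nat, nat, nat, harrow) qmap"

definition H_triples :: "('v, 'a) pquiver \<Rightarrow> ('v, 'a) word \<Rightarrow> ('v, 'a) word \<Rightarrow> ('v, 'a) triple set" where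
  "H_triples Q x y = {T.
     winding Q (hquiv T) (wind T) \<and>
     is_mor (hquiv T) (wind T) (Hx Q x) (Gx Q x) (phiq T) \<and> prop_q (hquiv T) (Hx Q x) (phiq T) \<and>
     is_mor (hquiv T) (wind T) (Hx Q y) (Gx Q y) (phis T) \<and> prop_s (hquiv T) (Hx Q y) (phis T) \<and>
     (\<forall>j\<in>verts (hquiv T). fst (phiq T) j \<in> spverts (Hx Q x) \<and> fst (phis T) j \<in> spverts (Hx Q y) \<longrightarrow>
        j \<in> spverts (hquiv T))}"

definition K_triples :: "('v, 'a) pquiver \<Rightarrow> ('v, 'a) word \<Rightarrow> ('v, 'a) word \<Rightarrow> ('v, 'a) triple set" where
  "K_triples Q x y = {T \<in> H_triples Q x y.
     prop_K (hquiv T) (Hx Q x) (phiq T) \<and> prop_K (hquiv T) (Hx Q y) (phis T)}"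

definition triple_equiv :: "('v, 'a) triple \<Rightarrow> ('v, 'a) triple \<Rightarrow> bool" where
  "triple_equiv T T' \<longleftrightarrow> (\<exists>f. is_iso (hquiv T) (wind T) (hquiv T') (wind T') f \<and>
     qmap_eq (hquiv T) (phiq T) (qcomp (phiq T') f) \<and> qmap_eq (hquiv T) (phis T) (qcomp (phis T') f))"

definition equiv_on :: "('v, 'a) triple set \<Rightarrow> (('v, 'a) triple \<times> ('v, 'a) triple) set" where
  "equiv_on S = {(T, T'). T \<in> S \<and> T' \<in> S \<and> triple_equiv T T'}"

definition H_classes :: "('v, 'a) pquiver \<Rightarrow> ('v, 'a) word \<Rightarrow> ('v, 'a) word \<Rightarrow> ('v, 'a) triple set set" where
  "H_classes Q x y = H_triples Q x y // equiv_on (H_triples Q x y)"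

definition K_classes :: "('v, 'a) pquiver \<Rightarrow> ('v, 'a) word \<Rightarrow> ('v, 'a) word \<Rightarrow> ('v, 'a) triple set set" where
  "K_classes Q x y = K_triples Q x y // equiv_on (K_triples Q x y)"

definition class_has_gtype :: "('v, 'a) triple set \<Rightarrow> gtype \<Rightarrow> bool" where
  "class_has_gtype C ty \<longleftrightarrow> (\<exists>T\<in>C. has_gtype (hquiv T) ty)"


section \<open>The embeddings pi and sigma\<close>

text \<open>For a non-projective string \<open>w\<close>, the strings before and after the change at the left end in
  the computation of \<open>tau_string Q w\<close>. This change either adds a cohook, so that the
  string gets longer, or removes a hook, so that the string gets shorter; the difference of
  the lengths is the number of arrows added or removed.\<close>

definition left_step :: "('v, 'a) pquiver \<Rightarrow> ('v, 'a) word \<Rightarrow> ('v, 'a) word \<times> ('v, 'a) word" where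
  "left_step Q w =
     (case Option.bind (rsucc Q w) (lsucc Q) of
        Some v \<Rightarrow> (the (rsucc Q w), v)
      | None \<Rightarrow> (w, the (lsucc Q w)))"

fun shift_arrow :: "nat \<Rightarrow> harrow \<Rightarrow> harrow" where
  "shift_arrow c (Nu i) = Nu (i + c)"
| "shift_arrow c Eta0 = Eta0"
| "shift_arrow c Eta1 = Eta1"

definition shift :: "nat \<Rightarrow> (nat, harrow, nat, harrow) qmap" where
  "shift c = (\<lambda>i. i + c, shift_arrow c)"

text \<open>The inclusions of full subquivers of \<open>H(\<tau>\<^sub>f x)\<close> are shifts of indices by the number of
  letters to the left of the subquiver: for \<open>pi\<close> the length of the cohook in \<open>Qf\<close> at the left
  end; for \<open>sigma\<close> one fringe arrow if \<open>\<tau> y\<close> arises by adding a cohook in \<open>Q\<close> at the left end,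
  and one fringe arrow together with the removed hook otherwise. At a punctured left end, and
  for the types \<open>(p, p)\<close> and \<open>(b)\<close>, nothing changes.\<close>

definition pi_emb :: "('v, 'a) pquiver \<Rightarrow> ('v, 'a) word \<Rightarrow> (nat, harrow, nat, harrow) qmap" where
  "pi_emb Qf x =
     (if closed_type Qf x \<or> lpunct Qf x then shift 0
      else let (u, v) = left_step Qf (completion Qf x) in shift (length v - length u))"

definition sigma_emb :: "('v, 'a) pquiver \<Rightarrow> ('v, 'a) word \<Rightarrow> (nat, harrow, nat, harrow) qmap" where
  "sigma_emb Q y =
     (if closed_type Q y \<or> lpunct Q y then shift 0
      else let (u, v) = left_step Q (completion Q y) in
        shift (if length u < length v then 1 else length u - length v + 1))"

text \<open>The inclusion of \<open>Q\<close> into \<open>Qf\<close> is the identity on elements, so that the winding itself is not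
  changed.\<close>

definition triple_map ::
    "('v, 'a) pquiver \<Rightarrow> ('v, 'a) pquiver \<Rightarrow> ('v, 'a) word \<Rightarrow> ('v, 'a) word \<Rightarrow> ('v, 'a) triple \<Rightarrow> ('v, 'a) triple" where
  "triple_map Q Qf x y T =
     \<lparr>hquiv = hquiv T, wind = wind T,
      phiq = qcomp (pi_emb Qf x) (phiq T), phis = qcomp (sigma_emb Q y) (phis T)\<rparr>"

text \<open>The induced map on equivalence classes: the class of the images of the representatives.\<close>

definition class_map ::
    "('v, 'a) pquiver \<Rightarrow> ('v, 'a) pquiver \<Rightarrow> ('v, 'a) word \<Rightarrow> ('v, 'a) word \<Rightarrow>
     ('v, 'a) triple set \<Rightarrow> ('v, 'a) triple set" where
  "class_map Q Qf x y C =
     equiv_on (K_triples Qf (tau Qf x) (tau Qf y)) `` (triple_map Q Qf x y ` C)"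

text \<open>The map from real h-lines to kisses induced by the embeddings \<open>sigma\<close> and \<open>pi\<close>.\<close>

definition hline_map ::
    "('v, 'a) pquiver \<Rightarrow> ('v, 'a) pquiver \<Rightarrow> ('v, 'a) word \<Rightarrow> ('v, 'a) word \<Rightarrow>
     (nat \<times> nat) set \<Rightarrow> (nat \<times> nat) set" where
  "hline_map Q Qf x y C = map_prod (fst (sigma_emb Q y)) (fst (pi_emb Qf x)) ` C"

end

theory Submission
  imports Defs
begin

text \<open>Write \<open>Qf\<close> for the fringed quiver. The words \<open>\<tau>\<^sub>f x\<close> and \<open>\<tau>\<^sub>f y\<close> prolong \<open>x\<close> and \<open>\<tau> y\<close> at every
  unpunctured end: for \<open>x\<close> by an arrow pointing away from \<open>H(x)\<close> and then arrows pointing towards it, for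
  \<open>\<tau> y\<close> with the opposite orientations. Hence an arrow of \<open>H(\<tau>\<^sub>f x)\<close> with target in \<open>H(x)\<close> lies in \<open>H(x)\<close>, and from
  a vertex outside of \<open>H(x)\<close> one reaches a boundary vertex by going back along arrows. For a morphism
  with (q), such a walk stays in its image and contradicts (K), so morphisms with (q) and (K) land in \<open>H(x)\<close>.
  Dually morphisms with (s) and (K) land in \<open>H(\<tau> y)\<close>. The same walk inside a kiss is possible because its
  vertices are neither red nor orange nor purple. If \<open>y\<close> is projective, then all arrows of \<open>H(\<tau>\<^sub>f y)\<close> point away
  from one point and the walk starts anywhere.

  The shape of \<open>\<tau>\<^sub>f x\<close> and \<open>\<tau> y\<close> is read off from the completions: with direct, trivial and inverse letters
  coded by \<open>-1\<close>, \<open>0\<close>, \<open>1\<close>, the orientation of an admissible word at a special letter is the sign of the first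
  nonzero sum of two letters that are symmetric to it, and this sign is not affected by removing cohooks.\<close>

subsection \<open>Signs at centres of symmetry\<close>

text \<open>The obstacle is a self-reference in the definition of admissible words: a loop at a
  special position is direct or inverse according to a comparison of two words whose own loops are
  oriented by the same rule. Changing one end of a word could therefore reorient loops anywhere.
  \<open>adm_iff\<close> breaks the circle: the orientation can be computed from the completion, in
  which special letters have value \<open>0\<close>. This is a statement about integer sequences,
  and it is proved as such. The fringing makes ends harmless. The completions of
  \<open>\<tau>\<^sub>f x\<close> and \<open>\<tau>\<^sub>f y\<close> end at fringe vertices where
  only the trivial letter is available (\<open>dead\<close>); so two tails never differ first at an
  end, and at a first difference both letters have the same nonzero value. Finally, prolonging a
  string \<open>w\<close> of \<open>Q\<close> by cohooks of \<open>Qf\<close> at both ends gives one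
  word \<open>W\<close> that contains \<open>w\<close> and, unless \<open>w\<close> is projective,
  also its translate over \<open>Q\<close>, as two cuts for \<open>s = 1\<close> and
  \<open>s = -1\<close>. The same sign \<open>s\<close> lets one set of lemmas serve
  \<open>x\<close> with (q) and \<open>\<tau> y\<close> with (s).\<close>

definition pal :: "(int \<Rightarrow> int) \<Rightarrow> int \<Rightarrow> int \<Rightarrow> bool" where
  "pal \<rho> k d \<longleftrightarrow> (\<forall>e. 1 \<le> e \<and> e < d --> \<rho> (k + e) + \<rho> (k - e) = 0)"

text \<open>For the letter values \<open>\<rho>\<close> of a word, the letter at distance
  \<open>e\<close> to the left of \<open>k\<close> is read backwards, hence counts as
  \<open>- \<rho> (k - e)\<close>. So \<open>pal \<rho> k d\<close> means that the two tails read
  away from \<open>k\<close> have the same values for \<open>d - 1\<close> letters, and the sum at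
  distance \<open>d\<close> is the difference of their \<open>d\<close>-th letters.\<close>

definition first_diff :: "(int \<Rightarrow> int) \<Rightarrow> int \<Rightarrow> int \<Rightarrow> bool" where
  "first_diff \<rho> k d \<longleftrightarrow> 1 \<le> d \<and> pal \<rho> k d \<and> \<rho> (k + d) + \<rho> (k - d) \<noteq> 0"

text \<open>The outcome of the lexicographic comparison of the two tails at \<open>k\<close>, with
  \<open>0\<close> for equal tails. The choice of \<open>d\<close> is unambiguous by
  \<open>first_diff_unique\<close>.\<close>

definition msgn :: "(int \<Rightarrow> int) \<Rightarrow> int \<Rightarrow> int" where
  "msgn \<rho> k = (if \<exists>d. first_diff \<rho> k d
     then let d = SOME d. first_diff \<rho> k d in sgn (\<rho> (k + d) + \<rho> (k - d)) else 0)"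

lemma msgn_none: "(\<And>d. \<not> first_diff \<rho> k d) ==> msgn \<rho> k = 0"
  unfolding msgn_def by (subst if_not_P) auto

lemma first_diff_unique: "first_diff \<rho> k d ==> first_diff \<rho> k d' ==> d = d'"
  unfolding first_diff_def pal_def by (metis linorder_neqE)

lemma msgn_first_diff: "first_diff \<rho> k d ==> msgn \<rho> k = sgn (\<rho> (k + d) + \<rho> (k - d))"
  unfolding msgn_def Let_def by (metis first_diff_unique someI)

lemma first_diff_ex:
  assumes "1 \<le> e" "\<rho> (k + e) + \<rho> (k - e) \<noteq> 0"
  shows "\<exists>d \<le> e. first_diff \<rho> k d"
proof -
  let ?P = "\<lambda>n. 1 \<le> n \<and> \<rho> (k + int n) + \<rho> (k - int n) \<noteq> 0"
  have "?P (nat e)" using assms by simp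
  hence P: "?P (LEAST n. ?P n)" and le: "(LEAST n. ?P n) \<le> nat e"
    by (rule LeastI, rule Least_le)
  have "first_diff \<rho> k (int (LEAST n. ?P n))"
    unfolding first_diff_def pal_def
  proof (intro conjI allI impI)
    fix e' assume e': "1 \<le> e' \<and> e' < int (LEAST n. ?P n)"
    hence "nat e' < (LEAST n. ?P n)" by linarith
    hence "\<not> ?P (nat e')" by (rule not_less_Least)
    with e' show "\<rho> (k + e') + \<rho> (k - e') = 0" by auto
  qed (use P in auto)
  moreover have "int (LEAST n. ?P n) \<le> e" using le assms by linarith
  ultimately show ?thesis by blast
qed

lemma msgn_zero_iff: "msgn \<rho> k = 0 \<longleftrightarrow> (\<forall>e\<ge>1. \<rho> (k + e) + \<rho> (k - e) = 0)"
proof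
  assume z: "msgn \<rho> k = 0"
  show "\<forall>e\<ge>1. \<rho> (k + e) + \<rho> (k - e) = 0"
  proof (rule ccontr)
    assume "\<not> ?thesis"
    then obtain d where "first_diff \<rho> k d" using first_diff_ex by blast
    thus False using z msgn_first_diff[of \<rho> k d] by (auto simp: first_diff_def sgn_if split: if_splits)
  qed
next
  assume "\<forall>e\<ge>1. \<rho> (k + e) + \<rho> (k - e) = 0"
  hence "\<not> first_diff \<rho> k d" for d unfolding first_diff_def by auto
  thus "msgn \<rho> k = 0" by (rule msgn_none)
qed

lemma msgn_nonzero: "msgn \<rho> k \<noteq> 0 ==> \<exists>d. first_diff \<rho> k d"
  unfolding msgn_def by (auto split: if_splits)

lemma msgn_range: "msgn \<rho> k \<in> {-1, 0, 1}"
  unfolding msgn_def by (auto simp: sgn_if Let_def)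

lemma msgn_pos: "msgn \<rho> k > 0 \<longleftrightarrow> (\<exists>d. first_diff \<rho> k d \<and> \<rho> (k + d) + \<rho> (k - d) > 0)"
  by (metis msgn_first_diff msgn_nonzero less_irrefl sgn_greater)

text \<open>The hypothesis \<open>\<rho> k = 0\<close> supplies distance \<open>0\<close>, and
  negative distances follow by symmetry. This form is needed because the windows around
  \<open>k - e\<close> and \<open>k + e\<close> below may reach across \<open>k\<close>.\<close>

lemma pal_abs: "pal \<rho> k d ==> \<rho> k = 0 ==> - d < e ==> e < d ==> \<rho> (k + e) + \<rho> (k - e) = 0"
  unfolding pal_def
  by (cases "e = 0"; cases "e \<ge> 1") (auto dest: spec[of _ e] spec[of _ "-e"] simp: add.commute)

lemma first_diff_uminus: "first_diff (\<lambda>i. - \<rho> i) k d \<longleftrightarrow> first_diff \<rho> k d"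
proof -
  have "(- \<rho> i + - \<rho> j = 0) \<longleftrightarrow> (\<rho> i + \<rho> j = 0)" for i j by linarith
  thus ?thesis unfolding first_diff_def pal_def by simp
qed

lemma msgn_uminus: "msgn (\<lambda>i. - \<rho> i) k = - msgn \<rho> k"
proof (cases "\<exists>d. first_diff \<rho> k d")
  case True
  then obtain d where d: "first_diff \<rho> k d" by blast
  hence "msgn (\<lambda>i. - \<rho> i) k = sgn (- \<rho> (k+d) + - \<rho> (k-d))"
    using msgn_first_diff first_diff_uminus by blast
  with d show ?thesis using msgn_first_diff[OF d] by (simp add: sgn_if)
next
  case False
  thus ?thesis by (simp add: msgn_none first_diff_uminus)
qed

lemma first_diff_reflect: "first_diff (\<lambda>i. \<rho> (c - i)) k d \<longleftrightarrow> first_diff \<rho> (c - k) d"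
  unfolding first_diff_def pal_def by (simp add: algebra_simps)

lemma msgn_reflect: "msgn (\<lambda>i. \<rho> (c - i)) k = msgn \<rho> (c - k)"
proof (cases "\<exists>d. first_diff \<rho> (c - k) d")
  case True
  then obtain d where d: "first_diff \<rho> (c - k) d" by blast
  hence "msgn (\<lambda>i. \<rho> (c - i)) k = sgn (\<rho> (c - (k+d)) + \<rho> (c - (k-d)))"
    using msgn_first_diff first_diff_reflect by blast
  with d show ?thesis using msgn_first_diff[OF d] by (simp add: algebra_simps)
next
  case False
  thus ?thesis by (simp add: msgn_none first_diff_reflect)
qed

lemma first_diff_shift: "first_diff (\<lambda>i. \<rho> (i + c)) k d \<longleftrightarrow> first_diff \<rho> (k + c) d"
  unfolding first_diff_def pal_def by (simp add: algebra_simps)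

lemma msgn_shift: "msgn (\<lambda>i. \<rho> (i + c)) k = msgn \<rho> (k + c)"
proof (cases "\<exists>d. first_diff \<rho> (k + c) d")
  case True
  then obtain d where d: "first_diff \<rho> (k + c) d" by blast
  hence "msgn (\<lambda>i. \<rho> (i + c)) k = sgn (\<rho> ((k+d) + c) + \<rho> ((k-d) + c))"
    using msgn_first_diff first_diff_shift by blast
  with d show ?thesis using msgn_first_diff[OF d] by (simp add: algebra_simps)
next
  case False
  thus ?thesis by (simp add: msgn_none first_diff_shift)
qed

text \<open>Reflection at \<open>k\<close> exchanges \<open>k - e\<close> and \<open>k + e\<close>
  and, within radius \<open>d\<close>, changes the sign of \<open>\<rho>\<close>. So the comparisons
  at these two positions are opposite as long as they stay inside that radius.\<close>

lemma pal_transfer: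
  assumes "\<rho> k = 0" "pal \<rho> k d" "1 \<le> e" "1 \<le> t" "t < d - e"
  shows "(\<rho> (k - e + t) + \<rho> (k - e - t)) + (\<rho> (k + e + t) + \<rho> (k + e - t)) = 0"
proof -
  have "\<rho> (k + (e - t)) + \<rho> (k - (e - t)) = 0" by (rule pal_abs) (use assms in auto)
  moreover have "\<rho> (k + (e + t)) + \<rho> (k - (e + t)) = 0" by (rule pal_abs) (use assms in auto)
  ultimately show ?thesis by (simp add: algebra_simps)
qed

text \<open>At distance \<open>d - e\<close> the outermost letters involved are those at
  \<open>k - d\<close> and \<open>k + d\<close>: the defect of symmetry at \<open>k\<close> is
  distributed over the comparisons at \<open>k - e\<close> and \<open>k + e\<close>.\<close>

lemma pal_transfer_last:
  assumes "\<rho> k = 0" "pal \<rho> k d" "1 \<le> e" "e < d"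
  shows "(\<rho> (k - e + (d - e)) + \<rho> (k - e - (d - e))) + (\<rho> (k + e + (d - e)) + \<rho> (k + e - (d - e)))
     = \<rho> (k + d) + \<rho> (k - d)"
proof -
  have "\<rho> (k + (2 * e - d)) + \<rho> (k - (2 * e - d)) = 0" by (rule pal_abs) (use assms in auto)
  thus ?thesis by (simp add: algebra_simps)
qed

text \<open>The comparisons at \<open>k - e\<close> and \<open>k + e\<close> are opposite before
  distance \<open>d - e\<close> and add up to a positive number there. If they are decided earlier,
  exactly one of them is positive; otherwise at least one of the two summands at distance
  \<open>d - e\<close> is.\<close>

lemma msgn_pos_neighbour:
  assumes "\<rho> k = 0" "first_diff \<rho> k d" "\<rho> (k + d) + \<rho> (k - d) > 0" "1 \<le> e" "e < d"
  shows "msgn \<rho> (k - e) > 0 \<or> msgn \<rho> (k + e) > 0"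
proof -
  have p: "pal \<rho> k d" using assms by (simp add: first_diff_def)
  let ?a = "\<lambda>t. \<rho> (k - e + t) + \<rho> (k - e - t)"
  let ?b = "\<lambda>t. \<rho> (k + e + t) + \<rho> (k + e - t)"
  have ab: "?b t = - ?a t" if "1 \<le> t" "t < d - e" for t
    using pal_transfer[OF assms(1) p assms(4) that] by linarith
  show ?thesis
  proof (cases "\<exists>t. 1 \<le> t \<and> t < d - e \<and> ?a t \<noteq> 0")
    case True
    then obtain t m where t: "1 \<le> t" "t < d - e" and m: "m \<le> t" "first_diff \<rho> (k - e) m"
      using first_diff_ex[of _ \<rho> "k - e"] by blast
    have "first_diff \<rho> (k + e) m"
      unfolding first_diff_def pal_def
    proof (intro conjI allI impI)
      show "1 \<le> m" using m by (simp add: first_diff_def)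
    next
      fix u assume u: "1 \<le> u \<and> u < m"
      hence "?a u = 0" using m by (auto simp: first_diff_def pal_def)
      thus "?b u = 0" using ab[of u] u t m by simp
    next
      show "?b m \<noteq> 0" using ab[of m] t m unfolding first_diff_def by simp
    qed
    moreover have "?b m = - ?a m" using ab[of m] t m unfolding first_diff_def by simp
    moreover have "?a m \<noteq> 0" using m unfolding first_diff_def by simp
    ultimately show ?thesis using m unfolding msgn_pos
      by (metis neg_0_less_iff_less linorder_neqE)
  next
    case False
    hence a0: "?a t = 0" if "1 \<le> t" "t < d - e" for t using that by blast
    hence b0: "?b t = 0" if "1 \<le> t" "t < d - e" for t using ab that by simp
    have s: "?a (d - e) + ?b (d - e) > 0"
      using pal_transfer_last[OF assms(1) p assms(4,5)] assms(3) by linarith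
    show ?thesis
    proof (cases "?a (d - e) > 0")
      case True
      hence "first_diff \<rho> (k - e) (d - e)" unfolding first_diff_def pal_def using a0 assms by auto
      with True show ?thesis unfolding msgn_pos by blast
    next
      case False
      hence g: "?b (d - e) > 0" using s by linarith
      hence "first_diff \<rho> (k + e) (d - e)" unfolding first_diff_def pal_def using b0 assms by auto
      with g show ?thesis unfolding msgn_pos by blast
    qed
  qed
qed

lemma msgn_neg_neighbour:
  assumes "\<rho> k = 0" "first_diff \<rho> k d" "\<rho> (k + d) + \<rho> (k - d) < 0" "1 \<le> e" "e < d"
  shows "msgn \<rho> (k - e) < 0 \<or> msgn \<rho> (k + e) < 0"
  using msgn_pos_neighbour[of "\<lambda>i. - \<rho> i" k d e] assms
  by (simp add: first_diff_uminus msgn_uminus)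

text \<open>If the tails at \<open>k + e\<close> agree up to radius \<open>d\<close>, the whole
  defect at \<open>k\<close> shows up at \<open>k - e\<close>, at the smaller distance
  \<open>d - e\<close>. This drop of the radius drives the descent below.\<close>

lemma first_diff_neighbour:
  assumes "\<rho> k = 0" "first_diff \<rho> k d" "\<rho> (k + d) + \<rho> (k - d) > 0" "1 \<le> e" "e < d"
    and "pal \<rho> (k + e) d"
  shows "first_diff \<rho> (k - e) (d - e)" "\<rho> (k - e + (d - e)) + \<rho> (k - e - (d - e)) > 0" (is ?A)
proof -
  have p: "pal \<rho> k d" using assms by (simp add: first_diff_def)
  have b0: "\<rho> (k + e + t) + \<rho> (k + e - t) = 0" if "1 \<le> t" "t \<le> d - e" for t
    using assms(4,6) that unfolding pal_def by auto
  have "\<rho> (k - e + t) + \<rho> (k - e - t) = 0" if "1 \<le> t" "t < d - e" for t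
    using pal_transfer[OF assms(1) p assms(4) that] b0[of t] that by simp
  moreover show g: ?A
    using pal_transfer_last[OF assms(1) p assms(4,5)] b0[of "d - e"] assms(3,5) by linarith
  ultimately show "first_diff \<rho> (k - e) (d - e)" unfolding first_diff_def pal_def using assms by auto
qed

text \<open>In the application \<open>\<rho>\<close> holds the values of the completion over
  \<open>Q\<close>, where special letters count \<open>0\<close>, \<open>\<eta>\<close> those of its
  lift to \<open>hat Q\<close>, where loops have been oriented, and \<open>S\<close> is the set of
  special positions. The condition \<open>closure\<close> reflects that a special letter is the only
  letter with its polarized target.\<close>

locale sign_data =
  fixes \<rho> \<eta> :: "int \<Rightarrow> int" and S :: "int set"
  assumes rho0: "k \<in> S ==> \<rho> k = 0"
    and off: "k \<notin> S ==> \<eta> k = \<rho> k"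
    and closure: "k \<in> S ==> 1 \<le> e ==> pal \<rho> k e ==> k + e \<in> S \<longleftrightarrow> k - e \<in> S"
begin

lemma first_diff_notin:
  assumes "k \<in> S" "first_diff \<rho> k d"
  shows "k + d \<notin> S" "k - d \<notin> S"
  using closure[of k d] assms rho0[of "k+d"] rho0[of "k-d"] by (auto simp: first_diff_def)

lemma eta_sum_first_diff:
  assumes "k \<in> S" "first_diff \<rho> k d"
  shows "\<eta> (k + d) + \<eta> (k - d) = \<rho> (k + d) + \<rho> (k - d)"
  using first_diff_notin[OF assms] off by simp

lemma eta_sum_special:
  assumes "k \<in> S" "1 \<le> e" "pal \<rho> k (e + 1)" "\<eta> (k + e) + \<eta> (k - e) \<noteq> 0"
  shows "k + e \<in> S" "k - e \<in> S"
proof -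
  have "pal \<rho> k e" "\<rho> (k + e) + \<rho> (k - e) = 0" using assms(2,3) by (auto simp: pal_def)
  thus "k + e \<in> S" "k - e \<in> S" using closure[OF assms(1,2)] assms(4) off by metis+
qed

lemma first_diff_eta_le:
  assumes "k \<in> S" "first_diff \<rho> k d"
  obtains e where "first_diff \<eta> k e" "e \<le> d"
proof -
  have "\<eta> (k + d) + \<eta> (k - d) \<noteq> 0" "1 \<le> d"
    using eta_sum_first_diff[OF assms] assms(2) by (auto simp: first_diff_def)
  thus ?thesis using first_diff_ex[of d \<eta> k] that by blast
qed

lemma pal_mono: "pal \<rho>' k d ==> e \<le> d ==> pal \<rho>' k e"
  by (auto simp: pal_def)

text \<open>One half of the removal of the self-reference: orientations taken from the completion
  satisfy the rule formulated for the lift. The lift can decide a comparison earlier than the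
  completion only at two special positions. One of them carries the correct sign by
  \<open>msgn_pos_neighbour\<close>, and since the values lie in \<open>{-1, 0, 1}\<close>, a
  nonzero sum has that sign too.\<close>

theorem msgn_eta_eq:
  assumes eq: "\<And>k. k \<in> S ==> \<eta> k = msgn \<rho> k" and k: "k \<in> S"
  shows "msgn \<eta> k = msgn \<rho> k"
proof (cases "msgn \<rho> k = 0")
  case True
  hence s: "\<rho> (k + e) + \<rho> (k - e) = 0" if "1 \<le> e" for e using that by (simp add: msgn_zero_iff)
  \<comment> \<open>Equal tails at \<open>k\<close> make \<open>\<rho>\<close> odd under the
    reflection at \<open>k\<close>; then the signs are odd as well, and so are the values of
    \<open>\<eta>\<close> at special positions.\<close>
  have refl: "\<rho> = (\<lambda>i. - \<rho> (2 * k - i))"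
  proof
    fix i show "\<rho> i = - \<rho> (2 * k - i)"
      using s[of "i - k"] s[of "k - i"] rho0[OF k]
      by (cases "i = k"; cases "i > k") (auto simp: algebra_simps)
  qed
  have ms: "msgn \<rho> j = - msgn \<rho> (2 * k - j)" for j
  proof -
    have "msgn \<rho> j = msgn (\<lambda>i. - \<rho> (2 * k - i)) j" using refl by simp
    also have "\<dots> = - msgn (\<lambda>i. \<rho> (2 * k - i)) j" by (rule msgn_uminus)
    finally show ?thesis by (simp add: msgn_reflect)
  qed
  have "\<eta> (k + e) + \<eta> (k - e) = 0" if e: "1 \<le> e" for e
  proof (rule ccontr)
    assume n: "\<eta> (k + e) + \<eta> (k - e) \<noteq> 0"
    have "pal \<rho> k (e + 1)" using s by (auto simp: pal_def)
    hence "k + e \<in> S" "k - e \<in> S" using eta_sum_special[OF k e _ n] by auto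
    hence "\<eta> (k + e) = msgn \<rho> (k + e)" "\<eta> (k - e) = msgn \<rho> (k - e)" using eq by auto
    moreover have "msgn \<rho> (k + e) = - msgn \<rho> (k - e)" using ms[of "k + e"] by (simp add: algebra_simps)
    ultimately show False using n by simp
  qed
  thus ?thesis using True msgn_zero_iff[of \<eta> k] by simp
next
  case False
  then obtain d where d: "first_diff \<rho> k d" using msgn_nonzero by blast
  obtain e where e: "first_diff \<eta> k e" "e \<le> d" by (rule first_diff_eta_le[OF k d])
  show ?thesis
  proof (cases "e = d")
    case True
    thus ?thesis using msgn_first_diff[OF d] msgn_first_diff[OF e(1)] eta_sum_first_diff[OF k d] by simp
  next
    case ne: False
    hence ed: "1 \<le> e" "e < d" "\<eta> (k + e) + \<eta> (k - e) \<noteq> 0"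
      using e by (auto simp: first_diff_def)
    have "pal \<rho> k (e + 1)" using d ed pal_mono by (auto simp: first_diff_def)
    hence S: "k + e \<in> S" "k - e \<in> S" using eta_sum_special[OF k ed(1) _ ed(3)] by auto
    note v = eq[OF S(1)] eq[OF S(2)]
    have r: "msgn \<rho> (k + e) \<in> {-1,0,1}" "msgn \<rho> (k - e) \<in> {-1,0,1}" by (rule msgn_range)+
    have m: "msgn \<eta> k = sgn (\<eta> (k + e) + \<eta> (k - e))" using msgn_first_diff[OF e(1)] .
    have dn: "\<rho> (k + d) + \<rho> (k - d) \<noteq> 0" using d by (simp add: first_diff_def)
    show ?thesis
    proof (cases "\<rho> (k + d) + \<rho> (k - d) > 0")
      case True
      hence "msgn \<rho> (k - e) > 0 \<or> msgn \<rho> (k + e) > 0"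
        using msgn_pos_neighbour[OF rho0[OF k] d True ed(1,2)] by blast
      hence "\<eta> (k + e) + \<eta> (k - e) > 0" using v r ed(3) by auto
      thus ?thesis using m msgn_first_diff[OF d] True by simp
    next
      case False
      hence ls: "\<rho> (k + d) + \<rho> (k - d) < 0" using dn by linarith
      hence "msgn \<rho> (k - e) < 0 \<or> msgn \<rho> (k + e) < 0"
        using msgn_neg_neighbour[OF rho0[OF k] d ls ed(1,2)] by blast
      hence "\<eta> (k + e) + \<eta> (k - e) < 0" using v r ed(3) by auto
      thus ?thesis using m msgn_first_diff[OF d] ls by simp
    qed
  qed
qed

end

section \<open>Uniqueness of orientations by descent on the radius of symmetry\<close>

lemma pal_uminus: "pal (\<lambda>i. - \<rho> i) k d \<longleftrightarrow> pal \<rho> k d"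
proof -
  have "(- \<rho> i + - \<rho> j = 0) \<longleftrightarrow> (\<rho> i + \<rho> j = 0)" for i j by linarith
  thus ?thesis unfolding pal_def by simp
qed

lemma pal_reflect: "pal (\<lambda>i. \<rho> (c - i)) k d \<longleftrightarrow> pal \<rho> (c - k) d"
  unfolding pal_def by (simp add: algebra_simps)

lemma sign_data_uminus: "sign_data \<rho> \<eta> S ==> sign_data (\<lambda>i. - \<rho> i) (\<lambda>i. - \<eta> i) S"
  unfolding sign_data_def by (simp add: pal_uminus)

lemma sign_data_reflect: "sign_data \<rho> \<eta> S ==> sign_data (\<lambda>i. \<rho> (- i)) (\<lambda>i. \<eta> (- i)) {k. - k \<in> S}"
  unfolding sign_data_def using pal_reflect[of \<rho> 0] by (auto simp: add.commute)

text \<open>A disagreement at a position of minimal radius of symmetry is pushed to a neighbour of smaller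
  radius.\<close>

lemma descent_right:
  assumes sd: "sign_data \<rho> \<eta> S" and eq: "\<And>k. k \<in> S ==> \<eta> k = msgn \<eta> k"
    and k: "k \<in> S" "first_diff \<rho> k d" "\<rho> (k + d) + \<rho> (k - d) > 0"
    and e: "1 \<le> e" "e < d" "k + e \<in> S" "k - e \<in> S" "\<eta> (k - e) \<le> 0" "\<eta> (k + e) \<le> 0"
    and pos: "msgn \<rho> (k + e) > 0"
    and min: "\<And>k' d'. k' \<in> S ==> first_diff \<rho> k' d' ==> d' < d ==> \<eta> k' = msgn \<rho> k'"
  shows False
proof -
  interpret sign_data \<rho> \<eta> S by (rule sd)
  obtain d2 where d2: "first_diff \<rho> (k + e) d2" using pos msgn_pos by blast
  \<comment> \<open>A smaller radius at \<open>k + e\<close> would give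
    \<open>\<eta> (k + e) = msgn \<rho> (k + e) > 0\<close> by minimality, contrary to the
    assumption on \<open>\<eta> (k + e)\<close>.\<close>
  have "\<not> d2 < d" using min[OF e(3) d2] pos e(6) by auto
  hence "pal \<rho> (k + e) d" using d2 pal_mono by (auto simp: first_diff_def)
  from first_diff_neighbour[OF rho0[OF k(1)] k(2,3) e(1,2) this]
  have f: "first_diff \<rho> (k - e) (d - e)" and g: "\<rho> (k - e + (d - e)) + \<rho> (k - e - (d - e)) > 0" .
  hence "msgn \<rho> (k - e) > 0" using msgn_pos by blast
  moreover have "\<eta> (k - e) = msgn \<rho> (k - e)" using min[OF e(4) f] e by simp
  ultimately show False using e by simp
qed

text \<open>Disagreement at \<open>k\<close> means that the lift decides the comparison earlier, at
  some distance \<open>e < d\<close>, with the opposite sign and at two special positions. Both of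
  these then have values at most \<open>0\<close>, although one of them has positive sign for
  \<open>\<rho>\<close>; a reflection places it on the right.\<close>

lemma descent_pos:
  assumes sd: "sign_data \<rho> \<eta> S" and eq: "\<And>k. k \<in> S ==> \<eta> k = msgn \<eta> k"
    and k: "k \<in> S" "first_diff \<rho> k d" "\<rho> (k + d) + \<rho> (k - d) > 0" "\<eta> k \<noteq> msgn \<rho> k"
    and min: "\<And>k' d'. k' \<in> S ==> first_diff \<rho> k' d' ==> d' < d ==> \<eta> k' = msgn \<rho> k'"
  shows False
proof -
  interpret sign_data \<rho> \<eta> S by (rule sd)
  have m1: "msgn \<rho> k = 1" using msgn_first_diff[OF k(2)] k(3) by simp
  obtain e where e: "first_diff \<eta> k e" "e \<le> d" by (rule first_diff_eta_le[OF k(1,2)])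
  have ek: "\<eta> k = sgn (\<eta> (k + e) + \<eta> (k - e))" using eq[OF k(1)] msgn_first_diff[OF e(1)] by simp
  have "e \<noteq> d" using ek m1 k(3,4) eta_sum_first_diff[OF k(1,2)] by auto
  hence ed: "1 \<le> e" "e < d" "\<eta> (k + e) + \<eta> (k - e) \<noteq> 0" using e by (auto simp: first_diff_def)
  have "pal \<rho> k (e + 1)" using k(2) ed pal_mono by (auto simp: first_diff_def)
  hence S: "k + e \<in> S" "k - e \<in> S" using eta_sum_special[OF k(1) ed(1) _ ed(3)] by auto
  have neg: "\<eta> (k + e) + \<eta> (k - e) < 0" using ek m1 k(4) ed(3) by (auto simp: sgn_if split: if_splits)
  have r: "\<eta> (k + e) \<in> {-1,0,1}" "\<eta> (k - e) \<in> {-1,0,1}" using eq S msgn_range by metis+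
  hence np: "\<eta> (k + e) \<le> 0" "\<eta> (k - e) \<le> 0" using neg by auto
  from msgn_pos_neighbour[OF rho0[OF k(1)] k(2,3) ed(1,2)] show False
  proof
    assume "msgn \<rho> (k + e) > 0"
    from descent_right[OF sd eq k(1,2,3) ed(1,2) S np(2,1) this min] show False .
  next
    assume p: "msgn \<rho> (k - e) > 0"
    show False
    proof (rule descent_right[OF sign_data_reflect[OF sd], of "- k" d e])
      show "\<And>j. j \<in> {j. - j \<in> S} ==> \<eta> (- j) = msgn (\<lambda>i. \<eta> (- i)) j"
        using eq msgn_reflect[of \<eta> 0] by simp
      show "first_diff (\<lambda>i. \<rho> (- i)) (- k) d" using k(2) first_diff_reflect[of \<rho> 0] by simp
      show "0 < msgn (\<lambda>i. \<rho> (- i)) (- k + e)"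
        using p msgn_reflect[of \<rho> 0 "- k + e"] by simp
      show "\<And>k' d'. k' \<in> {k. - k \<in> S} ==> first_diff (\<lambda>i. \<rho> (- i)) k' d' ==> d' < d ==>
        \<eta> (- k') = msgn (\<lambda>i. \<rho> (- i)) k'"
        using min first_diff_reflect[of \<rho> 0] msgn_reflect[of \<rho> 0] by simp
    qed (use k S ed np in "simp_all add: algebra_simps")
  qed
qed

text \<open>The converse of \<open>msgn_eta_eq\<close>. Positions with a first difference are
  handled by induction on its distance. At a position with equal tails the sequence is odd; by
  \<open>centre\<close> it is the only such special position, so the positions symmetric about it
  fall under the first case, with opposite signs.\<close>

theorem (in sign_data) eta_unique:
  assumes eq: "\<And>k. k \<in> S ==> \<eta> k = msgn \<eta> k"
    and centre: "\<And>k k'. k \<in> S ==> k' \<in> S ==> msgn \<rho> k = 0 ==> msgn \<rho> k' = 0 ==> k = k'"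
    and k: "k \<in> S"
  shows "\<eta> k = msgn \<rho> k"
proof -
  have nz: "\<eta> k = msgn \<rho> k" if "k \<in> S" "first_diff \<rho> k d" for k d
    using that
  proof (induction "nat d" arbitrary: k d rule: less_induct)
    case less
    have d1: "1 \<le> d" using less.prems by (simp add: first_diff_def)
    have min: "\<eta> k' = msgn \<rho> k'" if "k' \<in> S" "first_diff \<rho> k' d'" "d' < d" for k' d'
      using less.hyps[of d' k'] that d1 by simp
    show ?case
    proof (rule ccontr)
      assume ne: "\<eta> k \<noteq> msgn \<rho> k"
      consider "\<rho> (k + d) + \<rho> (k - d) > 0" | "\<rho> (k + d) + \<rho> (k - d) < 0"
        using less.prems(2) unfolding first_diff_def by linarith
      thus False
      proof cases
        case 1
        from descent_pos[OF sign_data_axioms eq less.prems(1,2) 1 ne min] show False .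
      next
        case 2
        show False
        proof (rule descent_pos[OF sign_data_uminus[OF sign_data_axioms], of k d])
          show "- \<eta> k \<noteq> msgn (\<lambda>i. - \<rho> i) k" using ne by (simp add: msgn_uminus)
        qed (use eq less.prems 2 min in "simp_all add: msgn_uminus first_diff_uminus")
      qed
    qed
  qed
  show ?thesis
  proof (cases "msgn \<rho> k = 0")
    case False
    thus ?thesis using nz[OF k] msgn_nonzero by blast
  next
    case True
    hence s: "\<rho> (k + e) + \<rho> (k - e) = 0" if "1 \<le> e" for e using that by (simp add: msgn_zero_iff)
    have refl: "\<rho> = (\<lambda>i. - \<rho> (2 * k - i))"
    proof
      fix i show "\<rho> i = - \<rho> (2 * k - i)"
        using s[of "i - k"] s[of "k - i"] rho0[OF k]
        by (cases "i = k"; cases "i > k") (auto simp: algebra_simps)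
    qed
    have ms: "msgn \<rho> j = - msgn \<rho> (2 * k - j)" for j
    proof -
      have "msgn \<rho> j = msgn (\<lambda>i. - \<rho> (2 * k - i)) j" using refl by simp
      also have "\<dots> = - msgn (\<lambda>i. \<rho> (2 * k - i)) j" by (rule msgn_uminus)
      finally show ?thesis by (simp add: msgn_reflect)
    qed
    have "\<eta> (k + e) + \<eta> (k - e) = 0" if e: "1 \<le> e" for e
    proof (rule ccontr)
      assume n: "\<eta> (k + e) + \<eta> (k - e) \<noteq> 0"
      have "pal \<rho> k (e + 1)" using s by (auto simp: pal_def)
      hence S: "k + e \<in> S" "k - e \<in> S" using eta_sum_special[OF k e _ n] by auto
      have "msgn \<rho> (k + e) \<noteq> 0" "msgn \<rho> (k - e) \<noteq> 0" using centre[OF k _ True] S e by (metis add_cancel_left_right diff_add_cancel not_one_le_zero)+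
      then obtain d1 d2 where "first_diff \<rho> (k + e) d1" "first_diff \<rho> (k - e) d2"
        using msgn_nonzero by meson
      hence "\<eta> (k + e) = msgn \<rho> (k + e)" "\<eta> (k - e) = msgn \<rho> (k - e)"
        using nz[OF S(1)] nz[OF S(2)] by auto
      moreover have "msgn \<rho> (k + e) = - msgn \<rho> (k - e)" using ms[of "k + e"] by (simp add: algebra_simps)
      ultimately show False using n by simp
    qed
    thus ?thesis using True eq[OF k] msgn_zero_iff[of \<eta> k] by simp
  qed
qed

section \<open>Sequences with dead ends, and their cuts at extreme letters\<close>

locale end_data =
  fixes \<rho> :: "int \<Rightarrow> int" and S :: "int set" and lo hi :: int
  assumes range: "\<rho> k \<in> {-1, 0, 1}" and outside: "k < lo \<or> hi < k ==> \<rho> k = 0"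
    and S0: "k \<in> S ==> \<rho> k = 0"
    and inner: "lo < k ==> k < hi ==> \<rho> k = 0 ==> k \<in> S" and ends: "\<rho> lo = 0" "\<rho> hi = 0"
    and closure: "k \<in> S ==> 1 \<le> e ==> pal \<rho> k e ==> k + e \<in> S \<longleftrightarrow> k - e \<in> S"
    and endhi: "k \<in> S ==> pal \<rho> k (hi - k) ==> hi - k = k - lo"
    and endlo: "k \<in> S ==> pal \<rho> k (k - lo) ==> hi - k = k - lo"
begin

text \<open>A vanishing letter outside \<open>S\<close> lies at or beyond an end. Then
  \<open>endhi\<close> or \<open>endlo\<close> puts \<open>k\<close> in the middle of the word, and
  the opposite letter vanishes too. Consequently the two letters at a first difference have the same
  nonzero value, and this value is the sign at \<open>k\<close>.\<close>

lemma sum_nonzero: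
  assumes k: "k \<in> S" and e: "1 \<le> e" "pal \<rho> k e" "\<rho> (k + e) + \<rho> (k - e) \<noteq> 0"
  shows "\<rho> (k + e) \<noteq> 0 \<and> \<rho> (k - e) \<noteq> 0"
proof (rule ccontr)
  have ns: "k + e \<notin> S" "k - e \<notin> S" using closure[OF k e(1,2)] e(3) S0 by force+
  assume "\<not> ?thesis"
  then consider "\<rho> (k + e) = 0" | "\<rho> (k - e) = 0" by blast
  thus False
  proof cases
    case 1
    have "k + e \<le> lo \<or> hi \<le> k + e" using inner[of "k + e"] 1 ns by linarith
    thus False
    proof
      assume "hi \<le> k + e"
      hence "pal \<rho> k (hi - k)" using e by (auto simp: pal_def)
      from endhi[OF k this] \<open>hi \<le> k + e\<close> have "k - e \<le> lo" by linarith
      hence "\<rho> (k - e) = 0" using outside[of "k - e"] ends by (cases "k - e = lo") auto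
      with 1 e show False by simp
    next
      assume "k + e \<le> lo"
      hence "k - e < lo" using e by linarith
      hence "\<rho> (k - e) = 0" using outside by simp
      with 1 e show False by simp
    qed
  next
    case 2
    have "k - e \<le> lo \<or> hi \<le> k - e" using inner[of "k - e"] 2 ns by linarith
    thus False
    proof
      assume "k - e \<le> lo"
      hence "pal \<rho> k (k - lo)" using e by (auto simp: pal_def)
      from endlo[OF k this] \<open>k - e \<le> lo\<close> have "hi \<le> k + e" by linarith
      hence "\<rho> (k + e) = 0" using outside[of "k + e"] ends by (cases "k + e = hi") auto
      with 2 e show False by simp
    next
      assume "hi \<le> k - e"
      hence "hi < k + e" using e by linarith
      hence "\<rho> (k + e) = 0" using outside by simp
      with 2 e show False by simp
    qed
  qed
qed

text \<open>The sign at \<open>k\<close> is the common value of the two letters at the first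
  difference, one of which lies to the right of \<open>k\<close>, where \<open>s\<close> does not
  occur.\<close>

lemma msgn_right:
  assumes k: "k \<in> S" and s: "s = 1 \<or> s = -1" and after: "\<And>j. k < j ==> \<rho> j \<noteq> s"
  shows "s * msgn \<rho> k \<le> 0"
proof (cases "msgn \<rho> k = 0")
  case False
  then obtain d where d: "first_diff \<rho> k d" using msgn_nonzero by blast
  hence dd: "1 \<le> d" "pal \<rho> k d" "\<rho> (k + d) + \<rho> (k - d) \<noteq> 0" by (auto simp: first_diff_def)
  have "\<rho> (k + d) = - s" using after[of "k + d"] range[of "k + d"] s sum_nonzero[OF k(1) dd] dd k by auto
  moreover have "\<rho> (k - d) = s \<or> \<rho> (k - d) = - s" using sum_nonzero[OF k(1) dd] range[of "k - d"] s by auto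
  ultimately have "\<rho> (k - d) = - s" "\<rho> (k + d) = - s" using dd by auto
  thus ?thesis using msgn_first_diff[OF d] s by auto
qed simp

lemma msgn_left:
  assumes k: "k \<in> S" and s: "s = 1 \<or> s = -1" and before: "\<And>j. j < k ==> \<rho> j \<noteq> - s"
  shows "s * msgn \<rho> k \<ge> 0"
proof (cases "msgn \<rho> k = 0")
  case False
  then obtain d where d: "first_diff \<rho> k d" using msgn_nonzero by blast
  hence dd: "1 \<le> d" "pal \<rho> k d" "\<rho> (k + d) + \<rho> (k - d) \<noteq> 0" by (auto simp: first_diff_def)
  have "\<rho> (k - d) = s" using before[of "k - d"] range[of "k - d"] s sum_nonzero[OF k(1) dd] dd k by auto
  moreover have "\<rho> (k + d) = s \<or> \<rho> (k + d) = - s" using sum_nonzero[OF k(1) dd] range[of "k + d"] s by auto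
  ultimately have "\<rho> (k - d) = s" "\<rho> (k + d) = s" using dd by auto
  thus ?thesis using msgn_first_diff[OF d] s by auto
qed simp

end

locale trim_data = end_data \<rho> S lo hi for \<rho> S lo hi +
  fixes p q s :: int
  assumes bnd: "lo \<le> p" "p < q" "q \<le> hi" and s: "s = 1 \<or> s = -1"
    and q: "\<rho> q = s" "q < k ==> \<rho> k \<noteq> s"
    and p: "\<rho> p = - s" "k < p ==> \<rho> k \<noteq> - s"
begin

definition "trim k = (if p < k \<and> k < q then \<rho> k else 0)"

lemma after_q: "q < k ==> \<rho> k = 0 \<or> \<rho> k = - s"
  using range[of k] q(2)[of k] s by auto

lemma before_p: "k < p ==> \<rho> k = 0 \<or> \<rho> k = s"
  using range[of k] p(2)[of k] s by auto

lemma trim_pal: "k - p \<le> q - k ==> m \<le> k - p ==> pal trim k m \<longleftrightarrow> pal \<rho> k m"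
  "q - k \<le> k - p ==> m \<le> q - k ==> pal trim k m \<longleftrightarrow> pal \<rho> k m"
  unfolding pal_def trim_def by auto

text \<open>Before the nearer cut \<open>q\<close> nothing changes. If the tails agree up to there,
  then in the trimmed word the right tail has come to its end and the letter \<open>?a\<close>
  opposite to \<open>q\<close> decides. The long word gives the same answer: for
  \<open>?a = s\<close> the letter at \<open>q\<close> confirms it at once, and for
  \<open>?a = - s\<close> the decision is made beyond \<open>q\<close>, where only
  \<open>- s\<close> can occur.\<close>

lemma msgn_trim_near:
  assumes k: "k \<in> S" "p < k" "k < q" and m: "q - k \<le> k - p"
  shows "msgn trim k = msgn \<rho> k"
proof (cases "pal \<rho> k (q - k)")
  case False
  then obtain e where "1 \<le> e" "e < q - k" "\<rho> (k + e) + \<rho> (k - e) \<noteq> 0" by (auto simp: pal_def)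
  then obtain d where d: "first_diff \<rho> k d" "d < q - k" using first_diff_ex[of e \<rho> k] by force
  hence "first_diff trim k d" using m k trim_pal(2)[of k d] by (auto simp: first_diff_def trim_def)
  from msgn_first_diff[OF d(1)] msgn_first_diff[OF this] d m k show ?thesis
    by (simp add: trim_def first_diff_def)
next
  case pl: True
  define m where "m = q - k"
  have m1: "1 \<le> m" "pal \<rho> k m" "q = k + m" using pl k m_def by auto
  have rq: "\<rho> (k + m) = s" using q(1) m1(3) by simp
  show ?thesis
  proof (cases "k - p = m")
    case eq: True
    hence pe: "p = k - m" by simp
    have "msgn trim k = 0"
    proof -
      have "trim (k + e) + trim (k - e) = 0" if "1 \<le> e" for e
        using that m1 pe unfolding trim_def by (auto simp: pal_def)
      thus ?thesis by (simp add: msgn_zero_iff)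
    qed
    moreover have "msgn \<rho> k = 0"
    proof (rule ccontr)
      assume "msgn \<rho> k \<noteq> 0"
      then obtain d where d: "first_diff \<rho> k d" using msgn_nonzero by blast
      hence dd: "1 \<le> d" "pal \<rho> k d" "\<rho> (k + d) + \<rho> (k - d) \<noteq> 0" by (auto simp: first_diff_def)
      have "\<rho> (k + m) + \<rho> (k - m) = 0" using q(1) p(1) m1 pe by simp
      hence "d > m" using dd m1 by (cases "d = m") (auto simp: pal_def)
      \<comment> \<open>Beyond the two cuts the nonzero values are \<open>- s\<close> on the right
        and \<open>s\<close> on the left. They cancel, so no first difference can occur
        there.\<close>
      hence "\<rho> (k + d) = 0 \<or> \<rho> (k + d) = - s" "\<rho> (k - d) = 0 \<or> \<rho> (k - d) = s"
        using after_q before_p m1 pe by auto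
      thus False using sum_nonzero[OF k(1) dd] dd(3) by auto
    qed
    ultimately show ?thesis by simp
  next
    case ne: False
    hence km: "m < k - p" using m m_def by linarith
    let ?a = "\<rho> (k - m)"
    have ns: "k + m \<notin> S" "k - m \<notin> S"
      using closure[OF k(1) m1(1,2)] S0[of q] q(1) s m1 by auto
    have a0: "?a \<noteq> 0"
    proof
      assume "?a = 0"
      hence "\<not> (lo < k - m \<and> k - m < hi)" using inner[of "k - m"] ns by blast
      thus False using km m1 k bnd by linarith
    qed
    hence a: "?a = s \<or> ?a = - s" using range[of "k - m"] s by auto
    have tr: "trim (k + m) = 0" "trim (k - m) = ?a" unfolding trim_def using m1(1,3) k km by simp_all
    have "pal trim k m" using trim_pal(2)[OF m, of "q - k"] pl unfolding m_def by blast
    hence ft: "first_diff trim k m" using m1(1) a0 tr unfolding first_diff_def by simp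
    have mt: "msgn trim k = sgn ?a" using msgn_first_diff[OF ft] tr by simp
    show ?thesis
    proof (cases "?a = s")
      case True
      hence "\<rho> (k + m) + ?a \<noteq> 0" using rq s by linarith
      hence "first_diff \<rho> k m" using m1(1,2) unfolding first_diff_def by blast
      from msgn_first_diff[OF this] have "msgn \<rho> k = sgn (s + s)" unfolding rq True .
      thus ?thesis using mt True by (simp add: sgn_if)
    next
      case False
      hence as: "?a = - s" using a by blast
      have s0: "\<rho> (k + m) + \<rho> (k - m) = 0" using as rq by simp
      \<comment> \<open>Equal tails would produce the mirror image of \<open>p\<close>, a letter of
        value \<open>s\<close>, to the right of \<open>q\<close>.\<close>
      have "msgn \<rho> k \<noteq> 0"
      proof
        assume "msgn \<rho> k = 0"
        hence pz: "\<rho> (k + e) + \<rho> (k - e) = 0" if "1 \<le> e" for e using that by (simp add: msgn_zero_iff)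
        have "\<rho> (k + (k - p)) = s" using pz[of "k - p"] p(1) k(2) by simp
        moreover have "q < k + (k - p)" using km m1(3) by linarith
        ultimately show False using q(2) by blast
      qed
      then obtain d where d: "first_diff \<rho> k d" using msgn_nonzero by blast
      hence dd: "1 \<le> d" "pal \<rho> k d" "\<rho> (k + d) + \<rho> (k - d) \<noteq> 0" by (auto simp: first_diff_def)
      have "\<not> d < m" "d \<noteq> m" using dd m1(1,2) s0 unfolding pal_def by blast+
      hence "q < k + d" using m1(3) by linarith
      hence "\<rho> (k + d) = - s" using after_q[of "k + d"] sum_nonzero[OF k(1) dd] by blast
      moreover have "\<rho> (k - d) = s \<or> \<rho> (k - d) = - s" using sum_nonzero[OF k(1) dd] range[of "k - d"] s by auto
      ultimately have "\<rho> (k - d) = - s" "\<rho> (k + d) = - s" using dd by auto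
      thus ?thesis using msgn_first_diff[OF d] mt as s by auto
    qed
  qed
qed

end

text \<open>Inverting a word reverses its order and negates the values. The two sign changes cancel
  in the conditions on the cuts, so \<open>p\<close> and \<open>q\<close> are exchanged while
  \<open>s\<close> is kept.\<close>

lemma trim_data_reflect:
  assumes "trim_data \<rho> S lo hi p q s"
  shows "trim_data (\<lambda>i. - \<rho> (- i)) {k. - k \<in> S} (- hi) (- lo) (- q) (- p) s"
proof -
  interpret trim_data \<rho> S lo hi p q s by (rule assms)
  have pl: "pal (\<lambda>i. - \<rho> (- i)) k e \<longleftrightarrow> pal \<rho> (- k) e" for k e
    using pal_uminus[of "\<lambda>i. \<rho> (- i)"] pal_reflect[of \<rho> 0] by simp
  show ?thesis
  proof
    show "\<And>k. - \<rho> (- k) \<in> {- 1, 0, 1}" using range by (metis insert_iff minus_equation_iff empty_iff neg_0_equal_iff_equal)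
    show "\<And>k e. k \<in> {k. - k \<in> S} ==> 1 \<le> e ==> pal (\<lambda>i. - \<rho> (- i)) k e ==>
        k + e \<in> {k. - k \<in> S} \<longleftrightarrow> k - e \<in> {k. - k \<in> S}"
      using closure[of "- k" for k] pl by (auto simp: algebra_simps)
    show "- lo - k = k - - hi"
      if "k \<in> {k. - k \<in> S}" "pal (\<lambda>i. - \<rho> (- i)) k (- lo - k)" for k
    proof -
      have e: "- lo - k = - k - lo" by simp
      show ?thesis using endlo[of "- k"] that unfolding pl e by simp
    qed
    show "- lo - k = k - - hi"
      if "k \<in> {k. - k \<in> S}" "pal (\<lambda>i. - \<rho> (- i)) k (k - - hi)" for k
    proof -
      have e: "k - - hi = hi - - k" by simp
      show ?thesis using endhi[of "- k"] that unfolding pl e by simp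
    qed
    show "\<And>k. - hi < k ==> k < - lo ==> - \<rho> (- k) = 0 ==> k \<in> {k. - k \<in> S}"
      using inner[of "- k" for k] by simp
    show "\<And>k. k < - hi \<or> - lo < k ==> - \<rho> (- k) = 0" using outside[of "- k" for k] by auto
    show "\<And>k. - p < k ==> - \<rho> (- k) \<noteq> s" using p(2)[of "- k" for k] by force
    show "\<And>k. k < - q ==> - \<rho> (- k) \<noteq> - s" using q(2)[of "- k" for k] by force
  qed (use bnd s ends S0 p q in auto)
qed

context trim_data
begin

theorem msgn_trim:
  assumes k: "k \<in> S" "p < k" "k < q"
  shows "msgn trim k = msgn \<rho> k"
proof (cases "q - k \<le> k - p")
  case True
  thus ?thesis using msgn_trim_near[OF k] by blast
next
  case False
  let ?r = "\<lambda>i. - \<rho> (- i)"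
  interpret R: trim_data ?r "{k. - k \<in> S}" "- hi" "- lo" "- q" "- p" s
    by (rule trim_data_reflect[OF trim_data_axioms])
  have t: "R.trim = (\<lambda>i. - trim (- i))" by (auto simp: R.trim_def trim_def)
  have "msgn R.trim (- k) = msgn ?r (- k)" by (rule R.msgn_trim_near) (use k False in auto)
  thus ?thesis unfolding t
    using msgn_uminus[of "\<lambda>i. trim (- i)" "- k"] msgn_uminus[of "\<lambda>i. \<rho> (- i)" "- k"]
      msgn_reflect[of trim 0 "- k"] msgn_reflect[of \<rho> 0 "- k"] by simp
qed

lemma msgn_after_q: "k \<in> S ==> q < k ==> s * msgn \<rho> k \<le> 0"
  using msgn_right[OF _ s, of k] q(2) by simp

lemma msgn_before_p: "k \<in> S ==> k < p ==> s * msgn \<rho> k \<ge> 0"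
  using msgn_left[OF _ s, of k] p(2) by simp

end

text \<open>The sequence is odd under the reflection at such a position. To the left of
  \<open>p\<close> the mirror image of \<open>q\<close>, and to the right of \<open>q\<close> the
  mirror image of \<open>p\<close>, would contradict the extremality of the cuts.\<close>

lemma (in trim_data) msgn_zero_inside:
  assumes k: "k \<in> S" "msgn \<rho> k = 0"
  shows "p < k \<and> k < q"
proof -
  have z: "\<rho> (k + e) + \<rho> (k - e) = 0" if "1 \<le> e" for e using k(2) that by (simp add: msgn_zero_iff)
  have kn: "k \<noteq> p" "k \<noteq> q" using S0[OF k(1)] p q s by auto
  have "\<not> k < p"
  proof
    assume "k < p"
    hence "\<rho> (k - (p - k)) = s" "\<rho> (k - (q - k)) = - s"
      using z[of "p - k"] z[of "q - k"] p(1) q(1) bnd by auto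
    thus False using p(2)[of "k - (q - k)"] bnd \<open>k < p\<close> by auto
  qed
  moreover have "\<not> q < k"
  proof
    assume "q < k"
    hence "\<rho> (k + (k - p)) = s" using z[of "k - p"] p(1) bnd by auto
    thus False using q(2)[of "k + (k - p)"] bnd \<open>q < k\<close> by auto
  qed
  ultimately show ?thesis using kn by linarith
qed

subsection \<open>Words and strings\<close>

definition follows :: "('v, 'a) pquiver \<Rightarrow> ('v, 'a) letter \<Rightarrow> ('v, 'a) letter \<Rightarrow> bool" where
  "follows Q a b \<longleftrightarrow> (\<exists>p. lso Q a = Some p \<and> lta Q b = Some (opp p))"

lemma opp_opp [simp]: "opp (opp p) = p"
  by (simp add: opp_def)

lemma opp_pair [simp]: "opp (i, r) = (i, - r)"
  by (simp add: opp_def)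

lemma opp_inj [simp]: "opp p = opp q \<longleftrightarrow> p = q"
  by (metis opp_opp)

lemma is_word_iff: "is_word Q w \<longleftrightarrow> set w \<subseteq> letters Q \<and> successively (follows Q) w"
  unfolding is_word_def successively_conv_nth follows_def by (metis opp_opp)

lemma is_word_Nil [simp]: "is_word Q []"
  by (simp add: is_word_iff)

lemma is_word_Cons:
  "is_word Q (l # w) \<longleftrightarrow> l \<in> letters Q \<and> is_word Q w \<and> (w \<noteq> [] --> follows Q l (hd w))"
  by (cases w) (auto simp: is_word_iff)

lemma is_word_append:
  "is_word Q (u @ v) \<longleftrightarrow> is_word Q u \<and> is_word Q v \<and> (u \<noteq> [] \<and> v \<noteq> [] --> follows Q (last u) (hd v))"
  by (auto simp: is_word_iff successively_append_iff)

lemma linv_linv [simp]: "linv (linv l) = l"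
  by (cases l) auto

lemma linv_inj [simp]: "linv l = linv l' \<longleftrightarrow> l = l'"
  by (metis linv_linv)

lemma lso_linv [simp]: "lso Q (linv l) = lta Q l"
  by (cases l) auto

lemma lta_linv [simp]: "lta Q (linv l) = lso Q l"
  by (cases l) auto

lemma lrank_linv: "lrank (linv l) = 2 - lrank l"
  by (cases l) auto

lemma lrank_le: "lrank l \<le> 2"
  by (cases l) auto

lemma linv_letters [simp]: "linv l \<in> letters Q \<longleftrightarrow> l \<in> letters Q"
  by (cases l) (auto simp: letters_def)

lemma follows_linv: "follows Q (linv b) (linv a) \<longleftrightarrow> follows Q a b"
  unfolding follows_def by auto

lemma winv_winv [simp]: "winv (winv w) = w"
  by (simp add: winv_def rev_map comp_def)

lemma winv_Nil [simp]: "winv [] = []"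
  by (simp add: winv_def)

lemma winv_append [simp]: "winv (u @ v) = winv v @ winv u"
  by (simp add: winv_def)

lemma winv_Cons: "winv (l # v) = winv v @ [linv l]"
  by (simp add: winv_def)

lemma winv_single [simp]: "winv [l] = [linv l]"
  by (simp add: winv_def)

lemma length_winv [simp]: "length (winv w) = length w"
  by (simp add: winv_def)

lemma winv_Nil_iff [simp]: "winv w = [] \<longleftrightarrow> w = []"
  by (simp add: winv_def)

lemma set_winv [simp]: "set (winv w) = linv ` set w"
  by (simp add: winv_def)

lemma hd_winv: "w \<noteq> [] ==> hd (winv w) = linv (last w)"
  by (simp add: winv_def hd_rev last_map)

lemma last_winv: "w \<noteq> [] ==> last (winv w) = linv (hd w)"
  by (simp add: winv_def last_rev hd_map)

lemma nth_winv: "m < length w ==> winv w ! m = linv (w ! (length w - Suc m))"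
  by (simp add: winv_def rev_nth)

lemma is_word_winv [simp]: "is_word Q (winv w) \<longleftrightarrow> is_word Q w"
proof -
  have *: "is_word Q (winv w)" if "is_word Q w" for w :: "('a, 'b) letter list"
    using that
  proof (induction w)
    case (Cons l w)
    hence "w \<noteq> [] ==> follows Q (last (winv w)) (linv l)"
      by (metis is_word_Cons last_winv follows_linv)
    with Cons show ?case by (auto simp: winv_Cons is_word_append is_word_Cons)
  qed simp
  show ?thesis using *[of w] *[of "winv w"] by auto
qed

lemma is_string_winv [simp]: "is_string Q (winv w) \<longleftrightarrow> is_string Q w"
proof -
  have *: "is_string Q (winv w)" if "is_string Q w" for w :: "('a, 'b) letter list"
    using that unfolding is_string_def by (auto simp: hd_winv last_winv)
  show ?thesis using *[of w] *[of "winv w"] by auto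
qed

lemma arrs_hat [simp]: "arrs (hat Q) = arrs Q"
  by (simp add: arrs_def hat_def)

lemma hat_simps [simp]: "verts (hat Q) = verts Q" "sparr (hat Q) = {}" "ordarr (hat Q) = arrs Q"
  "pso (hat Q) = pso Q" "pta (hat Q) = pta Q" "spverts (hat Q) = {}"
  by (simp_all add: hat_def spverts_def)

lemma lso_hat [simp]: "lso (hat Q) l = lso Q l" and lta_hat [simp]: "lta (hat Q) l = lta Q l"
  by (cases l; simp)+

lemma follows_hat [simp]: "follows (hat Q) = follows Q"
  unfolding follows_def by auto

lemma lless_hat [simp]: "lless (hat Q) = lless Q"
  unfolding lless_def by auto

lemma wless_hat [simp]: "wless (hat Q) = wless Q"
  unfolding wless_def by auto

lemma skewed_gentle_hat: "skewed_gentle Q ==> skewed_gentle (hat Q)"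
proof -
  assume Q: "skewed_gentle Q"
  have "finite (arrs Q)" using Q by (auto simp: skewed_gentle_def arrs_def)
  moreover have "adm_path (hat Q) = adm_path Q" unfolding adm_path_def by (intro ext) simp
  ultimately show ?thesis using Q by (auto simp: skewed_gentle_def)
qed

lemma pso_special: "skewed_gentle Q ==> e \<in> sparr Q ==> pso Q e = (src Q e, -1) \<and> pta Q e = (src Q e, -1)"
  unfolding skewed_gentle_def src_def tgt_def spol_def tpol_def by (metis prod.collapse)

lemma pso_inj: "skewed_gentle Q ==> a \<in> arrs Q ==> b \<in> arrs Q ==> pso Q a = pso Q b ==> a = b"
  and pta_inj: "skewed_gentle Q ==> a \<in> arrs Q ==> b \<in> arrs Q ==> pta Q a = pta Q b ==> a = b"
  unfolding skewed_gentle_def inj_on_def by blast+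

lemma pso_range: "skewed_gentle Q ==> a \<in> arrs Q ==> fst (pso Q a) \<in> verts Q \<and> snd (pso Q a) \<in> {-1, 1}"
  and pta_range: "skewed_gentle Q ==> a \<in> arrs Q ==> fst (pta Q a) \<in> verts Q \<and> snd (pta Q a) \<in> {-1, 1}"
  unfolding skewed_gentle_def by (metis image_subset_iff mem_Times_iff)+

lemma sparr_arrs: "e \<in> sparr Q ==> e \<in> arrs Q" and ordarr_arrs: "a \<in> ordarr Q ==> a \<in> arrs Q"
  by (auto simp: arrs_def)

lemma ordarr_not_sparr: "skewed_gentle Q ==> a \<in> ordarr Q ==> a \<notin> sparr Q"
  unfolding skewed_gentle_def by blast

lemma sploop_src:
  assumes "skewed_gentle Q" "e \<in> sparr Q"
  shows "sploop Q (src Q e) = e"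
  unfolding sploop_def
proof (rule the_equality)
  fix e' assume "e' \<in> sparr Q \<and> src Q e' = src Q e"
  thus "e' = e" using pso_inj[OF assms(1)] pso_special[OF assms(1)] assms(2) sparr_arrs by metis
qed (use assms in simp)

lemma sploop:
  assumes "skewed_gentle Q" "i \<in> spverts Q"
  shows "sploop Q i \<in> sparr Q" "src Q (sploop Q i) = i" "pso Q (sploop Q i) = (i, -1)" "pta Q (sploop Q i) = (i, -1)"
proof -
  obtain e where e: "e \<in> sparr Q" "i = src Q e" using assms by (auto simp: spverts_def)
  hence "sploop Q i = e" using sploop_src[OF assms(1)] by simp
  with e pso_special[OF assms(1)] show "sploop Q i \<in> sparr Q" "src Q (sploop Q i) = i"
    "pso Q (sploop Q i) = (i, -1)" "pta Q (sploop Q i) = (i, -1)" by auto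
qed

lemma spverts_verts: "skewed_gentle Q ==> i \<in> spverts Q ==> i \<in> verts Q"
  by (metis sploop(1,3) sparr_arrs pso_range fst_conv)

lemma letters_simps [simp]:
  "Dir a \<in> letters Q \<longleftrightarrow> a \<in> ordarr Q" "Inv a \<in> letters Q \<longleftrightarrow> a \<in> ordarr Q"
  "Spl i \<in> letters Q \<longleftrightarrow> i \<in> spverts Q"
  "Tr i r \<in> letters Q \<longleftrightarrow> i \<in> verts Q \<and> (r = -1 \<or> r = 1) \<and> (i \<in> spverts Q --> r \<noteq> -1)"
  "TrI i r \<in> letters Q \<longleftrightarrow> i \<in> verts Q \<and> (r = -1 \<or> r = 1) \<and> (i \<in> spverts Q --> r \<noteq> -1)"
proof -
  show "Dir a \<in> letters Q \<longleftrightarrow> a \<in> ordarr Q" by (simp add: letters_def image_iff)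
  show "Inv a \<in> letters Q \<longleftrightarrow> a \<in> ordarr Q" by (simp add: letters_def image_iff)
  show "Spl i \<in> letters Q \<longleftrightarrow> i \<in> spverts Q" by (simp add: letters_def image_iff)
  show "Tr i r \<in> letters Q \<longleftrightarrow> i \<in> verts Q \<and> (r = -1 \<or> r = 1) \<and> (i \<in> spverts Q --> r \<noteq> -1)"
    by (simp add: letters_def image_iff) auto
  show "TrI i r \<in> letters Q \<longleftrightarrow> i \<in> verts Q \<and> (r = -1 \<or> r = 1) \<and> (i \<in> spverts Q --> r \<noteq> -1)"
    by (simp add: letters_def image_iff) auto
qed

text \<open>The point \<open>(i, -1)\<close> is already occupied by the special loop, and the
  polarized source and target maps are injective.\<close>

lemma special_point_ordarr:
  assumes "skewed_gentle Q" "i \<in> spverts Q" "a \<in> ordarr Q"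
  shows "pso Q a \<noteq> (i, -1)" "pta Q a \<noteq> (i, -1)"
  by (metis assms sploop(1,3) pso_inj ordarr_not_sparr ordarr_arrs sparr_arrs)
    (metis assms sploop(1,4) pta_inj ordarr_not_sparr ordarr_arrs sparr_arrs)

lemma special_letter_unique:
  assumes "skewed_gentle Q" "i \<in> spverts Q" "l \<in> letters Q" "lta Q l = Some (i, -1)"
  shows "l = Spl i"
  using assms special_point_ordarr[OF assms(1,2)] by (cases l) auto

text \<open>Gentleness in terms of letters: a direct letter is determined by the target of its arrow
  and an inverse one by the source, while a special letter is alone at its point. This is what
  allows comparing words through their ranks.\<close>

lemma letter_det:
  assumes Q: "skewed_gentle Q" and l: "l \<in> letters Q" "l' \<in> letters Q"
    and p: "lta Q l = Some p" "lta Q l' = Some p" and r: "lrank l = lrank l'"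
  shows "l = l'"
proof (cases "\<exists>i. l = Spl i \<or> l' = Spl i")
  case True
  then obtain i where "l = Spl i \<or> l' = Spl i" by blast
  thus ?thesis using special_letter_unique[OF Q] l p by auto
next
  case False
  thus ?thesis using l p r pso_inj[OF Q] pta_inj[OF Q]
    by (cases l; cases l') (auto simp: arrs_def)
qed

lemma is_spl_simps [simp]: "is_spl (Spl i)" "\<not> is_spl (Dir a)" "\<not> is_spl (Inv a)" "\<not> is_spl (Tr i r)"
  "\<not> is_spl (TrI i r)"
  by (auto simp: is_spl_def)

lemma is_dir_simps [simp]: "\<not> is_dir (Spl i)" "is_dir (Dir a)" "\<not> is_dir (Inv a)" "\<not> is_dir (Tr i r)"
  "\<not> is_dir (TrI i r)"
  by (auto simp: is_dir_def)

subsection \<open>Tails of strings\<close>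

text \<open>A string without its first letter: for a letter \<open>TrI i r\<close>, the elements of
  \<open>St Q i r\<close> are the words \<open>TrI i r # u\<close> with
  \<open>tail Q (i, - r) u\<close>. The two words compared at a special position are of this form as
  well.\<close>

definition tail :: "('v, 'a) pquiver \<Rightarrow> 'v \<times> int \<Rightarrow> ('v, 'a) word \<Rightarrow> bool" where
  "tail Q p u \<longleftrightarrow> u \<noteq> [] \<and> is_word Q u \<and> lta Q (hd u) = Some p \<and> (\<exists>i r. last u = Tr i r)"

lemma tail_Cons: "tail Q p (l # u) \<longleftrightarrow> l \<in> letters Q \<and> lta Q l = Some p \<and>
    (if u = [] then \<exists>i r. l = Tr i r else \<exists>p'. lso Q l = Some p' \<and> tail Q (opp p') u)"
  unfolding tail_def by (auto simp: is_word_Cons follows_def)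

lemma word_nth: "is_word Q w ==> Suc k < length w ==> follows Q (w ! k) (w ! Suc k)"
  by (simp add: is_word_iff successively_conv_nth)

lemma word_letters: "is_word Q w ==> k < length w ==> w ! k \<in> letters Q"
  unfolding is_word_iff by (meson nth_mem subset_eq)

lemma word_Tr_last: "is_word Q w ==> k < length w ==> w ! k = Tr i r ==> k = length w - 1"
  using word_nth[of Q w k] by (cases "Suc k < length w") (auto simp: follows_def)

lemma word_TrI_first: "is_word Q w ==> k < length w ==> w ! k = TrI i r ==> k = 0"
  using word_nth[of Q w "k - 1"] by (cases k) (auto simp: follows_def)

lemma tail_Tr: "tail Q p u ==> k < length u ==> u ! k = Tr i r \<longleftrightarrow> k = length u - 1 \<and> last u = Tr i r"
  unfolding tail_def using word_Tr_last by (metis last_conv_nth)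

lemma tail_last: "tail Q p u ==> \<exists>i r. u ! (length u - 1) = Tr i r"
  unfolding tail_def by (metis last_conv_nth)

lemma tail_lta:
  assumes "tail Q p u" "tail Q p v" "\<And>k. k < m ==> u ! k = v ! k" "m < length u" "m < length v"
  shows "\<exists>p'. lta Q (u ! m) = Some p' \<and> lta Q (v ! m) = Some p'"
proof (cases m)
  case 0
  thus ?thesis using assms(1,2) unfolding tail_def by (metis hd_conv_nth)
next
  case (Suc k)
  hence "follows Q (u ! k) (u ! m)" "follows Q (v ! k) (v ! m)" "u ! k = v ! k"
    using assms word_nth[of Q u k] word_nth[of Q v k] unfolding tail_def by auto
  thus ?thesis unfolding follows_def by force
qed

text \<open>The polarized target of each letter is forced by its predecessor, so equal ranks give
  equal letters one after the other by \<open>letter_det\<close>.\<close>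

lemma tail_agree:
  assumes Q: "skewed_gentle Q" and u: "tail Q p u" and v: "tail Q p v"
  shows "m \<le> length u ==> m \<le> length v ==> (\<And>k. k < m ==> lrank (u ! k) = lrank (v ! k)) ==>
    k < m ==> u ! k = v ! k"
proof (induction m arbitrary: k)
  case (Suc m)
  hence IH: "u ! k = v ! k" if "k < m" for k using that by simp
  then obtain p' where "lta Q (u ! m) = Some p'" "lta Q (v ! m) = Some p'"
    using tail_lta[OF u v, of m] Suc.prems by auto
  hence "u ! m = v ! m"
    using letter_det[OF Q] Suc.prems u v word_letters unfolding tail_def by (metis Suc_le_lessD lessI)
  with IH Suc.prems show ?case by (cases "k = m") auto
qed simp

text \<open>A trivial letter can stand only at the end of a word, so no tail is a proper prefix of
  another tail.\<close>

lemma tail_prefix: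
  assumes u: "tail Q p u" and v: "tail Q p v"
    and "length u \<le> length v" "\<And>k. k < length u ==> u ! k = v ! k"
  shows "u = v"
proof -
  have "u \<noteq> []" using u by (simp add: tail_def)
  obtain i r where t: "u ! (length u - 1) = Tr i r" using tail_last[OF u] by blast
  hence vt: "v ! (length u - 1) = Tr i r" using assms(4)[of "length u - 1"] \<open>u \<noteq> []\<close> by simp
  have "length u - 1 < length v" using \<open>u \<noteq> []\<close> assms(3) by (cases u) auto
  hence "length u - 1 = length v - 1" using tail_Tr[OF v] vt by blast
  hence "length u = length v" using \<open>u \<noteq> []\<close> assms(3) by (cases u; cases v) auto
  thus ?thesis using assms(4) by (intro nth_equalityI) auto
qed

lemma tail_diff:
  assumes Q: "skewed_gentle Q" and u: "tail Q p u" and v: "tail Q p v" and ne: "u \<noteq> v"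
  obtains m where "m < length u" "m < length v" "\<And>k. k < m ==> u ! k = v ! k"
    "lrank (u ! m) \<noteq> lrank (v ! m)"
proof -
  define P where "P m \<longleftrightarrow> m < length u \<and> m < length v \<and> lrank (u ! m) \<noteq> lrank (v ! m)" for m
  have "\<exists>m. P m"
  proof (rule ccontr)
    assume "\<not> ?thesis"
    hence r: "lrank (u ! k) = lrank (v ! k)" if "k < length u" "k < length v" for k
      using that by (auto simp: P_def)
    show False
    proof (cases "length u \<le> length v")
      case True
      have "u ! k = v ! k" if "k < length u" for k
        using tail_agree[OF Q u v order_refl True r that] True by auto
      thus False using tail_prefix[OF u v True] ne by blast
    next
      case False
      hence le: "length v \<le> length u" by simp
      have "v ! k = u ! k" if "k < length v" for k
        using tail_agree[OF Q u v le order_refl r that] le by auto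
      thus False using tail_prefix[OF v u le] ne by blast
    qed
  qed
  hence ex: "P (LEAST m. P m)" by (rule LeastI_ex)
  define M where "M = (LEAST m. P m)"
  have P: "P M" using ex by (simp add: M_def)
  have r: "lrank (u ! k) = lrank (v ! k)" if "k < M" for k
  proof -
    have "\<not> P k" using that unfolding M_def by (rule not_less_Least)
    with P that show ?thesis by (auto simp: P_def)
  qed
  have "u ! k = v ! k" if "k < M" for k
  proof (rule tail_agree[OF Q u v _ _ _ that])
    show "M \<le> length u" "M \<le> length v" using P by (auto simp: P_def)
  qed (rule r)
  with P that show ?thesis unfolding P_def by blast
qed

lemma wless_tail:
  assumes "tail Q p u" "tail Q p v"
    and m: "m < length u" "m < length v" "\<And>k. k < m ==> u ! k = v ! k" "lrank (u ! m) \<noteq> lrank (v ! m)"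
  shows "wless Q u v \<longleftrightarrow> lrank (u ! m) < lrank (v ! m)"
proof
  assume "lrank (u ! m) < lrank (v ! m)"
  hence "lless Q (u ! m) (v ! m)" using tail_lta[OF assms(1,2) m(3,1,2)] by (auto simp: lless_def)
  moreover have "take m u = take m v" using m by (intro nth_take_lemma) auto
  ultimately show "wless Q u v" using m unfolding wless_def by blast
next
  assume "wless Q u v"
  then obtain k where k: "k < length u" "k < length v" "take k u = take k v" "lless Q (u ! k) (v ! k)"
    unfolding wless_def by blast
  have "\<not> k < m" using m(3)[of k] k(4) by (auto simp: lless_def)
  moreover have "\<not> m < k"
  proof
    assume "m < k"
    hence "u ! m = v ! m" using k(3) by (metis nth_take)
    with m show False by simp
  qed
  ultimately show "lrank (u ! m) < lrank (v ! m)" using k(4) by (simp add: lless_def)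
qed

lemma string_length: "is_string Q w ==> 2 \<le> length w"
  unfolding is_string_def by (cases w; cases "tl w") auto

lemma string_drop:
  assumes w: "is_string Q w" and k: "0 < k" "k < length w"
  shows "\<exists>p. lta Q (w ! k) = Some p \<and> tail Q p (drop k w)"
proof -
  have "follows Q (w ! (k - 1)) (w ! k)" using word_nth[of Q w "k - 1"] w k by (auto simp: is_string_def)
  then obtain p where p: "lta Q (w ! k) = Some p" by (auto simp: follows_def)
  have "is_word Q (take k w @ drop k w)" using w by (simp add: is_string_def)
  hence "is_word Q (drop k w)" using is_word_append by blast
  with p k w show ?thesis unfolding tail_def is_string_def by (auto simp: hd_drop_conv_nth)
qed

lemma string_take:
  assumes w: "is_string Q w" and k: "0 < k" "k < length w"
  shows "\<exists>p. lso Q (w ! (k - 1)) = Some p \<and> tail Q p (winv (take k w))"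
proof -
  have "0 < length w - k" "length w - k < length w" using k by auto
  then obtain p where "lta Q (winv w ! (length w - k)) = Some p" "tail Q p (drop (length w - k) (winv w))"
    using string_drop[of Q "winv w" "length w - k"] w by auto
  moreover have "drop (length w - k) (winv w) = winv (take k w)"
    by (simp add: winv_def rev_take flip: take_map)
  moreover have "winv w ! (length w - k) = linv (w ! (k - 1))" using k by (simp add: nth_winv)
  ultimately show ?thesis by auto
qed

section \<open>Letter values, and the comparison of the two tails at a special position\<close>

definition cen :: "('v, 'a) letter \<Rightarrow> int" where "cen l = int (lrank l) - 1"

definition seq :: "('v, 'a) word \<Rightarrow> int \<Rightarrow> int" where
  "seq w j = (if 0 \<le> j \<and> j < int (length w) then cen (w ! nat j) else 0)"

definition spos :: "('v, 'a) word \<Rightarrow> int set" where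
  "spos w = {j. 0 \<le> j \<and> j < int (length w) \<and> is_spl (w ! nat j)}"

lemma cen_linv: "cen (linv l) = - cen l"
  using lrank_le[of l] by (auto simp: cen_def lrank_linv)

lemma cen_range: "cen l \<in> {-1, 0, 1}"
  by (cases l) (auto simp: cen_def)

lemma cen_spl: "is_spl l ==> cen l = 0"
  by (auto simp: is_spl_def cen_def)

lemma seq_nth: "k < length w ==> seq w (int k) = cen (w ! k)"
  by (simp add: seq_def)

lemma seq_range: "seq w j \<in> {-1, 0, 1}"
  using cen_range by (auto simp: seq_def)

lemma spos_seq: "j \<in> spos w ==> seq w j = 0"
  by (auto simp: spos_def seq_def cen_spl)

lemma seq_winv: "seq (winv w) j = - seq w (int (length w) - 1 - j)"
proof -
  have "nat (int (length w) - 1 - j) = length w - Suc (nat j)" if "0 \<le> j" "j < int (length w)"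
    using that by linarith
  thus ?thesis by (auto simp: seq_def nth_winv cen_linv nat_less_iff)
qed

lemma special_tails:
  assumes w: "is_string Q w" and k: "0 < k" "k < length w - 1" "lso Q (w ! k) = Some (i, -1)"
    "lta Q (w ! k) = Some (i, -1)"
  shows "tail Q (i, 1) (drop (Suc k) w)" "tail Q (i, 1) (winv (take k w))"
proof -
  have wd: "is_word Q w" using w by (simp add: is_string_def)
  have "follows Q (w ! k) (w ! Suc k)" using word_nth[OF wd, of k] k by simp
  moreover have "\<exists>p. lta Q (w ! Suc k) = Some p \<and> tail Q p (drop (Suc k) w)"
    using string_drop[OF w, of "Suc k"] k by simp
  ultimately show "tail Q (i, 1) (drop (Suc k) w)" using k by (auto simp: follows_def)
  have "follows Q (w ! (k - 1)) (w ! k)" using word_nth[OF wd, of "k - 1"] k by simp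
  hence "lso Q (w ! (k - 1)) = Some (i, 1)" using k unfolding follows_def
    by (metis opp_opp opp_pair option.inject add.inverse_inverse)
  moreover have "\<exists>p. lso Q (w ! (k - 1)) = Some p \<and> tail Q p (winv (take k w))"
    using string_take[OF w, of k] k by simp
  ultimately show "tail Q (i, 1) (winv (take k w))" by auto
qed

lemma seq_right: "m < length w - Suc k ==> seq w (int k + int (Suc m)) = cen (drop (Suc k) w ! m)"
  using seq_nth[of "k + Suc m" w] by (simp add: algebra_simps)

lemma seq_left: "m < k ==> k < length w ==> seq w (int k - int (Suc m)) = - cen (winv (take k w) ! m)"
proof -
  assume m: "m < k" "k < length w"
  hence "int k - int (Suc m) = int (k - Suc m)" by simp
  thus ?thesis using m seq_nth[of "k - Suc m" w] by (simp add: nth_winv cen_linv)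
qed

lemma lrank_cen: "lrank l = lrank l' \<longleftrightarrow> cen l = cen l'" "lrank l < lrank l' \<longleftrightarrow> cen l < cen l'"
  by (auto simp: cen_def)

text \<open>The letter at \<open>k\<close> is described only by its polarized ends, so that the
  locale applies both to special letters over \<open>Q\<close> and to oriented special loops over
  \<open>hat Q\<close>.\<close>

locale special_pos =
  fixes Q :: "('v, 'a) pquiver" and w :: "('v, 'a) word" and k :: nat and i :: 'v
  assumes Q: "skewed_gentle Q" and w: "is_string Q w" and k: "0 < k" "k < length w - 1"
    and pt: "lso Q (w ! k) = Some (i, -1)" "lta Q (w ! k) = Some (i, -1)"
begin

definition "R = drop (Suc k) w"
definition "L = winv (take k w)"

lemma tails: "tail Q (i, 1) R" "tail Q (i, 1) L"
  using special_tails[OF w k pt] by (auto simp: R_def L_def)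

lemma lengths: "length R = length w - Suc k" "length L = k"
  using k by (auto simp: R_def L_def)

lemma sum_eq: "m < length R ==> m < length L ==>
  seq w (int k + int (Suc m)) + seq w (int k - int (Suc m)) = cen (R ! m) - cen (L ! m)"
  using seq_right[of m w k] seq_left[of m k w] k by (simp add: R_def L_def)

lemma pal_agree:
  assumes "pal (seq w) (int k) (int e)" "e \<le> Suc (length R)" "e \<le> Suc (length L)" "m < e - 1"
  shows "R ! m = L ! m"
proof (rule tail_agree[OF Q tails, of "e - 1"])
  fix m assume m: "m < e - 1"
  hence "1 \<le> int (Suc m) \<and> int (Suc m) < int e" by linarith
  hence "seq w (int k + int (Suc m)) + seq w (int k - int (Suc m)) = 0"
    using assms(1) unfolding pal_def by blast
  thus "lrank (R ! m) = lrank (L ! m)" using sum_eq[of m] m assms(2,3) by (simp add: lrank_cen)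
qed (use assms in auto)

text \<open>Agreement up to the end of the shorter tail makes it a prefix of the other one, hence
  equal to it.\<close>

lemma pal_ends:
  assumes "pal (seq w) (int k) (int e)" "length R < e \<or> length L < e"
  shows "length R = length L"
proof (rule ccontr)
  assume ne: "length R \<noteq> length L"
  show False
  proof (cases "length R < length L")
    case True
    have "pal (seq w) (int k) (int (Suc (length R)))" using assms True by (auto simp: pal_def)
    hence "R ! m = L ! m" if "m < length R" for m using pal_agree[of "Suc (length R)" m] True that by simp
    hence "R = L" using tail_prefix[OF tails] True by simp
    thus False using ne by simp
  next
    case False
    hence lt: "length L < length R" using ne by simp
    have "pal (seq w) (int k) (int (Suc (length L)))" using assms lt by (auto simp: pal_def)
    hence "L ! m = R ! m" if "m < length L" for m using pal_agree[of "Suc (length L)" m] lt that by simp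
    hence "L = R" using tail_prefix[OF tails(2,1)] lt by simp
    thus False using ne by simp
  qed
qed

text \<open>Tails that agree before distance \<open>e\<close> have the same polarized target at
  distance \<open>e\<close>, and a special letter is the only letter with its target. If one tail is
  exhausted, then so is the other, and both positions lie outside of the word.\<close>

lemma closure:
  assumes e: "1 \<le> e" "pal (seq w) (int k) e"
  shows "int k + e \<in> spos w \<longleftrightarrow> int k - e \<in> spos w"
proof -
  define m where "m = nat e - 1"
  have em: "e = int (Suc m)" using e m_def by linarith
  show ?thesis
  proof (cases "m < length R \<and> m < length L")
    case True
    have ag: "R ! j = L ! j" if "j < m" for j
      by (rule pal_agree[of "Suc m" j]) (use e(2) em True that in auto)
    obtain p where p: "lta Q (R ! m) = Some p" "lta Q (L ! m) = Some p"
      using tail_lta[OF tails ag] True by blast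
    have lt: "R ! m \<in> letters Q" "L ! m \<in> letters Q"
      using tails True word_letters unfolding tail_def by blast+
    have "is_spl (R ! m) \<longleftrightarrow> is_spl (L ! m)"
    proof -
      have "is_spl (L ! m)" if "is_spl (R ! m)"
        using that special_letter_unique[OF Q _ lt(2)] p lt(1) unfolding is_spl_def by auto
      moreover have "is_spl (R ! m)" if "is_spl (L ! m)"
        using that special_letter_unique[OF Q _ lt(1)] p lt(2) unfolding is_spl_def by auto
      ultimately show ?thesis by blast
    qed
    moreover have "is_spl (linv l) \<longleftrightarrow> is_spl l" for l :: "('v, 'a) letter" by (cases l) (auto simp: is_spl_def)
    moreover have "R ! m = w ! (k + Suc m)" "L ! m = linv (w ! (k - Suc m))"
      using True k lengths by (auto simp: nth_winv R_def L_def)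
    ultimately have sp: "is_spl (w ! (k + Suc m)) \<longleftrightarrow> is_spl (w ! (k - Suc m))" by metis
    have lt: "k + Suc m < length w" "k - Suc m < length w" and le: "Suc m \<le> k" using True lengths by linarith+
    have eq: "int k + e = int (k + Suc m)" "int k - e = int (k - Suc m)" using em le by linarith+
    have "int j \<in> spos w \<longleftrightarrow> is_spl (w ! j)" if "j < length w" for j
      using that by (simp add: spos_def)
    from this[OF lt(1)] this[OF lt(2)] sp show ?thesis unfolding eq by blast
  next
    case False
    hence "length R < Suc m \<or> length L < Suc m" by auto
    hence "length R = length L" using pal_ends[of "Suc m"] e(2) unfolding em by blast
    hence "\<not> int k + e < int (length w)" "int k - e < 0" using False em lengths k by linarith+
    thus ?thesis by (auto simp: spos_def)
  qed
qed

lemma msgn_zero_centre: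
  assumes "msgn (seq w) (int k) = 0"
  shows "length R = length L" "L = R"
proof -
  have p: "pal (seq w) (int k) e" for e using assms by (auto simp: msgn_zero_iff pal_def)
  show l: "length R = length L" using pal_ends[of "Suc (length R)"] p by blast
  have "R ! m = L ! m" if "m < length R" for m
    using pal_agree[of "Suc (length R)" m] p l that by simp
  with l show "L = R" by (intro nth_equalityI) auto
qed

text \<open>The sequence \<open>\<eta>\<close> only has to contain the values of \<open>w\<close> at
  offset \<open>c\<close>. Unequal tails already differ inside \<open>w\<close>, so whatever
  surrounds \<open>w\<close>, such as the mirrored part of a completion, does not influence the
  sign.\<close>

lemma compare:
  fixes \<eta> :: "int \<Rightarrow> int" and c :: int
  assumes eta: "\<And>j. j < length w ==> \<eta> (int j + c) = cen (w ! j)" and ne: "L \<noteq> R"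
  shows "msgn \<eta> (int k + c) \<noteq> 0" "wless Q R L \<longleftrightarrow> msgn \<eta> (int k + c) < 0" (is ?A)
proof -
  obtain m where m: "m < length R" "m < length L" "\<And>j. j < m ==> R ! j = L ! j" "lrank (R ! m) \<noteq> lrank (L ! m)"
    using tail_diff[OF Q tails] ne by metis
  have er: "\<eta> (int k + c + int (Suc j)) = cen (R ! j)" if "j < length R" for j
  proof -
    have eq: "int k + c + int (Suc j) = int (k + Suc j) + c" by linarith
    have "\<eta> (int k + c + int (Suc j)) = cen (w ! (k + Suc j))"
      unfolding eq by (rule eta) (use that lengths in linarith)
    moreover have "R ! j = w ! (k + Suc j)" using that lengths k by (simp add: R_def)
    ultimately show ?thesis by simp
  qed
  have el: "\<eta> (int k + c - int (Suc j)) = - cen (L ! j)" if "j < length L" for j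
  proof -
    have "int k - int (Suc j) = int (k - Suc j)" using that lengths by simp
    hence eq: "int k + c - int (Suc j) = int (k - Suc j) + c" by linarith
    have "\<eta> (int k + c - int (Suc j)) = cen (w ! (k - Suc j))"
      unfolding eq by (rule eta) (use k in linarith)
    moreover have "L ! j = linv (w ! (k - Suc j))" using that lengths k by (simp add: L_def nth_winv)
    ultimately show ?thesis by (simp add: cen_linv)
  qed
  have "first_diff \<eta> (int k + c) (int (Suc m))" unfolding first_diff_def pal_def
  proof (intro conjI allI impI)
    fix e :: int assume e: "1 \<le> e \<and> e < int (Suc m)"
    define j where "j = nat e - 1"
    have j: "e = int (Suc j)" "j < m" using e unfolding j_def by linarith+
    have "j < length R" "j < length L" using j m(1,2) by auto
    thus "\<eta> (int k + c + e) + \<eta> (int k + c - e) = 0"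
      unfolding j(1) using er[of j] el[of j] m(3)[OF j(2)] by (metis add.right_inverse)
  next
    show "\<eta> (int k + c + int (Suc m)) + \<eta> (int k + c - int (Suc m)) \<noteq> 0"
      unfolding er[OF m(1)] el[OF m(2)] using m(4) by (simp add: lrank_cen)
  qed simp
  from msgn_first_diff[OF this] have s: "msgn \<eta> (int k + c) = sgn (cen (R ! m) - cen (L ! m))"
    unfolding er[OF m(1)] el[OF m(2)] by (simp only: add_uminus_conv_diff)
  thus "msgn \<eta> (int k + c) \<noteq> 0" using m(4) by (simp add: lrank_cen sgn_if)
  show ?A
    using wless_tail[OF tails m] s by (simp add: lrank_cen)
qed

end

subsection \<open>Completions\<close>

declare winv_Cons [simp]

lemma Flet_linv: "Flet Q (linv l) = linv (Flet Q l)"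
  by (cases l) auto

lemma Fword_winv: "Fword Q (winv u) = winv (Fword Q u)"
  by (simp add: Fword_def winv_def rev_map Flet_linv)

lemma Fword_append [simp]: "Fword Q (u @ v) = Fword Q u @ Fword Q v"
  by (simp add: Fword_def)

lemma Fword_Cons [simp]: "Fword Q (l # v) = Flet Q l # Fword Q v"
  by (simp add: Fword_def)

lemma Fword_Nil [simp]: "Fword Q [] = []"
  by (simp add: Fword_def)

lemma length_Fword [simp]: "length (Fword Q u) = length u"
  by (simp add: Fword_def)

lemma nth_Fword: "k < length u ==> Fword Q u ! k = Flet Q (u ! k)"
  by (simp add: Fword_def)

lemma Flet_nonspecial: "\<not> is_spl (Flet Q l) ==> Flet Q l = l"
  by (cases l) (auto simp: is_spl_def)

lemma Flet_special:
  assumes "skewed_gentle Q" "l \<in> letters (hat Q)" "Flet Q l = Spl i"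
  shows "i \<in> spverts Q \<and> (l = Dir (sploop Q i) \<or> l = Inv (sploop Q i) \<or> l = Tr i (-1) \<or> l = TrI i (-1))"
proof -
  have *: "src Q a \<in> spverts Q \<and> sploop Q (src Q a) = a" if "a \<in> sparr Q" for a
    using that sploop_src[OF assms(1)] by (simp add: spverts_def)
  show ?thesis
  proof (cases l)
    case (Dir a)
    hence "a \<in> sparr Q" "src Q a = i" using assms(3) by (simp_all split: if_splits)
    with *[of a] Dir show ?thesis by metis
  next
    case (Inv a)
    hence "a \<in> sparr Q" "src Q a = i" using assms(3) by (simp_all split: if_splits)
    with *[of a] Inv show ?thesis by metis
  qed (use assms in "simp_all split: if_splits")
qed

lemma Flet_letters:
  assumes "l \<in> letters (hat Q)"
  shows "Flet Q l \<in> letters Q"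
proof -
  have "src Q a \<in> spverts Q" if "a \<in> sparr Q" for a using that by (simp add: spverts_def)
  thus ?thesis using assms by (cases l; simp add: arrs_def; metis)
qed

lemma lta_Flet: "skewed_gentle Q ==> lta Q l = Some p ==> lta Q (Flet Q l) = Some p"
  by (cases l) (auto dest: pso_special)

lemma lso_Flet: "skewed_gentle Q ==> lso Q l = Some p ==> lso Q (Flet Q l) = Some p"
  by (cases l) (auto dest: pso_special)

lemma follows_Flet: "skewed_gentle Q ==> follows Q a b ==> follows Q (Flet Q a) (Flet Q b)"
  unfolding follows_def using lta_Flet lso_Flet by metis

lemma hd_Fword: "u \<noteq> [] ==> hd (Fword Q u) = Flet Q (hd u)"
  by (simp_all add: Fword_def hd_map last_map)

lemma Fword_Nil_iff [simp]: "Fword Q u = [] \<longleftrightarrow> u = []"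
  by (simp add: Fword_def)

lemma is_word_Fword:
  assumes Q: "skewed_gentle Q"
  shows "is_word (hat Q) u ==> is_word Q (Fword Q u)"
proof (induction u)
  case (Cons l u)
  thus ?case using Flet_letters[of l Q] follows_Flet[OF Q, of l "hd u"]
    by (auto simp: is_word_Cons hd_Fword)
qed simp

text \<open>For types other than \<open>(p, p)\<close>: the completion formed before applying
  \<open>Fword\<close>. Unlike the completion it remembers the orientations of the loops. The copy
  of \<open>z\<close> in it starts at position \<open>coff Q z\<close>.\<close>

definition hcomp :: "('v, 'a) pquiver \<Rightarrow> ('v, 'a) word \<Rightarrow> ('v, 'a) word" where
  "hcomp Q z = (if lpunct Q z then winv (tl z) @ z else if rpunct Q z then z @ winv (butlast z) else z)"

definition coff :: "('v, 'a) pquiver \<Rightarrow> ('v, 'a) word \<Rightarrow> nat" where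
  "coff Q z = (if lpunct Q z then length z - 1 else 0)"

lemma completion_hcomp: "\<not> (lpunct Q z \<and> rpunct Q z) ==> completion Q z = Fword Q (hcomp Q z)"
  by (auto simp: completion_def hcomp_def)

lemma nth_hcomp: "j < length z ==> hcomp Q z ! (j + coff Q z) = z ! j"
  by (auto simp: hcomp_def coff_def nth_append)

lemma length_hcomp: "z \<noteq> [] ==> length (hcomp Q z) = (if lpunct Q z \<or> rpunct Q z then 2 * (length z - 1) + 1 else length z)"
  by (cases z) (auto simp: hcomp_def)

lemma string_split:
  assumes "is_string Q w"
  obtains i r m j s where "w = TrI i r # m @ [Tr j s]"
proof -
  have l: "w \<noteq> []" "2 \<le> length w" using assms string_length by (auto simp: is_string_def)
  obtain i r j s where h: "hd w = TrI i r" "last w = Tr j s" using assms by (auto simp: is_string_def)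
  have "w = hd w # butlast (tl w) @ [last w]" using l by (cases w) (auto simp: append_butlast_last_id)
  with h that show ?thesis by metis
qed

lemma lpunct_winv: "z \<noteq> [] ==> lpunct Q (winv z) \<longleftrightarrow> rpunct Q z"
  unfolding lpunct_def rpunct_def by (simp add: hd_winv) (metis linv.simps(4,5) linv_linv)

lemma rpunct_winv: "z \<noteq> [] ==> rpunct Q (winv z) \<longleftrightarrow> lpunct Q z"
  using lpunct_winv[of "winv z" Q] by simp

lemma hcomp_winv:
  assumes "z \<noteq> []" "\<not> (lpunct Q z \<and> rpunct Q z)"
  shows "hcomp Q (winv z) = winv (hcomp Q z)"
proof -
  have "tl (winv z) = winv (butlast z)" "butlast (winv z) = winv (tl z)"
    by (cases z rule: rev_cases; simp) (cases z; simp add: winv_Cons)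
  thus ?thesis using assms by (auto simp: hcomp_def lpunct_winv rpunct_winv)
qed

lemma completion_string:
  assumes Q: "skewed_gentle Q" and z: "is_string (hat Q) z" "\<not> (lpunct Q z \<and> rpunct Q z)"
  shows "is_string Q (completion Q z)"
proof -
  have left: "is_string Q (Fword Q (hcomp Q z))" if z: "is_string (hat Q) z" and np: "\<not> lpunct Q z"
    for z
  proof -
    obtain i r m j s where zz: "z = TrI i r # m @ [Tr j s]" using string_split[OF z] by metis
    have w: "is_word Q (Fword Q z)" using is_word_Fword[OF Q] z by (simp add: is_string_def)
    have F0: "Flet Q (TrI i r) = TrI i r" using np zz by (auto simp: lpunct_def)
    show ?thesis
    proof (cases "rpunct Q z")
      case False
      hence "Flet Q (Tr j s) = Tr j s" using zz by (auto simp: rpunct_def)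
      thus ?thesis using w F0 zz np False by (auto simp: is_string_def hcomp_def)
    next
      case True
      hence js: "j \<in> spverts Q" "s = -1" using zz by (auto simp: rpunct_def)
      define U where "U = Fword Q (TrI i r # m)"
      have U: "U \<noteq> []" "hd U = TrI i r" using F0 by (auto simp: U_def)
      have h: "Fword Q (hcomp Q z) = U @ [Spl j] @ winv U"
        using np True zz js by (simp add: hcomp_def Fword_winv U_def)
      have wu: "is_word Q (U @ [Spl j])" using w zz js by (simp add: U_def)
      hence "is_word Q U" "follows Q (last U) (Spl j)"
        using U unfolding is_word_append by auto
      moreover from this(2) have "follows Q (Spl j) (linv (last U))"
        by (metis follows_linv linv.simps(3))
      moreover have "hd (winv U) = linv (last U)" using U by (simp add: hd_winv)
      ultimately have "is_word Q (Fword Q (hcomp Q z))"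
        unfolding h using wu U by (simp add: is_word_append is_word_Cons)
      moreover have "hd (Fword Q (hcomp Q z)) = TrI i r" "last (Fword Q (hcomp Q z)) = Tr i r"
        unfolding h using U by (auto simp: last_winv)
      ultimately show ?thesis unfolding is_string_def h by auto
    qed
  qed
  show ?thesis
  proof (cases "lpunct Q z")
    case False
    thus ?thesis unfolding completion_hcomp[OF z(2)] by (rule left[OF z(1)])
  next
    case True
    hence "\<not> rpunct Q z" "z \<noteq> []" using z by (auto simp: is_string_def)
    hence "is_string Q (Fword Q (hcomp Q (winv z)))" using left[of "winv z"] z(1) by (simp add: lpunct_winv)
    hence "is_string Q (winv (Fword Q (hcomp Q z)))"
      unfolding hcomp_winv[OF \<open>z \<noteq> []\<close> z(2)] Fword_winv .
    thus ?thesis unfolding completion_hcomp[OF z(2)] by simp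
  qed
qed

lemma spos_special_pos:
  assumes Q: "skewed_gentle Q" and w: "is_string Q w" and j: "j \<in> spos w"
  obtains k i where "j = int k" "special_pos Q w k i" "w ! k = Spl i"
proof -
  define k where "k = nat j"
  have k: "j = int k" "k < length w" "is_spl (w ! k)" using j by (auto simp: spos_def k_def nat_less_iff)
  obtain a r m b s where ww: "w = TrI a r # m @ [Tr b s]" using string_split[OF w] by metis
  obtain i where i: "w ! k = Spl i" using k by (auto simp: is_spl_def)
  have "k \<noteq> 0" using i ww by (cases k) auto
  moreover have "k \<noteq> length w - 1" using i ww by (auto simp: nth_append)
  ultimately have "special_pos Q w k i" using Q w i k(2) by unfold_locales auto
  thus ?thesis using that k(1) i by blast
qed

text \<open>Equal tails have equal lengths, which leaves only the middle of the word.\<close>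

lemma spos_unique_centre:
  assumes "skewed_gentle Q" "is_string Q w" "j \<in> spos w" "msgn (seq w) j = 0"
  shows "2 * j = int (length w) - 1" "winv w = w"
proof -
  obtain k i where kj: "j = int k" "special_pos Q w k i" "w ! k = Spl i"
    using spos_special_pos[OF assms(1-3)] by blast
  interpret special_pos Q w k i by (rule kj(2))
  have "msgn (seq w) (int k) = 0" using assms(4) kj(1) by simp
  note l = msgn_zero_centre[OF this]
  show "2 * j = int (length w) - 1" using l(1) lengths kj(1) k by linarith
  have kl: "k < length w" using k by simp
  have d: "take k w @ [Spl i] @ drop (Suc k) w = w"
    unfolding kj(3)[symmetric] using id_take_nth_drop[OF kl] by (metis append_Cons append_Nil)
  have a: "winv (take k w) = drop (Suc k) w" using l(2) unfolding L_def R_def .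
  have b: "winv (drop (Suc k) w) = take k w" unfolding a[symmetric] by simp
  have "winv (take k w @ [Spl i] @ drop (Suc k) w) = take k w @ [Spl i] @ drop (Suc k) w"
    by (simp only: winv_append winv_single linv.simps a b append.assoc)
  thus "winv w = w" unfolding d .
qed

lemma sign_data_strings:
  assumes Q: "skewed_gentle Q" and w: "is_string Q (Fword Q h)"
  shows "sign_data (seq (Fword Q h)) (seq h) (spos (Fword Q h))"
proof
  fix k e
  assume k: "k \<in> spos (Fword Q h)"
  thus "seq (Fword Q h) k = 0" by (rule spos_seq)
  assume e: "1 \<le> e" "pal (seq (Fword Q h)) k e"
  obtain k' i where k': "k = int k'" "special_pos Q (Fword Q h) k' i"
    using spos_special_pos[OF Q w k] by blast
  show "k + e \<in> spos (Fword Q h) \<longleftrightarrow> k - e \<in> spos (Fword Q h)"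
    using special_pos.closure[OF k'(2) e(1)] e(2) k'(1) by simp
next
  fix k
  assume k: "k \<notin> spos (Fword Q h)"
  show "seq h k = seq (Fword Q h) k"
  proof (cases "0 \<le> k \<and> k < int (length h)")
    case True
    hence "\<not> is_spl (Flet Q (h ! nat k))" using k by (simp add: spos_def nth_Fword nat_less_iff)
    thus ?thesis using True Flet_nonspecial[of Q "h ! nat k"] by (simp add: seq_def nth_Fword nat_less_iff)
  qed (auto simp: seq_def)
qed

lemma msgn_antisym:
  assumes "\<And>j. f (2 * c - j) = - f j"
  shows "msgn f (2 * c - j) = - msgn f j" "msgn f c = 0"
proof -
  have "(\<lambda>i. f (2 * c - i)) = (\<lambda>i. - f i)" using assms by simp
  thus *: "msgn f (2 * c - j) = - msgn f j" for j
    using msgn_reflect[of f "2 * c" j] msgn_uminus[of f j] by simp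
  show "msgn f c = 0" using *[of c] by simp
qed

text \<open>The middle letter is a punctured or a special one. Inversion may change it as a letter
  (\<open>Tr\<close> against \<open>TrI\<close>), but not its value \<open>0\<close>.\<close>

lemma seq_antisym:
  assumes "length u = c" "cen l = 0"
  shows "seq (u @ [l] @ winv u) (2 * int c - j) = - seq (u @ [l] @ winv u) j"
proof -
  have "seq (u @ [l] @ winv u) = seq (u @ [linv l] @ winv u)"
  proof
    fix i show "seq (u @ [l] @ winv u) i = seq (u @ [linv l] @ winv u) i"
      using assms(2) cen_linv[of l] by (simp add: seq_def nth_append nth_Cons')
  qed
  also have "u @ [linv l] @ winv u = winv (u @ [l] @ winv u)" by (simp add: winv_Cons)
  finally show ?thesis using seq_winv[of "u @ [l] @ winv u" "2 * int c - j"] assms(1) by simp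
qed

section \<open>Admissibility of a string in terms of its completion\<close>

locale hat_string =
  fixes Q :: "('v, 'a) pquiver" and z :: "('v, 'a) word"
  assumes Q: "skewed_gentle Q" and z: "is_string (hat Q) z" and one: "\<not> (lpunct Q z \<and> rpunct Q z)"
begin

definition "W = completion Q z"
definition "\<eta> = seq (hcomp Q z)"

lemma W: "W = Fword Q (hcomp Q z)" "is_string Q W"
  using completion_hcomp[OF one] completion_string[OF Q z one] by (auto simp: W_def)

lemma sd: "sign_data (seq W) \<eta> (spos W)"
  using sign_data_strings[OF Q] W unfolding \<eta>_def by simp

lemma z_len: "2 \<le> length z" "z \<noteq> []"
  using string_length[OF z] by auto

lemma eta_nth: "j < length z ==> \<eta> (int j + int (coff Q z)) = cen (z ! j)"
proof -
  assume j: "j < length z"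
  have "j + coff Q z < length (hcomp Q z)" using j length_hcomp[OF z_len(2), of Q] by (auto simp: coff_def hcomp_def)
  thus ?thesis unfolding \<eta>_def using seq_nth[of "j + coff Q z" "hcomp Q z"] nth_hcomp[OF j] by simp
qed

lemma W_nth: "j < length z ==> W ! (j + coff Q z) = Flet Q (z ! j)"
proof -
  assume j: "j < length z"
  have "j + coff Q z < length (hcomp Q z)" using j length_hcomp[OF z_len(2), of Q] by (auto simp: coff_def hcomp_def)
  thus ?thesis unfolding W using nth_hcomp[OF j] by (simp add: nth_Fword)
qed

definition "int_special k \<longleftrightarrow> 0 < k \<and> k < length z - 1 \<and> is_spl (Flet Q (z ! k))"

lemma int_special_letter:
  assumes "int_special k"
  obtains i where "i \<in> spverts Q" "Flet Q (z ! k) = Spl i" "z ! k = Dir (sploop Q i) \<or> z ! k = Inv (sploop Q i)"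
proof -
  obtain i where i: "Flet Q (z ! k) = Spl i" using assms by (auto simp: int_special_def is_spl_def)
  have k: "0 < k" "k < length z - 1" using assms by (auto simp: int_special_def)
  have wd: "is_word (hat Q) z" using z by (simp add: is_string_def)
  have "z ! k \<in> letters (hat Q)" using word_letters[OF wd] k by simp
  from Flet_special[OF Q this i] have "i \<in> spverts Q"
    "z ! k = Dir (sploop Q i) \<or> z ! k = Inv (sploop Q i) \<or> z ! k = Tr i (-1) \<or> z ! k = TrI i (-1)" by auto
  moreover have "z ! k \<noteq> Tr i (-1)" using word_Tr_last[OF wd, of k i "-1"] k by force
  moreover have "z ! k \<noteq> TrI i (-1)" using word_TrI_first[OF wd, of k i "-1"] k by force
  ultimately show ?thesis using that i by blast
qed

lemma special_pos_z:
  assumes "int_special k"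
  obtains i where "special_pos (hat Q) z k i"
proof -
  obtain i where i: "i \<in> spverts Q" "z ! k = Dir (sploop Q i) \<or> z ! k = Inv (sploop Q i)"
    using int_special_letter[OF assms] by metis
  have "special_pos (hat Q) z k i"
    using skewed_gentle_hat[OF Q] z assms i(2) sploop[OF Q i(1)]
    by unfold_locales (auto simp: int_special_def)
  thus ?thesis by (rule that)
qed

lemma compare_z:
  assumes k: "int_special k"
  shows "winv (take k z) = drop (Suc k) z \<longleftrightarrow> msgn \<eta> (int k + int (coff Q z)) = 0" (is ?A)
    "winv (take k z) \<noteq> drop (Suc k) z ==>
      wless Q (drop (Suc k) z) (winv (take k z)) \<longleftrightarrow> msgn \<eta> (int k + int (coff Q z)) < 0" (is "PROP ?B")
proof -
  obtain i where sp: "special_pos (hat Q) z k i" using special_pos_z[OF k] by metis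
  interpret S: special_pos "hat Q" z k i by (rule sp)
  note c = S.compare[of \<eta> "int (coff Q z)", OF eta_nth]
  show "PROP ?B"
    using c(2) by (simp add: S.R_def S.L_def)
  \<comment> \<open>Equal tails force the last letter of \<open>z\<close> to be the inverse of the
    first one. As the type is not \<open>(p, p)\<close>, it is \<open>(u, u)\<close>, and
    \<open>\<eta>\<close> has no mirrored part.\<close>
  have "msgn \<eta> (int k + int (coff Q z)) = 0" if eq: "winv (take k z) = drop (Suc k) z"
  proof -
    have kk: "0 < k" "k < length z - 1" using k by (auto simp: int_special_def)
    have "take k z \<noteq> []" using kk by auto
    hence "last (winv (take k z)) = linv (hd z)" using kk by (simp add: last_winv hd_take)
    moreover have "last (drop (Suc k) z) = last z" using kk by (simp add: last_drop)
    ultimately have lz: "last z = linv (hd z)" using eq by simp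
    obtain a r where h: "hd z = TrI a r" using z by (auto simp: is_string_def)
    have "lpunct Q z \<longleftrightarrow> rpunct Q z" unfolding lpunct_def rpunct_def lz h by auto
    hence up: "\<not> lpunct Q z \<and> \<not> rpunct Q z" using one by blast
    hence e: "\<eta> = seq z" "coff Q z = 0" by (auto simp: \<eta>_def hcomp_def coff_def)
    have "length (winv (take k z)) = length (drop (Suc k) z)" using eq by simp
    hence len: "length z - Suc k = k" using kk by simp
    have "seq z (int k + e) + seq z (int k - e) = 0" if "1 \<le> e" for e
    proof (cases "e \<le> int k")
      case True
      define m where "m = nat e - 1"
      have m: "e = int (Suc m)" "m < k" using True that unfolding m_def by linarith+
      have "m < length S.R" "m < length S.L" using m len S.lengths by auto
      from S.sum_eq[OF this] eq m(1) show ?thesis by (simp add: S.R_def S.L_def)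
    next
      case False
      hence "\<not> int k + e < int (length z)" "\<not> 0 \<le> int k - e" using len kk by linarith+
      thus ?thesis by (simp add: seq_def)
    qed
    thus ?thesis unfolding e by (simp add: msgn_zero_iff)
  qed
  with c(1) show ?A
    by (auto simp: S.R_def S.L_def)
qed

lemma eta_special: "int_special k ==> \<eta> (int k + int (coff Q z)) = (if is_dir (z ! k) then -1 else 1)"
proof -
  assume k: "int_special k"
  hence "k < length z" by (auto simp: int_special_def)
  note e = eta_nth[OF this]
  obtain i where "z ! k = Dir (sploop Q i) \<or> z ! k = Inv (sploop Q i)" using int_special_letter[OF k] by metis
  thus ?thesis unfolding e by (elim disjE) (simp_all add: cen_def)
qed

text \<open>Both requirements at a special position become one equation: the left side is
  \<open>-1\<close> or \<open>1\<close>, so equality also excludes equal tails.\<close>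

lemma adm_eta:
  "adm_string Q z \<longleftrightarrow> (\<forall>k. int_special k --> \<eta> (int k + int (coff Q z)) = msgn \<eta> (int k + int (coff Q z)))"
proof -
  have "winv (take k z) \<noteq> drop (Suc k) z \<and> (is_dir (z ! k) \<longleftrightarrow> wless Q (drop (Suc k) z) (winv (take k z)))
      \<longleftrightarrow> \<eta> (int k + int (coff Q z)) = msgn \<eta> (int k + int (coff Q z))" if k: "int_special k" for k
  proof -
    define d where "d = msgn \<eta> (int k + int (coff Q z))"
    consider "d = -1" | "d = 0" | "d = 1" using msgn_range[of \<eta>] unfolding d_def by blast
    thus ?thesis
      using compare_z[OF k] unfolding eta_special[OF k] d_def[symmetric]
      by cases (cases "is_dir (z ! k)"; simp)+
  qed
  thus ?thesis unfolding adm_string_def using z one int_special_def by (auto simp only: wless_hat)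
qed

definition "I = {int k + int (coff Q z) | k. int_special k}"

lemma spos_W_uu: "\<not> lpunct Q z ==> \<not> rpunct Q z ==> spos W = I"
proof -
  assume u: "\<not> lpunct Q z" "\<not> rpunct Q z"
  hence e: "W = Fword Q z" "coff Q z = 0" by (auto simp: W hcomp_def coff_def)
  show ?thesis
  proof (intro set_eqI iffI)
    fix j assume j: "j \<in> spos W"
    obtain k i where k: "j = int k" "special_pos Q W k i" "W ! k = Spl i"
      using spos_special_pos[OF Q W(2) j] by blast
    hence "0 < k" "k < length z - 1" using special_pos.k[OF k(2)] e by auto
    hence "int_special k" using k(3) e by (simp add: int_special_def nth_Fword)
    thus "j \<in> I" using k(1) e by (auto simp: I_def)
  next
    fix j assume "j \<in> I"
    then obtain k where "j = int k" "int_special k" using e by (auto simp: I_def)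
    thus "j \<in> spos W" unfolding e by (auto simp: spos_def int_special_def nth_Fword)
  qed
qed

lemma I_spos: "I \<subseteq> spos W"
proof
  fix j assume "j \<in> I"
  then obtain k where k: "j = int k + int (coff Q z)" "int_special k" by (auto simp: I_def)
  hence kl: "k < length z" by (auto simp: int_special_def)
  have "k + coff Q z < length W" using kl length_hcomp[OF z_len(2), of Q] unfolding W by (auto simp: coff_def hcomp_def)
  moreover have "is_spl (W ! (k + coff Q z))" using W_nth[OF kl] k by (simp add: int_special_def)
  moreover have "j = int (k + coff Q z)" using k by simp
  ultimately show "j \<in> spos W" by (simp add: spos_def del: of_nat_add)
qed

lemma punct_form:
  assumes p: "lpunct Q z \<or> rpunct Q z"
  obtains u l i where "hcomp Q z = u @ [l] @ winv u" "length u = length z - 1" "cen l = 0"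
    "W = Fword Q u @ [Spl i] @ winv (Fword Q u)" "i \<in> spverts Q"
proof -
  obtain a r m b s where zz: "z = TrI a r # m @ [Tr b s]" using string_split[OF z] by metis
  show ?thesis
  proof (cases "lpunct Q z")
    case True
    hence a: "a \<in> spverts Q" "r = -1" using zz by (auto simp: lpunct_def)
    have h: "hcomp Q z = winv (tl z) @ [TrI a r] @ winv (winv (tl z))" using True zz by (simp add: hcomp_def)
    show ?thesis
      by (rule that[OF h, of a]) (use a W(1) h zz in "auto simp: cen_def Fword_winv")
  next
    case False
    hence r: "rpunct Q z" using p by blast
    hence b: "b \<in> spverts Q" "s = -1" using zz by (auto simp: rpunct_def)
    have h: "hcomp Q z = butlast z @ [Tr b s] @ winv (butlast z)" using r False zz by (simp add: hcomp_def)
    show ?thesis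
      by (rule that[OF h, of b]) (use b W(1) h zz in "auto simp: cen_def Fword_winv")
  qed
qed

lemma spos_W_punct:
  assumes p: "lpunct Q z \<or> rpunct Q z" and j: "j \<in> spos W"
  shows "j \<in> I \<or> j = int (length z) - 1 \<or> 2 * (int (length z) - 1) - j \<in> I"
proof -
  define n where "n = length z - 1"
  have n: "int n = int (length z) - 1" "1 \<le> n" "length z = Suc n" using z_len by (auto simp: n_def)
  obtain u l i where u: "hcomp Q z = u @ [l] @ winv u" "length u = n" "cen l = 0"
    "W = Fword Q u @ [Spl i] @ winv (Fword Q u)" using punct_form[OF p] n_def by metis
  have lW: "length W = 2 * n + 1" using u by simp
  have wi: "winv W = W" using u(4) by simp
  obtain k i' where k: "j = int k" "special_pos Q W k i'" "W ! k = Spl i'"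
    using spos_special_pos[OF Q W(2) j] by blast
  have kb: "0 < k" "k < 2 * n" using special_pos.k[OF k(2)] lW by auto
  define k2 where "k2 = 2 * n - k"
  have "k2 < length W" "length W - Suc k2 = k" using lW kb unfolding k2_def by linarith+
  hence "W ! k2 = linv (W ! k)" using nth_winv[of k2 W] wi by simp
  hence k2: "W ! k2 = Spl i'" using k(3) by simp
  have inI: "int m \<in> I" if "W ! m = Spl i'" "(lpunct Q z \<and> n < m \<and> m < 2 * n) \<or> (\<not> lpunct Q z \<and> 0 < m \<and> m < n)" for m
  proof -
    define q where "q = m - coff Q z"
    have q: "m = q + coff Q z" "0 < q" "q < n" using that(2) n unfolding q_def coff_def by auto
    have "q < length z" using q n by simp
    from W_nth[OF this] have "is_spl (Flet Q (z ! q))" using that(1) q(1) by simp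
    hence "int_special q" using q n by (simp add: int_special_def)
    thus ?thesis using q(1) by (auto simp: I_def)
  qed
  have "int k2 = 2 * int n - int k" using kb unfolding k2_def by simp
  hence "2 * (int (length z) - 1) - j = int k2" unfolding k(1) n(1)[symmetric] by simp
  moreover have "j = int n \<or> int k \<in> I \<or> int k2 \<in> I"
  proof (cases "k = n")
    case False
    show ?thesis
    proof (cases "k < n")
      case True
      hence "n < k2" "k2 < 2 * n" using kb unfolding k2_def by linarith+
      thus ?thesis using inI[OF k(3)] inI[OF k2] kb True by blast
    next
      case False
      hence "n < k" "0 < k2" "k2 < n" using kb \<open>k \<noteq> n\<close> unfolding k2_def by linarith+
      thus ?thesis using inI[OF k(3)] inI[OF k2] kb by blast
    qed
  qed (use k in simp)
  ultimately show ?thesis using k(1) n(1) by metis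
qed

text \<open>For punctured types the special positions of the completion are the interior ones of
  \<open>z\<close>, their mirror images and the centre. Values and signs are odd under the
  reflection, so the condition carries over from the interior positions to the mirrored ones, and at
  the centre both sides vanish.\<close>

lemma extend:
  assumes f: "f = seq W \<or> f = \<eta>"
  shows "(\<forall>j\<in>spos W. \<eta> j = msgn f j) \<longleftrightarrow> (\<forall>j\<in>I. \<eta> j = msgn f j)"
proof (cases "lpunct Q z \<or> rpunct Q z")
  case False
  thus ?thesis using spos_W_uu by simp
next
  case True
  define n where "n = length z - 1"
  have n: "int n = int (length z) - 1" using z_len by (auto simp: n_def)
  obtain u l i where u: "hcomp Q z = u @ [l] @ winv u" "length u = n" "cen l = 0"
    "W = Fword Q u @ [Spl i] @ winv (Fword Q u)" using punct_form[OF True] n_def by metis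
  have eta: "\<eta> (2 * int n - j) = - \<eta> j" for j using seq_antisym[OF u(2,3)] unfolding \<eta>_def u(1) .
  have W': "seq W (2 * int n - j) = - seq W j" for j
    using seq_antisym[of "Fword Q u" n "Spl i"] u(2) unfolding u(4) by (simp add: cen_def)
  have f': "f (2 * int n - j) = - f j" for j using f eta W' by auto
  note m = msgn_antisym[where f = f and c = "int n", OF f']
  show ?thesis
  proof (intro iffI ballI)
    fix j assume a: "\<forall>j\<in>I. \<eta> j = msgn f j" and j: "j \<in> spos W"
    from spos_W_punct[OF True j] consider "j \<in> I" | "j = int n" | "2 * int n - j \<in> I" unfolding n by blast
    thus "\<eta> j = msgn f j"
    proof cases
      case 2
      thus ?thesis using m(2) eta[of "int n"] by simp
    next
      case 3
      hence "\<eta> (2 * int n - j) = msgn f (2 * int n - j)" using a by blast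
      thus ?thesis using m(1)[of j] eta[of j] by simp
    qed (use a in blast)
  qed (use I_spos in blast)
qed

text \<open>The self-reference is gone: the right side depends only on the completion. The
  hypothesis \<open>centre\<close> of \<open>eta_unique\<close> holds because equal tails occur only
  in the middle of \<open>W\<close>.\<close>

theorem adm_iff:
  "adm_string Q z \<longleftrightarrow> (\<forall>k. int_special k -->
     \<eta> (int k + int (coff Q z)) = msgn (seq W) (int k + int (coff Q z)))"
proof -
  interpret sign_data "seq W" \<eta> "spos W" by (rule sd)
  have "(\<forall>j\<in>spos W. \<eta> j = msgn \<eta> j) \<longleftrightarrow> (\<forall>j\<in>spos W. \<eta> j = msgn (seq W) j)"
  proof
    assume a: "\<forall>j\<in>spos W. \<eta> j = msgn \<eta> j"
    show "\<forall>j\<in>spos W. \<eta> j = msgn (seq W) j"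
    proof (rule ballI, rule eta_unique)
      fix k k' assume "k \<in> spos W" "k' \<in> spos W" "msgn (seq W) k = 0" "msgn (seq W) k' = 0"
      hence "2 * k = 2 * k'" using spos_unique_centre(1)[OF Q W(2)] by simp
      thus "k = k'" by simp
    qed (use a in auto)
  next
    assume a: "\<forall>j\<in>spos W. \<eta> j = msgn (seq W) j"
    thus "\<forall>j\<in>spos W. \<eta> j = msgn \<eta> j" using msgn_eta_eq by simp
  qed
  hence "(\<forall>j\<in>I. \<eta> j = msgn \<eta> j) \<longleftrightarrow> (\<forall>j\<in>I. \<eta> j = msgn (seq W) j)" using extend by simp
  thus ?thesis unfolding adm_eta I_def by auto
qed

end

lemma adm_string_special:
  assumes Q: "skewed_gentle Q" and adm: "adm_string Q z" "\<not> (lpunct Q z \<and> rpunct Q z)"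
    and k: "0 < k" "k < length z - 1" "Flet Q (z ! k) = Spl i"
  shows "i \<in> spverts Q" "msgn (seq (completion Q z)) (int (k + coff Q z)) \<noteq> 0" (is ?A)
    "z ! k = (if msgn (seq (completion Q z)) (int (k + coff Q z)) < 0 then Dir (sploop Q i) else Inv (sploop Q i))" (is ?B)
proof -
  interpret hat_string Q z using Q adm by unfold_locales (auto simp: adm_string_def)
  have s: "int_special k" using k by (simp add: int_special_def)
  have "\<eta> (int k + int (coff Q z)) = msgn (seq W) (int k + int (coff Q z))" using adm_iff adm(1) s by blast
  hence e: "(if is_dir (z ! k) then -1 else 1) = msgn (seq (completion Q z)) (int (k + coff Q z))"
    using eta_special[OF s] by (simp add: W_def)
  obtain i' where i: "i' \<in> spverts Q" "Flet Q (z ! k) = Spl i'" "z ! k = Dir (sploop Q i') \<or> z ! k = Inv (sploop Q i')"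
    using int_special_letter[OF s] by metis
  show "i \<in> spverts Q" using i k by simp
  show ?A unfolding e[symmetric] by simp
  show ?B
    unfolding e[symmetric] using i k by auto
qed

text \<open>Type and completion determine the length and all letters up to \<open>Flet\<close>. The
  only remaining freedom, the orientation of the loops, is prescribed by the signs of the
  completion.\<close>

lemma adm_string_unique:
  assumes Q: "skewed_gentle Q" and z: "adm_string Q z" "\<not> (lpunct Q z \<and> rpunct Q z)" and z': "adm_string Q z'"
    and t: "lpunct Q z' = lpunct Q z" "rpunct Q z' = rpunct Q z" and c: "completion Q z' = completion Q z"
  shows "z' = z"
proof -
  have s: "is_string (hat Q) z" "is_string (hat Q) z'" using z z' by (auto simp: adm_string_def)
  have ne: "z \<noteq> []" "z' \<noteq> []" using s by (auto simp: is_string_def)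
  interpret A: hat_string Q z using Q z s by unfold_locales auto
  interpret B: hat_string Q z' using Q z s t by unfold_locales auto
  have WW: "B.W = A.W" using c by (simp add: A.W_def B.W_def)
  have "length (hcomp Q z) = length (hcomp Q z')" using WW A.W(1) B.W(1) by (metis length_Fword)
  hence len: "length z' = length z"
    using length_hcomp[OF ne(1), of Q] length_hcomp[OF ne(2), of Q] t A.z_len B.z_len
    by (auto split: if_splits)
  have off: "coff Q z' = coff Q z" using t len by (simp add: coff_def)
  have F: "Flet Q (z' ! k) = Flet Q (z ! k)" if "k < length z" for k
    using A.W_nth[of k] B.W_nth[of k] that len off WW by simp
  have "z' ! k = z ! k" if k: "k < length z" for k
  proof (cases "is_spl (Flet Q (z ! k))")
    case False
    thus ?thesis using F[OF k] Flet_nonspecial by metis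
  next
    case True
    then obtain i where i: "Flet Q (z ! k) = Spl i" by (auto simp: is_spl_def)
    have L: "z ! k \<in> letters (hat Q)" "z' ! k \<in> letters (hat Q)"
      using s k len word_letters unfolding is_string_def by metis+
    consider "k = 0" | "k = length z - 1" | "0 < k" "k < length z - 1" using k by linarith
    thus ?thesis
    proof cases
      case 1
      then obtain a r a' r' where "z ! k = TrI a r" "z' ! k = TrI a' r'"
        using s ne unfolding is_string_def by (metis hd_conv_nth)
      thus ?thesis using i F[OF k] by (auto split: if_splits)
    next
      case 2
      then obtain a r a' r' where "z ! k = Tr a r" "z' ! k = Tr a' r'"
        using s ne len unfolding is_string_def by (metis last_conv_nth)
      thus ?thesis using i F[OF k] by (auto split: if_splits)
    next
      case 3
      have one: "\<not> (lpunct Q z' \<and> rpunct Q z')" using z t by simp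
      show ?thesis
        using adm_string_special(3)[OF Q z 3 i] adm_string_special(3)[OF Q z' one, of k i] 3 len i F[OF k] c off
        by simp
    qed
  qed
  thus ?thesis using len by (intro nth_equalityI) auto
qed

subsection \<open>Existence of admissible lifts\<close>

text \<open>The orientation is the one demanded by \<open>adm_iff\<close>. For sign \<open>0\<close>
  the inverse letter is only a default; \<open>lift_adm\<close> requires that this case does not
  occur at interior positions of the lift.\<close>

definition lift_letter :: "('v, 'a) pquiver \<Rightarrow> ('v, 'a) word \<Rightarrow> nat \<Rightarrow> ('v, 'a) letter" where
  "lift_letter Q W k = (case W ! k of
      Spl i \<Rightarrow> if msgn (seq W) (int k) < 0 then Dir (sploop Q i) else Inv (sploop Q i)
    | l \<Rightarrow> l)"

lemma lift_letter:
  assumes Q: "skewed_gentle Q" and l: "W ! k \<in> letters Q"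
  shows "Flet Q (lift_letter Q W k) = W ! k" "lift_letter Q W k \<in> letters (hat Q)"
    "lso Q (lift_letter Q W k) = lso Q (W ! k)" "lta Q (lift_letter Q W k) = lta Q (W ! k)"
  using l sploop[OF Q] ordarr_not_sparr[OF Q]
  by (cases "W ! k"; force simp: lift_letter_def arrs_def)+

lemma lift_word:
  assumes Q: "skewed_gentle Q" and W: "is_word Q W" and b: "b \<le> length W"
  shows "is_word (hat Q) (map (lift_letter Q W) [a..<b])"
  unfolding is_word_iff
proof
  have L: "W ! k \<in> letters Q" if "k < length W" for k using word_letters[OF W that] .
  show "set (map (lift_letter Q W) [a..<b]) \<subseteq> letters (hat Q)"
    using lift_letter(2)[OF Q L] b by auto
  show "successively (follows (hat Q)) (map (lift_letter Q W) [a..<b])"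
    unfolding successively_conv_nth
  proof (intro allI impI)
    fix i assume "Suc i < length (map (lift_letter Q W) [a..<b])"
    hence i: "a + Suc i < b" by simp
    hence "follows Q (W ! (a + i)) (W ! (a + Suc i))" using word_nth[OF W, of "a + i"] b by simp
    moreover have "W ! (a + i) \<in> letters Q" "W ! (a + Suc i) \<in> letters Q" using L i b by auto
    ultimately have "follows Q (lift_letter Q W (a + i)) (lift_letter Q W (a + Suc i))"
      unfolding follows_def using lift_letter(3,4)[OF Q] by simp
    thus "follows (hat Q) (map (lift_letter Q W) [a..<b] ! i) (map (lift_letter Q W) [a..<b] ! Suc i)"
      using i by (simp del: upt_Suc)
  qed
qed

lemma Fword_lift:
  assumes Q: "skewed_gentle Q" and W: "is_word Q W" and b: "a \<le> b" "b \<le> length W"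
  shows "Fword Q (map (lift_letter Q W) [a..<b]) = take (b - a) (drop a W)"
proof (rule nth_equalityI)
  show "length (Fword Q (map (lift_letter Q W) [a..<b])) = length (take (b - a) (drop a W))" using b by simp
  fix i assume "i < length (Fword Q (map (lift_letter Q W) [a..<b]))"
  hence "i < b - a" by simp
  thus "Fword Q (map (lift_letter Q W) [a..<b]) ! i = take (b - a) (drop a W) ! i"
    using lift_letter(1)[OF Q word_letters[OF W]] b by (simp add: nth_Fword)
qed

lemma lift_adm:
  assumes Q: "skewed_gentle Q" and z: "is_string (hat Q) z" "\<not> (lpunct Q z \<and> rpunct Q z)"
    and W: "completion Q z = W"
    and zk: "\<And>k. 0 < k ==> k < length z - 1 ==> z ! k = lift_letter Q W (k + coff Q z)"
    and nz: "\<And>k. 0 < k ==> k < length z - 1 ==> is_spl (W ! (k + coff Q z)) ==>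
       msgn (seq W) (int (k + coff Q z)) \<noteq> 0"
  shows "adm_string Q z"
proof -
  interpret H: hat_string Q z using Q z by unfold_locales
  have WW: "H.W = W" using W by (simp add: H.W_def)
  show ?thesis unfolding H.adm_iff
  proof (intro allI impI)
    fix k assume "H.int_special k"
    hence k: "0 < k" "k < length z - 1" "k < length z" "is_spl (Flet Q (z ! k))"
      by (auto simp: H.int_special_def)
    hence "is_spl (W ! (k + coff Q z))" using H.W_nth[of k] WW by simp
    then obtain i where i: "W ! (k + coff Q z) = Spl i" by (auto simp: is_spl_def)
    define m where "m = msgn (seq W) (int (k + coff Q z))"
    have m: "m \<in> {-1, 0, 1}" "m \<noteq> 0" unfolding m_def using msgn_range nz[OF k(1,2)] i by auto
    have "z ! k = (if m < 0 then Dir (sploop Q i) else Inv (sploop Q i))"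
      using zk[OF k(1,2)] i by (simp add: lift_letter_def m_def)
    hence "cen (z ! k) = m" using m by (auto simp: cen_def)
    thus "H.\<eta> (int k + int (coff Q z)) = msgn (seq H.W) (int k + int (coff Q z))"
      using H.eta_nth[OF k(3)] WW by (simp add: m_def)
  qed
qed

lemma ex_adm_uu:
  assumes Q: "skewed_gentle Q" and W: "is_string Q W" and nz: "\<And>j. j \<in> spos W ==> msgn (seq W) j \<noteq> 0"
  shows "\<exists>z. adm_string Q z \<and> \<not> lpunct Q z \<and> \<not> rpunct Q z \<and> completion Q z = W"
proof -
  define z where "z = map (lift_letter Q W) [0..<length W]"
  obtain a r m b s where ww: "W = TrI a r # m @ [Tr b s]" using string_split[OF W] by metis
  have wd: "is_word Q W" using W by (simp add: is_string_def)
  have L: "TrI a r \<in> letters Q" "Tr b s \<in> letters Q"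
    using wd unfolding ww is_word_Cons is_word_append by auto
  have ne: "z \<noteq> []" "length z = length W" using ww by (auto simp: z_def)
  have h: "hd z = TrI a r" using ne by (simp add: hd_conv_nth) (simp add: z_def lift_letter_def ww nth_append)
  have "W ! (length W - 1) = Tr b s" unfolding ww by (simp add: nth_append)
  hence "lift_letter Q W (length W - 1) = Tr b s" by (simp add: lift_letter_def)
  moreover have "z ! (length W - 1) = lift_letter Q W (length W - 1)" 
  proof -
    have "length W - 1 < length W" using ww by simp
    thus ?thesis by (simp add: z_def)
  qed
  ultimately have l: "last z = Tr b s" using last_conv_nth[OF ne(1)] ne(2) by metis
  have F: "Fword Q z = W" using Fword_lift[OF Q wd, of 0 "length W"] by (simp add: z_def)
  have np: "\<not> lpunct Q z" "\<not> rpunct Q z" unfolding lpunct_def rpunct_def h l using L by auto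
  hence c: "completion Q z = W" "coff Q z = 0" using F by (auto simp: completion_def coff_def)
  have s: "is_string (hat Q) z" unfolding is_string_def using ne h l lift_word[OF Q wd, of "length W" 0]
    by (auto simp: z_def)
  have "adm_string Q z"
  proof (rule lift_adm[OF Q s _ c(1)])
    fix k assume "0 < k" "k < length z - 1"
    thus "z ! k = lift_letter Q W (k + coff Q z)" using ne(2) c(2) by (simp add: z_def)
    assume "is_spl (W ! (k + coff Q z))"
    hence "int k \<in> spos W" using c(2) \<open>k < length z - 1\<close> ne(2) by (simp add: spos_def)
    thus "msgn (seq W) (int (k + coff Q z)) \<noteq> 0" using nz c(2) by simp
  qed (use np in blast)
  with np c show ?thesis by blast
qed

text \<open>In the lifts of a symmetric string the middle is taken by a punctured letter, so this
  covers all positions where a loop has to be oriented.\<close>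

lemma centre_nonzero:
  assumes Q: "skewed_gentle Q" and W: "is_string Q W" and l: "length W = 2 * c + 1"
    and k: "k \<noteq> c" "k < length W" "is_spl (W ! k)"
  shows "msgn (seq W) (int k) \<noteq> 0"
proof
  assume z: "msgn (seq W) (int k) = 0"
  have "int k \<in> spos W" using k by (simp add: spos_def)
  hence "2 * int k = int (length W) - 1" by (rule spos_unique_centre(1)[OF Q W _ z])
  thus False using l k by simp
qed

text \<open>Only the half before the centre is lifted. The centre itself, where the tails are equal
  and no orientation is possible, becomes the punctured trivial letter.\<close>

lemma ex_adm_up:
  assumes Q: "skewed_gentle Q" and W: "is_string Q W" and u: "W = u @ [Spl i] @ winv u"
  shows "\<exists>z. adm_string Q z \<and> \<not> lpunct Q z \<and> rpunct Q z \<and> completion Q z = W"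
proof -
  define c where "c = length u"
  have lW: "length W = 2 * c + 1" using u c_def by simp
  define y where "y = map (lift_letter Q W) [0..<c]"
  define z where "z = y @ [Tr i (-1)]"
  obtain a r m b s where ww: "W = TrI a r # m @ [Tr b s]" using string_split[OF W] by metis
  have wd: "is_word Q W" using W by (simp add: is_string_def)
  have L: "TrI a r \<in> letters Q" using wd unfolding ww is_word_Cons by auto
  have i: "i \<in> spverts Q" using wd unfolding u is_word_append is_word_Cons by auto
  have une: "u \<noteq> []" using u ww by (cases u) auto
  hence ne: "y \<noteq> []" "length y = c" "0 < c" by (auto simp: y_def c_def)
  have "W ! 0 = TrI a r" using ww by simp
  hence h: "hd y = TrI a r" using ne by (simp add: hd_conv_nth) (simp add: y_def lift_letter_def)
  have F: "Fword Q y = u" using Fword_lift[OF Q wd, of 0 c] lW by (simp add: y_def) (simp add: u c_def)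
  have p: "\<not> lpunct Q z" "rpunct Q z" unfolding lpunct_def rpunct_def z_def using h ne L i by auto
  hence c: "completion Q z = W" "coff Q z = 0"
    unfolding completion_def coff_def z_def using F i by (auto simp: Fword_winv u)
  have s: "is_string (hat Q) z"
  proof -
    have "is_word (hat Q) y" using lift_word[OF Q wd, of c 0] lW by (simp add: y_def)
    moreover have "last y = lift_letter Q W (c - 1)" using ne by (simp add: last_conv_nth) (simp add: y_def)
    moreover have "follows Q (W ! (c - 1)) (W ! c)" using word_nth[OF wd, of "c - 1"] lW ne by simp
    moreover have "W ! c = Spl i" using u c_def by (simp add: nth_append)
    moreover have "W ! (c - 1) \<in> letters Q" using word_letters[OF wd] lW by simp
    ultimately have "follows Q (last y) (Tr i (-1))"
      using lift_letter(3)[OF Q] unfolding follows_def by simp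
    hence "is_word (hat Q) z" unfolding z_def using \<open>is_word (hat Q) y\<close> spverts_verts[OF Q i]
      by (simp add: is_word_append is_word_Cons)
    thus ?thesis unfolding is_string_def z_def using h ne by auto
  qed
  have "adm_string Q z"
  proof (rule lift_adm[OF Q s _ c(1)])
    fix k assume k: "0 < k" "k < length z - 1"
    thus "z ! k = lift_letter Q W (k + coff Q z)" using ne c(2) by (simp add: z_def nth_append) (simp add: y_def)
    assume "is_spl (W ! (k + coff Q z))"
    thus "msgn (seq W) (int (k + coff Q z)) \<noteq> 0"
      using centre_nonzero[OF Q W lW, of k] k c(2) ne lW by (simp add: z_def)
  qed (use p in blast)
  with p c show ?thesis by blast
qed

lemma ex_adm_pu:
  assumes Q: "skewed_gentle Q" and W: "is_string Q W" and u: "W = u @ [Spl i] @ winv u"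
  shows "\<exists>z. adm_string Q z \<and> lpunct Q z \<and> \<not> rpunct Q z \<and> completion Q z = W"
proof -
  define c where "c = length u"
  have lW: "length W = 2 * c + 1" using u c_def by simp
  define y where "y = map (lift_letter Q W) [Suc c..<2 * c + 1]"
  define z where "z = TrI i (-1) # y"
  obtain a r m b s where ww: "W = TrI a r # m @ [Tr b s]" using string_split[OF W] by metis
  have wd: "is_word Q W" using W by (simp add: is_string_def)
  have L: "Tr b s \<in> letters Q" using wd unfolding ww is_word_Cons is_word_append by auto
  have i: "i \<in> spverts Q" using wd unfolding u is_word_append is_word_Cons by auto
  have une: "u \<noteq> []" using u ww by (cases u) auto
  hence ne: "y \<noteq> []" "length y = c" "0 < c" by (auto simp: y_def c_def simp del: upt_Suc)
  have "W ! (length W - 1) = Tr b s" unfolding ww by (simp add: nth_append)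
  hence "W ! (c + c) = Tr b s" using lW by (simp add: mult_2)
  hence h: "last y = Tr b s" using ne by (simp add: last_conv_nth) (simp add: y_def lift_letter_def del: upt_Suc)
  have F: "Fword Q y = winv u" using Fword_lift[OF Q wd, of "Suc c" "2 * c + 1"] lW
    by (simp add: y_def del: upt_Suc) (simp add: u c_def)
  have p: "lpunct Q z" "\<not> rpunct Q z" unfolding lpunct_def rpunct_def z_def using h ne L i by auto
  hence c: "completion Q z = W" "coff Q z = c"
    unfolding completion_def coff_def z_def using F i ne by (auto simp: Fword_winv u)
  have s: "is_string (hat Q) z"
  proof -
    have "is_word (hat Q) y" using lift_word[OF Q wd, of "2 * c + 1" "Suc c"] lW by (simp add: y_def del: upt_Suc)
    moreover have "hd y = lift_letter Q W (Suc c)" using ne by (simp add: hd_conv_nth) (simp add: y_def del: upt_Suc)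
    moreover have "follows Q (W ! c) (W ! Suc c)" using word_nth[OF wd, of c] lW ne by simp
    moreover have "W ! c = Spl i" using u c_def by (simp add: nth_append)
    moreover have "W ! Suc c \<in> letters Q" using word_letters[OF wd] lW ne by simp
    ultimately have "follows Q (TrI i (-1)) (hd y)"
      using lift_letter(4)[OF Q] unfolding follows_def by simp
    hence "is_word (hat Q) z" unfolding z_def using \<open>is_word (hat Q) y\<close> spverts_verts[OF Q i]
      by (simp add: is_word_Cons)
    thus ?thesis unfolding is_string_def z_def using h ne by auto
  qed
  have "adm_string Q z"
  proof (rule lift_adm[OF Q s _ c(1)])
    fix k assume k: "0 < k" "k < length z - 1"
    then obtain j where j: "k = Suc j" "j < c" using ne by (cases k) (auto simp: z_def)
    thus "z ! k = lift_letter Q W (k + coff Q z)" using ne c(2) by (simp add: z_def) (simp add: y_def add.commute del: upt_Suc)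
    assume "is_spl (W ! (k + coff Q z))"
    thus "msgn (seq W) (int (k + coff Q z)) \<noteq> 0"
      using centre_nonzero[OF Q W lW, of "k + c"] k c(2) ne lW by (simp add: z_def)
  qed (use p in blast)
  with p c show ?thesis by blast
qed

subsection \<open>Strings that cannot be prolonged\<close>

text \<open>Satisfied at fringe vertices for polarity \<open>-1\<close>, see
  \<open>dead_fringe\<close>: a word arriving there has to stop.\<close>

definition dead :: "('v, 'a) pquiver \<Rightarrow> 'v \<Rightarrow> int \<Rightarrow> bool" where
  "dead Q a r \<longleftrightarrow> (\<forall>l\<in>letters Q. lta Q l = Some (a, r) --> l = Tr a r)"

locale dead_string =
  fixes Q :: "('v, 'a) pquiver" and W :: "('v, 'a) word" and a :: 'v and r :: int and b :: 'v and t :: int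
  assumes Q: "skewed_gentle Q" and W: "is_string Q W" and hdW: "hd W = TrI a r" and lastW: "last W = Tr b t"
    and dead: "dead Q a r" "dead Q b t"
begin

lemma W_len: "2 \<le> length W" and W_word: "is_word Q W"
  using string_length[OF W] W by (auto simp: is_string_def)

lemma W_0: "W ! 0 = TrI a r" and W_last: "W ! (length W - 1) = Tr b t"
  using hdW lastW hd_conv_nth[of W] last_conv_nth[of W] W_len by force+

text \<open>The conditions on the two ends are where \<open>dead\<close> enters. If the tails at
  \<open>k\<close> agree up to the final trivial letter of one of them, then the letter of the other
  tail at this place has the same target; being at a dead point it is the trivial letter too, and
  both tails end there.\<close>

lemma end_data: "end_data (seq W) (spos W) 0 (int (length W) - 1)"
proof
  show "seq W k \<in> {-1, 0, 1}" for k by (rule seq_range)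
  show "k < 0 \<or> int (length W) - 1 < k ==> seq W k = 0" for k by (auto simp: seq_def)
  show "k \<in> spos W ==> seq W k = 0" for k by (rule spos_seq)
  show "seq W 0 = 0" using W_0 W_len by (simp add: seq_def cen_def)
  show "seq W (int (length W) - 1) = 0"
    using W_last W_len seq_nth[of "length W - 1" W] by (simp add: cen_def of_nat_diff)
  show "k \<in> spos W" if k: "0 < k" "k < int (length W) - 1" "seq W k = 0" for k
  proof -
    define j where "j = nat k"
    have j: "k = int j" "0 < j" "j < length W - 1" "j < length W" using k(1,2) unfolding j_def by linarith+
    have "cen (W ! j) = 0" using k(3) j seq_nth by metis
    moreover have "W ! j \<noteq> Tr x y" "W ! j \<noteq> TrI x y" for x y
      using word_Tr_last[OF W_word j(4)] word_TrI_first[OF W_word j(4)] j by force+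
    ultimately have "is_spl (W ! j)" by (cases "W ! j") (auto simp: cen_def)
    thus ?thesis using j by (simp add: spos_def)
  qed
  show "k + e \<in> spos W \<longleftrightarrow> k - e \<in> spos W" if "k \<in> spos W" "1 \<le> e" "pal (seq W) k e" for k e
    using spos_special_pos[OF Q W that(1)] special_pos.closure that(2,3) by metis
  show "int (length W) - 1 - k = k - 0" if k: "k \<in> spos W" "pal (seq W) k (int (length W) - 1 - k)" for k
  proof -
    obtain k' i where k': "k = int k'" "special_pos Q W k' i" using spos_special_pos[OF Q W k(1)] by metis
    interpret S: special_pos Q W k' i by (rule k'(2))
    define e where "e = length S.R"
    have e: "int (length W) - 1 - k = int e" "1 \<le> e" "length S.R = e" using k'(1) S.lengths S.k unfolding e_def by auto
    hence p: "pal (seq W) (int k') (int e)" using k(2) k'(1) by simp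
    have "length S.R = length S.L"
    proof (rule ccontr)
      assume ne: "length S.R \<noteq> length S.L"
      hence le: "\<not> length S.L < e" using S.pal_ends[OF p] by blast
      have ag: "S.R ! m = S.L ! m" if "m < e - 1" for m
        using S.pal_agree[OF p _ _ that] e(3) le by simp
      have "e - 1 < length S.R" "e - 1 < length S.L" using le e by linarith+
      then obtain p' where p': "lta Q (S.R ! (e - 1)) = Some p'" "lta Q (S.L ! (e - 1)) = Some p'"
        using tail_lta[OF S.tails ag] by blast
      have "last S.R = last W" unfolding S.R_def using S.k by (simp add: last_drop)
      hence "S.R ! (e - 1) = Tr b t" using lastW e S.tails(1) by (metis last_conv_nth tail_def)
      hence "p' = (b, t)" using p'(1) by simp
      moreover have "S.L ! (e - 1) \<in> letters Q"
        using word_letters[of Q S.L "e - 1"] S.tails(2) \<open>e - 1 < length S.L\<close> by (simp add: tail_def)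
      ultimately have "S.L ! (e - 1) = Tr b t" using p'(2) dead(2) by (auto simp: dead_def)
      hence "e - 1 = length S.L - 1" using tail_Tr[OF S.tails(2) \<open>e - 1 < length S.L\<close>] by blast
      thus False using ne e le by linarith
    qed
    thus ?thesis using e S.lengths(2) k'(1) by simp
  qed
  show "int (length W) - 1 - k = k - 0" if k: "k \<in> spos W" "pal (seq W) k (k - 0)" for k
  proof -
    obtain k' i where k': "k = int k'" "special_pos Q W k' i" using spos_special_pos[OF Q W k(1)] by metis
    interpret S: special_pos Q W k' i by (rule k'(2))
    have e: "1 \<le> k'" "length S.L = k'" using S.lengths S.k by auto
    have p: "pal (seq W) (int k') (int k')" using k(2) k'(1) by simp
    have "length S.R = length S.L"
    proof (rule ccontr)
      assume ne: "length S.R \<noteq> length S.L"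
      hence le: "\<not> length S.R < k'" using S.pal_ends[OF p] by blast
      have ag: "S.L ! m = S.R ! m" if "m < k' - 1" for m
        using S.pal_agree[OF p _ _ that] e le by simp
      have "k' - 1 < length S.R" "k' - 1 < length S.L" using le e by linarith+
      then obtain p' where p': "lta Q (S.L ! (k' - 1)) = Some p'" "lta Q (S.R ! (k' - 1)) = Some p'"
        using tail_lta[OF S.tails(2,1) ag] by blast
      have "take k' W \<noteq> []" using e W_len by auto
      hence "last S.L = linv (hd W)" unfolding S.L_def using e by (simp add: last_winv hd_take)
      hence "S.L ! (k' - 1) = Tr a r" using hdW e S.tails(2) by (metis last_conv_nth tail_def linv.simps(5))
      hence "p' = (a, r)" using p'(1) by simp
      moreover have "S.R ! (k' - 1) \<in> letters Q"
        using word_letters[of Q S.R "k' - 1"] S.tails(1) \<open>k' - 1 < length S.R\<close> by (simp add: tail_def)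
      ultimately have "S.R ! (k' - 1) = Tr a r" using p'(2) dead(1) by (auto simp: dead_def)
      hence "k' - 1 = length S.R - 1" using tail_Tr[OF S.tails(1) \<open>k' - 1 < length S.R\<close>] by blast
      thus False using ne e le by linarith
    qed
    hence "length W - Suc k' = k'" using S.lengths by simp
    thus ?thesis using k'(1) S.k by simp
  qed
qed

end

subsection \<open>Trimming\<close>

text \<open>The word \<open>W'\<close> is obtained from \<open>W\<close> by cutting at the first letter of value \<open>- s\<close> and at the last
  letter of value \<open>s\<close>. With \<open>s = 1\<close> (inverse letters) this removes the cohooks of \<open>\<tau>\<^sub>f x\<close> and gives back
  \<open>x\<close>; with \<open>s = -1\<close> (direct letters) it gives \<open>\<tau> y\<close> from \<open>\<tau>\<^sub>f y\<close>, whether the corresponding end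
  of \<open>y\<close> is changed by a hook or by a cohook.\<close>

definition cut :: "('v, 'a) word \<Rightarrow> int \<Rightarrow> nat \<Rightarrow> nat \<Rightarrow> bool" where
  "cut W s p q \<longleftrightarrow> p < q \<and> q < length W \<and> cen (W ! p) = - s \<and> cen (W ! q) = s \<and>
     (\<forall>k<p. cen (W ! k) \<noteq> - s) \<and> (\<forall>k<length W. q < k --> cen (W ! k) \<noteq> s)"

locale trimmed_string = dead_string Qf W a r b t
  for Qf :: "('v, 'a) pquiver" and W a r b t +
  fixes Q :: "('v, 'a) pquiver" and W' :: "('v, 'a) word" and s :: int and p q :: nat
  assumes Q': "skewed_gentle Q" and W': "is_string Q W'" and s: "s = 1 \<or> s = -1" and cut: "cut W s p q"
    and len': "length W' = q - p + 1" and W'_nth: "\<And>j. 0 < j ==> j < q - p ==> W' ! j = W ! (j + p)"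
begin

lemma pq: "p < q" "q < length W - 1" "0 < p" "cen (W ! p) = - s" "cen (W ! q) = s"
  "k < p ==> cen (W ! k) \<noteq> - s" "k < length W ==> q < k ==> cen (W ! k) \<noteq> s"
proof -
  have "cen (W ! 0) = 0" "cen (W ! (length W - 1)) = 0" unfolding W_0 W_last by (simp_all add: cen_def)
  hence "cen (W ! (length W - 1)) \<noteq> s" "cen (W ! 0) \<noteq> - s" using s by auto
  hence "q \<noteq> length W - 1" "p \<noteq> 0" using cut unfolding cut_def by metis+
  thus "q < length W - 1" "0 < p" using cut unfolding cut_def by linarith+
qed (use cut in "auto simp: cut_def")

lemma td: "trim_data (seq W) (spos W) 0 (int (length W) - 1) (int p) (int q) s"
proof (rule trim_data.intro[OF end_data], unfold_locales)
  show "seq W (int q) = s" "seq W (int p) = - s" using pq by (simp_all add: seq_nth)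
  show "seq W k \<noteq> s" if "int q < k" for k
  proof (cases "k < int (length W)")
    case True
    hence "nat k < length W" "q < nat k" using that by linarith+
    hence "cen (W ! nat k) \<noteq> s" by (rule pq(7))
    thus ?thesis using s by (auto simp: seq_def)
  qed (use s in "auto simp: seq_def")
  show "seq W k \<noteq> - s" if "k < int p" for k
  proof (cases "0 \<le> k")
    case True
    hence "nat k < p" using that by linarith
    hence "cen (W ! nat k) \<noteq> - s" by (rule pq(6))
    thus ?thesis using True s by (auto simp: seq_def)
  qed (use s in "auto simp: seq_def")
qed (use pq(1,2) s in simp_all)

text \<open>The new letters of \<open>W'\<close> at the two cuts are trivial and have value
  \<open>0\<close>, so the sequence of \<open>W'\<close> is the trimmed sequence of
  \<open>W\<close>, moved by \<open>p\<close>.\<close>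

lemma msgn_trimmed:
  assumes j: "j < length W'" "is_spl (W' ! j)"
  shows "msgn (seq W') (int j) = msgn (seq W) (int (j + p))" (is ?A) "0 < j" "j < q - p"
proof -
  interpret T: trim_data "seq W" "spos W" 0 "int (length W) - 1" "int p" "int q" s by (rule td)
  have wd: "is_word Q W'" using W' by (simp add: is_string_def)
  have ends: "cen (W' ! 0) = 0" "cen (W' ! (q - p)) = 0" "\<not> is_spl (W' ! 0)" "\<not> is_spl (W' ! (q - p))"
    using W' len' unfolding is_string_def by (auto simp: hd_conv_nth last_conv_nth cen_def)
  show jb: "0 < j" "j < q - p" using j ends len' pq(1) by (cases "j = 0"; cases "j = q - p"; auto)+
  have e: "seq W' = (\<lambda>i. T.trim (i + int p))"
  proof
    fix i
    show "seq W' i = T.trim (i + int p)"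
    proof (cases "0 < i \<and> i < int q - int p")
      case True
      define m where "m = nat i"
      have m: "i = int m" "0 < m" "m < q - p" using True unfolding m_def by linarith+
      have "seq W' i = cen (W ! (m + p))" using m len' W'_nth by (simp add: seq_nth)
      moreover have "T.trim (i + int p) = seq W (int (m + p))"
      proof -
        have "int p < i + int p" "i + int p < int q" "i + int p = int (m + p)" using m pq(1) by auto
        thus ?thesis unfolding T.trim_def by metis
      qed
      moreover have "m + p < length W" using m pq by linarith
      ultimately show ?thesis using seq_nth by metis
    next
      case False
      hence "T.trim (i + int p) = 0" unfolding T.trim_def by auto
      moreover have "seq W' i = 0"
      proof (cases "i = 0 \<or> i = int q - int p")
        case True
        then consider "i = int 0" | "i = int (q - p)" using pq(1) by fastforce
        thus ?thesis
        proof cases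
          case 1
          show ?thesis unfolding 1 using seq_nth[of 0 W'] ends(1) len' by simp
        next
          case 2
          show ?thesis unfolding 2 using seq_nth[of "q - p" W'] ends(2) len' by simp
        qed
      next
        case ne: False
        hence "i < 0 \<or> int (length W') \<le> i" using False len' pq(1) by auto
        thus ?thesis by (auto simp: seq_def)
      qed
      ultimately show ?thesis by simp
    qed
  qed
  have "j + p < length W" using jb pq by linarith
  moreover have "is_spl (W ! (j + p))" using j W'_nth jb by simp
  ultimately have "int (j + p) \<in> spos W" by (simp add: spos_def del: of_nat_add)
  hence "msgn T.trim (int (j + p)) = msgn (seq W) (int (j + p))" using T.msgn_trim jb by simp
  thus ?A
    unfolding e msgn_shift by simp
qed

text \<open>A position of \<open>W\<close> with equal tails lies between the cuts by
  \<open>msgn_zero_inside\<close>, so it would be visible in \<open>W'\<close> with the same sign.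
  This transfers asymmetry, hence the existence of unpunctured lifts.\<close>

lemma msgn_W_nonzero:
  assumes "\<And>j. j \<in> spos W' ==> msgn (seq W') j \<noteq> 0" "j \<in> spos W"
  shows "msgn (seq W) j \<noteq> 0"
proof
  assume z: "msgn (seq W) j = 0"
  interpret T: trim_data "seq W" "spos W" 0 "int (length W) - 1" "int p" "int q" s by (rule td)
  have j: "int p < j" "j < int q" using T.msgn_zero_inside[OF assms(2) z] by auto
  define m where "m = nat j - p"
  have m: "j = int (m + p)" "0 < m" "m < q - p" using j unfolding m_def by linarith+
  have "is_spl (W ! (m + p))" using assms(2) unfolding m(1) spos_def by (simp del: of_nat_add)
  hence s': "is_spl (W' ! m)" "m < length W'" using W'_nth m len' by auto
  hence "int m \<in> spos W'" by (simp add: spos_def)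
  thus False using assms(1) msgn_trimmed(1)[OF s'(2,1)] m(1) z by metis
qed

lemma msgn_W'_nonzero:
  assumes "\<And>j. j \<in> spos W ==> msgn (seq W) j \<noteq> 0" "j \<in> spos W'"
  shows "msgn (seq W') j \<noteq> 0"
proof -
  define m where "m = nat j"
  have m: "j = int m" "m < length W'" "is_spl (W' ! m)" using assms(2) by (auto simp: spos_def m_def nat_less_iff)
  note t = msgn_trimmed[OF m(2,3)]
  have "is_spl (W ! (m + p))" "m + p < length W" using W'_nth t(2,3) m(3) pq by auto
  hence "int (m + p) \<in> spos W" by (simp add: spos_def del: of_nat_add)
  thus ?thesis using assms(1) t(1) m(1) by simp
qed

end

text \<open>\<open>prolongs s Q Qf z Z c\<close>: the string \<open>Z\<close> contains the inner letters of \<open>z\<close>, moved by \<open>c\<close>, and at every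
  unpunctured end it goes on with a letter of value \<open>s\<close> (read away from \<open>z\<close>), followed by letters of
  value \<open>- s\<close> only.\<close>

definition prolongs :: "int \<Rightarrow> ('v, 'a) pquiver \<Rightarrow> ('v, 'a) pquiver \<Rightarrow> ('v, 'a) word \<Rightarrow> ('v, 'a) word \<Rightarrow> nat \<Rightarrow> bool" where
  "prolongs s Q Qf z Z c \<longleftrightarrow>
     is_string (hat Q) z \<and> is_string (hat Qf) Z \<and> lpunct Qf Z = lpunct Q z \<and> rpunct Qf Z = rpunct Q z \<and>
     (\<forall>k. 0 < k \<and> k < length z - 1 --> Z ! (k + c) = z ! k) \<and>
     (if lpunct Q z then c = 0 \<and> hd Z = hd z
      else 0 < c \<and> cen (Z ! c) = - s \<and> \<not> is_spl (Flet Qf (Z ! c)) \<and> lso Qf (Z ! c) = lso Q (hd z) \<and>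
        (\<forall>k. 0 < k \<and> k < c --> cen (Z ! k) = s)) \<and>
     (if rpunct Q z then length Z = length z + c \<and> last Z = last z
      else length z + c < length Z \<and> cen (Z ! (length z - 1 + c)) = s \<and>
        \<not> is_spl (Flet Qf (Z ! (length z - 1 + c))) \<and> lta Qf (Z ! (length z - 1 + c)) = lta Q (last z) \<and>
        (\<forall>k. length z - 1 + c < k \<and> k < length Z - 1 --> cen (Z ! k) = - s))"

lemma cen_adm_special:
  assumes Q: "skewed_gentle Q" and z: "adm_string Q z" "\<not> (lpunct Q z \<and> rpunct Q z)"
    and k: "0 < k" "k < length z - 1" "is_spl (Flet Q (z ! k))"
  shows "cen (z ! k) = msgn (seq (completion Q z)) (int (k + coff Q z))" (is ?A)
    "msgn (seq (completion Q z)) (int (k + coff Q z)) \<noteq> 0" (is ?B)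
proof -
  obtain i where i: "Flet Q (z ! k) = Spl i" using k(3) by (auto simp: is_spl_def)
  note sp = adm_string_special[OF Q z k(1,2) i]
  show ?B by (rule sp(2))
  define m where "m = msgn (seq (completion Q z)) (int (k + coff Q z))"
  have "m = -1 \<or> m = 1" using sp(2) msgn_range[of "seq (completion Q z)"] unfolding m_def by blast
  thus ?A
    using sp(3) unfolding m_def[symmetric] by (elim disjE) (simp_all add: cen_def)
qed

lemma (in hat_string) winv_W:
  assumes "lpunct Q z \<or> rpunct Q z"
  shows "winv W = W"
proof -
  obtain u i where "W = Fword Q u @ [Spl i] @ winv (Fword Q u)" using punct_form[OF assms] by metis
  thus ?thesis by simp
qed

text \<open>Inversion exchanges the first letter of value \<open>- s\<close> with the last letter of
  value \<open>s\<close>.\<close>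

lemma (in trimmed_string) symmetric_cut:
  assumes "winv W = W"
  shows "p + q = length W - 1"
proof -
  define p' where "p' = length W - 1 - p"
  define q' where "q' = length W - 1 - q"
  have "length W - Suc p' = p" "p' < length W" "length W - Suc q' = q" "q' < length W"
    using pq(1,2) unfolding p'_def q'_def by linarith+
  hence "W ! p' = linv (W ! p)" "W ! q' = linv (W ! q)"
    using nth_winv[of p' W] nth_winv[of q' W] assms by auto
  hence "cen (W ! p') = s" "cen (W ! q') = - s" using pq(4,5) by (auto simp: cen_linv)
  hence "\<not> q < p'" "\<not> q' < p" using pq(7)[OF \<open>p' < length W\<close>] pq(6)[of q'] by auto
  thus ?thesis using pq(1,2) unfolding p'_def q'_def by linarith
qed

text \<open>Between the cuts the loops keep their orientations by \<open>msgn_trimmed\<close>.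
  Before \<open>p\<close> an ordinary letter does not have value \<open>- s\<close> by the choice of
  \<open>p\<close>, and neither does a loop by \<open>msgn_before_p\<close>; dually after
  \<open>q\<close>. For a punctured type the cuts are symmetric and the strings show only one half
  of their completions.\<close>

lemma (in trimmed_string) prolongs:
  assumes Z: "adm_string Qf Z" "completion Qf Z = W" and z: "adm_string Q z" "completion Q z = W'"
    and one: "\<not> (lpunct Q z \<and> rpunct Q z)" and fl: "lpunct Qf Z = lpunct Q z" "rpunct Qf Z = rpunct Q z"
    and ends: "lso Q (hd W') = lso Qf (W ! p)" "lta Q (last W') = lta Qf (W ! q)"
    and spl: "\<And>i. i \<in> spverts Q ==> sploop Qf i = sploop Q i"
  shows "prolongs s Q Qf z Z (if lpunct Q z then 0 else p)"
proof -
  have st: "is_string (hat Q) z" "is_string (hat Qf) Z" using Z z by (auto simp: adm_string_def)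
  have oneZ: "\<not> (lpunct Qf Z \<and> rpunct Qf Z)" using one fl by simp
  interpret A: hat_string Qf Z using Q st oneZ by unfold_locales
  interpret B: hat_string Q z using Q' st one by unfold_locales
  have AW: "A.W = W" and BW: "B.W = W'" using Z z by (auto simp: A.W_def B.W_def)
  define n where "n = length z - 1"
  define N where "N = length Z - 1"
  define oz where "oz = coff Q z"
  define oZ where "oZ = coff Qf Z"
  define c where "c = (if lpunct Q z then 0 else p)"
  have n: "length z = Suc n" "length Z = Suc N" "0 < n" "0 < N"
    using A.z_len B.z_len unfolding n_def N_def by linarith+
  have he: "hd z = z ! 0" "hd Z = Z ! 0" "last z = z ! n" "last Z = Z ! N"
    unfolding n_def N_def by (rule hd_conv_nth[OF B.z_len(2)] hd_conv_nth[OF A.z_len(2)]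
      last_conv_nth[OF B.z_len(2)] last_conv_nth[OF A.z_len(2)])+
  have W'ne: "W' \<noteq> []" using W' by (auto simp: is_string_def)
  have lW: "length W = (if lpunct Q z \<or> rpunct Q z then 2 * N + 1 else Suc N)"
    using length_hcomp[OF A.z_len(2), of Qf] A.W(1) AW fl n by simp
  have lW': "length W' = (if lpunct Q z \<or> rpunct Q z then 2 * n + 1 else Suc n)"
    using length_hcomp[OF B.z_len(2), of Q] B.W(1) BW n by simp
  have sym: "p + q = length W - 1" if "lpunct Q z \<or> rpunct Q z"
  proof (rule symmetric_cut)
    show "winv W = W" using A.winv_W fl that AW by simp
  qed
  \<comment> \<open>The string \<open>z\<close> stands at \<open>oz\<close> in \<open>W'\<close> and
    at \<open>c\<close> in \<open>Z\<close>, which in turn stand at \<open>p\<close> and at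
    \<open>oZ\<close> in \<open>W\<close>. The first equation says that both routes from
    \<open>z\<close> to \<open>W\<close> agree; the others list the lengths for each type.\<close>
  have off: "oz + p = c + oZ" "c = (if lpunct Q z then 0 else p)" "oZ = (if lpunct Q z then N else 0)"
      "oz = (if lpunct Q z then n else 0)" "lpunct Q z \<or> rpunct Q z ==> N = n + p \<and> q - p = 2 * n \<and> q = p + 2 * n"
      "\<not> rpunct Q z ==> n + c + oZ = q" "\<not> lpunct Q z ==> \<not> rpunct Q z ==> q = n + p \<and> N = length W - 1"
  proof -
    show c: "c = (if lpunct Q z then 0 else p)" by (rule c_def)
    show oZ: "oZ = (if lpunct Q z then N else 0)" using fl by (simp add: oZ_def coff_def N_def)
    show oz: "oz = (if lpunct Q z then n else 0)" by (simp add: oz_def coff_def n_def)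
    show a: "N = n + p \<and> q - p = 2 * n \<and> q = p + 2 * n" if "lpunct Q z \<or> rpunct Q z"
    proof -
      have "p + q = 2 * N" "q - p + 1 = 2 * n + 1" using sym[OF that] lW lW' len' that by simp_all
      thus ?thesis using pq(1) by linarith
    qed
    show b: "q = n + p \<and> N = length W - 1" if "\<not> lpunct Q z" "\<not> rpunct Q z"
      using lW lW' len' that pq(1) by simp
    show "oz + p = c + oZ" using a oZ oz c by (cases "lpunct Q z") auto
    show "n + c + oZ = q" if "\<not> rpunct Q z" using a b oZ c that by (cases "lpunct Q z") auto
  qed
  have Wn: "W ! (k + oZ) = Flet Qf (Z ! k)" if "k < length Z" for k
    using A.W_nth[OF that] AW by (simp add: oZ_def)
  have W'n: "W' ! (k + oz) = Flet Q (z ! k)" if "k < length z" for k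
    using B.W_nth[OF that] BW by (simp add: oz_def)
  have bnds: "0 < k + oz \<and> k + oz < q - p \<and> 0 < k + c \<and> k + c < N \<and> k + oz < length W'" if "0 < k" "k < n" for k
  proof -
    consider "\<not> lpunct Q z" "\<not> rpunct Q z" | "lpunct Q z" | "\<not> lpunct Q z" "rpunct Q z" by blast
    thus ?thesis
    proof cases
      case 1
      hence "oz = 0" "c = p" "q = n + p" "N = length W - 1" "length W' = Suc n"
        using off(2,4) off(7) lW' by simp_all
      thus ?thesis using that pq(2) by simp
    next
      case 2
      hence "oz = n" "c = 0" "N = n + p" "q - p = 2 * n" "length W' = 2 * n + 1"
        using off(2,4) off(5) lW' by simp_all
      thus ?thesis using that by simp
    next
      case 3
      hence "oz = 0" "c = p" "N = n + p" "q - p = 2 * n" "length W' = 2 * n + 1"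
        using off(2,4) off(5) lW' by simp_all
      thus ?thesis using that by simp
    qed
  qed
  have inner: "Z ! (k + c) = z ! k" if k: "0 < k" "k < n" for k
  proof -
    note b = bnds[OF k]
    have e: "k + oz + p = k + c + oZ" using off(1) by simp
    have kl: "k < length z" "k + c < length Z" using b k n by linarith+
    have "W' ! (k + oz) = W ! (k + oz + p)" using b by (intro W'_nth) blast+
    hence F: "Flet Q (z ! k) = Flet Qf (Z ! (k + c))"
      unfolding e Wn[OF kl(2)] W'n[OF kl(1)] .
    show ?thesis
    proof (cases "is_spl (Flet Q (z ! k))")
      case False
      thus ?thesis using F Flet_nonspecial[of Q "z ! k"] Flet_nonspecial[of Qf "Z ! (k + c)"] by simp
    next
      case True
      then obtain i where i: "Flet Q (z ! k) = Spl i" by (auto simp: is_spl_def)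
      have ks: "k < length z - 1" "k + c < length Z - 1" "0 < k + c" using b k by (auto simp: n_def N_def)
      note z1 = adm_string_special[OF Q' z(1) one k(1) ks(1) i]
      have iZ: "Flet Qf (Z ! (k + c)) = Spl i" using F i by simp
      note Z1 = adm_string_special[OF Q Z(1) oneZ ks(3,2) iZ]
      have "is_spl (W' ! (k + oz))" unfolding W'n[OF kl(1)] i by simp
      hence "msgn (seq W') (int (k + oz)) = msgn (seq W) (int (k + oz + p))"
        using b by (intro msgn_trimmed(1)) blast+
      hence "msgn (seq (completion Q z)) (int (k + coff Q z)) = msgn (seq (completion Qf Z)) (int (k + c + coff Qf Z))"
        unfolding z(2) Z(2) oz_def[symmetric] oZ_def[symmetric] e .
      thus ?thesis using z1(1,3) Z1(3) spl by simp
    qed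
  qed
  interpret T: trim_data "seq W" "spos W" 0 "int (length W) - 1" "int p" "int q" s by (rule td)
  have cenZ: "cen (Z ! k) = cen (W ! (k + oZ)) \<or> (int (k + oZ) \<in> spos W \<and> cen (Z ! k) = msgn (seq W) (int (k + oZ)) \<and> cen (Z ! k) \<noteq> 0)"
    "\<not> is_spl (W ! (k + oZ)) ==> Z ! k = W ! (k + oZ)"
    if k: "0 < k" "k < N" for k
  proof -
    have kl: "k < length Z" "k < length Z - 1" using k n by auto
    have lt: "k + oZ < length W" using k lW off(3) by (cases "lpunct Q z"; cases "rpunct Q z") auto
    show e: "\<not> is_spl (W ! (k + oZ)) ==> Z ! k = W ! (k + oZ)" using Wn[OF kl(1)] Flet_nonspecial by metis
    show "cen (Z ! k) = cen (W ! (k + oZ)) \<or> (int (k + oZ) \<in> spos W \<and> cen (Z ! k) = msgn (seq W) (int (k + oZ)) \<and> cen (Z ! k) \<noteq> 0)"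
    proof (cases "is_spl (W ! (k + oZ))")
      case True
      hence sp: "is_spl (Flet Qf (Z ! k))" using Wn[OF kl(1)] by simp
      have "int (k + oZ) \<in> spos W" using True lt by (simp add: spos_def del: of_nat_add)
      thus ?thesis using cen_adm_special[OF Q Z(1) oneZ k(1) kl(2) sp] Z(2) by (simp add: oZ_def)
    qed (use e in simp)
  qed
  have nonzero: "cen (Z ! k) \<noteq> 0" if k: "0 < k" "k < N" for k
  proof -
    have wd: "is_word (hat Qf) Z" "k < length Z" using st k n by (auto simp: is_string_def)
    have "Z ! k \<noteq> Tr x y" "Z ! k \<noteq> TrI x y" for x y
      using word_Tr_last[OF wd] word_TrI_first[OF wd] k n by force+
    moreover have "Z ! k \<noteq> Spl i" for i using word_letters[OF wd] by (cases "Z ! k") auto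
    ultimately show ?thesis by (cases "Z ! k") (auto simp: cen_def)
  qed
  have left: "cen (Z ! k) = s" if k: "0 < k" "k < N" "k + oZ < p" for k
  proof -
    have "int (k + oZ) < int p" using k(3) by simp
    hence m: "int (k + oZ) \<in> spos W ==> s * msgn (seq W) (int (k + oZ)) \<ge> 0" by (rule T.msgn_before_p[rotated])
    have r: "cen (Z ! k) \<in> {-1, 0, 1}" by (rule cen_range)
    show ?thesis using cenZ(1)[OF k(1,2)] m pq(6)[OF k(3)] r nonzero[OF k(1,2)] s by auto
  qed
  have right: "cen (Z ! k) = - s" if k: "0 < k" "k < N" "q < k + oZ" for k
  proof -
    have lt: "k + oZ < length W" using k lW off(3) by (cases "lpunct Q z"; cases "rpunct Q z") auto
    have "int q < int (k + oZ)" using k(3) by simp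
    hence m: "int (k + oZ) \<in> spos W ==> s * msgn (seq W) (int (k + oZ)) \<le> 0" by (rule T.msgn_after_q[rotated])
    have r: "cen (Z ! k) \<in> {-1, 0, 1}" by (rule cen_range)
    show ?thesis using cenZ(1)[OF k(1,2)] m pq(7)[OF lt k(3)] r nonzero[OF k(1,2)] s by auto
  qed
  have ns: "\<not> is_spl (W ! p)" "\<not> is_spl (W ! q)" using pq(4,5) s cen_spl by force+
  have pu: "c = 0 \<and> hd Z = hd z" if l: "lpunct Q z"
  proof -
    obtain i j where ij: "i \<in> spverts Q" "hd z = TrI i (-1)" "j \<in> spverts Qf" "hd Z = TrI j (-1)"
      using l fl by (auto simp: lpunct_def)
    have "z ! 0 = hd z" "Z ! 0 = hd Z" using he by simp_all
    hence "W' ! n = Spl i" "W ! N = Spl j"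
      using W'n[of 0] Wn[of 0] n off(3,4) l ij by (simp_all)
    moreover have "W' ! n = W ! (n + p)" using W'_nth[of n] off(5) l n by simp
    ultimately show ?thesis using ij off(2,5) l by simp
  qed
  have nl: "0 < c \<and> cen (Z ! c) = - s \<and> \<not> is_spl (Flet Qf (Z ! c)) \<and> lso Qf (Z ! c) = lso Q (hd z) \<and>
        (\<forall>k. 0 < k \<and> k < c --> cen (Z ! k) = s)" if l: "\<not> lpunct Q z"
  proof -
    have o: "oZ = 0" "c = p" "oz = 0" using off l by auto
    have "p < N"
    proof (cases "rpunct Q z")
      case True
      hence "N = n + p" using off(5) by blast
      thus ?thesis using n(3) by simp
    next
      case False
      hence "q = n + p" "N = length W - 1" using off(7) l by blast+
      thus ?thesis using pq(1,2) by linarith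
    qed
    hence Zp: "Z ! p = W ! p" using cenZ(2)[of p] ns pq(3) o by simp
    moreover have "hd z = hd W'"
    proof -
      obtain a r where h: "hd z = TrI a r" using st by (auto simp: is_string_def)
      hence "Flet Q (hd z) = hd z" using l by (auto simp: lpunct_def)
      moreover have "W' \<noteq> []" "z ! 0 = hd z" using W'ne he by simp_all
      moreover have "0 < length z" using n by simp
      ultimately show ?thesis using W'n[of 0] hd_conv_nth[of W'] o(3) by simp
    qed
    moreover have "\<not> is_spl (Flet Qf (Z ! p))" using Wn[of p] \<open>p < N\<close> n o ns by simp
    ultimately show ?thesis using o pq(3,4) ends(1) left \<open>p < N\<close> by auto
  qed
  have rp: "length Z = length z + c \<and> last Z = last z" if r: "rpunct Q z"
  proof -
    have l: "\<not> lpunct Q z" using r one by blast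
    have o: "oZ = 0" "c = p" "oz = 0" using off l by auto
    obtain i j where ij: "i \<in> spverts Q" "last z = Tr i (-1)" "j \<in> spverts Qf" "last Z = Tr j (-1)"
      using r fl by (auto simp: rpunct_def)
    have "z ! n = last z" "Z ! N = last Z" using he by simp_all
    hence "W' ! n = Spl i" "W ! N = Spl j"
      using W'n[of n] Wn[of N] n ij o by simp_all
    moreover have "W' ! n = W ! (n + p)" using W'_nth[of n] off(5) r n by simp
    ultimately show ?thesis using ij off(5) o r n by simp
  qed
  have nr: "length z + c < length Z \<and> cen (Z ! (n + c)) = s \<and>
        \<not> is_spl (Flet Qf (Z ! (n + c))) \<and> lta Qf (Z ! (n + c)) = lta Q (last z) \<and>
        (\<forall>k. n + c < k \<and> k < N --> cen (Z ! k) = - s)" if r: "\<not> rpunct Q z"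
  proof -
    have q: "n + c + oZ = q" using off(6) r .
    have nN: "n + c < N" using off r pq(2,3) n by (cases "lpunct Q z") auto
    have Zq: "Z ! (n + c) = W ! q" using cenZ(2)[of "n + c"] ns q nN n by simp
    moreover have "last z = last W'"
    proof -
      obtain a r where h: "last z = Tr a r" using st by (auto simp: is_string_def)
      hence "Flet Q (last z) = last z" using r by (auto simp: rpunct_def)
      moreover have "z ! n = last z" using he by simp
      moreover have "W' ! (n + oz) = last W'"
        using last_conv_nth[OF W'ne] lW' off(4) r by (cases "lpunct Q z") (auto simp: mult_2)
      ultimately show ?thesis using W'n[of n] n by simp
    qed
    moreover have "\<not> is_spl (Flet Qf (Z ! (n + c)))" using Wn[of "n + c"] nN n q ns by simp
    moreover have "cen (Z ! k) = - s" if "n + c < k" "k < N" for k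
      using right[of k] that q by simp
    ultimately show ?thesis using nN pq(5) ends(2) n by auto
  qed
  have inner': "\<forall>k. 0 < k \<and> k < length z - 1 --> Z ! (k + c) = z ! k" using inner by (simp add: n_def)
  have L: "if lpunct Q z then c = 0 \<and> hd Z = hd z
      else 0 < c \<and> cen (Z ! c) = - s \<and> \<not> is_spl (Flet Qf (Z ! c)) \<and> lso Qf (Z ! c) = lso Q (hd z) \<and>
        (\<forall>k. 0 < k \<and> k < c --> cen (Z ! k) = s)" using pu nl by presburger
  have R: "if rpunct Q z then length Z = length z + c \<and> last Z = last z
      else length z + c < length Z \<and> cen (Z ! (length z - 1 + c)) = s \<and>
        \<not> is_spl (Flet Qf (Z ! (length z - 1 + c))) \<and> lta Qf (Z ! (length z - 1 + c)) = lta Q (last z) \<and>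
        (\<forall>k. length z - 1 + c < k \<and> k < length Z - 1 --> cen (Z ! k) = - s)"
    using rp nr unfolding n_def N_def by presburger
  show ?thesis unfolding prolongs_def c_def[symmetric] using st fl inner' L R by blast
qed

text \<open>\<open>outward\<close>: all arrows of \<open>H(Z)\<close> point away from one vertex, or from the punctured end.\<close>

definition outward :: "('v, 'a) pquiver \<Rightarrow> ('v, 'a) word \<Rightarrow> bool" where
  "outward Q Z \<longleftrightarrow> is_string (hat Q) Z \<and> \<not> (lpunct Q Z \<and> rpunct Q Z) \<and>
     (\<forall>a b. 0 < a \<and> a < b \<and> b < length Z - 1 --> \<not> (cen (Z ! a) = 1 \<and> cen (Z ! b) = -1)) \<and>
     (lpunct Q Z --> (\<forall>k. 0 < k \<and> k < length Z - 1 --> cen (Z ! k) = 1)) \<and>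
     (rpunct Q Z --> (\<forall>k. 0 < k \<and> k < length Z - 1 --> cen (Z ! k) = -1))"

text \<open>The hypothesis \<open>out\<close> speaks of the ordinary letters of \<open>W\<close>
  only. Loops follow suit by \<open>msgn_right\<close> and \<open>msgn_left\<close>: with no direct
  letter to the right a loop is inverse, with no inverse letter to the left it is direct. For a
  punctured type a wrong letter in the visible half would violate \<open>out\<close> together with
  its mirror image.\<close>

lemma (in dead_string) outward:
  assumes Z: "adm_string Q Z" "completion Q Z = W" "\<not> (lpunct Q Z \<and> rpunct Q Z)"
    and out: "\<And>a b. a < b ==> b < length W ==> \<not> (cen (W ! a) = 1 \<and> cen (W ! b) = -1)"
  shows "outward Q Z"
proof -
  have st: "is_string (hat Q) Z" using Z by (auto simp: adm_string_def)
  interpret A: hat_string Q Z using Q st Z(3) by unfold_locales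
  have AW: "A.W = W" using Z by (simp add: A.W_def)
  interpret E: end_data "seq W" "spos W" 0 "int (length W) - 1" by (rule end_data)
  define N where "N = length Z - 1"
  define oZ where "oZ = coff Q Z"
  have n: "length Z = Suc N" "0 < N" using A.z_len unfolding N_def by linarith+
  have lW: "length W = (if lpunct Q Z \<or> rpunct Q Z then 2 * N + 1 else Suc N)"
    using length_hcomp[OF A.z_len(2), of Q] A.W(1) AW n by simp
  have oZ: "oZ = (if lpunct Q Z then N else 0)" by (simp add: oZ_def coff_def N_def)
  have lt: "k + oZ < length W" if "k < N" for k using that lW oZ by (cases "lpunct Q Z"; cases "rpunct Q Z") auto
  have Wn: "W ! (k + oZ) = Flet Q (Z ! k)" if "k < length Z" for k
    using A.W_nth[OF that] AW by (simp add: oZ_def)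
  have right: "cen (Z ! k) = 1"
    if k: "0 < k" "k < N" and no: "\<And>j. j < length W ==> k + oZ \<le> j ==> cen (W ! j) \<noteq> -1" for k
  proof (cases "is_spl (Flet Q (Z ! k))")
    case True
    have sp: "int (k + oZ) \<in> spos W" using True Wn[of k] k n lt[of k] by (simp add: spos_def del: of_nat_add)
    have "-1 * msgn (seq W) (int (k + oZ)) \<le> 0"
    proof (rule E.msgn_right[OF sp])
      fix j assume j: "int (k + oZ) < j"
      show "seq W j \<noteq> -1"
      proof (cases "j < int (length W)")
        case True
        hence "nat j < length W" "k + oZ \<le> nat j" using j by linarith+
        thus ?thesis using no by (simp add: seq_def)
      qed (simp add: seq_def)
    qed simp
    moreover have "k < length Z - 1" using k n by simp
    ultimately show ?thesis using cen_adm_special[OF Q Z(1,3) k(1) _ True] msgn_range[of "seq W" "int (k + oZ)"]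
      unfolding Z(2) oZ_def[symmetric] by auto
  next
    case False
    have kl: "k < length Z" using k n by simp
    have "Z ! k = W ! (k + oZ)" using Wn[OF kl] Flet_nonspecial[OF False] by simp
    moreover have "cen (Z ! k) \<noteq> 0"
    proof -
      have wd: "is_word (hat Q) Z" using st by (simp add: is_string_def)
      have "Z ! k \<noteq> Tr x y" "Z ! k \<noteq> TrI x y" for x y
        using word_Tr_last[OF wd kl] word_TrI_first[OF wd kl] k n by force+
      moreover have "Z ! k \<noteq> Spl i" for i using word_letters[OF wd kl] by (cases "Z ! k") auto
      ultimately show ?thesis by (cases "Z ! k") (auto simp: cen_def)
    qed
    ultimately show ?thesis using no[OF lt[OF k(2)]] cen_range[of "Z ! k"] by auto
  qed
  have left: "cen (Z ! k) = -1"
    if k: "0 < k" "k < N" and no: "\<And>j. j \<le> k + oZ ==> cen (W ! j) \<noteq> 1" for k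
  proof (cases "is_spl (Flet Q (Z ! k))")
    case True
    have sp: "int (k + oZ) \<in> spos W" using True Wn[of k] k n lt[of k] by (simp add: spos_def del: of_nat_add)
    have "-1 * msgn (seq W) (int (k + oZ)) \<ge> 0"
    proof (rule E.msgn_left[OF sp])
      fix j assume j: "j < int (k + oZ)"
      show "seq W j \<noteq> - (-1)"
      proof (cases "0 \<le> j")
        case True
        hence "nat j \<le> k + oZ" using j by linarith
        thus ?thesis using no by (simp add: seq_def)
      qed (simp add: seq_def)
    qed simp
    moreover have "k < length Z - 1" using k n by simp
    ultimately show ?thesis using cen_adm_special[OF Q Z(1,3) k(1) _ True] msgn_range[of "seq W" "int (k + oZ)"]
      unfolding Z(2) oZ_def[symmetric] by auto
  next
    case False
    have kl: "k < length Z" using k n by simp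
    have "Z ! k = W ! (k + oZ)" using Wn[OF kl] Flet_nonspecial[OF False] by simp
    moreover have "cen (Z ! k) \<noteq> 0"
    proof -
      have wd: "is_word (hat Q) Z" using st by (simp add: is_string_def)
      have "Z ! k \<noteq> Tr x y" "Z ! k \<noteq> TrI x y" for x y
        using word_Tr_last[OF wd kl] word_TrI_first[OF wd kl] k n by force+
      moreover have "Z ! k \<noteq> Spl i" for i using word_letters[OF wd kl] by (cases "Z ! k") auto
      ultimately show ?thesis by (cases "Z ! k") (auto simp: cen_def)
    qed
    ultimately show ?thesis using no[of "k + oZ"] cen_range[of "Z ! k"] by auto
  qed
  have dich: "(\<forall>j<length W. m \<le> j --> cen (W ! j) \<noteq> -1) \<or> (\<forall>j\<le>m. cen (W ! j) \<noteq> 1)" if m: "m < length W" for m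
  proof (rule ccontr)
    assume "\<not> ?thesis"
    then obtain j j' where j: "j < length W" "m \<le> j" "cen (W ! j) = -1" "j' \<le> m" "cen (W ! j') = 1" by blast
    hence "j' \<noteq> j" by auto
    thus False using out[of j' j] j by auto
  qed
  have sym: "cen (W ! (2 * N - j)) = - cen (W ! j)" if "lpunct Q Z \<or> rpunct Q Z" "j < length W" for j
  proof -
    have w: "winv W = W" using A.winv_W that AW by simp
    have "2 * N - j < length W" "length W - Suc (2 * N - j) = j" using that lW by auto
    hence "W ! (2 * N - j) = linv (W ! j)" using nth_winv[of "2 * N - j" W] w by simp
    thus ?thesis by (simp add: cen_linv)
  qed
  have "\<not> (cen (Z ! a) = 1 \<and> cen (Z ! b) = -1)" if ab: "0 < a" "a < b" "b < length Z - 1" for a b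
  proof
    assume h: "cen (Z ! a) = 1 \<and> cen (Z ! b) = -1"
    have b: "a < N" "b < N" "0 < b" using ab by (auto simp: N_def)
    show False
    proof (cases "\<forall>j\<le>a + oZ. cen (W ! j) \<noteq> 1")
      case True
      thus False using left[OF ab(1) b(1)] h by simp
    next
      case False
      then obtain j where j: "j \<le> a + oZ" "cen (W ! j) = 1" by blast
      have "cen (Z ! b) = 1"
      proof (rule right[OF b(3,2)])
        fix j' assume "j' < length W" "b + oZ \<le> j'"
        thus "cen (W ! j') \<noteq> -1" using out[of j j'] j ab by auto
      qed
      thus False using h by simp
    qed
  qed
  moreover have "cen (Z ! k) = 1" if l: "lpunct Q Z" and k: "0 < k" "k < length Z - 1" for k
  proof -
    have o: "oZ = N" "length W = 2 * N + 1" using oZ lW l by auto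
    have kN: "k < N" using k by (simp add: N_def)
    show ?thesis
    proof (rule right[OF k(1) kN])
      fix j assume j: "j < length W" "k + oZ \<le> j"
      show "cen (W ! j) \<noteq> -1"
      proof
        assume "cen (W ! j) = -1"
        hence "cen (W ! (2 * N - j)) = 1" using sym[of j] j l by simp
        moreover have "2 * N - j < j" using j o k by linarith
        ultimately show False using out[of "2 * N - j" j] j \<open>cen (W ! j) = -1\<close> by simp
      qed
    qed
  qed
  moreover have "cen (Z ! k) = -1" if r: "rpunct Q Z" and k: "0 < k" "k < length Z - 1" for k
  proof -
    have o: "oZ = 0" "length W = 2 * N + 1" using oZ lW r Z(3) by auto
    have kN: "k < N" using k by (simp add: N_def)
    show ?thesis
    proof (rule left[OF k(1) kN])
      fix j assume j: "j \<le> k + oZ"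
      show "cen (W ! j) \<noteq> 1"
      proof
        assume c: "cen (W ! j) = 1"
        have jl: "j < length W" using j o kN by simp
        hence "cen (W ! (2 * N - j)) = -1" using sym[of j] c r by simp
        moreover have "j < 2 * N - j" "2 * N - j < length W" using j o kN by linarith+
        ultimately show False using out[of j "2 * N - j"] c by simp
      qed
    qed
  qed
  ultimately show ?thesis unfolding outward_def using st Z(3) by blast
qed

subsection \<open>Immediate successors\<close>

text \<open>At a right end, a cohook consists of an inverse letter and a minimal tail, and a hook of
  a direct letter and a maximal tail.\<close>

definition mint :: "('v, 'a) pquiver \<Rightarrow> ('v, 'a) word \<Rightarrow> bool" where
  "mint Q u \<longleftrightarrow> (\<forall>l\<in>set u. \<forall>l'\<in>letters Q. \<not> lless Q l' l)"

definition maxt :: "('v, 'a) pquiver \<Rightarrow> ('v, 'a) word \<Rightarrow> bool" where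
  "maxt Q u \<longleftrightarrow> (\<forall>l\<in>set u. \<forall>l'\<in>letters Q. \<not> lless Q l l')"

lemma wless_Cons: "wless Q (l # u) (l # v) \<longleftrightarrow> wless Q u v"
proof
  assume "wless Q (l # u) (l # v)"
  then obtain k where k: "k < length (l # u)" "k < length (l # v)" "take k (l # u) = take k (l # v)"
    "lless Q ((l # u) ! k) ((l # v) ! k)" unfolding wless_def by blast
  hence "k \<noteq> 0" by (cases k) (auto simp: lless_def)
  then obtain j where "k = Suc j" by (cases k) auto
  with k show "wless Q u v" unfolding wless_def by (intro exI[of _ j]) simp
next
  assume "wless Q u v"
  then obtain k where "k < length u" "k < length v" "take k u = take k v" "lless Q (u ! k) (v ! k)"
    unfolding wless_def by blast
  thus "wless Q (l # u) (l # v)" unfolding wless_def by (intro exI[of _ "Suc k"]) simp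
qed

lemma St_iff: "w \<in> St Q i r \<longleftrightarrow> (\<exists>u. w = TrI i r # u \<and> TrI i r \<in> letters Q \<and> tail Q (i, - r) u)"
proof
  assume "w \<in> St Q i r"
  hence w: "is_string Q w" "hd w = TrI i r" by (auto simp: St_def)
  obtain u where u: "w = TrI i r # u" using w by (cases w) (auto simp: is_string_def)
  have "u \<noteq> []" using w u by (auto simp: is_string_def)
  thus "\<exists>u. w = TrI i r # u \<and> TrI i r \<in> letters Q \<and> tail Q (i, - r) u"
    using w u by (auto simp: is_string_def is_word_Cons follows_def tail_def)
next
  assume "\<exists>u. w = TrI i r # u \<and> TrI i r \<in> letters Q \<and> tail Q (i, - r) u"
  thus "w \<in> St Q i r" by (auto simp: St_def is_string_def is_word_Cons follows_def tail_def)
qed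

lemma string_St: "is_string Q (TrI i r # u) \<longleftrightarrow> TrI i r \<in> letters Q \<and> tail Q (i, - r) u"
  using St_iff[of "TrI i r # u" Q i r] by (auto simp: St_def)

lemma wless_total:
  assumes "skewed_gentle Q" "tail Q p u" "tail Q p v" "u \<noteq> v"
  shows "wless Q u v \<or> wless Q v u"
proof -
  obtain m where m: "m < length u" "m < length v" "\<And>k. k < m ==> u ! k = v ! k" "lrank (u ! m) \<noteq> lrank (v ! m)"
    using tail_diff[OF assms] by metis
  show ?thesis using wless_tail[OF assms(2,3) m] wless_tail[OF assms(3,2) m(2,1)] m by force
qed

lemma wless_diff:
  assumes "skewed_gentle Q" "tail Q p u" "tail Q p v" "wless Q u v"
  obtains m where "m < length u" "m < length v" "\<And>k. k < m ==> u ! k = v ! k" "lless Q (u ! m) (v ! m)"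
proof -
  obtain k where k: "k < length u" "k < length v" "take k u = take k v" "lless Q (u ! k) (v ! k)"
    using assms(4) unfolding wless_def by blast
  have "u ! j = v ! j" if "j < k" for j using k(3) that by (metis nth_take)
  with k that show ?thesis by blast
qed

lemma lless_irrefl: "\<not> lless Q l l" and lless_asym: "lless Q l l' ==> \<not> lless Q l' l"
  by (auto simp: lless_def)

definition tsucc :: "('v, 'a) pquiver \<Rightarrow> 'v \<times> int \<Rightarrow> ('v, 'a) word \<Rightarrow> ('v, 'a) word \<Rightarrow> bool" where
  "tsucc Q p u v \<longleftrightarrow> tail Q p u \<and> tail Q p v \<and> wless Q u v \<and>
     \<not> (\<exists>x. tail Q p x \<and> wless Q u x \<and> wless Q x v)"

text \<open>Strings with the same first letter are compared through their tails. Totality of this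
  order makes the immediate successor unique, as the definite description in \<open>rsucc\<close>
  requires.\<close>

lemma rsucc_tsucc:
  assumes Q: "skewed_gentle Q" and l: "TrI i r \<in> letters Q" and uv: "tsucc Q (i, - r) u v"
  shows "rsucc Q (TrI i r # u) = Some (TrI i r # v)"
proof -
  have uv': "tail Q (i, - r) u" "tail Q (i, - r) v" "wless Q u v"
    "\<And>x. tail Q (i, - r) x ==> wless Q u x ==> \<not> wless Q x v" using uv by (auto simp: tsucc_def)
  have St: "TrI i r # x \<in> St Q i' r' \<longleftrightarrow> i' = i \<and> r' = r \<and> tail Q (i, - r) x" for x i' r'
    using l by (auto simp: St_iff)
  have "\<not> is_max Q (TrI i r # u)"
  proof
    assume "is_max Q (TrI i r # u)"
    hence "\<forall>v\<in>St Q i r. \<not> wless Q (TrI i r # u) v" unfolding is_max_def St by blast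
    moreover have "TrI i r # v \<in> St Q i r" using St uv' by simp
    ultimately have "\<not> wless Q (TrI i r # u) (TrI i r # v)" by blast
    thus False using uv'(3) by (simp add: wless_Cons)
  qed
  moreover have "(THE w'. is_succ Q (TrI i r # u) w') = TrI i r # v"
  proof (rule the_equality)
    show "is_succ Q (TrI i r # u) (TrI i r # v)"
      unfolding is_succ_def
    proof (intro exI conjI notI)
      assume "\<exists>x\<in>St Q i r. wless Q (TrI i r # u) x \<and> wless Q x (TrI i r # v)"
      then obtain x where x: "x \<in> St Q i r" "wless Q (TrI i r # u) x" "wless Q x (TrI i r # v)" by blast
      then obtain y where y: "x = TrI i r # y" "tail Q (i, - r) y" by (auto simp: St_iff)
      thus False using uv'(4)[OF y(2)] x by (simp add: wless_Cons)
    qed (use uv'(1-3) St in "simp_all add: wless_Cons")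
  next
    fix w' assume "is_succ Q (TrI i r # u) w'"
    then obtain i' r' where h: "TrI i r # u \<in> St Q i' r'" "w' \<in> St Q i' r'" "wless Q (TrI i r # u) w'"
      "\<not> (\<exists>v\<in>St Q i' r'. wless Q (TrI i r # u) v \<and> wless Q v w')" unfolding is_succ_def by blast
    hence "i' = i" "r' = r" using St by blast+
    then obtain x where x: "w' = TrI i r # x" "tail Q (i, - r) x" using h(2) by (auto simp: St_iff)
    have "wless Q u x" using h(3) x by (simp add: wless_Cons)
    moreover have "\<not> wless Q v x"
    proof
      assume "wless Q v x"
      hence "wless Q (TrI i r # u) (TrI i r # v) \<and> wless Q (TrI i r # v) w'"
        using uv'(3) x(1) by (simp add: wless_Cons)
      moreover have "TrI i r # v \<in> St Q i' r'" using St \<open>i' = i\<close> \<open>r' = r\<close> uv'(2) by blast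
      ultimately show False using h(4) by blast
    qed
    ultimately have "x = v" using wless_total[OF Q x(2) uv'(2)] uv'(4) x(2) by blast
    thus "w' = TrI i r # v" using x by simp
  qed
  ultimately show ?thesis by (simp add: rsucc_def)
qed

lemma maxt_not_less:
  assumes "skewed_gentle Q" "tail Q p u" "tail Q p v" "maxt Q u"
  shows "\<not> wless Q u v"
proof
  assume "wless Q u v"
  then obtain m where m: "m < length u" "m < length v" "lless Q (u ! m) (v ! m)"
    using wless_diff[OF assms(1-3)] by metis
  moreover have "v ! m \<in> letters Q" using word_letters m assms(3) by (auto simp: tail_def)
  ultimately show False using assms(4) unfolding maxt_def by (meson nth_mem)
qed

lemma maxt_unique:
  assumes "skewed_gentle Q" "tail Q p u" "tail Q p v" "maxt Q u" "maxt Q v"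
  shows "u = v"
  using wless_total[OF assms(1-3)] maxt_not_less assms by metis

lemma is_max_maxt:
  assumes Q: "skewed_gentle Q" and l: "TrI i r \<in> letters Q" and u: "tail Q (i, - r) u" "maxt Q u"
  shows "is_max Q (TrI i r # u)"
  unfolding is_max_def
proof (intro exI conjI ballI)
  show "TrI i r # u \<in> St Q i r" using l u by (simp add: St_iff)
  fix v assume "v \<in> St Q i r"
  then obtain x where "v = TrI i r # x" "tail Q (i, - r) x" by (auto simp: St_iff)
  thus "\<not> wless Q (TrI i r # u) v" using maxt_not_less[OF Q u(1) _ u(2)] by (simp add: wless_Cons)
qed

lemma rsucc_max:
  assumes "skewed_gentle Q" "TrI i r \<in> letters Q" "tail Q (i, - r) u" "maxt Q u"
  shows "rsucc Q (TrI i r # u) = None"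
  using is_max_maxt[OF assms] by (simp add: rsucc_def)

lemma tail_append:
  "v \<noteq> [] ==> tail Q p (u @ v) \<longleftrightarrow> is_word Q u \<and> is_word Q v \<and> (u \<noteq> [] --> follows Q (last u) (hd v)) \<and>
     lta Q (if u = [] then hd v else hd u) = Some p \<and> (\<exists>i r. last v = Tr i r)"
  by (auto simp: tail_def is_word_append)

lemma tail_replace:
  assumes uv: "tail Q p (u @ l # v)" and l: "lta Q l' = lta Q l" "tail Q p' (l' # v')"
  shows "tail Q p (u @ l' # v')"
proof -
  have "follows Q x l' \<longleftrightarrow> follows Q x l" for x using l(1) by (simp add: follows_def)
  moreover have "is_word Q (l' # v')" "\<exists>i r. last (l' # v') = Tr i r" using l(2) by (auto simp: tail_def)
  ultimately show ?thesis using uv l(1) by (auto simp: tail_append)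
qed

lemma tail_nth_letters: "tail Q p u ==> k < length u ==> u ! k \<in> letters Q"
  using word_letters by (auto simp: tail_def)

text \<open>A word strictly in between cannot differ from the bounds inside their common part
  \<open>u\<close>, since it would then lie on the same side of both. So it exceeds the trivial
  letter, which forces the inverse of \<open>\<alpha>\<close>, and afterwards it would have to fall
  below the minimal tail \<open>g\<close>.\<close>

lemma tsucc_cohook:
  assumes Q: "skewed_gentle Q" and w: "tail Q p (u @ [Tr i r])" and a: "\<alpha> \<in> ordarr Q" "pso Q \<alpha> = (i, r)"
    and g: "tail Q (opp (pta Q \<alpha>)) g" "mint Q g"
  shows "tsucc Q p (u @ [Tr i r]) (u @ Inv \<alpha> # g)"
proof -
  let ?w = "u @ [Tr i r]" and ?w' = "u @ Inv \<alpha> # g"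
  have "tail Q (i, r) (Inv \<alpha> # g)" using a g by (simp add: tail_Cons) (simp add: tail_def)
  hence w': "tail Q p ?w'" using tail_replace[OF w, of "Inv \<alpha>"] a by simp
  have less: "wless Q ?w ?w'" unfolding wless_def
    by (intro exI[of _ "length u"]) (use a in "simp add: lless_def")
  have "\<not> (tail Q p x \<and> wless Q ?w x \<and> wless Q x ?w')" for x
  proof
    assume x: "tail Q p x \<and> wless Q ?w x \<and> wless Q x ?w'"
    then obtain m where m: "m < length ?w" "m < length x" "\<And>k. k < m ==> ?w ! k = x ! k" "lless Q (?w ! m) (x ! m)"
      using wless_diff[OF Q w] by metis
    obtain m' where m': "m' < length x" "m' < length ?w'" "\<And>k. k < m' ==> x ! k = ?w' ! k" "lless Q (x ! m') (?w' ! m')"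
      using wless_diff[OF Q _ w'] x by metis
    have eq: "?w ! k = ?w' ! k" if "k < length u" for k using that by (simp add: nth_append)
    have "m = length u"
    proof (rule ccontr)
      assume "m \<noteq> length u"
      hence mu: "m < length u" using m(1) by simp
      hence "\<not> m < m'" using m'(3)[of m] eq[OF mu] m(4) lless_irrefl by metis
      moreover have "\<not> m' < m"
      proof
        assume a: "m' < m"
        hence "?w ! m' = x ! m'" "?w ! m' = ?w' ! m'" using m(3) eq mu by (blast, simp)
        thus False using m'(4) lless_irrefl by metis
      qed
      ultimately have "m = m'" by simp
      thus False using m(4) m'(4) eq[OF mu] lless_asym by metis
    qed
    hence xr: "lta Q (x ! m) = Some (i, r)" "lrank (x ! m) = 2"
      using m(4) lrank_le[of "x ! m"] by (auto simp: lless_def)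
    have "x ! m \<in> letters Q" using x m(2) tail_nth_letters by blast
    hence xm: "x ! m = Inv \<alpha>" using letter_det[OF Q _ _ xr(1), of "Inv \<alpha>"] a xr(2) by simp
    have "\<not> m' < length u" using m(3)[of m'] \<open>m = length u\<close> eq[of m'] m'(4) lless_irrefl by metis
    moreover have "m' \<noteq> length u"
    proof
      assume "m' = length u"
      hence "x ! m' = ?w' ! m'" using xm \<open>m = length u\<close> by simp
      thus False using m'(4) lless_irrefl by metis
    qed
    ultimately obtain j where j: "m' = length u + Suc j" using less_imp_Suc_add[of "length u" m'] by auto
    hence "?w' ! m' = g ! j" "j < length g" using m'(2) by (simp_all add: nth_append)
    moreover have "x ! m' \<in> letters Q" using x m'(1) tail_nth_letters by blast
    ultimately show False using m'(4) g(2) unfolding mint_def by (metis nth_mem)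
  qed
  thus ?thesis unfolding tsucc_def using w w' less by blast
qed

lemma ord_trivial_letter:
  assumes "skewed_gentle Q" "\<beta> \<in> ordarr Q"
  shows "pta Q \<beta> = (i, r) ==> Tr i r \<in> letters Q \<and> TrI i r \<in> letters Q"
    "pso Q \<beta> = (i, r) ==> Tr i r \<in> letters Q \<and> TrI i r \<in> letters Q"
  using special_point_ordarr[OF assms(1) _ assms(2), of i] pta_range[OF assms(1), of \<beta>] pso_range[OF assms(1), of \<beta>]
    ordarr_arrs[OF assms(2)] by auto

text \<open>The same argument from above: a word in between falls below the trivial letter, which
  forces \<open>\<beta>\<close>, and afterwards it would have to exceed the maximal tail
  \<open>g\<close>.\<close>

lemma tsucc_hook:
  assumes Q: "skewed_gentle Q" and w: "tail Q p (u @ Dir \<beta> # g)" and b: "pta Q \<beta> = (i, r)" and g: "maxt Q g"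
  shows "tsucc Q p (u @ Dir \<beta> # g) (u @ [Tr i r])"
proof -
  let ?w = "u @ Dir \<beta> # g" and ?w' = "u @ [Tr i r]"
  have beta: "\<beta> \<in> ordarr Q" using w by (auto simp: tail_append is_word_Cons)
  have "tail Q (i, r) [Tr i r]" using ord_trivial_letter(1)[OF Q beta b] by (simp add: tail_Cons)
  hence w': "tail Q p ?w'" using tail_replace[OF w, of "Tr i r"] b by simp
  have less: "wless Q ?w ?w'" unfolding wless_def
    using b by (intro exI[of _ "length u"]) (simp add: lless_def)
  have "\<not> (tail Q p x \<and> wless Q ?w x \<and> wless Q x ?w')" for x
  proof
    assume x: "tail Q p x \<and> wless Q ?w x \<and> wless Q x ?w'"
    then obtain m where m: "m < length ?w" "m < length x" "\<And>k. k < m ==> ?w ! k = x ! k" "lless Q (?w ! m) (x ! m)"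
      using wless_diff[OF Q w] by metis
    obtain m' where m': "m' < length x" "m' < length ?w'" "\<And>k. k < m' ==> x ! k = ?w' ! k" "lless Q (x ! m') (?w' ! m')"
      using wless_diff[OF Q _ w'] x by metis
    have eq: "?w ! k = ?w' ! k" if "k < length u" for k using that by (simp add: nth_append)
    have "m' = length u"
    proof (rule ccontr)
      assume "m' \<noteq> length u"
      hence mu: "m' < length u" using m'(2) by simp
      hence "\<not> m' < m" using m(3)[of m'] eq[OF mu] m'(4) lless_irrefl by metis
      moreover have "\<not> m < m'"
      proof
        assume a: "m < m'"
        hence "x ! m = ?w' ! m" "?w ! m = ?w' ! m" using m'(3) eq mu by (blast, simp)
        thus False using m(4) lless_irrefl by metis
      qed
      ultimately have "m = m'" by simp
      thus False using m(4) m'(4) eq[OF mu] lless_asym by metis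
    qed
    hence xr: "lta Q (x ! m') = Some (i, r)" "lrank (x ! m') = 0"
      using m'(4) by (auto simp: lless_def)
    have "x ! m' \<in> letters Q" using x m'(1) tail_nth_letters by blast
    hence xm: "x ! m' = Dir \<beta>" using letter_det[OF Q _ _ xr(1), of "Dir \<beta>"] beta b xr(2) by simp
    have "\<not> m < length u" using m'(3)[of m] \<open>m' = length u\<close> eq[of m] m(4) lless_irrefl by metis
    moreover have "m \<noteq> length u"
    proof
      assume "m = length u"
      hence "x ! m = ?w ! m" using xm \<open>m' = length u\<close> by simp
      thus False using m(4) lless_irrefl by metis
    qed
    ultimately obtain j where j: "m = length u + Suc j" using less_imp_Suc_add[of "length u" m] by auto
    hence "?w ! m = g ! j" "j < length g" using m(1) by (simp_all add: nth_append)
    moreover have "x ! m \<in> letters Q" using x m(2) tail_nth_letters by blast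
    ultimately show False using m(4) g unfolding maxt_def by (metis nth_mem)
  qed
  thus ?thesis unfolding tsucc_def using w w' less by blast
qed

subsection \<open>Extremal tails\<close>

text \<open>\<open>d = True\<close> stands for minimal and \<open>d = False\<close> for maximal
  letters, so that both kinds of extremal tails are constructed by one argument.\<close>

definition ext :: "('v, 'a) pquiver \<Rightarrow> bool \<Rightarrow> ('v, 'a) letter \<Rightarrow> bool" where
  "ext Q d l \<longleftrightarrow> (\<forall>l'\<in>letters Q. \<not> (if d then lless Q l' l else lless Q l l'))"

text \<open>A special letter is represented by its loop. In this way a run of minimal letters
  becomes an admissible path, and a run of maximal letters becomes one when it is traversed
  backwards.\<close>

fun larr :: "('v, 'a) pquiver \<Rightarrow> ('v, 'a) letter \<Rightarrow> 'a" where
  "larr Q (Dir a) = a"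
| "larr Q (Inv a) = a"
| "larr Q (Spl i) = sploop Q i"
| "larr Q _ = undefined"

lemma ext_letter:
  assumes Q: "skewed_gentle Q" and l: "l \<in> letters Q" "lta Q l = Some p" "ext Q d l"
  shows "(\<exists>i r. l = Tr i r \<and> p = (i, r)) \<or> (\<exists>i. l = Spl i) \<or> (\<exists>a. l = (if d then Dir a else Inv a))"
proof (cases l)
  case (Dir a)
  show ?thesis
  proof (cases d)
    case False
    obtain i r where p: "p = (i, r)" by (cases p)
    hence "Tr i r \<in> letters Q" using ord_trivial_letter(1)[OF Q, of a i r] l Dir by simp
    moreover have "lless Q l (Tr i r)" using l Dir p by (simp add: lless_def)
    ultimately show ?thesis using l(3) False by (auto simp: ext_def)
  qed (use Dir in auto)
next
  case (Inv a)
  show ?thesis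
  proof (cases d)
    case True
    obtain i r where p: "p = (i, r)" by (cases p)
    hence "Tr i r \<in> letters Q" using ord_trivial_letter(2)[OF Q, of a i r] l Inv by simp
    moreover have "lless Q (Tr i r) l" using l Inv p by (simp add: lless_def)
    ultimately show ?thesis using l(3) True by (auto simp: ext_def)
  qed (use Inv in auto)
qed (use l in auto)

lemma ext_letter_ex:
  assumes Q: "skewed_gentle Q" and p: "fst p \<in> verts Q" "snd p \<in> {-1, 1}"
  shows "\<exists>l\<in>letters Q. lta Q l = Some p \<and> ext Q d l"
proof -
  obtain i r where ir: "p = (i, r)" by (cases p)
  let ?L = "{l \<in> letters Q. lta Q l = Some p}"
  have ne: "?L \<noteq> {}"
  proof (cases "i \<in> spverts Q \<and> r = -1")
    case True
    hence "Spl i \<in> ?L" using ir by simp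
    thus ?thesis by blast
  next
    case False
    hence "Tr i r \<in> ?L" using ir p by auto
    thus ?thesis by blast
  qed
  let ?m = "\<lambda>l. if d then lrank l else 2 - lrank l"
  obtain l where l: "l \<in> ?L" "\<And>l'. l' \<in> ?L ==> ?m l \<le> ?m l'"
    using ne ex_has_least_nat[of "\<lambda>l. l \<in> ?L" _ ?m] by (metis (lifting) ex_in_conv)
  have "ext Q d l" unfolding ext_def
  proof
    fix l' assume l': "l' \<in> letters Q"
    show "\<not> (if d then lless Q l' l else lless Q l l')"
    proof
      assume a: "if d then lless Q l' l else lless Q l l'"
      hence "l' \<in> ?L" using l' l(1) by (auto simp: lless_def split: if_splits)
      from l(2)[OF this] a lrank_le[of l'] lrank_le[of l] show False by (auto simp: lless_def split: if_splits)
    qed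
  qed
  with l show ?thesis by blast
qed

lemma ext_letter_arrow:
  assumes Q: "skewed_gentle Q" and l: "l \<in> letters Q" "lta Q l = Some p" "ext Q d l" "lso Q l = Some p'"
  shows "larr Q l \<in> arrs Q \<and> (if d then pso Q (larr Q l) = p' \<and> pta Q (larr Q l) = p
     else pta Q (larr Q l) = p' \<and> pso Q (larr Q l) = p)"
  using ext_letter[OF Q l(1-3)]
proof (elim disjE exE conjE)
  fix i assume "l = Spl i"
  thus ?thesis using l sploop[OF Q, of i] sparr_arrs by auto
next
  fix a assume "l = (if d then Dir a else Inv a)"
  thus ?thesis using l ordarr_arrs by (cases d) auto
qed (use l in simp)

text \<open>There is an extremal letter at every polarized vertex. Choosing one after the other
  either reaches a trivial letter or can be continued to any length.\<close>

lemma ext_tail_or_path: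
  assumes Q: "skewed_gentle Q" and p: "fst p \<in> verts Q" "snd p \<in> {-1, 1}"
  shows "(\<exists>g. tail Q p g \<and> (\<forall>l\<in>set g. ext Q d l)) \<or>
    (\<exists>ls. length ls = Suc n \<and> is_word Q ls \<and> lta Q (hd ls) = Some p \<and> lso Q (last ls) \<noteq> None \<and> (\<forall>l\<in>set ls. ext Q d l))"
proof (induction n)
  case 0
  obtain l where l: "l \<in> letters Q" "lta Q l = Some p" "ext Q d l" using ext_letter_ex[OF Q p] by blast
  show ?case
  proof (cases "\<exists>i r. l = Tr i r")
    case True
    thus ?thesis using l by (intro disjI1 exI[of _ "[l]"]) (auto simp: tail_Cons)
  next
    case False
    hence "lso Q l \<noteq> None" by (cases l) auto
    thus ?thesis using l by (intro disjI2 exI[of _ "[l]"]) (auto simp: is_word_Cons)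
  qed
next
  case (Suc n)
  show ?case
  proof (cases "\<exists>g. tail Q p g \<and> (\<forall>l\<in>set g. ext Q d l)")
    case False
    then obtain ls where ls: "length ls = Suc n" "is_word Q ls" "lta Q (hd ls) = Some p" "lso Q (last ls) \<noteq> None"
      "\<forall>l\<in>set ls. ext Q d l" using Suc by blast
    have ne: "ls \<noteq> []" using ls(1) by auto
    obtain p' where p': "lso Q (last ls) = Some p'" using ls(4) by blast
    have last: "last ls \<in> letters Q" using ne ls(2) by (auto simp: is_word_iff)
    have "fst p' \<in> verts Q \<and> snd p' \<in> {-1, 1}"
      using p' last pso_range[OF Q] pta_range[OF Q] ordarr_arrs[of _ Q] spverts_verts[OF Q]
      by (cases "last ls") auto
    hence v: "fst (opp p') \<in> verts Q" "snd (opp p') \<in> {-1, 1}" by (auto simp: opp_def)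
    obtain l where l: "l \<in> letters Q" "lta Q l = Some (opp p')" "ext Q d l" using ext_letter_ex[OF Q v] by blast
    have w: "is_word Q (ls @ [l])" using ls(2) l p' by (auto simp: is_word_append is_word_Cons follows_def)
    show ?thesis
    proof (cases "\<exists>i r. l = Tr i r")
      case True
      hence "tail Q p (ls @ [l])" using w ls ne by (auto simp: tail_def)
      thus ?thesis using ls(5) l(3) by (intro disjI1 exI[of _ "ls @ [l]"]) auto
    next
      case f: False
      hence "lso Q l \<noteq> None" using l(2) by (cases l) auto
      thus ?thesis using w ls l ne by (intro disjI2 exI[of _ "ls @ [l]"]) auto
    qed
  qed blast
qed

lemma ext_path_adm:
  assumes Q: "skewed_gentle Q" and ls: "is_word Q ls" "lta Q (hd ls) \<noteq> None" "lso Q (last ls) \<noteq> None"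
    "\<forall>l\<in>set ls. ext Q d l"
  shows "adm_path Q (if d then map (larr Q) ls else rev (map (larr Q) ls))"
proof -
  have nth: "\<exists>p p'. lta Q (ls ! k) = Some p \<and> lso Q (ls ! k) = Some p' \<and> ls ! k \<in> letters Q \<and> ext Q d (ls ! k)"
    if k: "k < length ls" for k
  proof -
    have "lta Q (ls ! k) \<noteq> None" using ls(2) k word_nth[OF ls(1), of "k - 1"]
      by (cases k) (auto simp: hd_conv_nth follows_def)
    moreover have "lso Q (ls ! k) \<noteq> None"
    proof (cases "Suc k < length ls")
      case True
      thus ?thesis using word_nth[OF ls(1) True] by (auto simp: follows_def)
    next
      case False
      hence "k = length ls - 1" "ls \<noteq> []" using k by auto
      thus ?thesis using ls(3) by (metis last_conv_nth)
    qed
    ultimately show ?thesis using word_letters[OF ls(1) k] ls(4) k nth_mem by (metis option.exhaust)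
  qed
  note ar = ext_letter_arrow[OF Q]
  have arrs: "set (map (larr Q) ls) \<subseteq> arrs Q"
  proof
    fix a assume "a \<in> set (map (larr Q) ls)"
    then obtain k where "k < length ls" "a = larr Q (ls ! k)" by (metis in_set_conv_nth length_map nth_map)
    thus "a \<in> arrs Q" using nth[of k] ar by metis
  qed
  have st: "if d then pso Q (larr Q (ls ! k)) = opp (pta Q (larr Q (ls ! Suc k)))
      else pso Q (larr Q (ls ! Suc k)) = opp (pta Q (larr Q (ls ! k)))" if k: "Suc k < length ls" for k
  proof -
    obtain p p' where 1: "lta Q (ls ! k) = Some p" "lso Q (ls ! k) = Some p'" "ls ! k \<in> letters Q" "ext Q d (ls ! k)"
      using nth[of k] k by auto
    obtain s s' where 2: "lta Q (ls ! Suc k) = Some s" "lso Q (ls ! Suc k) = Some s'" "ls ! Suc k \<in> letters Q" "ext Q d (ls ! Suc k)"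
      using nth[OF k] by auto
    have "s = opp p'" using word_nth[OF ls(1) k] 1 2 by (auto simp: follows_def)
    thus ?thesis using ar[OF 1(3,1,4,2)] ar[OF 2(3,1,4,2)] by (cases d) auto
  qed
  show ?thesis
  proof (cases d)
    case True
    thus ?thesis unfolding adm_path_def using arrs st by auto
  next
    case False
    have "pso Q (rev (map (larr Q) ls) ! k) = opp (pta Q (rev (map (larr Q) ls) ! Suc k))"
      if k: "Suc k < length (rev (map (larr Q) ls))" for k
    proof -
      define j where "j = length ls - Suc (Suc k)"
      have "Suc j < length ls" "length ls - Suc k = Suc j" "length ls - Suc (Suc k) = j"
        using k unfolding j_def by auto
      thus ?thesis using st[of j] False k by (simp add: rev_nth)
    qed
    thus ?thesis unfolding adm_path_def using arrs False by auto
  qed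
qed

text \<open>Here the finiteness of the set of admissible paths is used: a run of extremal letters
  that never meets a trivial one would give paths of unbounded length.\<close>

lemma ext_tail_ex:
  assumes Q: "skewed_gentle Q" and p: "fst p \<in> verts Q" "snd p \<in> {-1, 1}"
  shows "\<exists>g. tail Q p g \<and> (\<forall>l\<in>set g. ext Q d l)"
proof (rule ccontr)
  assume no: "\<not> ?thesis"
  have fin: "finite {p. adm_path Q p}" using Q by (simp add: skewed_gentle_def)
  define n where "n = Max (length ` {p. adm_path Q p})"
  obtain ls where ls: "length ls = Suc n" "is_word Q ls" "lta Q (hd ls) = Some p" "lso Q (last ls) \<noteq> None"
    "\<forall>l\<in>set ls. ext Q d l" using ext_tail_or_path[OF Q p, of d n] no by blast
  have "adm_path Q (if d then map (larr Q) ls else rev (map (larr Q) ls))"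
    by (rule ext_path_adm[OF Q ls(2) _ ls(4,5)]) (simp add: ls(3))
  hence "length (if d then map (larr Q) ls else rev (map (larr Q) ls)) \<le> n"
    unfolding n_def using fin by (intro Max_ge) auto
  thus False using ls(1) by (auto split: if_splits)
qed

lemma mint_ext: "mint Q u \<longleftrightarrow> (\<forall>l\<in>set u. ext Q True l)" and maxt_ext: "maxt Q u \<longleftrightarrow> (\<forall>l\<in>set u. ext Q False l)"
  by (auto simp: mint_def maxt_def ext_def)

lemma mint_cen:
  assumes Q: "skewed_gentle Q" and g: "tail Q p g" "mint Q g" and l: "l \<in> set g"
  shows "cen l \<noteq> 1"
proof -
  obtain k where k: "k < length g" "l = g ! k" using l by (metis in_set_conv_nth)
  have "l \<in> letters Q" using tail_nth_letters[OF g(1) k(1)] k by simp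
  moreover obtain p' where "lta Q l = Some p'" using tail_lta[OF g(1) g(1) _ k(1) k(1)] k by auto
  ultimately show ?thesis using ext_letter[OF Q, of l p' True] g(2) l by (auto simp: mint_ext cen_def)
qed

lemma maxt_cen:
  assumes Q: "skewed_gentle Q" and g: "tail Q p g" "maxt Q g" and l: "l \<in> set g"
  shows "cen l \<noteq> -1"
proof -
  obtain k where k: "k < length g" "l = g ! k" using l by (metis in_set_conv_nth)
  have "l \<in> letters Q" using tail_nth_letters[OF g(1) k(1)] k by simp
  moreover obtain p' where "lta Q l = Some p'" using tail_lta[OF g(1) g(1) _ k(1) k(1)] k by auto
  ultimately show ?thesis using ext_letter[OF Q, of l p' False] g(2) l by (auto simp: maxt_ext cen_def)
qed

lemma wmax_eq:
  assumes Q: "skewed_gentle Q" and l: "TrI i r \<in> letters Q" and u: "tail Q (i, - r) u" "maxt Q u"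
  shows "wmax Q i r = u"
  unfolding wmax_def
proof (rule the_equality)
  show "TrI i r # u \<in> St Q i r \<and> is_max Q (TrI i r # u)"
    using is_max_maxt[OF Q l u] l u by (auto simp: St_iff)
  fix v assume v: "TrI i r # v \<in> St Q i r \<and> is_max Q (TrI i r # v)"
  hence tv: "tail Q (i, - r) v" by (auto simp: St_iff)
  obtain i' r' where m: "TrI i r # v \<in> St Q i' r'" "\<forall>x\<in>St Q i' r'. \<not> wless Q (TrI i r # v) x"
    using v unfolding is_max_def by blast
  hence "i' = i" "r' = r" by (auto simp: St_iff)
  moreover have "TrI i r # u \<in> St Q i r" using u l by (simp add: St_iff)
  ultimately have "\<not> wless Q (TrI i r # v) (TrI i r # u)" using m(2) by blast
  hence "\<not> wless Q v u" by (simp add: wless_Cons)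
  thus "v = u" using wless_total[OF Q tv u(1)] maxt_not_less[OF Q u(1) tv u(2)] by blast
qed

subsection \<open>Fringed quivers\<close>

lemma dead_tail:
  assumes d: "dead Q f r" and g: "tail Q (f, r) g"
  shows "g = [Tr f r]"
proof (cases g)
  case (Cons l u)
  hence "l = Tr f r" using g d by (auto simp: tail_Cons dead_def)
  thus ?thesis using g Cons by (auto simp: tail_Cons split: if_splits)
qed (use g in "simp add: tail_def")

lemma tail_suffix:
  assumes "tail Q p (A @ l # B)" "B \<noteq> []"
  shows "\<exists>p'. tail Q p' B"
proof -
  have "is_word Q (l # B)" "last (l # B) = last (A @ l # B)" using assms by (auto simp: tail_def is_word_append)
  thus ?thesis using assms unfolding tail_def is_word_Cons follows_def by auto
qed

locale fringed =
  fixes Q Qf :: "('v, 'a) pquiver"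
  assumes fr: "fringing Q Qf"
begin

lemma Q: "skewed_gentle Q" and Qf: "skewed_gentle Qf"
  using fr by (auto simp: fringing_def)

lemma verts_sub: "verts Q \<subseteq> verts Qf" and ord_sub: "ordarr Q \<subseteq> ordarr Qf" and sp_sub: "sparr Q \<subseteq> sparr Qf"
  using fr by (auto simp: fringing_def)

lemma arrs_sub: "arrs Q \<subseteq> arrs Qf"
  using ord_sub sp_sub by (auto simp: arrs_def)

lemma pso_eq: "a \<in> arrs Q ==> pso Qf a = pso Q a" and pta_eq: "a \<in> arrs Q ==> pta Qf a = pta Q a"
  using fr by (auto simp: fringing_def)

lemma fringe_arrow:
  assumes "a \<in> arrs Qf" "a \<notin> arrs Q"
  shows "(\<exists>f\<in>verts Qf - verts Q. fst (pso Qf a) \<in> verts Q \<and> pta Qf a = (f, 1)) \<or>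
    (\<exists>f\<in>verts Qf - verts Q. pso Qf a = (f, 1) \<and> fst (pta Qf a) \<in> verts Q)"
proof -
  have "src Qf a \<in> verts Q \<and> pta Qf a \<in> (verts Qf - verts Q) \<times> {1} \<or>
    pso Qf a \<in> (verts Qf - verts Q) \<times> {1} \<and> tgt Qf a \<in> verts Q" using fr assms unfolding fringing_def by blast
  thus ?thesis unfolding src_def tgt_def by (metis SigmaE singletonD)
qed

lemma arrs_Q_verts: "a \<in> arrs Q ==> fst (pso Qf a) \<in> verts Q \<and> fst (pta Qf a) \<in> verts Q"
  using pso_eq pta_eq pso_range[OF Q] pta_range[OF Q] by metis

text \<open>A fringe arrow has exactly one end in \<open>verts Q\<close>, so it cannot be a special
  loop.\<close>

lemma sparr_eq: "sparr Qf = sparr Q"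
proof
  show "sparr Qf \<subseteq> sparr Q"
  proof
    fix e assume e: "e \<in> sparr Qf"
    have p: "pso Qf e = pta Qf e" using pso_special[OF Qf e] by simp
    have "e \<in> arrs Q"
    proof (rule ccontr)
      assume "e \<notin> arrs Q"
      thus False using fringe_arrow[of e] sparr_arrs[OF e] p by force
    qed
    moreover have "e \<notin> ordarr Q" using ordarr_not_sparr[OF Qf] ord_sub e by blast
    ultimately show "e \<in> sparr Q" by (simp add: arrs_def)
  qed
qed (rule sp_sub)

lemma src_sparr: "e \<in> sparr Q ==> src Qf e = src Q e"
  by (simp add: src_def pso_eq[OF sparr_arrs])

lemma spverts_eq: "spverts Qf = spverts Q"
  unfolding spverts_def sparr_eq by (rule image_cong[OF refl src_sparr])

lemma sploop_eq: "sploop Qf i = sploop Q i"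
proof -
  have "(e \<in> sparr Qf \<and> src Qf e = i) \<longleftrightarrow> (e \<in> sparr Q \<and> src Q e = i)" for e
    unfolding sparr_eq using src_sparr by auto
  thus ?thesis unfolding sploop_def by simp
qed

lemma ordarr_Q: "a \<in> ordarr Qf ==> a \<in> arrs Q ==> a \<in> ordarr Q"
  using ordarr_not_sparr[OF Qf] sp_sub by (auto simp: arrs_def)

lemma letters_sub: "l \<in> letters Q ==> l \<in> letters Qf"
  using ord_sub verts_sub spverts_eq by (cases l) auto

lemma lso_eq: "l \<in> letters Q ==> lso Qf l = lso Q l" and lta_eq: "l \<in> letters Q ==> lta Qf l = lta Q l"
proof -
  have *: "pso Qf a = pso Q a \<and> pta Qf a = pta Q a" if "a \<in> ordarr Q" for a
    using pso_eq[OF ordarr_arrs[OF that]] pta_eq[OF ordarr_arrs[OF that]] by blast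
  show "lso Qf l = lso Q l" if "l \<in> letters Q" using that * by (cases l) simp_all
  show "lta Qf l = lta Q l" if "l \<in> letters Q" using that * by (cases l) simp_all
qed

lemma is_word_sub: "is_word Q w ==> is_word Qf w"
proof (induction w)
  case (Cons l w)
  have "w \<noteq> [] ==> hd w \<in> letters Q" using Cons.prems by (cases w) (auto simp: is_word_Cons)
  hence "w \<noteq> [] ==> follows Qf l (hd w)"
    using Cons.prems lso_eq lta_eq by (simp add: is_word_Cons follows_def)
  thus ?case using Cons letters_sub by (simp add: is_word_Cons)
qed simp

lemma is_string_sub: "is_string Q w ==> is_string Qf w"
  using is_word_sub by (auto simp: is_string_def)

text \<open>By injectivity of the polarized maps at most two arrows start and at most two arrows end
  at \<open>i\<close>; the total of four forces all possible polarities to occur.\<close>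

lemma degree:
  assumes i: "i \<in> verts Q" "r \<in> {-1, 1}"
  shows "\<exists>a\<in>arrs Qf. pso Qf a = (i, r)" (is ?S) "\<exists>a\<in>arrs Qf. pta Qf a = (i, r)" (is ?T)
proof -
  let ?A = "{a \<in> arrs Qf. src Qf a = i}" and ?B = "{a \<in> arrs Qf. tgt Qf a = i}"
  let ?P = "{(i, -1), (i, 1)} :: ('v \<times> int) set"
  have fin: "finite (arrs Qf)" using Qf by (auto simp: skewed_gentle_def arrs_def)
  have A: "pso Qf ` ?A \<subseteq> ?P"
  proof
    fix x assume "x \<in> pso Qf ` ?A"
    then obtain a where a: "a \<in> arrs Qf" "fst (pso Qf a) = i" "x = pso Qf a" by (auto simp: src_def)
    hence "snd x = -1 \<or> snd x = 1" "fst x = i" using pso_range[OF Qf a(1)] by auto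
    thus "x \<in> ?P" by (cases x) auto
  qed
  have B: "pta Qf ` ?B \<subseteq> ?P"
  proof
    fix x assume "x \<in> pta Qf ` ?B"
    then obtain a where a: "a \<in> arrs Qf" "fst (pta Qf a) = i" "x = pta Qf a" by (auto simp: tgt_def)
    hence "snd x = -1 \<or> snd x = 1" "fst x = i" using pta_range[OF Qf a(1)] by auto
    thus "x \<in> ?P" by (cases x) auto
  qed
  have cP: "card ?P = 2" by simp
  have cA: "card (pso Qf ` ?A) = card ?A" using pso_inj[OF Qf] by (intro card_image inj_onI) auto
  have cB: "card (pta Qf ` ?B) = card ?B" using pta_inj[OF Qf] by (intro card_image inj_onI) auto
  have "card ?A \<le> 2" "card ?B \<le> 2" using card_mono[OF _ A] card_mono[OF _ B] cA cB cP by auto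
  moreover have "card ?A + card ?B = 4" using fr i by (auto simp: fringing_def)
  ultimately have "card (pso Qf ` ?A) = card ?P" "card (pta Qf ` ?B) = card ?P" using cA cB cP by linarith+
  hence "pso Qf ` ?A = ?P" "pta Qf ` ?B = ?P" using card_subset_eq[OF _ A] card_subset_eq[OF _ B] by auto
  hence "(i, r) \<in> pso Qf ` ?A" "(i, r) \<in> pta Qf ` ?B" using i by auto
  thus ?S ?T by force+
qed

lemma degree_ord:
  assumes "Tr i r \<in> letters Qf" "i \<in> verts Q"
  shows "\<exists>a\<in>ordarr Qf. pso Qf a = (i, r)" (is ?S) "\<exists>a\<in>ordarr Qf. pta Qf a = (i, r)" (is ?T)
proof -
  have r: "r \<in> {-1, 1}" "\<not> (i \<in> spverts Qf \<and> r = -1)" using assms by auto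
  obtain a b where ab: "a \<in> arrs Qf" "pso Qf a = (i, r)" "b \<in> arrs Qf" "pta Qf b = (i, r)"
    using degree[OF assms(2) r(1)] by blast
  have "a \<notin> sparr Qf" "b \<notin> sparr Qf"
    using ab r(2) pso_special[OF Qf, of a] pso_special[OF Qf, of b] by (auto simp: spverts_def)
  thus ?S ?T using ab by (auto simp: arrs_def)
qed

text \<open>Fringe arrows meet the vertices outside \<open>Q\<close> with polarity \<open>1\<close>
  only, and arrows of \<open>Q\<close> do not meet them at all.\<close>

lemma dead_fringe:
  assumes "f \<in> verts Qf - verts Q"
  shows "dead Qf f (-1)"
  unfolding dead_def
proof (intro ballI impI)
  fix l assume l: "l \<in> letters Qf" "lta Qf l = Some (f, -1)"
  have no: "pso Qf a \<noteq> (f, -1) \<and> pta Qf a \<noteq> (f, -1)" if "a \<in> arrs Qf" for a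
  proof (cases "a \<in> arrs Q")
    case True
    thus ?thesis using arrs_Q_verts[OF True] assms by auto
  next
    case False
    thus ?thesis using fringe_arrow[OF that] assms by auto
  qed
  show "l = Tr f (-1)"
  proof (cases l)
    case (Spl i)
    hence "f \<in> spverts Q" using l spverts_eq by simp
    thus ?thesis using spverts_verts[OF Q] assms by blast
  next
    case (Dir a)
    thus ?thesis using l no[of a] ordarr_arrs[of a Qf] by simp
  next
    case (Inv a)
    thus ?thesis using l no[of a] ordarr_arrs[of a Qf] by simp
  qed (use l in auto)
qed

text \<open>At a polarized vertex of \<open>Q\<close> a direct or a special letter is always
  available over \<open>Qf\<close>, so a minimal tail cannot stop inside \<open>Q\<close>: it leaves
  along a fringe arrow and is then at a dead end. By injectivity, \<open>Q\<close> has no direct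
  letter at the place where the tail leaves, so a trivial letter there makes the rest minimal over
  \<open>Q\<close>.\<close>

lemma mint_tail_end:
  assumes "tail Qf p g" "mint Qf g" "fst p \<in> verts Q"
  shows "\<exists>b \<phi> f i r. g = b @ [Dir \<phi>, Tr f (-1)] \<and> \<phi> \<in> ordarr Qf - arrs Q \<and> f \<in> verts Qf - verts Q \<and>
    pta Qf \<phi> = (i, r) \<and> tail Q p (b @ [Tr i r]) \<and> mint Q (b @ [Tr i r])"
  using assms
proof (induction g arbitrary: p)
  case (Cons l g)
  have l: "l \<in> letters Qf" "lta Qf l = Some p" using Cons.prems(1) by (simp_all add: tail_Cons)
  have "ext Qf True l" using Cons.prems(2) by (simp add: mint_ext)
  have mg: "mint Qf g" using Cons.prems(2) by (simp add: mint_def)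
  from ext_letter[OF Qf l \<open>ext Qf True l\<close>]
  consider (Tr) i r where "l = Tr i r" "p = (i, r)" | (Spl) i where "l = Spl i" | (Dir) a where "l = Dir a" by auto
  thus ?case
  proof cases
    case Tr
    then obtain b where "b \<in> ordarr Qf" "pta Qf b = (i, r)" using degree_ord(2)[of i r] l Cons.prems(3) by auto
    hence "Dir b \<in> letters Qf" "lless Qf (Dir b) l" using Tr by (auto simp: lless_def)
    thus ?thesis using \<open>ext Qf True l\<close> unfolding ext_def by auto
  next
    case Spl
    hence i: "i \<in> spverts Q" "p = (i, -1)" using l spverts_eq by auto
    hence iv: "i \<in> verts Q" using spverts_verts[OF Q] by blast
    have tg: "tail Qf (i, 1) g" using Cons.prems(1) Spl by (auto simp: tail_Cons split: if_splits)
    obtain b \<phi> f j r where b: "g = b @ [Dir \<phi>, Tr f (-1)]" "\<phi> \<in> ordarr Qf - arrs Q" "f \<in> verts Qf - verts Q"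
      "pta Qf \<phi> = (j, r)" "tail Q (i, 1) (b @ [Tr j r])" "mint Q (b @ [Tr j r])"
      using Cons.IH[OF tg mg] iv by auto
    have "tail Q p ((Spl i # b) @ [Tr j r])" using b(5) i by (simp add: tail_Cons)
    moreover have "\<not> lless Q l' (Spl i)" if "l' \<in> letters Q" for l'
      using special_letter_unique[OF Q i(1) that] by (auto simp: lless_def)
    hence "mint Q ((Spl i # b) @ [Tr j r])" using b(6) by (simp add: mint_def)
    moreover have "l # g = (Spl i # b) @ [Dir \<phi>, Tr f (-1)]" using b(1) Spl by simp
    ultimately show ?thesis using b(2-4) by blast
  next
    case Dir
    hence a: "a \<in> ordarr Qf" "pta Qf a = p" using l by auto
    have tg: "tail Qf (opp (pso Qf a)) g" using Cons.prems(1) Dir by (auto simp: tail_Cons split: if_splits)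
    show ?thesis
    proof (cases "a \<in> arrs Q")
      case True
      have iv: "fst (opp (pso Qf a)) \<in> verts Q" using arrs_Q_verts[OF True] by (simp add: opp_def)
      obtain b \<phi> f j r where b: "g = b @ [Dir \<phi>, Tr f (-1)]" "\<phi> \<in> ordarr Qf - arrs Q" "f \<in> verts Qf - verts Q"
        "pta Qf \<phi> = (j, r)" "tail Q (opp (pso Qf a)) (b @ [Tr j r])" "mint Q (b @ [Tr j r])"
        using Cons.IH[OF tg mg iv] by auto
      have "tail Q p ((Dir a # b) @ [Tr j r])" using b(5) a ordarr_Q[OF a(1) True] pso_eq[OF True] pta_eq[OF True]
        by (simp add: tail_Cons)
      moreover have "mint Q ((Dir a # b) @ [Tr j r])" using b(6) by (simp add: mint_def lless_def)
      moreover have "l # g = (Dir a # b) @ [Dir \<phi>, Tr f (-1)]" using b(1) Dir by simp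
      ultimately show ?thesis using b(2-4) by blast
    next
      case False
      obtain f where f: "f \<in> verts Qf - verts Q" "pso Qf a = (f, 1)"
        using fringe_arrow[OF ordarr_arrs[OF a(1)] False] a(2) Cons.prems(3) by force
      have g: "g = [Tr f (-1)]" using dead_tail[OF dead_fringe[OF f(1)]] tg f(2) by simp
      obtain i r where p: "p = (i, r)" by (cases p)
      have "Tr i r \<in> letters Qf" using ord_trivial_letter(1)[OF Qf a(1)] a(2) p by blast
      hence tr: "Tr i r \<in> letters Q" using Cons.prems(3) p spverts_eq by auto
      hence "tail Q p ([] @ [Tr i r])" using p by (simp add: tail_Cons)
      moreover have "mint Q ([] @ [Tr i r])"
      proof -
        have "\<not> lless Q l' (Tr i r)" if l': "l' \<in> letters Q" for l'
        proof
          assume "lless Q l' (Tr i r)"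
          then obtain c where c: "l' = Dir c" "pta Q c = (i, r)" by (cases l') (auto simp: lless_def)
          hence "c \<in> arrs Q" using l' ordarr_arrs by auto
          hence "c = a" using pta_inj[OF Qf, of c a] pta_eq c a p arrs_sub ordarr_arrs[OF a(1)] by auto
          thus False using False \<open>c \<in> arrs Q\<close> by simp
        qed
        thus ?thesis by (simp add: mint_def)
      qed
      ultimately show ?thesis using a f g p Dir False by (intro exI[of _ "[]"]) auto
    qed
  qed
qed (simp add: tail_def)

text \<open>The case distinction behind hooks and cohooks. In the first case \<open>\<alpha>\<close>
  is a fringe arrow and no cohook can be added over \<open>Q\<close>. In the second case the cohook
  over \<open>Qf\<close> is the one over \<open>Q\<close>, followed by a single fringe
  arrow.\<close>

lemma cohook_tail:
  assumes a: "\<alpha> \<in> ordarr Qf" "pso Qf \<alpha> = (j, s)" "j \<in> verts Q" and g: "tail Qf (opp (pta Qf \<alpha>)) g" "mint Qf g"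
  obtains (fringe) f where "\<alpha> \<notin> arrs Q" "g = [Tr f (-1)]" "f \<in> verts Qf - verts Q"
  | (inner) b \<phi> f i r where "\<alpha> \<in> ordarr Q" "g = b @ [Dir \<phi>, Tr f (-1)]" "\<phi> \<in> ordarr Qf" "f \<in> verts Qf - verts Q"
    "pta Qf \<phi> = (i, r)" "tail Q (opp (pta Q \<alpha>)) (b @ [Tr i r])" "mint Q (b @ [Tr i r])"
proof (cases "\<alpha> \<in> arrs Q")
  case False
  obtain f where f: "f \<in> verts Qf - verts Q" "pta Qf \<alpha> = (f, 1)"
    using fringe_arrow[OF ordarr_arrs[OF a(1)] False] a(2,3) by force
  have "g = [Tr f (-1)]" using dead_tail[OF dead_fringe[OF f(1)]] g(1) f(2) by simp
  thus ?thesis using fringe False f by blast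
next
  case True
  have "fst (opp (pta Qf \<alpha>)) \<in> verts Q" using arrs_Q_verts[OF True] by (simp add: opp_def)
  from mint_tail_end[OF g this] obtain b \<phi> f i r where "g = b @ [Dir \<phi>, Tr f (-1)]" "\<phi> \<in> ordarr Qf - arrs Q"
    "f \<in> verts Qf - verts Q" "pta Qf \<phi> = (i, r)" "tail Q (opp (pta Qf \<alpha>)) (b @ [Tr i r])" "mint Q (b @ [Tr i r])"
    by blast
  thus ?thesis using inner ordarr_Q[OF a(1) True] pta_eq[OF True] by auto
qed

lemma cohook_end:
  assumes "\<alpha> \<in> ordarr Qf" "pso Qf \<alpha> = (j, s)" "j \<in> verts Q" "tail Qf (opp (pta Qf \<alpha>)) g" "mint Qf g"
  obtains f where "last g = Tr f (-1)" "f \<in> verts Qf - verts Q"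
  by (rule cohook_tail[OF assms]) auto

lemma cen_dir: "cen l = -1 \<longleftrightarrow> (\<exists>a. l = Dir a)" and cen_inv: "cen l = 1 \<longleftrightarrow> (\<exists>a. l = Inv a)"
  by (cases l; simp add: cen_def)+

text \<open>Inverse and special letters cannot be exceeded. The only letter above the final trivial
  one would be the inverse of \<open>\<alpha>\<close>, which is not a letter of
  \<open>Q\<close>.\<close>

lemma maxt_nondir:
  assumes u: "tail Q p (u @ [Tr j s])" and no: "\<And>l. l \<in> set u ==> cen l \<noteq> -1"
    and a: "\<alpha> \<in> ordarr Qf" "pso Qf \<alpha> = (j, s)" "\<alpha> \<notin> arrs Q"
  shows "maxt Q (u @ [Tr j s])"
  unfolding maxt_def
proof (intro ballI notI)
  fix l l' assume l: "l \<in> set (u @ [Tr j s])" and l': "l' \<in> letters Q" and less: "lless Q l l'"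
  obtain k where k: "k < length (u @ [Tr j s])" "l = (u @ [Tr j s]) ! k" using l by (metis in_set_conv_nth)
  show False
  proof (cases "k = length u")
    case True
    hence "l = Tr j s" using k by simp
    then obtain b where b: "l' = Inv b" "pso Q b = (j, s)" using less by (cases l') (auto simp: lless_def)
    hence "b \<in> arrs Q" using l' ordarr_arrs by auto
    hence "b = \<alpha>" using pso_inj[OF Qf, of b \<alpha>] pso_eq b a arrs_sub ordarr_arrs[OF a(1)] by auto
    thus False using a(3) \<open>b \<in> arrs Q\<close> by simp
  next
    case False
    hence ku: "k < length u" "l \<in> set u" using k by (auto simp: nth_append)
    have "cen l \<noteq> -1" by (rule no[OF ku(2)])
    moreover have "l \<noteq> Tr x y" for x y using tail_Tr[OF u k(1)] ku(1) k(2) by auto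
    moreover have "lta Q l \<noteq> None" "lrank l < 2" using less lrank_le[of l'] by (auto simp: lless_def)
    ultimately obtain i where i: "l = Spl i" by (cases l) (auto simp: cen_def)
    have "Spl i \<in> letters Q" using tail_nth_letters[OF u k(1)] k(2) i by simp
    hence "l' = l" using special_letter_unique[OF Q _ l'] less i by (auto simp: lless_def)
    thus False using less lless_irrefl by metis
  qed
qed

text \<open>The right end of \<open>v\<close>, prolonged by a cohook over the fringed quiver, is cut at its last direct letter
  to obtain \<open>v[1]\<close>, no matter whether a cohook is added or a hook is removed over \<open>Q\<close>.\<close>

lemma right_succ:
  assumes v: "is_string Q (TrI i r # u @ [Tr j s])" and a: "\<alpha> \<in> ordarr Qf" "pso Qf \<alpha> = (j, s)"
    and g: "tail Qf (opp (pta Qf \<alpha>)) g" "mint Qf g"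
  shows "(\<exists>A \<beta> B k t. u @ Inv \<alpha> # g = A @ Dir \<beta> # B \<and> (\<forall>l\<in>set B. cen l \<noteq> -1) \<and> pta Qf \<beta> = (k, t) \<and>
       rsucc Q (TrI i r # u @ [Tr j s]) = Some (TrI i r # A @ [Tr k t]) \<and> is_string Q (TrI i r # A @ [Tr k t])) \<or>
    ((\<forall>l\<in>set (u @ Inv \<alpha> # g). cen l \<noteq> -1) \<and> rsucc Q (TrI i r # u @ [Tr j s]) = None)"
proof -
  have tr: "TrI i r \<in> letters Q" "tail Q (i, - r) (u @ [Tr j s])" using v by (auto simp: string_St)
  have "Tr j s \<in> letters Q" using tr(2) by (simp add: tail_def is_word_append is_word_Cons)
  hence j: "j \<in> verts Q" by simp
  from a(1,2) j g show ?thesis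
  proof (cases rule: cohook_tail)
    \<comment> \<open>A cohook is added over \<open>Q\<close>; the fringe arrow
      \<open>\<phi>\<close> that follows it is the last direct letter.\<close>
    case (inner b \<phi> f k t)
    have "pso Q \<alpha> = (j, s)" using a(2) pso_eq ordarr_arrs[OF inner(1)] by simp
    from tsucc_cohook[OF Q tr(2) inner(1) this inner(6,7)]
    have ts: "tsucc Q (i, - r) (u @ [Tr j s]) (u @ Inv \<alpha> # b @ [Tr k t])" .
    have "rsucc Q (TrI i r # u @ [Tr j s]) = Some (TrI i r # (u @ Inv \<alpha> # b) @ [Tr k t])"
      using rsucc_tsucc[OF Q tr(1) ts] by simp
    moreover have "is_string Q (TrI i r # (u @ Inv \<alpha> # b) @ [Tr k t])"
      using ts tr(1) by (simp add: string_St tsucc_def)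
    moreover have "u @ Inv \<alpha> # g = (u @ Inv \<alpha> # b) @ Dir \<phi> # [Tr f (-1)]" using inner(2) by simp
    moreover have "\<forall>l\<in>set [Tr f (-1)]. cen l \<noteq> -1" by (simp add: cen_def)
    ultimately show ?thesis using inner(5) by blast
  next
    \<comment> \<open>No cohook can be added over \<open>Q\<close>. The hook starting at the last
      direct letter of \<open>u\<close> is removed, and if there is no direct letter, then the
      string is maximal.\<close>
    case (fringe f)
    show ?thesis
    proof (cases "\<exists>l\<in>set u. cen l = -1")
      case True
      then obtain A l B where s: "u = A @ l # B" "cen l = -1" "\<forall>l\<in>set B. cen l \<noteq> -1"
        using split_list_last_prop[of u "\<lambda>l. cen l = -1"] by metis
      then obtain \<beta> where b: "l = Dir \<beta>" by (auto simp: cen_dir)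
      obtain k t where kt: "pta Qf \<beta> = (k, t)" by (cases "pta Qf \<beta>")
      have tl: "tail Q (i, - r) (A @ Dir \<beta> # B @ [Tr j s])" using tr(2) s b by simp
      hence "Dir \<beta> \<in> letters Q" by (simp add: tail_append is_word_Cons)
      hence beta: "\<beta> \<in> ordarr Q" by simp
      hence kt': "pta Q \<beta> = (k, t)" using kt pta_eq[OF ordarr_arrs[OF beta]] by simp
      obtain p' where "tail Q p' (B @ [Tr j s])" using tail_suffix[of Q "(i, - r)" A "Dir \<beta>" "B @ [Tr j s]"] tl by blast
      from maxt_nondir[OF this _ a fringe(1)] s(3) have "maxt Q (B @ [Tr j s])" by blast
      from tsucc_hook[OF Q tl kt' this]
      have ts: "tsucc Q (i, - r) (u @ [Tr j s]) (A @ [Tr k t])" using s b by simp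
      have "rsucc Q (TrI i r # u @ [Tr j s]) = Some (TrI i r # A @ [Tr k t])"
        using rsucc_tsucc[OF Q tr(1) ts] by simp
      moreover have "is_string Q (TrI i r # A @ [Tr k t])"
        using ts tr(1) by (simp add: string_St tsucc_def)
      moreover have "u @ Inv \<alpha> # g = A @ Dir \<beta> # (B @ Inv \<alpha> # g)" using s b by simp
      moreover have "\<forall>l\<in>set (B @ Inv \<alpha> # g). cen l \<noteq> -1" using s(3) fringe(2) by (auto simp: cen_def)
      ultimately show ?thesis using kt by blast
    next
      case False
      hence "maxt Q (u @ [Tr j s])" using maxt_nondir[OF tr(2) _ a fringe(1)] by blast
      from rsucc_max[OF Q tr this] have "rsucc Q (TrI i r # u @ [Tr j s]) = None" .
      moreover have "\<forall>l\<in>set (u @ Inv \<alpha> # g). cen l \<noteq> -1" using False fringe(2) by (auto simp: cen_def)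
      ultimately show ?thesis by blast
    qed
  qed
qed

text \<open>Inversion turns the last direct letter in \<open>right_succ\<close> into the first
  inverse letter.\<close>

lemma left_succ:
  assumes v: "is_string Q (TrI j s # u @ [Tr i r])" and a: "\<alpha> \<in> ordarr Qf" "pso Qf \<alpha> = (j, s)"
    and g: "tail Qf (opp (pta Qf \<alpha>)) g" "mint Qf g"
  shows "(\<exists>A \<beta> B k t. winv g @ Dir \<alpha> # u = B @ Inv \<beta> # A \<and> (\<forall>l\<in>set B. cen l \<noteq> 1) \<and> pta Qf \<beta> = (k, t) \<and>
       lsucc Q (TrI j s # u @ [Tr i r]) = Some (TrI k t # A @ [Tr i r]) \<and> is_string Q (TrI k t # A @ [Tr i r])) \<or>
    ((\<forall>l\<in>set (winv g @ Dir \<alpha> # u). cen l \<noteq> 1) \<and> lsucc Q (TrI j s # u @ [Tr i r]) = None)"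
proof -
  have w: "winv (TrI j s # u @ [Tr i r]) = TrI i r # winv u @ [Tr j s]" by simp
  have v': "is_string Q (TrI i r # winv u @ [Tr j s])" using v is_string_winv[of Q "TrI j s # u @ [Tr i r]"] w by simp
  have ls: "lsucc Q (TrI j s # u @ [Tr i r]) = map_option winv (rsucc Q (TrI i r # winv u @ [Tr j s]))"
    unfolding lsucc_def w ..
  have cw: "(\<forall>l\<in>set (winv B). cen l \<noteq> 1) \<longleftrightarrow> (\<forall>l\<in>set B. cen l \<noteq> -1)" for B :: "('v, 'a) word"
    by (auto simp: cen_linv)
  from right_succ[OF v' a g] show ?thesis
  proof (elim disjE exE conjE)
    fix A \<beta> B k t
    assume h: "winv u @ Inv \<alpha> # g = A @ Dir \<beta> # B" "\<forall>l\<in>set B. cen l \<noteq> -1" "pta Qf \<beta> = (k, t)"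
      "rsucc Q (TrI i r # winv u @ [Tr j s]) = Some (TrI i r # A @ [Tr k t])" "is_string Q (TrI i r # A @ [Tr k t])"
    have "winv (winv u @ Inv \<alpha> # g) = winv (A @ Dir \<beta> # B)" using h(1) by simp
    hence "winv g @ Dir \<alpha> # u = winv B @ Inv \<beta> # winv A" by simp
    moreover have "\<forall>l\<in>set (winv B). cen l \<noteq> 1" using h(2) cw by blast
    moreover have "lsucc Q (TrI j s # u @ [Tr i r]) = Some (TrI k t # winv A @ [Tr i r])" unfolding ls h(4) by simp
    moreover have "is_string Q (TrI k t # winv A @ [Tr i r])"
      using h(5) is_string_winv[of Q "TrI i r # A @ [Tr k t]"] by simp
    ultimately show ?thesis using h(3) by blast
  next
    assume h: "\<forall>l\<in>set (winv u @ Inv \<alpha> # g). cen l \<noteq> -1" "rsucc Q (TrI i r # winv u @ [Tr j s]) = None"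
    have "\<forall>l\<in>set (winv (winv u @ Inv \<alpha> # g)). cen l \<noteq> 1" using h(1) cw by blast
    hence "\<forall>l\<in>set (winv g @ Dir \<alpha> # u). cen l \<noteq> 1" by simp
    thus ?thesis unfolding ls h(2) by simp
  qed
qed

end

section \<open>The word with cohooks over the fringed quiver at both ends, and its two cuts\<close>

locale cohooked = fringed Q Qf for Q Qf :: "('v, 'a) pquiver" +
  fixes i :: 'v and r :: int and m :: "('v, 'a) word" and j :: 'v and s :: int and \<alpha>L \<alpha>R gL gR
  assumes w: "is_string Q (TrI i r # m @ [Tr j s])"
    and L: "\<alpha>L \<in> ordarr Qf" "pso Qf \<alpha>L = (i, r)" "tail Qf (opp (pta Qf \<alpha>L)) gL" "mint Qf gL"
    and R: "\<alpha>R \<in> ordarr Qf" "pso Qf \<alpha>R = (j, s)" "tail Qf (opp (pta Qf \<alpha>R)) gR" "mint Qf gR"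
begin

definition "w = TrI i r # m @ [Tr j s]"
definition "W = winv gL @ Dir \<alpha>L # m @ Inv \<alpha>R # gR"

lemma ij: "i \<in> verts Q" "j \<in> verts Q"
proof -
  have "TrI i r \<in> letters Q" "Tr j s \<in> letters Q" using w by (auto simp: is_string_def is_word_Cons is_word_append)
  thus "i \<in> verts Q" "j \<in> verts Q" by auto
qed

lemma rsucc_f: "rsucc Qf w = Some (TrI i r # m @ Inv \<alpha>R # gR)" "is_string Qf (TrI i r # m @ Inv \<alpha>R # gR)"
proof -
  have t: "TrI i r \<in> letters Qf" "tail Qf (i, - r) (m @ [Tr j s])"
    using is_string_sub[OF w] by (auto simp: string_St)
  have ts: "tsucc Qf (i, - r) (m @ [Tr j s]) (m @ Inv \<alpha>R # gR)" using tsucc_cohook[OF Qf t(2) R] .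
  show "rsucc Qf w = Some (TrI i r # m @ Inv \<alpha>R # gR)" using rsucc_tsucc[OF Qf t(1) ts] by (simp add: w_def)
  show "is_string Qf (TrI i r # m @ Inv \<alpha>R # gR)" using ts t(1) by (simp add: string_St tsucc_def)
qed

text \<open>The left end is the right end of the inverse word. After the first step this inverse
  word starts at a fringe vertex, whose trivial letter has polarity \<open>-1\<close>.\<close>

lemma lsucc_f: "lsucc Qf (TrI i r # m @ Inv \<alpha>R # gR) = Some W" "is_string Qf W"
proof -
  obtain f where f: "last gR = Tr f (-1)" using cohook_end[OF R(1,2) ij(2) R(3,4)] by metis
  have ne: "gR \<noteq> []" using R(3) by (auto simp: tail_def)
  define h where "h = butlast gR"
  have gR: "gR = h @ [Tr f (-1)]" using f ne unfolding h_def by (metis append_butlast_last_id)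
  have wi: "winv (TrI i r # m @ Inv \<alpha>R # gR) = TrI f (-1) # (winv h @ Dir \<alpha>R # winv m) @ [Tr i r]" using gR by simp
  have "is_string Qf (TrI f (-1) # (winv h @ Dir \<alpha>R # winv m) @ [Tr i r])"
    using rsucc_f(2) wi is_string_winv by metis
  hence t: "TrI f (-1) \<in> letters Qf" "tail Qf (f, - (-1)) ((winv h @ Dir \<alpha>R # winv m) @ [Tr i r])"
    by (simp_all only: string_St)
  have ts: "tsucc Qf (f, - (-1)) ((winv h @ Dir \<alpha>R # winv m) @ [Tr i r]) ((winv h @ Dir \<alpha>R # winv m) @ Inv \<alpha>L # gL)"
    using tsucc_cohook[OF Qf t(2) L] .
  have r: "rsucc Qf (winv (TrI i r # m @ Inv \<alpha>R # gR)) = Some (TrI f (-1) # (winv h @ Dir \<alpha>R # winv m) @ Inv \<alpha>L # gL)"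
    unfolding wi by (rule rsucc_tsucc[OF Qf t(1) ts])
  have e: "winv (TrI f (-1) # (winv h @ Dir \<alpha>R # winv m) @ Inv \<alpha>L # gL) = W" unfolding W_def by (simp add: gR)
  show "lsucc Qf (TrI i r # m @ Inv \<alpha>R # gR) = Some W" unfolding lsucc_def r using e by simp
  have "is_string Qf (TrI f (-1) # (winv h @ Dir \<alpha>R # winv m) @ Inv \<alpha>L # gL)"
    using ts t(1) by (simp only: string_St tsucc_def)
  thus "is_string Qf W" using e is_string_winv by metis
qed

lemma tau_string_f: "tau_string Qf w = W" and left_step_f: "left_step Qf w = (TrI i r # m @ Inv \<alpha>R # gR, W)"
  using rsucc_f lsucc_f by (simp_all add: tau_string_def left_step_def)

lemma ends: obtains f f' where "hd W = TrI f (-1)" "dead Qf f (-1)" "last W = Tr f' (-1)" "dead Qf f' (-1)"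
proof -
  obtain f where f: "last gL = Tr f (-1)" "f \<in> verts Qf - verts Q" using cohook_end[OF L(1,2) ij(1) L(3,4)] by metis
  obtain f' where f': "last gR = Tr f' (-1)" "f' \<in> verts Qf - verts Q" using cohook_end[OF R(1,2) ij(2) R(3,4)] by metis
  have "gL \<noteq> []" "gR \<noteq> []" using L(3) R(3) by (auto simp: tail_def)
  hence "hd W = TrI f (-1)" "last W = Tr f' (-1)" unfolding W_def using f f' by (simp_all add: hd_winv)
  thus ?thesis using that dead_fringe f f' by blast
qed

lemma gL_gR_cen: "l \<in> set gL ==> cen l \<noteq> 1" "l \<in> set gR ==> cen l \<noteq> 1" "l \<in> set (winv gL) ==> cen l \<noteq> -1"
  using mint_cen[OF Qf L(3,4)] mint_cen[OF Qf R(3,4)] by (auto simp: cen_linv)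

text \<open>The cuts for \<open>s = 1\<close> are at \<open>\<alpha>L\<close> and
  \<open>\<alpha>R\<close>: the minimal tails beyond them contain no inverse letter when read
  outwards, hence no direct letter on the left and no inverse letter on the right.\<close>

lemma trimmed_w: "\<exists>f f'. trimmed_string Qf W f (-1) f' (-1) Q w 1 (length gL) (Suc (length gL + length m))"
proof -
  obtain f f' where e: "hd W = TrI f (-1)" "dead Qf f (-1)" "last W = Tr f' (-1)" "dead Qf f' (-1)" by (rule ends)
  let ?p = "length gL" and ?q = "Suc (length gL + length m)"
  have Wp: "W ! ?p = Dir \<alpha>L" "W ! ?q = Inv \<alpha>R" by (simp_all add: W_def nth_append)
  have before: "cen (W ! k) \<noteq> -1" if "k < ?p" for k
  proof -
    have "W ! k \<in> set (winv gL)" using that by (simp add: W_def nth_append del: set_winv)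
    thus ?thesis by (rule gL_gR_cen(3))
  qed
  have after: "cen (W ! k) \<noteq> 1" if "k < length W" "?q < k" for k
  proof -
    define k' where "k' = k - Suc ?q"
    have k': "k = Suc ?q + k'" using that by (simp add: k'_def)
    have "W ! k = gR ! k'" "k' < length gR" using that unfolding k' by (simp_all add: W_def nth_append)
    thus ?thesis using gL_gR_cen(2) by simp
  qed
  have cut: "cut W 1 ?p ?q" unfolding cut_def using before after by (simp add: Wp cen_def) (simp add: W_def)
  have "trimmed_string Qf W f (-1) f' (-1) Q w 1 ?p ?q"
  proof
    show "skewed_gentle Qf" "is_string Qf W" "hd W = TrI f (-1)" "last W = Tr f' (-1)"
      "dead Qf f (-1)" "dead Qf f' (-1)" using Qf lsucc_f(2) e by auto
    show "skewed_gentle Q" "is_string Q w" using Q w by (simp_all add: w_def)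
    show "w ! k = W ! (k + ?p)" if "0 < k" "k < ?q - ?p" for k
      using that by (cases k) (simp_all add: w_def W_def nth_append)
  qed (use cut in "simp_all add: w_def")
  thus ?thesis by blast
qed

text \<open>The condition under which the cuts for \<open>s = -1\<close>, at the first inverse and
  at the last direct letter, come in this order. It turns out to be equivalent to \<open>w\<close>
  not being projective.\<close>

definition "inv_before_dir \<longleftrightarrow> (\<exists>a b. a < b \<and> b < length W \<and> cen (W ! a) = 1 \<and> cen (W ! b) = -1)"

lemma no_inv_before_dir_split:
  assumes "W = A @ B" "\<forall>l\<in>set A. cen l \<noteq> 1" "\<forall>l\<in>set B. cen l \<noteq> -1"
  shows "\<not> inv_before_dir"
proof
  assume "inv_before_dir"
  then obtain a b where ab: "a < b" "b < length W" "cen (W ! a) = 1" "cen (W ! b) = -1"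
    unfolding inv_before_dir_def by blast
  have "\<not> a < length A"
  proof
    assume "a < length A"
    hence "W ! a \<in> set A" using assms(1) by (simp add: nth_append)
    thus False using ab assms(2) by blast
  qed
  hence "W ! b = B ! (b - length A)" "b - length A < length B" using ab assms(1) by (auto simp: nth_append)
  hence "W ! b \<in> set B" by simp
  thus False using ab assms(3) by blast
qed

definition "sshift = (let (u, v) = left_step Q w in if length u < length v then 1 else length u - length v + 1)"

text \<open>The shift prescribed by \<open>sigma_emb\<close> is the position of the first inverse
  letter of \<open>W\<close>. If the cohook lies in \<open>Q\<close>, this letter is its fringe
  arrow, at position \<open>1\<close>. Otherwise \<open>\<alpha>L\<close> is a fringe arrow, and the
  trivial letter, \<open>\<alpha>L\<close> and the removed hook without its inverse letter come
  before.\<close>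

lemma shift_length:
  assumes B: "winv gL @ Dir \<alpha>L # A' = B @ Inv \<gamma> # A2" "\<forall>l\<in>set B. cen l \<noteq> 1"
  shows "(if length A' < length A2 then 1 else length A' - length A2 + 1) = length B"
proof -
  have len: "length gL + 1 + length A' = length B + 1 + length A2" using arg_cong[OF B(1), of length] by simp
  from L(1,2) ij(1) L(3,4) show ?thesis
  proof (cases rule: cohook_tail)
    case (fringe f)
    have "B \<noteq> []"
    proof
      assume "B = []"
      thus False using B(1) fringe(2) by simp
    qed
    hence "length B = 1 + length A' - length A2" "length A2 \<le> length A'" using len fringe(2) by (cases B; simp)+
    thus ?thesis by simp
  next
    case (inner b \<phi> f k t)
    have g: "winv gL = TrI f (-1) # Inv \<phi> # winv b" using inner(2) by simp
    have "length B = 1"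
    proof (cases B)
      case Nil
      thus ?thesis using B(1) g by simp
    next
      case (Cons l B')
      hence "Inv \<phi> # winv b @ Dir \<alpha>L # A' = B' @ Inv \<gamma> # A2" using B(1) g by simp
      thus ?thesis using B(2) Cons by (cases B') (auto simp: cen_def)
    qed
    thus ?thesis using len inner(2) by simp
  qed
qed

text \<open>The definition of \<open>tau_string\<close> changes the right end first if this is
  possible, and otherwise the left end. In either order, a missing change would mean that no inverse
  letter of \<open>W\<close> precedes a direct one.\<close>

lemma tau_string_trim:
  assumes ibd: "inv_before_dir"
  shows "\<exists>B \<gamma> A \<beta> B' k t k' t'. W = B @ Inv \<gamma> # A @ Dir \<beta> # B' \<and> (\<forall>l\<in>set B. cen l \<noteq> 1) \<and> (\<forall>l\<in>set B'. cen l \<noteq> -1) \<and>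
    pta Qf \<gamma> = (k, t) \<and> pta Qf \<beta> = (k', t') \<and> tau_string Q w = TrI k t # A @ [Tr k' t'] \<and>
    is_string Q (TrI k t # A @ [Tr k' t']) \<and> sshift = length B"
  using right_succ[OF w R]
proof (elim disjE exE conjE)
  fix A \<beta> B' k' t'
  assume h: "m @ Inv \<alpha>R # gR = A @ Dir \<beta> # B'" "\<forall>l\<in>set B'. cen l \<noteq> -1" "pta Qf \<beta> = (k', t')"
    "rsucc Q (TrI i r # m @ [Tr j s]) = Some (TrI i r # A @ [Tr k' t'])" "is_string Q (TrI i r # A @ [Tr k' t'])"
  have W1: "W = (winv gL @ Dir \<alpha>L # A) @ Dir \<beta> # B'" using h(1) by (simp add: W_def)
  from left_succ[OF h(5) L] show ?thesis
  proof (elim disjE exE conjE)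
    fix A2 \<gamma> B k t
    assume g: "winv gL @ Dir \<alpha>L # A = B @ Inv \<gamma> # A2" "\<forall>l\<in>set B. cen l \<noteq> 1" "pta Qf \<gamma> = (k, t)"
      "lsucc Q (TrI i r # A @ [Tr k' t']) = Some (TrI k t # A2 @ [Tr k' t'])" "is_string Q (TrI k t # A2 @ [Tr k' t'])"
    have "W = B @ Inv \<gamma> # A2 @ Dir \<beta> # B'" using W1 unfolding g(1) by simp
    moreover have "tau_string Q w = TrI k t # A2 @ [Tr k' t']"
      unfolding tau_string_def w_def h(4) by (simp add: g(4))
    moreover have "sshift = length B"
      unfolding sshift_def left_step_def w_def h(4) using shift_length[OF g(1,2)] by (auto simp: g(4) split: if_splits)
    ultimately show ?thesis using g(2,3,5) h(2,3) by blast
  next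
    assume "\<forall>l\<in>set (winv gL @ Dir \<alpha>L # A). cen l \<noteq> 1"
    moreover have "W = (winv gL @ Dir \<alpha>L # A @ [Dir \<beta>]) @ B'" using W1 by simp
    ultimately have "\<not> inv_before_dir" using h(2) by (intro no_inv_before_dir_split) (auto simp: cen_def)
    thus ?thesis using ibd by blast
  qed
next
  assume h: "\<forall>l\<in>set (m @ Inv \<alpha>R # gR). cen l \<noteq> -1" "rsucc Q (TrI i r # m @ [Tr j s]) = None"
  from left_succ[OF w L] show ?thesis
  proof (elim disjE exE conjE)
    fix A2 \<gamma> B k t
    assume g: "winv gL @ Dir \<alpha>L # m = B @ Inv \<gamma> # A2" "\<forall>l\<in>set B. cen l \<noteq> 1" "pta Qf \<gamma> = (k, t)"
      "lsucc Q (TrI i r # m @ [Tr j s]) = Some (TrI k t # A2 @ [Tr j s])" "is_string Q (TrI k t # A2 @ [Tr j s])"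
    have W1: "W = B @ Inv \<gamma> # A2 @ Inv \<alpha>R # gR"
    proof -
      have "W = (winv gL @ Dir \<alpha>L # m) @ Inv \<alpha>R # gR" by (simp add: W_def)
      thus ?thesis unfolding g(1) by simp
    qed
    from right_succ[OF g(5) R] show ?thesis
    proof (elim disjE exE conjE)
      fix A \<beta> B' k' t'
      assume e: "A2 @ Inv \<alpha>R # gR = A @ Dir \<beta> # B'" "\<forall>l\<in>set B'. cen l \<noteq> -1" "pta Qf \<beta> = (k', t')"
        "rsucc Q (TrI k t # A2 @ [Tr j s]) = Some (TrI k t # A @ [Tr k' t'])" "is_string Q (TrI k t # A @ [Tr k' t'])"
      have "W = B @ Inv \<gamma> # A @ Dir \<beta> # B'" using W1 unfolding e(1) .
      moreover have "tau_string Q w = TrI k t # A @ [Tr k' t']"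
        unfolding tau_string_def w_def h(2) by (simp add: g(4) e(4))
      moreover have "sshift = length B"
        unfolding sshift_def left_step_def w_def h(2) using shift_length[OF g(1,2)] by (auto simp: g(4) split: if_splits)
      ultimately show ?thesis using g(2,3) e(2,3,5) by blast
    next
      assume "\<forall>l\<in>set (A2 @ Inv \<alpha>R # gR). cen l \<noteq> -1"
      moreover have "W = B @ (Inv \<gamma> # A2 @ Inv \<alpha>R # gR)" using W1 by simp
      ultimately have "\<not> inv_before_dir" using g(2) by (intro no_inv_before_dir_split) (auto simp: cen_def)
      thus ?thesis using ibd by blast
    qed
  next
    assume "\<forall>l\<in>set (winv gL @ Dir \<alpha>L # m). cen l \<noteq> 1"
    moreover have "W = (winv gL @ Dir \<alpha>L # m) @ Inv \<alpha>R # gR" by (simp add: W_def)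
    moreover have "\<forall>l\<in>set (Inv \<alpha>R # gR). cen l \<noteq> -1" using h(1) by simp
    ultimately have "\<not> inv_before_dir" by (intro no_inv_before_dir_split)
    thus ?thesis using ibd by blast
  qed
qed

lemma trimmed_tau:
  assumes ibd: "inv_before_dir"
  shows "\<exists>f f' q. trimmed_string Qf W f (-1) f' (-1) Q (tau_string Q w) (-1) sshift q \<and>
    lso Q (hd (tau_string Q w)) = lso Qf (W ! sshift) \<and> lta Q (last (tau_string Q w)) = lta Qf (W ! q) \<and>
    (winv W = W --> winv (tau_string Q w) = tau_string Q w)"
proof -
  obtain f f' where e: "hd W = TrI f (-1)" "dead Qf f (-1)" "last W = Tr f' (-1)" "dead Qf f' (-1)" by (rule ends)
  obtain B \<gamma> A \<beta> B' k t k' t' where h: "W = B @ Inv \<gamma> # A @ Dir \<beta> # B'" "\<forall>l\<in>set B. cen l \<noteq> 1" "\<forall>l\<in>set B'. cen l \<noteq> -1"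
    "pta Qf \<gamma> = (k, t)" "pta Qf \<beta> = (k', t')" "tau_string Q w = TrI k t # A @ [Tr k' t']"
    "is_string Q (TrI k t # A @ [Tr k' t'])" "sshift = length B" using tau_string_trim[OF ibd] by blast
  let ?p = "length B" and ?q = "Suc (length B + length A)"
  have Wp: "W ! ?p = Inv \<gamma>" "W ! ?q = Dir \<beta>" by (simp_all add: h(1) nth_append)
  have before: "cen (W ! n) \<noteq> 1" if "n < ?p" for n
  proof -
    have "W ! n \<in> set B" using that by (simp add: h(1) nth_append)
    thus ?thesis using h(2) by blast
  qed
  have after: "cen (W ! n) \<noteq> -1" if "n < length W" "?q < n" for n
  proof -
    define n' where "n' = n - Suc ?q"
    have n': "n = Suc ?q + n'" using that by (simp add: n'_def)
    have "W ! n = B' ! n'" "n' < length B'" using that unfolding n' by (simp_all add: h(1) nth_append)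
    thus ?thesis using h(3) by simp
  qed
  have cut: "cut W (-1) ?p ?q" unfolding cut_def using before after by (simp add: Wp cen_def) (simp add: h(1))
  have tr: "trimmed_string Qf W f (-1) f' (-1) Q (tau_string Q w) (-1) ?p ?q"
  proof
    show "skewed_gentle Qf" "is_string Qf W" "hd W = TrI f (-1)" "last W = Tr f' (-1)"
      "dead Qf f (-1)" "dead Qf f' (-1)" using Qf lsucc_f(2) e by auto
    show "skewed_gentle Q" "is_string Q (tau_string Q w)" using Q h by simp_all
    show "tau_string Q w ! n = W ! (n + ?p)" if "0 < n" "n < ?q - ?p" for n
      using that by (cases n) (simp_all add: h(1,6) nth_append)
  qed (use cut in "simp_all add: h(6)")
  interpret T: trimmed_string Qf W f "-1" f' "-1" Q "tau_string Q w" "-1" ?p ?q by (rule tr)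
  \<comment> \<open>For symmetric \<open>W\<close> the cuts are symmetric as well, so the outer
    parts have equal lengths and the pieces of \<open>W\<close> and of its inverse can be compared
    one by one.\<close>
  have "winv (tau_string Q w) = tau_string Q w" if s: "winv W = W"
  proof -
    have "?p + ?q = length W - 1" by (rule T.symmetric_cut[OF s])
    hence len: "length B' = length B" by (simp add: h(1))
    have "winv B' @ Inv \<beta> # winv A @ Dir \<gamma> # winv B = B @ Inv \<gamma> # A @ Dir \<beta> # B'" using s by (simp add: h(1))
    hence "Inv \<beta> # winv A @ Dir \<gamma> # winv B = Inv \<gamma> # A @ Dir \<beta> # B'" 
      using len append_eq_append_conv[of "winv B'" B] unfolding length_winv by blast
    hence bg: "\<beta> = \<gamma>" and "winv A @ Dir \<gamma> # winv B = A @ Dir \<beta> # B'" by blast+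
    hence "winv A = A" using append_eq_append_conv[of "winv A" A] unfolding length_winv by blast
    thus ?thesis using h(4,5) bg unfolding h(6) by simp
  qed
  moreover have "lso Q (hd (tau_string Q w)) = lso Qf (W ! ?p)" "lta Q (last (tau_string Q w)) = lta Qf (W ! ?q)"
    unfolding Wp h(6) using h(4,5) by simp_all
  ultimately show ?thesis using tr unfolding h(8)[symmetric] by blast
qed

end

subsection \<open>Projective strings\<close>

lemma lta_range:
  assumes Q: "skewed_gentle Q" and l: "l \<in> letters Q" "lta Q l = Some p"
  shows "fst p \<in> verts Q \<and> (snd p = -1 \<or> snd p = 1)"
proof (cases l)
  case (Dir a)
  thus ?thesis using l pta_range[OF Q, of a] ordarr_arrs[of a Q] by auto
next
  case (Inv a)
  thus ?thesis using l pso_range[OF Q, of a] ordarr_arrs[of a Q] by auto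
next
  case (Spl i)
  thus ?thesis using l spverts_verts[OF Q, of i] by auto
qed (use l in auto)

lemma cen_simps [simp]: "cen (Dir a) = -1" "cen (Inv a) = 1" "cen (Spl i) = 0" "cen (Tr i r) = 0" "cen (TrI i r) = 0"
  by (simp_all add: cen_def)

context cohooked
begin

lemma max_end_fringe:
  assumes "maxt Q u" "Tr j' s' \<in> set u" "\<alpha> \<in> ordarr Qf" "pso Qf \<alpha> = (j', s')"
  shows "\<alpha> \<notin> arrs Q"
proof
  assume a: "\<alpha> \<in> arrs Q"
  hence "Inv \<alpha> \<in> letters Q" "lless Q (Tr j' s') (Inv \<alpha>)"
    using ordarr_Q[OF assms(3) a] pso_eq[OF a] assms(4) by (simp_all add: lless_def)
  thus False using assms(1,2) unfolding maxt_def by blast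
qed

text \<open>Maximal tails contain no direct letters, and they end where \<open>Q\<close> has no
  inverse letter, so that both cohooks are single fringe arrows. Hence all direct letters of
  \<open>W\<close> come before all inverse ones. The word \<open>c\<close> is empty or the central
  special letter, according to the two kinds of projective strings.\<close>

lemma not_inv_before_dir:
  assumes m: "m = winv b' @ c @ b" and c: "\<forall>l\<in>set c. is_spl l"
    and u: "tail Q p (b @ [Tr j s])" "maxt Q (b @ [Tr j s])"
    and u': "tail Q p' (b' @ [Tr i r])" "maxt Q (b' @ [Tr i r])"
  shows "\<not> inv_before_dir"
proof (rule no_inv_before_dir_split)
  have aR: "\<alpha>R \<notin> arrs Q" using max_end_fringe[OF u(2) _ R(1,2)] by simp
  have aL: "\<alpha>L \<notin> arrs Q" using max_end_fringe[OF u'(2) _ L(1,2)] by simp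
  obtain f where f: "gL = [Tr f (-1)]"
    using cohook_tail[OF L(1,2) ij(1) L(3,4)] aL ordarr_arrs by metis
  obtain f' where f': "gR = [Tr f' (-1)]"
    using cohook_tail[OF R(1,2) ij(2) R(3,4)] aR ordarr_arrs by metis
  show "W = (winv gL @ Dir \<alpha>L # winv b') @ (c @ b @ Inv \<alpha>R # gR)" unfolding W_def by (simp add: m)
  have b: "\<forall>l\<in>set b. cen l \<noteq> -1" using maxt_cen[OF Q u] by simp
  have b': "\<forall>l\<in>set b'. cen l \<noteq> -1" using maxt_cen[OF Q u'] by simp
  have c': "\<forall>l\<in>set c. cen l \<noteq> -1" using c cen_spl by force
  show "\<forall>l\<in>set (winv gL @ Dir \<alpha>L # winv b'). cen l \<noteq> 1" using b' by (auto simp: cen_linv f)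
  show "\<forall>l\<in>set (c @ b @ Inv \<alpha>R # gR). cen l \<noteq> -1" using b c' by (auto simp: f')
qed

lemma max_tail_ex:
  assumes "fst p \<in> verts Q" "snd p \<in> {-1, 1}"
  obtains b k t where "tail Q p (b @ [Tr k t])" "maxt Q (b @ [Tr k t])"
proof -
  obtain g where g: "tail Q p g" "maxt Q g" using ext_tail_ex[OF Q assms, of False] by (auto simp: maxt_ext)
  hence "g \<noteq> []" by (simp add: tail_def)
  obtain k t where kt: "last g = Tr k t" using g(1) by (auto simp: tail_def)
  have "g = butlast g @ [Tr k t]" using \<open>g \<noteq> []\<close> kt by (metis append_butlast_last_id)
  thus ?thesis using g that by metis
qed

lemma proj_not_inv_before_dir:
  assumes "proj_string Q w"
  shows "\<not> inv_before_dir"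
  using assms unfolding proj_string_def
proof (elim disjE bexE exE conjE)
  fix k t assume k: "k \<in> verts Q - spverts Q" "t \<in> {-1, 1}" and e: "w = winv (wmax Q k (- t)) @ wmax Q k t"
  have l: "TrI k t \<in> letters Q" "TrI k (- t) \<in> letters Q" using k by auto
  obtain b k1 t1 where b: "tail Q (k, - t) (b @ [Tr k1 t1])" "maxt Q (b @ [Tr k1 t1])"
    using max_tail_ex[of "(k, - t)"] k by auto
  obtain b' k2 t2 where b': "tail Q (k, - (- t)) (b' @ [Tr k2 t2])" "maxt Q (b' @ [Tr k2 t2])"
    using max_tail_ex[of "(k, - (- t))"] k by auto
  have "w = winv (b' @ [Tr k2 t2]) @ b @ [Tr k1 t1]"
    unfolding e wmax_eq[OF Q l(1) b] wmax_eq[OF Q l(2) b'] ..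
  hence "TrI i r # m @ [Tr j s] = TrI k2 t2 # (winv b' @ b) @ [Tr k1 t1]" by (simp add: w_def)
  hence h: "m = winv b' @ [] @ b" "k1 = j" "t1 = s" "k2 = i" "t2 = r" by auto
  show ?thesis by (rule not_inv_before_dir[OF h(1) _ b[unfolded h(2,3)] b'[unfolded h(4,5)]]) simp
next
  fix k w' assume k: "k \<in> spverts Q" and e: "wmax Q k 1 = Spl k # w'" "w = winv w' @ [Spl k] @ w'"
  have kv: "k \<in> verts Q" using spverts_verts[OF Q k] .
  have l: "TrI k 1 \<in> letters Q" using kv by simp
  obtain b k1 t1 where b: "tail Q (k, - 1) (b @ [Tr k1 t1])" "maxt Q (b @ [Tr k1 t1])"
    using max_tail_ex[of "(k, - 1)"] kv by auto
  have "b @ [Tr k1 t1] = Spl k # w'" using wmax_eq[OF Q l b] e(1) by simp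
  then obtain c where c: "w' = c @ [Tr k1 t1]" "b = Spl k # c" by (cases b) auto
  have t: "tail Q (k, 1) (c @ [Tr k1 t1])" using b(1) c by (simp add: tail_Cons)
  have mx: "maxt Q (c @ [Tr k1 t1])" using b(2) c by (simp add: maxt_def)
  have "TrI i r # m @ [Tr j s] = TrI k1 t1 # (winv c @ [Spl k] @ c) @ [Tr k1 t1]" using e(2) c by (simp add: w_def)
  hence h: "m = winv c @ [Spl k] @ c" "k1 = j" "t1 = s" "k1 = i" "t1 = r" by auto
  have ij: "i = j" "r = s" using h by auto
  show ?thesis by (rule not_inv_before_dir[OF h(1)]) (use t mx h ij in auto)
qed

lemma inv_before_dirI: "W = A @ Inv \<gamma> # B ==> Dir \<beta> \<in> set B ==> inv_before_dir"
proof -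
  assume W: "W = A @ Inv \<gamma> # B" and b: "Dir \<beta> \<in> set B"
  obtain k where k: "k < length B" "B ! k = Dir \<beta>" using b by (metis in_set_conv_nth)
  show "inv_before_dir" unfolding inv_before_dir_def
    by (rule exI[of _ "length A"], rule exI[of _ "length A + Suc k"]) (use k in "simp add: W nth_append")
qed

text \<open>A cohook inside \<open>Q\<close> would contribute an inverse letter before a direct one,
  so both cohooks are single fringe arrows. Then \<open>w\<close> has a part without inverse
  letters, followed by a part without direct letters, and both are maximal when read from the
  turning point.\<close>

lemma not_inv_before_dir_proj:
  assumes no: "\<not> inv_before_dir"
  shows "proj_string Q w"
proof -
  have aL: "\<alpha>L \<notin> arrs Q"
  proof
    assume a: "\<alpha>L \<in> arrs Q"
    from L(1,2) ij(1) L(3,4) show False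
    proof (cases rule: cohook_tail)
      case (inner b \<phi> f k t)
      have "W = [TrI f (-1)] @ Inv \<phi> # (winv b @ Dir \<alpha>L # m @ Inv \<alpha>R # gR)"
        unfolding W_def by (simp add: inner(2))
      moreover have "Dir \<alpha>L \<in> set (winv b @ Dir \<alpha>L # m @ Inv \<alpha>R # gR)" by simp
      ultimately show False using no inv_before_dirI by blast
    qed (use a in simp)
  qed
  have aR: "\<alpha>R \<notin> arrs Q"
  proof
    assume a: "\<alpha>R \<in> arrs Q"
    from R(1,2) ij(2) R(3,4) show False
    proof (cases rule: cohook_tail)
      case (inner b \<phi> f k t)
      have "W = (winv gL @ Dir \<alpha>L # m) @ Inv \<alpha>R # gR" by (simp add: W_def)
      moreover have "Dir \<phi> \<in> set gR" using inner(2) by simp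
      ultimately show False using no inv_before_dirI by blast
    qed (use a in simp)
  qed
  \<comment> \<open>The division is made directly after the last direct letter. So special letters
    at the turning point belong to \<open>m2\<close>, and \<open>m1\<close>, unless empty, does not
    end with one.\<close>
  have "\<exists>m1 m2. m = m1 @ m2 \<and> (\<forall>l\<in>set m1. cen l \<noteq> 1) \<and> (\<forall>l\<in>set m2. cen l \<noteq> -1) \<and> (m1 = [] \<or> (\<exists>\<beta>. last m1 = Dir \<beta>))"
  proof (cases "\<exists>l\<in>set m. cen l = -1")
    case True
    then obtain A l B where s: "m = A @ l # B" "cen l = -1" "\<forall>l\<in>set B. cen l \<noteq> -1"
      using split_list_last_prop[of m "\<lambda>l. cen l = -1"] by metis
    then obtain \<beta> where b: "l = Dir \<beta>" by (auto simp: cen_dir)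
    have "cen l' \<noteq> 1" if l': "l' \<in> set A" for l'
    proof
      assume "cen l' = 1"
      then obtain \<gamma> where g: "l' = Inv \<gamma>" by (auto simp: cen_inv)
      then obtain A1 A2 where "A = A1 @ Inv \<gamma> # A2" using l' by (metis split_list)
      hence "W = (winv gL @ Dir \<alpha>L # A1) @ Inv \<gamma> # (A2 @ Dir \<beta> # B @ Inv \<alpha>R # gR)"
        unfolding W_def using s b by simp
      moreover have "Dir \<beta> \<in> set (A2 @ Dir \<beta> # B @ Inv \<alpha>R # gR)" by simp
      ultimately show False using no inv_before_dirI by blast
    qed
    thus ?thesis using s b by (intro exI[of _ "A @ [Dir \<beta>]"] exI[of _ B]) auto
  qed (intro exI[of _ "[]"] exI[of _ m], auto)
  then obtain m1 m2 where m: "m = m1 @ m2" "\<forall>l\<in>set m1. cen l \<noteq> 1" "\<forall>l\<in>set m2. cen l \<noteq> -1"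
    "m1 = [] \<or> (\<exists>\<beta>. last m1 = Dir \<beta>)" by blast
  define v1 where "v1 = TrI i r # m1"
  define u2 where "u2 = m2 @ [Tr j s]"
  define u1 where "u1 = winv m1 @ [Tr i r]"
  have ww: "w = v1 @ u2" unfolding w_def v1_def u2_def by (simp add: m(1))
  have u1: "u1 = winv v1" unfolding u1_def v1_def by simp
  have ne: "v1 \<noteq> []" "u2 \<noteq> []" by (simp_all add: v1_def u2_def)
  have "is_word Q (v1 @ u2)" unfolding ww[symmetric] using w unfolding w_def is_string_def by blast
  hence wd: "is_word Q v1" "is_word Q u2" "follows Q (last v1) (hd u2)"
    unfolding is_word_append using ne by blast+
  obtain p0 where p0: "lso Q (last v1) = Some p0" "lta Q (hd u2) = Some (opp p0)"
    using wd(3) unfolding follows_def by blast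
  obtain k t' where kt': "p0 = (k, t')" by (cases p0)
  define t where "t = - t'"
  have kt: "lta Q (hd u2) = Some (k, t)" "lso Q (last v1) = Some (k, - t)"
    using p0 kt' by (simp_all add: t_def)
  have t2: "tail Q (k, t) u2" using wd ne kt by (simp add: tail_def u2_def)
  have t1: "tail Q (k, - t) u1" unfolding u1 using wd(1) ne kt
    by (simp add: tail_def hd_winv last_winv) (simp add: v1_def)
  have mx2: "maxt Q u2" unfolding u2_def
    using maxt_nondir[OF t2[unfolded u2_def] _ R(1,2) aR] m(3) by blast
  have mx1: "maxt Q u1" unfolding u1_def
    by (rule maxt_nondir[OF t1[unfolded u1_def] _ L(1,2) aL]) (use m(2) in "auto simp: cen_linv")
  have hd2: "hd u2 \<in> letters Q" "hd u1 \<in> letters Q" "lta Q (hd u1) = Some (k, - t)"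
    using t1 t2 by (auto simp: tail_def is_word_iff)
  have kv: "k \<in> verts Q" "t = -1 \<or> t = 1" using lta_range[OF Q hd2(1) kt(1)] by simp_all
  show ?thesis
  proof (cases "\<exists>a m3. m2 = Spl a # m3")
    case True
    then obtain a m3 where m2: "m2 = Spl a # m3" by blast
    hence ka: "k = a" "t = -1" using kt(1) by (simp_all add: u2_def)
    have a: "a \<in> spverts Q" using hd2(1) by (simp add: u2_def m2)
    have e: "u2 = Spl a # m3 @ [Tr j s]" by (simp add: u2_def m2)
    have t3: "tail Q (a, 1) (m3 @ [Tr j s])" using t2 ka unfolding e by (auto simp: tail_Cons)
    have mx3: "maxt Q (m3 @ [Tr j s])" using mx2 unfolding e by (simp add: maxt_def)
    have t1': "tail Q (a, 1) u1" using t1 unfolding ka by simp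
    \<comment> \<open>Both sides of the special letter are maximal tails with the same start, which
      makes \<open>w\<close> symmetric about it.\<close>
    have "u1 = m3 @ [Tr j s]" by (rule maxt_unique[OF Q t1' t3 mx1 mx3])
    hence "v1 = winv (m3 @ [Tr j s])" unfolding u1 by (metis winv_winv)
    hence "w = winv (m3 @ [Tr j s]) @ [Spl a] @ (m3 @ [Tr j s])" unfolding ww e by (simp only: append_Cons append_Nil)
    moreover have "wmax Q a 1 = Spl a # (m3 @ [Tr j s])"
    proof (rule wmax_eq[OF Q])
      show "TrI a 1 \<in> letters Q" using kv(1) ka(1) by simp
      show "tail Q (a, - 1) (Spl a # m3 @ [Tr j s])" using t2 unfolding ka e .
      show "maxt Q (Spl a # m3 @ [Tr j s])" using mx2 unfolding e .
    qed
    ultimately show ?thesis unfolding proj_string_def using a by blast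
  next
    case False
    have "k \<notin> spverts Q"
    proof
      assume k: "k \<in> spverts Q"
      show False using kv(2)
      proof
        assume "t = -1"
        hence "hd u2 = Spl k" using special_letter_unique[OF Q k hd2(1)] kt(1) by blast
        thus False using False unfolding u2_def by (cases m2) auto
      next
        assume "t = 1"
        hence "hd u1 = Spl k" using special_letter_unique[OF Q k hd2(2)] hd2(3) by blast
        moreover have "hd u1 = linv (last v1)" unfolding u1 using ne(1) by (rule hd_winv)
        ultimately have "linv (last v1) = Spl k" by simp
        thus False using m(4) unfolding v1_def by (cases "m1 = []") auto
      qed
    qed
    hence l: "TrI k t \<in> letters Q" "TrI k (- t) \<in> letters Q" using kv by auto
    have "wmax Q k t = u1" using wmax_eq[OF Q l(1) t1 mx1] .
    moreover have "wmax Q k (- t) = u2" using wmax_eq[OF Q l(2) _ mx2] t2 by simp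
    moreover have "w = winv u1 @ u2" unfolding ww u1 by simp
    ultimately have "w = winv (wmax Q k (- (- t))) @ wmax Q k (- t)" by simp
    thus ?thesis unfolding proj_string_def using \<open>k \<notin> spverts Q\<close> kv by (intro disjI1 bexI[of _ k] bexI[of _ "- t"]) auto
  qed
qed

end

subsection \<open>The operator on admissible strings\<close>

lemma string_not_band: "is_string (hat Q) x ==> \<not> is_band (hat Q) x"
  unfolding is_string_def is_band_def by (auto simp: is_word_append follows_def)

lemma string_closed_type: "is_string (hat Q) x ==> closed_type Q x \<longleftrightarrow> lpunct Q x \<and> rpunct Q x"
  using string_not_band by (auto simp: closed_type_def)

lemma symmetric_split:
  assumes "winv W = W" "length W = 2 * c + 1"
  shows "W = take c W @ [W ! c] @ winv (take c W)"
proof -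
  have c: "c < length W" using assms by simp
  have "winv (drop (Suc c) W) = take c (winv W)" using assms(2) by (simp add: winv_def take_rev drop_map)
  hence d: "drop (Suc c) W = winv (take c W)" unfolding assms(1) by (metis winv_winv)
  show ?thesis using id_take_nth_drop[OF c] d by simp
qed

lemma ex_adm:
  assumes Q: "skewed_gentle Q" and W: "is_string Q W" and one: "\<not> (lp \<and> rp)"
    and nz: "\<not> lp ==> \<not> rp ==> (\<And>j. j \<in> spos W ==> msgn (seq W) j \<noteq> 0)"
    and sym: "lp \<or> rp ==> winv W = W \<and> (\<exists>c. length W = 2 * c + 1 \<and> is_spl (W ! c))"
  shows "\<exists>z. adm_string Q z \<and> lpunct Q z = lp \<and> rpunct Q z = rp \<and> completion Q z = W"
proof (cases "lp \<or> rp")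
  case False
  thus ?thesis using ex_adm_uu[OF Q W] nz by auto
next
  case True
  obtain c where c: "winv W = W" "length W = 2 * c + 1" "is_spl (W ! c)" using sym[OF True] by blast
  then obtain i where i: "W = take c W @ [Spl i] @ winv (take c W)" using symmetric_split[OF c(1,2)] by (auto simp: is_spl_def)
  show ?thesis using ex_adm_up[OF Q W i] ex_adm_pu[OF Q W i] one True by (cases lp) auto
qed

lemma tau_eq:
  assumes Q: "skewed_gentle Q" and x: "\<not> closed_type Q x" "\<not> (lpunct Q x \<and> rpunct Q x)"
    and z: "adm_string Q z" "lpunct Q z = lpunct Q x" "rpunct Q z = rpunct Q x"
      "completion Q z = tau_string Q (completion Q x)"
  shows "tau Q x = z"
proof -
  have "(THE z. adm_string Q z \<and> lpunct Q z = lpunct Q x \<and> rpunct Q z = rpunct Q x \<and>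
             completion Q z = tau_string Q (completion Q x)) = z"
  proof (rule the_equality)
    fix z' assume z': "adm_string Q z' \<and> lpunct Q z' = lpunct Q x \<and> rpunct Q z' = rpunct Q x \<and>
             completion Q z' = tau_string Q (completion Q x)"
    show "z' = z" by (rule adm_string_unique[OF Q z(1)]) (use z z' x in auto)
  qed (use z in blast)
  thus ?thesis using x(1) by (simp add: tau_def)
qed

lemma adm_uu_nonzero:
  assumes Q: "skewed_gentle Q" and z: "adm_string Q z" "\<not> lpunct Q z" "\<not> rpunct Q z" and j: "j \<in> spos (completion Q z)"
  shows "msgn (seq (completion Q z)) j \<noteq> 0"
proof -
  interpret H: hat_string Q z using Q z by unfold_locales (auto simp: adm_string_def)
  have "j \<in> H.I" using H.spos_W_uu[OF z(2,3)] j by (simp add: H.W_def)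
  then obtain k where k: "j = int k + int (coff Q z)" "H.int_special k" by (auto simp: H.I_def)
  hence "0 < k" "k < length z - 1" "is_spl (Flet Q (z ! k))" by (auto simp: H.int_special_def)
  from cen_adm_special(2)[OF Q z(1) H.one this] show ?thesis using k(1) by simp
qed

context fringed
begin

lemma Flet_eq: "l \<in> letters (hat Q) ==> Flet Qf l = Flet Q l"
  using src_sparr spverts_eq sparr_eq by (cases l) auto

lemma lpunct_eq [simp]: "lpunct Qf = lpunct Q" and rpunct_eq [simp]: "rpunct Qf = rpunct Q"
  by (simp_all add: fun_eq_iff lpunct_def rpunct_def spverts_eq)

lemma letters_hat_sub: "l \<in> letters (hat Q) ==> l \<in> letters (hat Qf)"
  using arrs_sub verts_sub by (cases l) auto

lemma hat_word_sub: "is_word (hat Q) z ==> is_word (hat Qf) z"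
proof (induction z)
  case (Cons l z)
  have eq: "lso Qf l = lso Q l" "lta Qf l = lta Q l" if "l \<in> letters (hat Q)" for l
    using that pso_eq pta_eq by (cases l; simp)+
  have "z \<noteq> [] ==> hd z \<in> letters (hat Q)" using Cons.prems by (cases z) (auto simp: is_word_Cons)
  thus ?case using Cons eq letters_hat_sub by (simp add: is_word_Cons follows_def)
qed simp

lemma hat_string_sub: "is_string (hat Q) z ==> is_string (hat Qf) z"
  using hat_word_sub by (auto simp: is_string_def)

lemma completion_eq:
  assumes z: "is_string (hat Q) z"
  shows "completion Qf z = completion Q z"
proof -
  have "set z \<subseteq> letters (hat Q)" using z by (auto simp: is_string_def is_word_iff)
  hence "set z \<union> linv ` set z \<subseteq> letters (hat Q)" by auto
  hence z': "Fword Qf u = Fword Q u" if "set u \<subseteq> set z \<union> linv ` set z" for u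
    unfolding Fword_def using that by (intro map_cong refl Flet_eq) blast
  have s: "set (tl z) \<subseteq> set z" "set (butlast z) \<subseteq> set z" "set (butlast (tl z)) \<subseteq> set z"
    by (auto dest: in_set_butlastD list.set_sel(2)[rotated]) (metis in_set_butlastD list.set_sel(2) list.sel(2) empty_iff set_empty)+
  have "Fword Qf z = Fword Q z" "Fword Qf (winv (tl z)) = Fword Q (winv (tl z))"
    "Fword Qf (winv (butlast z)) = Fword Q (winv (butlast z))"
    "Fword Qf (winv (butlast (tl z))) = Fword Q (winv (butlast (tl z)))"
    using s by (intro z'; auto)+
  thus ?thesis by (simp add: completion_def)
qed

lemma cohook_ex:
  assumes "Tr j s \<in> letters Q"
  shows "\<exists>\<alpha> g. \<alpha> \<in> ordarr Qf \<and> pso Qf \<alpha> = (j, s) \<and> tail Qf (opp (pta Qf \<alpha>)) g \<and> mint Qf g"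
proof -
  have "j \<in> verts Q" "Tr j s \<in> letters Qf" using assms letters_sub by (simp, blast)
  then obtain \<alpha> where a: "\<alpha> \<in> ordarr Qf" "pso Qf \<alpha> = (j, s)" using degree_ord(1) by blast
  have "fst (opp (pta Qf \<alpha>)) \<in> verts Qf" "snd (opp (pta Qf \<alpha>)) \<in> {-1, 1}"
    using pta_range[OF Qf ordarr_arrs[OF a(1)]] by (auto simp: opp_def)
  from ext_tail_ex[OF Qf this, of True] show ?thesis using a by (auto simp: mint_ext)
qed

text \<open>If the two ends coincide, the same cohook is chosen at both of them. This keeps
  symmetric strings symmetric after prolongation.\<close>

lemma cohooked_ex:
  assumes "is_string Q w"
  obtains i r m j s \<alpha>L \<alpha>R gL gR where "cohooked Q Qf i r m j s \<alpha>L \<alpha>R gL gR" "w = TrI i r # m @ [Tr j s]"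
    "i = j \<and> r = s --> \<alpha>L = \<alpha>R \<and> gL = gR"
proof -
  obtain i r m j s where w: "w = TrI i r # m @ [Tr j s]" using string_split[OF assms] by metis
  have l: "Tr i r \<in> letters Q" "Tr j s \<in> letters Q" using assms w by (auto simp: is_string_def is_word_Cons is_word_append)
  obtain \<alpha>R gR where R: "\<alpha>R \<in> ordarr Qf" "pso Qf \<alpha>R = (j, s)" "tail Qf (opp (pta Qf \<alpha>R)) gR" "mint Qf gR"
    using cohook_ex[OF l(2)] by blast
  obtain \<alpha>L gL where L: "\<alpha>L \<in> ordarr Qf" "pso Qf \<alpha>L = (i, r)" "tail Qf (opp (pta Qf \<alpha>L)) gL" "mint Qf gL"
    "i = j \<and> r = s --> \<alpha>L = \<alpha>R \<and> gL = gR"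
  proof (cases "i = j \<and> r = s")
    case True
    thus ?thesis using R that by blast
  next
    case False
    thus ?thesis using cohook_ex[OF l(1)] that by blast
  qed
  have "cohooked Q Qf i r m j s \<alpha>L \<alpha>R gL gR" using assms w L R by unfold_locales auto
  thus ?thesis using that w L(5) by blast
qed

end

section \<open>The translates over both quivers of an admissible string\<close>

locale adm_cohooked = cohooked Q Qf i r m j s \<alpha>L \<alpha>R gL gR
  for Q Qf :: "('v, 'a) pquiver" and i r m j s \<alpha>L \<alpha>R gL gR +
  fixes x :: "('v, 'a) word"
  assumes x: "adm_string Q x" "\<not> (lpunct Q x \<and> rpunct Q x)" and xw: "completion Q x = w"
    and sym: "i = j \<and> r = s --> \<alpha>L = \<alpha>R \<and> gL = gR"
begin

lemma x_str: "is_string (hat Q) x" "is_string (hat Qf) x" "\<not> closed_type Q x" "\<not> closed_type Qf x"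
proof -
  show a: "is_string (hat Q) x" using x by (simp add: adm_string_def)
  thus "is_string (hat Qf) x" by (rule hat_string_sub)
  with a show "\<not> closed_type Q x" "\<not> closed_type Qf x" using x by (simp_all add: string_closed_type)
qed

lemma xw_f: "completion Qf x = w"
  using completion_eq[OF x_str(1)] xw by simp

sublocale H: hat_string Q x
  using Q x x_str by unfold_locales auto

text \<open>A symmetric \<open>w\<close> has coinciding ends and gets the same cohook on both sides,
  so \<open>W\<close> is symmetric too, with the same central special letter.\<close>

lemma punct_W:
  assumes "lpunct Q x \<or> rpunct Q x"
  shows "winv w = w" "winv W = W" "\<exists>c. length W = 2 * c + 1 \<and> is_spl (W ! c)" (is ?A)
proof -
  obtain u k where u: "w = Fword Q u @ [Spl k] @ winv (Fword Q u)"
    using H.punct_form[OF assms] xw unfolding H.W_def by metis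
  show ww: "winv w = w" by (simp add: u)
  have "winv (TrI i r # m @ [Tr j s]) = TrI j s # winv m @ [Tr i r]" by simp
  from trans[OF this[symmetric] ww[unfolded w_def]]
  have "winv m @ [Tr i r] = m @ [Tr j s]" by blast
  hence e: "i = j" "r = s" "winv m = m" unfolding append1_eq_conv letter.inject by blast+
  hence LR: "\<alpha>L = \<alpha>R" "gL = gR" using sym by blast+
  have "winv (winv gL @ Dir \<alpha>L # m @ Inv \<alpha>R # gR) = winv gR @ Dir \<alpha>R # winv m @ Inv \<alpha>L # gL" by simp
  also have "\<dots> = winv gL @ Dir \<alpha>L # m @ Inv \<alpha>R # gR" unfolding e(3) LR ..
  finally show WW: "winv W = W" unfolding W_def .
  obtain f f' where "trimmed_string Qf W f (-1) f' (-1) Q w 1 (length gL) (Suc (length gL + length m))" using trimmed_w by blast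
  then interpret T: trimmed_string Qf W f "-1" f' "-1" Q w 1 "length gL" "Suc (length gL + length m)" .
  define c where "c = length u"
  have c: "length w = 2 * c + 1" "w ! c = Spl k" by (simp_all add: u c_def nth_append)
  have lm: "length m + 1 = 2 * c" using c(1) by (simp add: w_def)
  hence c0: "0 < c" "c < Suc (length gL + length m) - length gL" by linarith+
  have "W ! (c + length gL) = Spl k" using T.W'_nth[OF c0] c(2) by simp
  moreover have "length W = 2 * (c + length gL) + 1" 
  proof -
    have "length W = length gL + (length m + 2) + length gR" unfolding W_def by simp
    moreover have "length gL = length gR" using LR(2) by (rule arg_cong)
    ultimately have "length W = 2 * length gL + (length m + 1) + 1" by linarith
    thus ?thesis unfolding lm by simp
  qed
  ultimately show ?A by (intro exI[of _ "c + length gL"]) simp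
qed

lemma W_nonzero: "\<not> lpunct Q x ==> \<not> rpunct Q x ==> k \<in> spos W ==> msgn (seq W) k \<noteq> 0"
proof -
  assume u: "\<not> lpunct Q x" "\<not> rpunct Q x" "k \<in> spos W"
  obtain f f' where "trimmed_string Qf W f (-1) f' (-1) Q w 1 (length gL) (Suc (length gL + length m))" using trimmed_w by blast
  then interpret T: trimmed_string Qf W f "-1" f' "-1" Q w 1 "length gL" "Suc (length gL + length m)" .
  show ?thesis using T.msgn_W_nonzero[OF _ u(3)] adm_uu_nonzero[OF Q x(1) u(1,2)] xw by simp
qed

lemma tau_f: "adm_string Qf (tau Qf x)" "completion Qf (tau Qf x) = W"
  "lpunct Q (tau Qf x) = lpunct Q x" "rpunct Q (tau Qf x) = rpunct Q x"
proof -
  have "\<exists>z. adm_string Qf z \<and> lpunct Qf z = lpunct Q x \<and> rpunct Qf z = rpunct Q x \<and> completion Qf z = W"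
    by (rule ex_adm[OF Qf lsucc_f(2) x(2)]) (use W_nonzero punct_W in blast)+
  then obtain z where z: "adm_string Qf z" "lpunct Qf z = lpunct Q x" "rpunct Qf z = rpunct Q x" "completion Qf z = W" by blast
  hence "tau Qf x = z" using tau_eq[OF Qf x_str(4)] x(2) xw_f tau_string_f by simp
  with z show "adm_string Qf (tau Qf x)" "completion Qf (tau Qf x) = W"
    "lpunct Q (tau Qf x) = lpunct Q x" "rpunct Q (tau Qf x) = rpunct Q x" by simp_all
qed

lemma prolongs_f: "\<exists>c. prolongs 1 Q Qf x (tau Qf x) c \<and> pi_emb Qf x = shift c"
proof -
  obtain f f' where "trimmed_string Qf W f (-1) f' (-1) Q w 1 (length gL) (Suc (length gL + length m))" using trimmed_w by blast
  then interpret T: trimmed_string Qf W f "-1" f' "-1" Q w 1 "length gL" "Suc (length gL + length m)" .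
  have "prolongs 1 Q Qf x (tau Qf x) (if lpunct Q x then 0 else length gL)"
  proof (rule T.prolongs[OF tau_f(1,2) x(1) xw x(2)])
    show "lso Q (hd w) = lso Qf (W ! length gL)" "lta Q (last w) = lta Qf (W ! Suc (length gL + length m))"
      by (simp_all add: w_def W_def nth_append L R)
  qed (use tau_f sploop_eq in simp_all)
  moreover have "pi_emb Qf x = shift (if lpunct Q x then 0 else length gL)"
    unfolding pi_emb_def xw_f left_step_f using x_str(4) by (simp add: W_def)
  ultimately show ?thesis by blast
qed

lemma projective_iff: "projective Q x \<longleftrightarrow> \<not> inv_before_dir"
  unfolding projective_def xw using x_str(3) proj_not_inv_before_dir not_inv_before_dir_proj by blast

lemma prolongs_tau:
  assumes "\<not> projective Q x"
  shows "\<exists>c. prolongs (-1) Q Qf (tau Q x) (tau Qf x) c \<and> sigma_emb Q x = shift c"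
proof -
  have ibd: "inv_before_dir" using assms projective_iff by blast
  obtain f f' q where t: "trimmed_string Qf W f (-1) f' (-1) Q (tau_string Q w) (-1) sshift q"
    "lso Q (hd (tau_string Q w)) = lso Qf (W ! sshift)" "lta Q (last (tau_string Q w)) = lta Qf (W ! q)"
    "winv W = W --> winv (tau_string Q w) = tau_string Q w" using trimmed_tau[OF ibd] by blast
  interpret T: trimmed_string Qf W f "-1" f' "-1" Q "tau_string Q w" "-1" sshift q by (rule t(1))
  have "\<exists>z. adm_string Q z \<and> lpunct Q z = lpunct Q x \<and> rpunct Q z = rpunct Q x \<and> completion Q z = tau_string Q w"
  proof (rule ex_adm[OF Q T.W' x(2)])
    show "msgn (seq (tau_string Q w)) j \<noteq> 0" if "\<not> lpunct Q x" "\<not> rpunct Q x" "j \<in> spos (tau_string Q w)" for j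
      using T.msgn_W'_nonzero[OF _ that(3)] W_nonzero[OF that(1,2)] by blast
    assume p: "lpunct Q x \<or> rpunct Q x"
    obtain c where c: "length W = 2 * c + 1" "is_spl (W ! c)" using punct_W(3)[OF p] by blast
    have e: "sshift + q = 2 * c" using T.symmetric_cut[OF punct_W(2)[OF p]] c by simp
    have k: "0 < c - sshift" "c - sshift < q - sshift" using e T.pq(1) by linarith+
    have "c - sshift + sshift = c" using k by linarith
    hence "tau_string Q w ! (c - sshift) = W ! c" using T.W'_nth[OF k] by simp
    moreover have "length (tau_string Q w) = 2 * (c - sshift) + 1" using T.len' e T.pq(1) by linarith
    ultimately show "winv (tau_string Q w) = tau_string Q w \<and>
        (\<exists>c. length (tau_string Q w) = 2 * c + 1 \<and> is_spl (tau_string Q w ! c))"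
      using t(4) punct_W(2)[OF p] c(2) by auto
  qed
  then obtain z where z: "adm_string Q z" "lpunct Q z = lpunct Q x" "rpunct Q z = rpunct Q x" "completion Q z = tau_string Q w" by blast
  hence tz: "tau Q x = z" using tau_eq[OF Q x_str(3) x(2)] xw by simp
  have "prolongs (-1) Q Qf z (tau Qf x) (if lpunct Q z then 0 else sshift)"
    by (rule T.prolongs[OF tau_f(1,2) z(1,4)]) (use tau_f sploop_eq z x(2) t(2,3) in simp_all)
  moreover have "sigma_emb Q x = shift (if lpunct Q z then 0 else sshift)"
    unfolding sigma_emb_def xw sshift_def using x_str(3) z(2) by (auto simp: Let_def split: prod.split)
  ultimately show ?thesis using tz by blast
qed

lemma outward_tau:
  assumes "projective Q x"
  shows "outward Qf (tau Qf x)"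
proof -
  have no: "\<not> inv_before_dir" using assms projective_iff by blast
  obtain f f' where e: "hd W = TrI f (-1)" "dead Qf f (-1)" "last W = Tr f' (-1)" "dead Qf f' (-1)" by (rule ends)
  interpret D: dead_string Qf W f "-1" f' "-1" using Qf lsucc_f(2) e by unfold_locales
  show ?thesis
    by (rule D.outward[OF tau_f(1,2)]) (use tau_f x(2) no in "auto simp: inv_before_dir_def")
qed

end

context fringed
begin

lemma adm_cohooked_ex:
  assumes x: "adm_string Q x" "\<not> (lpunct Q x \<and> rpunct Q x)"
  obtains i r m j s \<alpha>L \<alpha>R gL gR where "adm_cohooked Q Qf i r m j s \<alpha>L \<alpha>R gL gR x"
proof -
  have "is_string Q (completion Q x)" using completion_string[OF Q _ x(2)] x(1) by (simp add: adm_string_def)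
  then obtain i r m j s \<alpha>L \<alpha>R gL gR where c: "cohooked Q Qf i r m j s \<alpha>L \<alpha>R gL gR"
    "completion Q x = TrI i r # m @ [Tr j s]" "i = j \<and> r = s --> \<alpha>L = \<alpha>R \<and> gL = gR" by (rule cohooked_ex)
  have "adm_cohooked Q Qf i r m j s \<alpha>L \<alpha>R gL gR x"
    by (intro adm_cohooked.intro c(1) adm_cohooked_axioms.intro) (use x c cohooked.w_def[OF c(1)] in auto)
  thus ?thesis by (rule that)
qed

theorem tau_f_prolongs:
  assumes "adm_string Q x" "\<not> (lpunct Q x \<and> rpunct Q x)"
  shows "\<exists>c. prolongs 1 Q Qf x (tau Qf x) c \<and> pi_emb Qf x = shift c"
  using adm_cohooked_ex[OF assms] adm_cohooked.prolongs_f by metis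

theorem tau_prolongs:
  assumes "adm_string Q y" "\<not> (lpunct Q y \<and> rpunct Q y)" "\<not> projective Q y"
  shows "\<exists>c. prolongs (-1) Q Qf (tau Q y) (tau Qf y) c \<and> sigma_emb Q y = shift c"
  using adm_cohooked_ex[OF assms(1,2)] adm_cohooked.prolongs_tau assms(3) by metis

theorem tau_outward:
  assumes "adm_string Q y" "\<not> (lpunct Q y \<and> rpunct Q y)" "projective Q y"
  shows "outward Qf (tau Qf y)"
  using adm_cohooked_ex[OF assms(1,2)] adm_cohooked.outward_tau assms(3) by metis

end

subsection \<open>Half-edges\<close>

text \<open>The end of an arrow at a vertex, with its polarity. Both ends of a special loop are one
  and the same half-edge, in accordance with loops counting once for
  \<open>boundary\<close>.\<close>

definition half :: "('v, 'a) pquiver \<Rightarrow> 'v \<Rightarrow> int \<Rightarrow> 'a \<Rightarrow> bool" where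
  "half H i r a \<longleftrightarrow> a \<in> arrs H \<and> (pso H a = (i, r) \<or> pta H a = (i, r))"

text \<open>The common property of hereditary quivers and of the quivers \<open>Hx\<close>: every
  vertex has one slot for each of the two polarities, filled by at most one arrow. The quivers
  \<open>Hx\<close> are treated through this property, without a proof that they are
  hereditary.\<close>

definition polar :: "('v, 'a) pquiver \<Rightarrow> bool" where
  "polar H \<longleftrightarrow> (\<forall>i r a b. half H i r a \<and> half H i r b --> a = b) \<and>
     (\<forall>i r a. half H i r a --> i \<in> verts H \<and> (r = 1 \<or> r = -1)) \<and>
     (\<forall>a\<in>ordarr H. src H a \<noteq> tgt H a) \<and> (\<forall>a\<in>sparr H. pso H a = pta H a) \<and> finite (arrs H) \<and>
     sparr H \<inter> ordarr H = {}"

lemma half_src: "a \<in> arrs H ==> half H (src H a) (spol H a) a"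
  and half_tgt: "a \<in> arrs H ==> half H (tgt H a) (tpol H a) a"
  by (simp_all add: half_def src_def spol_def tgt_def tpol_def)

lemma half_incident: "half H i r a ==> a \<in> arrs H \<and> (src H a = i \<or> tgt H a = i)"
  by (auto simp: half_def src_def tgt_def)

lemma incident_half: "a \<in> arrs H ==> src H a = i \<or> tgt H a = i ==> \<exists>r. half H i r a"
  using half_src half_tgt by metis

lemma polar_unique: "polar H ==> half H i r a ==> half H i r b ==> a = b"
  and polar_range: "polar H ==> half H i r a ==> i \<in> verts H \<and> (r = 1 \<or> r = -1)"
  unfolding polar_def by blast+

lemma polar_half_pol:
  assumes H: "polar H" and a: "half H i r a" "half H i r' a"
  shows "r = r'"
proof (cases "a \<in> sparr H")
  case True
  hence "pso H a = pta H a" using H by (simp add: polar_def)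
  thus ?thesis using a by (auto simp: half_def)
next
  case False
  hence "a \<in> ordarr H" using a by (auto simp: half_def arrs_def)
  hence "src H a \<noteq> tgt H a" using H by (simp add: polar_def)
  thus ?thesis using a by (auto simp: half_def src_def tgt_def)
qed

text \<open>An arrow has only one polarity at a given vertex, so two different incident arrows fill
  both slots.\<close>

lemma polar_not_boundary:
  assumes H: "polar H"
  shows "\<not> boundary H j \<and> j \<in> verts H \<longleftrightarrow> (\<exists>a b. half H j 1 a \<and> half H j (-1) b)"
proof
  let ?I = "{a \<in> arrs H. src H a = j \<or> tgt H a = j}"
  assume "\<not> boundary H j \<and> j \<in> verts H"
  hence "\<not> card ?I \<le> 1" by (simp add: boundary_def)
  then obtain a b where ab: "a \<in> ?I" "b \<in> ?I" "a \<noteq> b"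
    by (metis (no_types, lifting) card_le_Suc0_iff_eq One_nat_def card.infinite le_zero_eq nat_le_linear zero_le)
  then obtain r r' where r: "half H j r a" "half H j r' b" using incident_half[of _ H j] by blast
  hence "r \<noteq> r'" using polar_unique[OF H] ab(3) by blast
  thus "\<exists>a b. half H j 1 a \<and> half H j (-1) b" using r polar_range[OF H] by blast
next
  let ?I = "{a \<in> arrs H. src H a = j \<or> tgt H a = j}"
  assume "\<exists>a b. half H j 1 a \<and> half H j (-1) b"
  then obtain a b where ab: "half H j 1 a" "half H j (-1) b" by blast
  have "a \<noteq> b" using polar_half_pol[OF H ab(1)] ab(2) by force
  have "{a, b} \<subseteq> ?I" using half_incident ab by fastforce
  moreover have "finite ?I" using H by (simp add: polar_def)
  ultimately have "card {a, b} \<le> card ?I" by (rule card_mono[rotated])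
  hence "\<not> card ?I \<le> 1" using \<open>a \<noteq> b\<close> by simp
  thus "\<not> boundary H j \<and> j \<in> verts H" using polar_range[OF H ab(1)] by (simp add: boundary_def)
qed

text \<open>Injectivity separates two sources and two targets with the same polarity. A source
  against a target is excluded by the last condition in \<open>hereditary\<close>.\<close>

lemma hereditary_polar:
  assumes "hereditary H"
  shows "polar H"
proof -
  have sg: "skewed_gentle H" using assms by (simp add: hereditary_def)
  have op: "\<And>a b. a \<in> arrs H ==> b \<in> arrs H ==> a \<noteq> b ==> src H a = tgt H b ==> spol H a = - tpol H b"
    using assms by (auto simp: hereditary_def)
  have rng: "i \<in> verts H \<and> (r = 1 \<or> r = -1)" if "half H i r a" for i r a
    using that pso_range[OF sg, of a] pta_range[OF sg, of a] by (auto simp: half_def)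
  have cross: "a = b" if "a \<in> arrs H" "b \<in> arrs H" "pso H a = (i, r)" "pta H b = (i, r)" for a b i r
  proof (rule ccontr)
    assume "a \<noteq> b"
    hence "spol H a = - tpol H b" using op[of a b] that by (simp add: src_def tgt_def)
    moreover have "r = 1 \<or> r = -1" using rng[of i r a] that by (simp add: half_def)
    ultimately show False using that by (auto simp: spol_def tpol_def)
  qed
  have "a = b" if "half H i r a" "half H i r b" for i r a b
    using that cross pso_inj[OF sg, of a b] pta_inj[OF sg, of a b] unfolding half_def by metis
  moreover have "src H a \<noteq> tgt H a" if "a \<in> ordarr H" for a
    using assms that ordarr_not_sparr[OF sg that] ordarr_arrs[OF that] unfolding hereditary_def by blast
  moreover have "pso H a = pta H a" if "a \<in> sparr H" for a using pso_special[OF sg that] by simp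
  moreover have "finite (arrs H)" "sparr H \<inter> ordarr H = {}" using sg by (auto simp: skewed_gentle_def arrs_def)
  ultimately show ?thesis unfolding polar_def using rng by blast
qed

lemma hom_pso:
  assumes f: "pq_hom H H' f" and a: "a \<in> arrs H"
  shows "snd f a \<in> arrs H'" "pso H' (snd f a) = (fst f (src H a), spol H a)" "pta H' (snd f a) = (fst f (tgt H a), tpol H a)"
  using assms unfolding pq_hom_def src_def tgt_def spol_def tpol_def by (auto simp: prod_eq_iff)

lemma hom_half:
  assumes f: "pq_hom H H' f" and h: "half H j r a"
  shows "half H' (fst f j) r (snd f a)"
  using h hom_pso[OF f, of a] unfolding half_def src_def tgt_def spol_def tpol_def by auto

text \<open>Homomorphisms preserve polarities. With both slots filled at \<open>j\<close>, both
  slots at its image are hit, and by uniqueness no other arrow can be there.\<close>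

lemma hom_cover:
  assumes H: "polar H" and H': "polar H'" and f: "pq_hom H H' f" and j: "\<not> boundary H j" "j \<in> verts H"
    and a': "a' \<in> arrs H'" "src H' a' = fst f j \<or> tgt H' a' = fst f j"
  shows "\<exists>a r. half H j r a \<and> snd f a = a'"
proof -
  obtain r where r: "half H' (fst f j) r a'" using incident_half[OF a'] by blast
  obtain a b where ab: "half H j 1 a" "half H j (-1) b" using polar_not_boundary[OF H, of j] j by blast
  from polar_range[OF H' r] show ?thesis
    using hom_half[OF f ab(1)] hom_half[OF f ab(2)] r polar_unique[OF H'] ab by metis
qed

lemma hom_not_boundary:
  assumes H: "polar H" and H': "polar H'" and f: "pq_hom H H' f" and j: "\<not> boundary H j" "j \<in> verts H"
  shows "\<not> boundary H' (fst f j)"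
  using polar_not_boundary[OF H, of j] polar_not_boundary[OF H', of "fst f j"] j hom_half[OF f] by blast

subsection \<open>The quivers of strings and bands\<close>

definition walk :: "('v, 'a) pquiver \<Rightarrow> ('v, 'a) word \<Rightarrow> bool" where
  "walk Q z \<longleftrightarrow> skewed_gentle Q \<and> (is_string (hat Q) z \<or> is_band (hat Q) z)"

definition ltv :: "('v, 'a) pquiver \<Rightarrow> ('v, 'a) word \<Rightarrow> nat \<Rightarrow> 'v \<times> int" where
  "ltv Q z k = the (lta Q (z ! k))"

lemma Hx_simps:
  "verts (Hx Q x) = (if is_string (hat Q) x then {1..length x - 1} else {0..<length x})"
  "sparr (Hx Q x) = (if lpunct Q x then {Eta0} else {}) \<union> (if rpunct Q x then {Eta1} else {})"
  "ordarr (Hx Q x) = (if is_string (hat Q) x then Nu ` {1..<length x - 1} else Nu ` {0..<length x})"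
  "pso (Hx Q x) (Nu i) = (if is_dir (x ! i) then hnext Q x i else i, spol Q (arrow_of (x ! i)))"
  "pta (Hx Q x) (Nu i) = (if is_dir (x ! i) then i else hnext Q x i, tpol Q (arrow_of (x ! i)))"
  "pso (Hx Q x) Eta0 = (1, spol Q (sploop Q (fst (the (lso Q (hd x))))))"
  "pta (Hx Q x) Eta0 = (1, tpol Q (sploop Q (fst (the (lso Q (hd x))))))"
  "pso (Hx Q x) Eta1 = (length x - 1, spol Q (sploop Q (fst (the (lta Q (last x))))))"
  "pta (Hx Q x) Eta1 = (length x - 1, tpol Q (sploop Q (fst (the (lta Q (last x))))))"
  by (simp_all add: Hx_def Gx_def)

lemma Gx_simps:
  "fst (Gx Q x) i = fst (ltv Q x i)" "snd (Gx Q x) (Nu i) = arrow_of (x ! i)"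
  "snd (Gx Q x) Eta0 = sploop Q (fst (the (lso Q (hd x))))" "snd (Gx Q x) Eta1 = sploop Q (fst (the (lta Q (last x))))"
  by (simp_all add: Gx_def ltv_def)

lemma band_nth:
  assumes b: "is_band Q' z" and k: "k < length z"
  shows "z ! k \<in> letters Q'" "follows Q' (z ! k) (z ! (Suc k mod length z))" (is ?A)
    "\<exists>j<length z. Suc j mod length z = k \<and> follows Q' (z ! j) (z ! k)" (is ?B)
proof -
  have w: "is_word Q' (z @ z)" using b by (simp add: is_band_def)
  have f: "follows Q' (z ! k) (z ! (Suc k mod length z))" if k: "k < length z" for k
  proof -
    have "follows Q' ((z @ z) ! k) ((z @ z) ! Suc k)" using word_nth[OF w, of k] k by simp
    thus ?thesis using k by (cases "Suc k < length z") (auto simp: nth_append not_less le_Suc_eq mod_Suc)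
  qed
  show "z ! k \<in> letters Q'" using w k by (auto simp: is_word_iff)
  show ?A by (rule f[OF k])
  show ?B
  proof (cases k)
    case 0
    have "Suc (length z - 1) mod length z = k" "length z - 1 < length z" using k 0 by simp_all
    thus ?thesis using f[of "length z - 1"] by (metis)
  next
    case (Suc j)
    hence "Suc j mod length z = k" "j < length z" using k by simp_all
    thus ?thesis using f[of j] by metis
  qed
qed

text \<open>A band of one letter would be an arrow composable with itself, with admissible paths of
  any length. Excluding this ensures that no ordinary arrow of \<open>Hx\<close> is a loop.\<close>

lemma band_length:
  assumes Q: "skewed_gentle Q" and b: "is_band (hat Q) z"
  shows "2 \<le> length z"
proof (rule ccontr)
  assume n: "\<not> 2 \<le> length z"
  have "length z = 1"
  proof -
    have "length z \<noteq> 0" using b by (simp add: is_band_def)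
    with n show ?thesis by linarith
  qed
  hence z: "z = [z ! 0]" by (metis length_0_conv length_Suc_conv nth_Cons_0 One_nat_def)
  have "follows (hat Q) (z ! 0) (z ! (Suc 0 mod length z))" using band_nth(2)[OF b, of 0] \<open>length z = 1\<close> by simp
  hence f: "follows Q (z ! 0) (z ! 0)" using \<open>length z = 1\<close> by simp
  have l: "z ! 0 \<in> letters (hat Q)" using band_nth(1)[OF b, of 0] \<open>length z = 1\<close> by simp
  obtain a where a: "a \<in> arrs Q" "pso Q a = opp (pta Q a)"
  proof (cases "z ! 0")
    case (Dir a)
    thus ?thesis using that[of a] f l by (auto simp: follows_def)
  next
    case (Inv a)
    thus ?thesis using that[of a] f l by (auto simp: follows_def)
  qed (use f l in "auto simp: follows_def")
  have "adm_path Q (replicate n a)" for n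
    using a by (auto simp: adm_path_def)
  hence "range (\<lambda>n. replicate n a) \<subseteq> {p. adm_path Q p}" by blast
  moreover have "inj (\<lambda>n. replicate n a)" by (rule injI) (metis length_replicate)
  ultimately have "infinite {p. adm_path Q p}"
    using finite_subset finite_imageD infinite_UNIV_nat by blast
  thus False using Q by (simp add: skewed_gentle_def)
qed

lemma walk_nu:
  assumes z: "walk Q z" and k: "Nu k \<in> ordarr (Hx Q z)"
  shows "\<exists>a\<in>arrs Q. z ! k = Dir a \<or> z ! k = Inv a" (is ?A) "k \<in> verts (Hx Q z)" "hnext Q z k \<in> verts (Hx Q z)"
    "lta Q (z ! k) = Some (ltv Q z k)" "lso Q (z ! k) = Some (opp (ltv Q z (hnext Q z k)))" (is ?B) "hnext Q z k \<noteq> k"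
proof -
  have Q: "skewed_gentle Q" using z by (simp add: walk_def)
  have main: "(?A) \<and> k \<in> verts (Hx Q z) \<and> hnext Q z k \<in> verts (Hx Q z) \<and>
    lta Q (z ! k) = Some (ltv Q z k) \<and> ?B \<and> hnext Q z k \<noteq> k"
  proof (cases "is_string (hat Q) z")
    case True
    have wd: "is_word (hat Q) z" using True by (simp add: is_string_def)
    have kk: "0 < k" "k < length z - 1" using k True by (auto simp: Hx_simps)
    have f: "follows Q (z ! k) (z ! Suc k)" using word_nth[OF wd, of k] kk by simp
    have f0: "follows Q (z ! (k - 1)) (z ! k)" using word_nth[OF wd, of "k - 1"] kk by simp
    have "z ! k \<in> letters (hat Q)" using word_letters[OF wd] kk by simp
    hence ?A using f f0 by (cases "z ! k") (auto simp: follows_def)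
    moreover have "lta Q (z ! k) = Some (ltv Q z k)" using f0 by (auto simp: follows_def ltv_def)
    moreover have "lso Q (z ! k) = Some (opp (ltv Q z (Suc k)))" using f by (auto simp: follows_def ltv_def)
    ultimately show ?thesis using kk True by (auto simp: Hx_simps hnext_def)
  next
    case False
    hence b: "is_band (hat Q) z" using z by (simp add: walk_def)
    have kk: "k < length z" using k False by (auto simp: Hx_simps)
    obtain j where j: "follows (hat Q) (z ! j) (z ! k)" using band_nth(3)[OF b kk] by blast
    note f = band_nth(2)[OF b kk]
    have ?A using band_nth(1)[OF b kk] j f
      by (cases "z ! k") (auto simp: follows_def)
    moreover have "lta Q (z ! k) = Some (ltv Q z k)" using j by (auto simp: follows_def ltv_def)
    moreover have "lso Q (z ! k) = Some (opp (ltv Q z (Suc k mod length z)))" using f by (auto simp: follows_def ltv_def)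
    moreover have "Suc k mod length z \<noteq> k" using band_length[OF Q b] kk by (cases "Suc k < length z") (auto simp: not_less le_Suc_eq)
    moreover have "Suc k mod length z < length z" by (rule mod_less_divisor) (use kk in linarith)
    ultimately show ?thesis using kk False by (simp add: Hx_simps hnext_def)
  qed
  thus ?A "k \<in> verts (Hx Q z)" "hnext Q z k \<in> verts (Hx Q z)"
    "lta Q (z ! k) = Some (ltv Q z k)" ?B "hnext Q z k \<noteq> k"
    by blast+
qed

lemma punct_string: "walk Q z ==> lpunct Q z \<or> rpunct Q z ==> is_string (hat Q) z"
proof (rule ccontr)
  assume z: "walk Q z" "lpunct Q z \<or> rpunct Q z" "\<not> is_string (hat Q) z"
  hence b: "is_band (hat Q) z" by (simp add: walk_def)
  hence ne: "z \<noteq> []" by (simp add: is_band_def)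
  have 0: "0 < length z" "length z - 1 < length z" using ne by auto
  have "\<exists>p. lta Q (hd z) = Some p" using band_nth(3)[OF b 0(1)] ne by (auto simp: follows_def hd_conv_nth)
  moreover have "\<exists>p. lso Q (last z) = Some p" using band_nth(2)[OF b 0(2)] ne by (auto simp: follows_def last_conv_nth)
  ultimately show False using z(2) by (auto simp: lpunct_def rpunct_def)
qed

lemma walk_eta0:
  assumes z: "walk Q z" and l: "lpunct Q z"
  obtains i where "i \<in> spverts Q" "hd z = TrI i (-1)" "ltv Q z 1 = (i, 1)" "1 \<in> verts (Hx Q z)" "is_string (hat Q) z"
proof -
  have s: "is_string (hat Q) z" using punct_string[OF z] l by blast
  obtain i where i: "i \<in> spverts Q" "hd z = TrI i (-1)" using l by (auto simp: lpunct_def)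
  have len: "2 \<le> length z" by (rule string_length[OF s])
  hence "follows (hat Q) (z ! 0) (z ! 1)" using word_nth[of "hat Q" z 0] s by (simp add: is_string_def)
  moreover have "z ! 0 = TrI i (-1)" using i len by (metis hd_conv_nth list.size(3) not_numeral_le_zero)
  ultimately have "ltv Q z 1 = (i, 1)" by (auto simp: follows_def ltv_def opp_def prod_eq_iff)
  thus ?thesis using that i s len by (simp add: Hx_simps)
qed

lemma walk_eta1:
  assumes z: "walk Q z" and l: "rpunct Q z"
  obtains i where "i \<in> spverts Q" "last z = Tr i (-1)" "ltv Q z (length z - 1) = (i, -1)"
    "length z - 1 \<in> verts (Hx Q z)" "is_string (hat Q) z"
proof -
  have s: "is_string (hat Q) z" using punct_string[OF z] l by blast
  obtain i where i: "i \<in> spverts Q" "last z = Tr i (-1)" using l by (auto simp: rpunct_def)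
  have len: "2 \<le> length z" by (rule string_length[OF s])
  hence "z ! (length z - 1) = Tr i (-1)" using i by (metis last_conv_nth list.size(3) not_numeral_le_zero)
  hence "ltv Q z (length z - 1) = (i, -1)" by (simp add: ltv_def)
  thus ?thesis using that i s len by (simp add: Hx_simps)
qed

lemma Hx_nu:
  assumes z: "walk Q z" and k: "Nu k \<in> ordarr (Hx Q z)"
  defines "p \<equiv> (k, snd (ltv Q z k))" and "q \<equiv> (hnext Q z k, - snd (ltv Q z (hnext Q z k)))"
  shows "is_dir (z ! k) ==> pta (Hx Q z) (Nu k) = p \<and> pso (Hx Q z) (Nu k) = q \<and>
      pta Q (snd (Gx Q z) (Nu k)) = ltv Q z k \<and> pso Q (snd (Gx Q z) (Nu k)) = opp (ltv Q z (hnext Q z k))" (is "PROP ?A")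
    "\<not> is_dir (z ! k) ==> pso (Hx Q z) (Nu k) = p \<and> pta (Hx Q z) (Nu k) = q \<and>
      pso Q (snd (Gx Q z) (Nu k)) = ltv Q z k \<and> pta Q (snd (Gx Q z) (Nu k)) = opp (ltv Q z (hnext Q z k))" (is "PROP ?B")
proof -
  note w = walk_nu[OF z k]
  obtain a where a: "a \<in> arrs Q" "z ! k = Dir a \<or> z ! k = Inv a" using w(1) by blast
  show "PROP ?A"
    using a w(4,5) by (elim disjE) (simp_all add: Hx_simps Gx_simps p_def q_def spol_def tpol_def opp_def)
  show "PROP ?B"
    using a w(4,5) by (elim disjE) (simp_all add: Hx_simps Gx_simps p_def q_def spol_def tpol_def opp_def)
qed

lemma Hx_arrow_cases:
  assumes "a \<in> arrs (Hx Q z)"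
  obtains (nu) k where "a = Nu k" "Nu k \<in> ordarr (Hx Q z)" | (eta0) "a = Eta0" "lpunct Q z" | (eta1) "a = Eta1" "rpunct Q z"
  using assms by (auto simp: arrs_def Hx_simps split: if_splits)

lemma Hx_eta:
  assumes z: "walk Q z"
  shows "lpunct Q z ==> pso (Hx Q z) Eta0 = (1, -1) \<and> pta (Hx Q z) Eta0 = (1, -1) \<and>
      snd (Gx Q z) Eta0 = sploop Q (fst (ltv Q z 1)) \<and> ltv Q z 1 = (fst (ltv Q z 1), 1) \<and> fst (ltv Q z 1) \<in> spverts Q" (is "PROP ?A")
    "rpunct Q z ==> pso (Hx Q z) Eta1 = (length z - 1, -1) \<and> pta (Hx Q z) Eta1 = (length z - 1, -1) \<and>
      snd (Gx Q z) Eta1 = sploop Q (fst (ltv Q z (length z - 1))) \<and> ltv Q z (length z - 1) = (fst (ltv Q z (length z - 1)), -1) \<and>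
      fst (ltv Q z (length z - 1)) \<in> spverts Q" (is "PROP ?B")
proof -
  have Q: "skewed_gentle Q" using z by (simp add: walk_def)
  have sp: "spol Q (sploop Q i) = -1" "tpol Q (sploop Q i) = -1" if "i \<in> spverts Q" for i
    using sploop[OF Q that] by (simp_all add: spol_def tpol_def)
  show "PROP ?A"
  proof -
    assume l: "lpunct Q z"
    obtain i where "i \<in> spverts Q" "hd z = TrI i (-1)" "ltv Q z 1 = (i, 1)" using walk_eta0[OF z l] by metis
    thus ?thesis using sp[of i] unfolding Hx_simps Gx_simps by simp
  qed
  show "PROP ?B"
  proof -
    assume l: "rpunct Q z"
    obtain i where "i \<in> spverts Q" "last z = Tr i (-1)" "ltv Q z (length z - 1) = (i, -1)" using walk_eta1[OF z l] by metis
    thus ?thesis using sp[of i] unfolding Hx_simps Gx_simps by simp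
  qed
qed

text \<open>The word passes a vertex \<open>i\<close> from the half-edge of polarity \<open>- snd (ltv Q z i)\<close> to the one of polarity
  \<open>snd (ltv Q z i)\<close>.\<close>

lemma half_Hx:
  assumes z: "walk Q z"
  shows "half (Hx Q z) i r a \<longleftrightarrow>
    (r = snd (ltv Q z i) \<and> (a = Nu i \<and> a \<in> ordarr (Hx Q z) \<or> a = Eta1 \<and> rpunct Q z \<and> i = length z - 1)) \<or>
    (r = - snd (ltv Q z i) \<and> ((\<exists>k. a = Nu k \<and> a \<in> ordarr (Hx Q z) \<and> hnext Q z k = i) \<or> a = Eta0 \<and> lpunct Q z \<and> i = 1))"
    (is "?L \<longleftrightarrow> ?R")
proof
  assume h: ?L
  hence a: "a \<in> arrs (Hx Q z)" by (simp add: half_def)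
  thus ?R
  proof (cases rule: Hx_arrow_cases)
    case (nu k)
    show ?thesis using h nu Hx_nu[OF z nu(2)] by (cases "is_dir (z ! k)") (auto simp: half_def)
  next
    case eta0
    hence "i = 1" "r = -1" using h Hx_eta(1)[OF z] by (auto simp: half_def)
    moreover have "snd (ltv Q z 1) = 1" using Hx_eta(1)[OF z eta0(2)] by (metis snd_conv)
    ultimately show ?thesis using eta0 by simp
  next
    case eta1
    hence "i = length z - 1" "r = -1" using h Hx_eta(2)[OF z] by (auto simp: half_def)
    moreover have "snd (ltv Q z (length z - 1)) = -1" using Hx_eta(2)[OF z eta1(2)] by (metis snd_conv)
    ultimately show ?thesis using eta1 by simp
  qed
next
  have o: "a \<in> ordarr (Hx Q z) ==> a \<in> arrs (Hx Q z)" for a by (simp add: arrs_def)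
  have e: "lpunct Q z ==> Eta0 \<in> arrs (Hx Q z)" "rpunct Q z ==> Eta1 \<in> arrs (Hx Q z)"
    by (simp_all add: arrs_def Hx_simps)
  assume ?R
  then consider "r = snd (ltv Q z i)" "a = Nu i" "Nu i \<in> ordarr (Hx Q z)"
    | "r = snd (ltv Q z i)" "a = Eta1" "rpunct Q z" "i = length z - 1"
    | k where "r = - snd (ltv Q z i)" "a = Nu k" "Nu k \<in> ordarr (Hx Q z)" "hnext Q z k = i"
    | "r = - snd (ltv Q z i)" "a = Eta0" "lpunct Q z" "i = 1" by auto
  thus ?L
  proof cases
    case 1
    thus ?thesis using Hx_nu[OF z 1(3)] o by (cases "is_dir (z ! i)") (auto simp: half_def)
  next
    case 2
    hence "r = -1" using Hx_eta(2)[OF z 2(3)] by (metis snd_conv)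
    thus ?thesis using 2 Hx_eta(2)[OF z 2(3)] e by (simp add: half_def)
  next
    case (3 k)
    thus ?thesis using Hx_nu[OF z 3(3)] o by (cases "is_dir (z ! k)") (auto simp: half_def)
  next
    case 4
    hence "r = -1" using Hx_eta(1)[OF z 4(3)] by (metis snd_conv)
    thus ?thesis using 4 Hx_eta(1)[OF z 4(3)] e by (simp add: half_def)
  qed
qed

lemma ltv_range:
  assumes z: "walk Q z" and i: "i \<in> verts (Hx Q z)"
  shows "lta Q (z ! i) = Some (ltv Q z i)" "snd (ltv Q z i) = 1 \<or> snd (ltv Q z i) = -1" (is ?A) "fst (ltv Q z i) \<in> verts Q"
proof -
  have Q: "skewed_gentle Q" using z by (simp add: walk_def)
  have "\<exists>p. lta Q (z ! i) = Some p \<and> z ! i \<in> letters (hat Q)"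
  proof (cases "is_string (hat Q) z")
    case True
    hence i': "0 < i" "i < length z" using i by (auto simp: Hx_simps)
    have wd: "is_word (hat Q) z" using True by (simp add: is_string_def)
    have "follows Q (z ! (i - 1)) (z ! i)" using word_nth[OF wd, of "i - 1"] i' by simp
    thus ?thesis using word_letters[OF wd i'(2)] by (auto simp: follows_def)
  next
    case False
    hence b: "is_band (hat Q) z" using z by (simp add: walk_def)
    have kk: "i < length z" using i False by (auto simp: Hx_simps)
    show ?thesis using band_nth(1,3)[OF b kk] by (auto simp: follows_def)
  qed
  then obtain p where p: "lta Q (z ! i) = Some p" "z ! i \<in> letters (hat Q)" by blast
  hence e: "ltv Q z i = p" by (simp add: ltv_def)
  show "lta Q (z ! i) = Some (ltv Q z i)" using p e by simp
  have "fst p \<in> verts Q \<and> (snd p = -1 \<or> snd p = 1)" using lta_range[OF skewed_gentle_hat[OF Q] p(2)] p(1) by simp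
  thus ?A "fst (ltv Q z i) \<in> verts Q" unfolding e by blast+
qed

lemma hnext_inj:
  assumes z: "walk Q z" and k: "Nu k \<in> ordarr (Hx Q z)" "Nu k' \<in> ordarr (Hx Q z)" "hnext Q z k = hnext Q z k'"
  shows "k = k'"
proof (cases "is_string (hat Q) z")
  case False
  hence "k < length z" "k' < length z" "Suc k mod length z = Suc k' mod length z"
    using k by (auto simp: Hx_simps hnext_def)
  thus ?thesis by (cases "Suc k < length z"; cases "Suc k' < length z") (auto simp: not_less le_Suc_eq)
qed (use k in "simp add: hnext_def")

lemma Hx_polar:
  assumes z: "walk Q z"
  shows "polar (Hx Q z)"
proof -
  note hH = half_Hx[OF z]
  have v0: "1 \<in> verts (Hx Q z)" if "lpunct Q z" using walk_eta0[OF z that] by metis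
  have v1: "length z - 1 \<in> verts (Hx Q z)" if "rpunct Q z" using walk_eta1[OF z that] by metis
  have vert: "i \<in> verts (Hx Q z)" if h: "half (Hx Q z) i r a" for i r a
    using h unfolding hH by (elim disjE conjE exE) (use v0 v1 walk_nu(2,3)[OF z] in auto)
  have pol: "r = 1 \<or> r = -1" if "half (Hx Q z) i r a" for i r a
    using ltv_range(2)[OF z vert[OF that]] that hH[of i r a] by auto
  \<comment> \<open>At a punctured end the slot of the special loop is not claimed by an ordinary
    arrow as well.\<close>
  have ex: "\<not> (Nu (length z - 1) \<in> ordarr (Hx Q z) \<and> rpunct Q z)"
    using punct_string[OF z] by (auto simp: Hx_simps)
  have ex0: "\<not> (Nu k \<in> ordarr (Hx Q z) \<and> hnext Q z k = 1 \<and> lpunct Q z)" for k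
    using punct_string[OF z] by (auto simp: Hx_simps hnext_def)
  have uniq: "a = b" if h: "half (Hx Q z) i r a" "half (Hx Q z) i r b" for i r a b
  proof -
    have "r \<noteq> 0" using pol[OF h(1)] by auto
    thus ?thesis using h unfolding hH using ex ex0 hnext_inj[OF z] by auto
  qed
  have "src (Hx Q z) a \<noteq> tgt (Hx Q z) a" if a: "a \<in> ordarr (Hx Q z)" for a
  proof -
    obtain k where k: "a = Nu k" using a by (auto simp: Hx_simps split: if_splits)
    show ?thesis using Hx_nu[OF z a[unfolded k]] walk_nu(6)[OF z a[unfolded k]] unfolding k src_def tgt_def
      by (cases "is_dir (z ! k)") auto
  qed
  moreover have "pso (Hx Q z) a = pta (Hx Q z) a" if "a \<in> sparr (Hx Q z)" for a
    using that Hx_eta[OF z] by (auto simp: Hx_simps(2) split: if_splits)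
  moreover have "finite (arrs (Hx Q z))" by (auto simp: arrs_def Hx_simps)
  moreover have "sparr (Hx Q z) \<inter> ordarr (Hx Q z) = {}" by (auto simp: Hx_simps)
  ultimately show ?thesis unfolding polar_def using uniq vert pol by blast
qed

lemma Gx_pso:
  assumes z: "walk Q z" and a: "a \<in> arrs (Hx Q z)"
  shows "snd (Gx Q z) a \<in> arrs Q" "pso Q (snd (Gx Q z) a) = (fst (Gx Q z) (src (Hx Q z) a), spol (Hx Q z) a)" (is ?A)
    "pta Q (snd (Gx Q z) a) = (fst (Gx Q z) (tgt (Hx Q z) a), tpol (Hx Q z) a)" (is ?B)
    "a \<in> sparr (Hx Q z) ==> snd (Gx Q z) a \<in> sparr Q" (is "PROP ?C")
proof -
  have Q: "skewed_gentle Q" using z by (simp add: walk_def)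
  have "snd (Gx Q z) a \<in> arrs Q \<and> ?A \<and>
    ?B \<and>
    (a \<in> sparr (Hx Q z) --> snd (Gx Q z) a \<in> sparr Q)"
    using a
  proof (cases rule: Hx_arrow_cases)
    case (nu k)
    have "snd (Gx Q z) (Nu k) \<in> arrs Q" using walk_nu(1)[OF z nu(2)] by (auto simp: Gx_simps)
    moreover have "Nu k \<notin> sparr (Hx Q z)" by (simp add: Hx_simps)
    ultimately show ?thesis unfolding nu(1) using Hx_nu[OF z nu(2)]
      by (cases "is_dir (z ! k)") (simp_all add: src_def tgt_def spol_def tpol_def Gx_simps(1) opp_def)
  next
    case eta0
    note e = Hx_eta(1)[OF z eta0(2)]
    thus ?thesis unfolding eta0(1) using sploop[OF Q, of "fst (ltv Q z 1)"] sparr_arrs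
      by (simp add: src_def tgt_def spol_def tpol_def Gx_simps(1))
  next
    case eta1
    note e = Hx_eta(2)[OF z eta1(2)]
    thus ?thesis unfolding eta1(1) using sploop[OF Q, of "fst (ltv Q z (length z - 1))"] sparr_arrs
      by (simp add: src_def tgt_def spol_def tpol_def Gx_simps(1))
  qed
  thus "snd (Gx Q z) a \<in> arrs Q" ?A
    ?B
    "PROP ?C" by blast+
qed

subsection \<open>Embeddings of quivers of words\<close>

text \<open>Heads and tails of arrows, exchanged for \<open>s = -1\<close>. Condition (q) is about
  heads for \<open>s = 1\<close>, condition (s) about heads for \<open>s = -1\<close>.\<close>

definition hdv :: "int \<Rightarrow> ('v, 'a) pquiver \<Rightarrow> 'a \<Rightarrow> 'v" where
  "hdv s H a = (if s = 1 then tgt H a else src H a)"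

definition tlv :: "int \<Rightarrow> ('v, 'a) pquiver \<Rightarrow> 'a \<Rightarrow> 'v" where
  "tlv s H a = (if s = 1 then src H a else tgt H a)"

lemma head_nu:
  assumes z: "walk Q z" and k: "Nu k \<in> ordarr (Hx Q z)" and s: "s = 1 \<or> s = -1"
  shows "cen (z ! k) = s ==> hdv s (Hx Q z) (Nu k) = hnext Q z k \<and> tlv s (Hx Q z) (Nu k) = k" (is "PROP ?A")
    "cen (z ! k) = - s ==> hdv s (Hx Q z) (Nu k) = k \<and> tlv s (Hx Q z) (Nu k) = hnext Q z k" (is "PROP ?B")
    "cen (z ! k) = s \<or> cen (z ! k) = - s" (is ?C)
proof -
  obtain a where a: "z ! k = Dir a \<or> z ! k = Inv a" using walk_nu(1)[OF z k] by blast
  show "PROP ?A"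
    "PROP ?B"
    ?C
    using a s by (auto simp: hdv_def tlv_def src_def tgt_def Hx_simps is_dir_def)
qed

lemma boundary_ends:
  assumes z: "walk Q z" and st: "is_string (hat Q) z"
  shows "\<not> lpunct Q z ==> boundary (Hx Q z) 1" "\<not> rpunct Q z ==> boundary (Hx Q z) (length z - 1)"
    "i \<in> verts (Hx Q z) ==> 1 < i \<or> lpunct Q z ==> i < length z - 1 \<or> rpunct Q z ==> \<not> boundary (Hx Q z) i"
proof -
  have len: "2 \<le> length z" by (rule string_length[OF st])
  have v: "1 \<in> verts (Hx Q z)" "length z - 1 \<in> verts (Hx Q z)" using st len by (auto simp: Hx_simps)
  note pb = polar_not_boundary[OF Hx_polar[OF z]]
  have hn: "hnext Q z k = Suc k" for k using st by (simp add: hnext_def)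
  have ord: "Nu k \<in> ordarr (Hx Q z) \<longleftrightarrow> 0 < k \<and> k < length z - 1" for k using st by (auto simp: Hx_simps)
  have eta: "Eta0 \<notin> ordarr (Hx Q z)" "Eta1 \<notin> ordarr (Hx Q z)" using st by (auto simp: Hx_simps)
  show "boundary (Hx Q z) 1" if l: "\<not> lpunct Q z"
  proof (rule ccontr)
    assume "\<not> boundary (Hx Q z) 1"
    then obtain a b where ab: "half (Hx Q z) 1 1 a" "half (Hx Q z) 1 (-1) b" using pb[of 1] v by blast
    have "\<not> half (Hx Q z) 1 (- snd (ltv Q z 1)) a" for a
    proof
      assume h: "half (Hx Q z) 1 (- snd (ltv Q z 1)) a"
      have "snd (ltv Q z 1) \<noteq> - snd (ltv Q z 1)" using ltv_range(2)[OF z v(1)] by auto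
      thus False using h l unfolding half_Hx[OF z] hn by (auto simp: ord)
    qed
    thus False using ab ltv_range(2)[OF z v(1)] by (metis minus_minus)
  qed
  show "boundary (Hx Q z) (length z - 1)" if l: "\<not> rpunct Q z"
  proof (rule ccontr)
    assume "\<not> boundary (Hx Q z) (length z - 1)"
    then obtain a b where ab: "half (Hx Q z) (length z - 1) 1 a" "half (Hx Q z) (length z - 1) (-1) b"
      using pb[of "length z - 1"] v by blast
    have "\<not> half (Hx Q z) (length z - 1) (snd (ltv Q z (length z - 1))) a" for a
    proof
      assume h: "half (Hx Q z) (length z - 1) (snd (ltv Q z (length z - 1))) a"
      have "snd (ltv Q z (length z - 1)) \<noteq> - snd (ltv Q z (length z - 1))" using ltv_range(2)[OF z v(2)] by auto
      thus False using h l unfolding half_Hx[OF z] hn by (auto simp: ord)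
    qed
    thus False using ab ltv_range(2)[OF z v(2)] by metis
  qed
  show "\<not> boundary (Hx Q z) i" if i: "i \<in> verts (Hx Q z)" "1 < i \<or> lpunct Q z" "i < length z - 1 \<or> rpunct Q z"
  proof -
    have ir: "0 < i" "i \<le> length z - 1" using i(1) st by (auto simp: Hx_simps)
    have "\<exists>a. half (Hx Q z) i (snd (ltv Q z i)) a"
    proof (cases "i < length z - 1")
      case True
      hence "Nu i \<in> ordarr (Hx Q z)" using ord ir by blast
      thus ?thesis unfolding half_Hx[OF z] by blast
    next
      case False
      hence "rpunct Q z" "i = length z - 1" using i ir by auto
      thus ?thesis unfolding half_Hx[OF z] by blast
    qed
    moreover have "\<exists>a. half (Hx Q z) i (- snd (ltv Q z i)) a"
    proof (cases "1 < i")
      case True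
      hence "Nu (i - 1) \<in> ordarr (Hx Q z)" "hnext Q z (i - 1) = i" using ord ir hn by auto
      thus ?thesis unfolding half_Hx[OF z] by blast
    next
      case False
      hence "lpunct Q z" "i = 1" using i ir by auto
      thus ?thesis unfolding half_Hx[OF z] by blast
    qed
    ultimately show ?thesis using pb[of i] ltv_range(2)[OF z i(1)] by (metis minus_minus)
  qed
qed

lemma band_not_boundary:
  assumes z: "walk Q z" and b: "is_band (hat Q) z"
  shows "\<not> boundary (Hx Q z) i"
proof
  assume bd: "boundary (Hx Q z) i"
  hence i: "i \<in> verts (Hx Q z)" by (simp add: boundary_def)
  have ns: "\<not> is_string (hat Q) z" using string_not_band b by blast
  have il: "i < length z" using i ns by (simp add: Hx_simps)
  have ord: "Nu k \<in> ordarr (Hx Q z) \<longleftrightarrow> k < length z" for k using ns by (auto simp: Hx_simps)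
  obtain j where "j < length z" "Suc j mod length z = i" using band_nth(3)[OF b il] by blast
  hence "Nu j \<in> ordarr (Hx Q z) \<and> hnext Q z j = i" using ord ns by (simp add: hnext_def)
  hence "\<exists>a. half (Hx Q z) i (- snd (ltv Q z i)) a" unfolding half_Hx[OF z] by blast
  moreover have "\<exists>a. half (Hx Q z) i (snd (ltv Q z i)) a" using ord il unfolding half_Hx[OF z] by blast
  ultimately show False
    using polar_not_boundary[OF Hx_polar[OF z], of i] bd i ltv_range(2)[OF z i] by (metis minus_minus)
qed

text \<open>The vertices outside \<open>I\<close> can be left along arrows, against the direction of the arrows if \<open>s = 1\<close>,
  until a boundary vertex is reached.\<close>

definition drains :: "int \<Rightarrow> (nat, harrow) pquiver \<Rightarrow> nat set \<Rightarrow> bool" where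
  "drains s H I \<longleftrightarrow> (\<exists>\<mu>::nat \<Rightarrow> nat. \<forall>i\<in>verts H - I. boundary H i \<or>
     (\<exists>a\<in>ordarr H. hdv s H a = i \<and> tlv s H a \<in> verts H - I \<and> \<mu> (tlv s H a) < \<mu> i))"

text \<open>Direct letters come before inverse ones. So from a vertex preceded by direct letters
  only, following arrows leads to the left end, and from the other vertices it leads to the right
  end. At a punctured end, all letters have the direction that leads to the opposite end. The
  measure counts the distance to the end in question.\<close>

lemma outward_drains:
  assumes z: "walk Q z" and o: "outward Q z"
  shows "drains (-1) (Hx Q z) {}"
proof -
  have st: "is_string (hat Q) z" and np: "\<not> (lpunct Q z \<and> rpunct Q z)" using o by (auto simp: outward_def)
  have ord: "Nu k \<in> ordarr (Hx Q z) \<longleftrightarrow> 0 < k \<and> k < length z - 1" for k using st by (auto simp: Hx_simps)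
  have hn: "hnext Q z k = Suc k" for k using st by (simp add: hnext_def)
  have vt: "i \<in> verts (Hx Q z) \<longleftrightarrow> 0 < i \<and> i \<le> length z - 1" for i using st by (auto simp: Hx_simps)
  define L where "L i \<longleftrightarrow> \<not> lpunct Q z \<and> (\<forall>k. 0 < k \<and> k < i --> cen (z ! k) = -1)" for i
  define \<mu> where "\<mu> i = (if L i then i else length z - i)" for i
  have "boundary (Hx Q z) i \<or> (\<exists>a\<in>ordarr (Hx Q z). hdv (-1) (Hx Q z) a = i \<and>
      tlv (-1) (Hx Q z) a \<in> verts (Hx Q z) \<and> \<mu> (tlv (-1) (Hx Q z) a) < \<mu> i)" if i: "i \<in> verts (Hx Q z)" for i
  proof (cases "L i")
    case True
    show ?thesis
    proof (cases "i = 1")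
      case i1: True
      thus ?thesis using boundary_ends(1)[OF z st] True by (simp add: L_def)
    next
      case False
      define k where "k = i - 1"
      have k: "i = Suc k" "0 < k" "k < length z - 1" using i False unfolding vt k_def by auto
      have kk: "Nu k \<in> ordarr (Hx Q z)" using k ord by blast
      have c: "cen (z ! k) = -1" using True k by (auto simp: L_def)
      have "L k" using True k by (auto simp: L_def)
      have "hdv (-1) (Hx Q z) (Nu k) = i \<and> tlv (-1) (Hx Q z) (Nu k) = k" using head_nu(1)[OF z kk, of "-1"] c hn k by simp
      moreover have "\<mu> k < \<mu> i" using True \<open>L k\<close> k by (simp add: \<mu>_def)
      moreover have "k \<in> verts (Hx Q z)" using k vt by simp
      ultimately show ?thesis using kk by metis
    qed
  next
    case False
    show ?thesis
    proof (cases "i = length z - 1")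
      case last: True
      have "\<not> rpunct Q z"
      proof
        assume r: "rpunct Q z"
        hence "\<not> lpunct Q z" using np by blast
        moreover have "\<forall>k. 0 < k \<and> k < i --> cen (z ! k) = -1" using o r last by (auto simp: outward_def)
        ultimately show False using False by (simp add: L_def)
      qed
      thus ?thesis using boundary_ends(2)[OF z st] last by simp
    next
      case nl: False
      hence il: "0 < i" "i < length z - 1" using i vt by auto
      have kk: "Nu i \<in> ordarr (Hx Q z)" using il ord by blast
      have c: "cen (z ! i) = 1"
      proof (rule ccontr)
        assume n: "cen (z ! i) \<noteq> 1"
        have nl': "\<not> lpunct Q z" using o n il by (auto simp: outward_def)
        then obtain k where k: "0 < k" "k < i" "cen (z ! k) \<noteq> -1" using False by (auto simp: L_def)
        have "Nu k \<in> ordarr (Hx Q z)" using k il ord by auto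
        hence "cen (z ! k) = 1" using head_nu(3)[OF z, of k 1] k(3) by auto
        moreover have "cen (z ! i) = -1" using head_nu(3)[OF z kk, of 1] n by auto
        ultimately show False using o k il unfolding outward_def by blast
      qed
      have nL: "\<not> L (Suc i)" using False by (auto simp: L_def)
      have "hdv (-1) (Hx Q z) (Nu i) = i \<and> tlv (-1) (Hx Q z) (Nu i) = Suc i" using head_nu(2)[OF z kk, of "-1"] c hn by simp
      moreover have "\<mu> (Suc i) < \<mu> i" using False nL il by (simp add: \<mu>_def)
      moreover have "Suc i \<in> verts (Hx Q z)" using il vt by simp
      ultimately show ?thesis using kk by metis
    qed
  qed
  thus ?thesis unfolding drains_def by auto
qed

text \<open>The second alternative of \<open>emb\<close> is for bands, on which \<open>tau\<close>
  is the identity. Strings of type \<open>(p, p)\<close> are covered by \<open>prolongs\<close>,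
  with nothing added at either end.\<close>

locale embedded = fringed +
  fixes s :: int and z Z :: "('a, 'b) word" and c :: nat
  assumes wz: "walk Q z" and wZ: "walk Qf Z" and s: "s = 1 \<or> s = -1"
    and emb: "prolongs s Q Qf z Z c \<or> Z = z \<and> c = 0 \<and> is_band (hat Q) z"
begin

abbreviation "H \<equiv> Hx Q z"
abbreviation "H' \<equiv> Hx Qf Z"
abbreviation "G \<equiv> Gx Q z"
abbreviation "G' \<equiv> Gx Qf Z"
abbreviation "im \<equiv> (\<lambda>i. i + c) ` verts H"

lemma not_band: "is_string (hat Q) z ==> prolongs s Q Qf z Z c"
  using emb string_not_band by blast

lemma string_iff: "is_string (hat Qf) Z \<longleftrightarrow> is_string (hat Q) z"
proof
  assume Z: "is_string (hat Qf) Z"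
  show "is_string (hat Q) z"
  proof (cases "prolongs s Q Qf z Z c")
    case False
    hence "is_band (hat Q) z" "Z = z" using emb by auto
    hence "is_band (hat Qf) Z" using hat_word_sub by (auto simp: is_band_def)
    thus ?thesis using string_not_band[OF Z] by blast
  qed (simp add: prolongs_def)
qed (use not_band in "auto simp: prolongs_def")

lemma band_case: "\<not> is_string (hat Q) z ==> Z = z \<and> c = 0 \<and> is_band (hat Q) z"
  using emb by (auto simp: prolongs_def)

lemma punct: "lpunct Qf Z = lpunct Q z" "rpunct Qf Z = rpunct Q z"
  using emb by (auto simp: prolongs_def)

lemma len:
  assumes st: "is_string (hat Q) z"
  shows "2 \<le> length z" "if lpunct Q z then c = 0 else 0 < c" (is ?A)
    "if rpunct Q z then length Z = length z + c else length z + c < length Z" (is ?B)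
proof -
  show "2 \<le> length z" by (rule string_length[OF st])
  show ?A ?B
    using not_band[OF st] by (auto simp: prolongs_def)
qed

lemma vert: "i \<in> verts H ==> i + c \<in> verts H'"
proof (cases "is_string (hat Q) z")
  case True
  assume "i \<in> verts H"
  thus ?thesis using len[OF True] True string_iff by (auto simp: Hx_simps split: if_splits)
next
  case False
  assume "i \<in> verts H"
  thus ?thesis using band_case[OF False] False string_iff by (simp add: Hx_simps)
qed

lemma nu_shift:
  assumes k: "Nu k \<in> ordarr H"
  shows "Nu (k + c) \<in> ordarr H'" "Z ! (k + c) = z ! k" "hnext Qf Z (k + c) = hnext Q z k + c" (is ?A)
proof -
  have "Nu (k + c) \<in> ordarr H' \<and> Z ! (k + c) = z ! k \<and> ?A"
  proof (cases "is_string (hat Q) z")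
    case True
    have kk: "0 < k" "k < length z - 1" using k True by (auto simp: Hx_simps)
    hence "Z ! (k + c) = z ! k" using not_band[OF True] by (simp add: prolongs_def)
    thus ?thesis using kk len[OF True] True string_iff by (auto simp: Hx_simps hnext_def split: if_splits)
  next
    case False
    thus ?thesis using band_case[OF False] k string_iff by (auto simp: Hx_simps hnext_def)
  qed
  thus "Nu (k + c) \<in> ordarr H'" "Z ! (k + c) = z ! k" ?A by blast+
qed

lemma ltv_shift:
  assumes i: "i \<in> verts H"
  shows "ltv Qf Z (i + c) = ltv Q z i"
proof (cases "Nu i \<in> ordarr H")
  case True
  obtain a where a: "a \<in> arrs Q" "z ! i = Dir a \<or> z ! i = Inv a" using walk_nu(1)[OF wz True] by blast
  thus ?thesis using pso_eq[OF a(1)] pta_eq[OF a(1)] nu_shift(2)[OF True] by (auto simp: ltv_def)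
next
  case False
  have st: "is_string (hat Q) z"
  proof (rule ccontr)
    assume "\<not> is_string (hat Q) z"
    thus False using False i by (simp add: Hx_simps)
  qed
  have i1: "i = length z - 1" using i False st by (auto simp: Hx_simps)
  have z: "z \<noteq> []" "last z = z ! i" using st i1 by (auto simp: is_string_def last_conv_nth)
  show ?thesis
  proof (cases "rpunct Q z")
    case True
    have "length Z = length z + c" "last Z = last z" using not_band[OF st] True by (auto simp: prolongs_def)
    moreover have "Z \<noteq> []" using st string_iff by (auto simp: is_string_def)
    ultimately have "Z ! (i + c) = z ! i" using i1 z len(1)[OF st] by (simp add: last_conv_nth)
    thus ?thesis using z True by (auto simp: ltv_def rpunct_def)
  next
    case False
    hence "lta Qf (Z ! (i + c)) = lta Q (z ! i)" using not_band[OF st] i1 z by (simp add: prolongs_def)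
    thus ?thesis by (simp add: ltv_def)
  qed
qed

lemma fst_G: "i \<in> verts H ==> fst G' (i + c) = fst G i"
  by (simp add: Gx_simps ltv_shift)

lemma sparr: "sparr H' = sparr H"
  unfolding Hx_simps punct ..

lemma sparr_fix: "a \<in> sparr H ==> shift_arrow c a = a"
  by (auto simp: Hx_simps split: if_splits)

lemma ord: "a \<in> ordarr H ==> shift_arrow c a \<in> ordarr H'"
proof -
  assume a: "a \<in> ordarr H"
  then obtain k where k: "a = Nu k" by (auto simp: Hx_simps split: if_splits)
  show ?thesis using nu_shift(1)[of k] a k by simp
qed

lemma arr: "a \<in> arrs H ==> shift_arrow c a \<in> arrs H'"
  using ord sparr_fix by (auto simp: arrs_def sparr)

lemma shift_pso:
  assumes a: "a \<in> arrs H"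
  shows "pso H' (shift_arrow c a) = (src H a + c, spol H a)" (is ?A) "pta H' (shift_arrow c a) = (tgt H a + c, tpol H a)" (is ?B)
    "snd G' (shift_arrow c a) = snd G a"
proof -
  have "?A \<and> ?B \<and>
    snd G' (shift_arrow c a) = snd G a"
    using a
  proof (cases rule: Hx_arrow_cases)
    case (nu k)
    note n = nu_shift[OF nu(2)]
    obtain a where a: "a \<in> arrs Q" "z ! k = Dir a \<or> z ! k = Inv a" using walk_nu(1)[OF wz nu(2)] by blast
    thus ?thesis unfolding nu(1) using n pso_eq[OF a(1)] pta_eq[OF a(1)]
      by (auto simp: Hx_simps Gx_simps src_def tgt_def spol_def tpol_def is_dir_def)
  next
    case eta0
    hence st: "is_string (hat Q) z" using punct_string[OF wz] by blast
    have c: "c = 0" using len[OF st] eta0 by simp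
    have v: "1 \<in> verts H" using len(1)[OF st] st by (simp add: Hx_simps)
    show ?thesis unfolding eta0(1) using Hx_eta(1)[OF wz eta0(2)] Hx_eta(1)[OF wZ] punct eta0(2) ltv_shift[OF v] c
      by (simp add: src_def tgt_def spol_def tpol_def sploop_eq)
  next
    case eta1
    hence st: "is_string (hat Q) z" using punct_string[OF wz] by blast
    have c: "length Z = length z + c" using len[OF st] eta1 by simp
    have l2: "length Z - 1 = (length z - 1) + c" using c len(1)[OF st] by simp
    have v: "length z - 1 \<in> verts H" using len(1)[OF st] st by (simp add: Hx_simps)
    have l: "ltv Qf Z (length Z - 1) = ltv Q z (length z - 1)" using ltv_shift[OF v] l2 by simp
    have rZ: "rpunct Qf Z" using punct eta1(2) by simp
    show ?thesis unfolding eta1(1) using Hx_eta(2)[OF wz eta1(2)] Hx_eta(2)[OF wZ rZ] l l2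
      by (simp add: src_def tgt_def spol_def tpol_def sploop_eq)
  qed
  thus ?A ?B
    "snd G' (shift_arrow c a) = snd G a" by blast+
qed

lemma extra_arrow:
  assumes k: "Nu k \<in> ordarr H'" "Nu k \<notin> shift_arrow c ` ordarr H"
  shows "is_string (hat Q) z \<and> hnext Qf Z k = Suc k \<and>
    (\<not> lpunct Q z \<and> 0 < k \<and> (k < c \<and> cen (Z ! k) = s \<or> k = c \<and> cen (Z ! k) = - s \<and> \<not> is_spl (Flet Qf (Z ! k))) \<or>
     \<not> rpunct Q z \<and> (length z - 1 + c < k \<and> cen (Z ! k) = - s \<or>
       k = length z - 1 + c \<and> cen (Z ! k) = s \<and> \<not> is_spl (Flet Qf (Z ! k))))"
proof -
  have img: "Nu j \<in> ordarr H ==> k = j + c ==> False" for j using k(2) by (metis image_eqI shift_arrow.simps(1))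
  have st: "is_string (hat Q) z"
  proof (rule ccontr)
    assume n: "\<not> is_string (hat Q) z"
    hence "Nu k \<in> ordarr H" using k(1) band_case[OF n] string_iff by (simp add: Hx_simps)
    thus False using img[of k] band_case[OF n] by simp
  qed
  have kk: "0 < k" "k < length Z - 1" using k(1) st string_iff by (auto simp: Hx_simps)
  note p = not_band[OF st, unfolded prolongs_def]
  have "k \<le> c \<or> length z - 1 + c \<le> k"
  proof (rule ccontr)
    assume n: "\<not> (k \<le> c \<or> length z - 1 + c \<le> k)"
    moreover have "Nu j \<in> ordarr H \<longleftrightarrow> 0 < j \<and> j < length z - 1" for j using st by (auto simp: Hx_simps)
    ultimately have "Nu (k - c) \<in> ordarr H" by (simp add: less_diff_conv2)
    thus False using img[of "k - c"] n by simp
  qed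
  moreover have hn: "hnext Qf Z k = Suc k" using st string_iff by (simp add: hnext_def)
  ultimately show ?thesis
  proof (elim disjE)
    assume kc: "k \<le> c"
    hence l: "\<not> lpunct Q z" using p kk by auto
    hence "cen (Z ! c) = - s \<and> \<not> is_spl (Flet Qf (Z ! c)) \<and> (\<forall>k. 0 < k \<and> k < c --> cen (Z ! k) = s)" using p by simp
    thus ?thesis using st hn l kc kk by (cases "k = c") auto
  next
    assume kc: "length z - 1 + c \<le> k"
    hence l: "\<not> rpunct Q z" using p kk by auto
    hence "cen (Z ! (length z - 1 + c)) = s \<and> \<not> is_spl (Flet Qf (Z ! (length z - 1 + c))) \<and>
      (\<forall>k. length z - 1 + c < k \<and> k < length Z - 1 --> cen (Z ! k) = - s)" using p by simp
    thus ?thesis using st hn l kc kk by (cases "k = length z - 1 + c") auto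
  qed
qed

lemma im_iff: "is_string (hat Q) z ==> k \<in> im \<longleftrightarrow> c < k \<and> k \<le> length z - 1 + c"
proof
  assume st: "is_string (hat Q) z" and k: "c < k \<and> k \<le> length z - 1 + c"
  hence "k - c \<in> verts H" "k = (k - c) + c" by (auto simp: Hx_simps)
  thus "k \<in> im" by blast
qed (auto simp: Hx_simps)

text \<open>The letter next to an end of the image has the value that makes its arrow leave the
  image, in the sense of \<open>s\<close>. It is not special, so for h-lines leaving along it is
  detected by red vertices.\<close>

lemma extra_head:
  assumes a: "a \<in> ordarr H'" "a \<notin> shift_arrow c ` ordarr H"
  shows "hdv s H' a \<notin> im" "tlv s H' a \<in> im ==> snd G' a \<notin> sparr Qf"
proof -
  obtain k where k: "a = Nu k" using a(1) by (auto simp: Hx_simps split: if_splits)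
  note e = extra_arrow[OF a[unfolded k]]
  hence st: "is_string (hat Q) z" by blast
  note l = len[OF st]
  note hd = head_nu[OF wZ a(1)[unfolded k] s]
  show "hdv s H' a \<notin> im" unfolding k im_iff[OF st] using e hd(1,2) l(1) by (auto split: if_splits)
  show "snd G' a \<notin> sparr Qf" if t: "tlv s H' a \<in> im"
  proof -
    have "\<not> is_spl (Flet Qf (Z ! k))" using t e hd(1,2) l(1) unfolding k im_iff[OF st] by (auto split: if_splits)
    thus ?thesis using walk_nu(1)[OF wZ a(1)[unfolded k]] unfolding k by (auto simp: Gx_simps is_spl_def)
  qed
qed

text \<open>Beyond the arrow next to the image all arrows have the other orientation, so going from
  heads to tails means moving away from the image, down in index on the left and up on the right.
  The measure counts the letters that remain.\<close>

lemma drain: "drains s H' im"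
proof -
  define \<mu> where "\<mu> i = (if i \<le> c then i else length Z - i)" for i
  have "boundary H' i \<or> (\<exists>a\<in>ordarr H'. hdv s H' a = i \<and> tlv s H' a \<in> verts H' - im \<and> \<mu> (tlv s H' a) < \<mu> i)"
    if i: "i \<in> verts H'" "i \<notin> im" for i
  proof -
    have st: "is_string (hat Q) z"
    proof (rule ccontr)
      assume n: "\<not> is_string (hat Q) z"
      hence "verts H' = im" using band_case[OF n] string_iff by (auto simp: Hx_simps)
      thus False using i by blast
    qed
    have stZ: "is_string (hat Qf) Z" using st string_iff by simp
    note l = len[OF st]
    note p = not_band[OF st, unfolded prolongs_def]
    have ordn: "Nu k \<in> ordarr H' \<longleftrightarrow> 0 < k \<and> k < length Z - 1" for k using stZ by (auto simp: Hx_simps)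
    have hn: "hnext Qf Z k = Suc k" for k using stZ by (simp add: hnext_def)
    have vt: "i \<in> verts H' \<longleftrightarrow> 0 < i \<and> i \<le> length Z - 1" for i using stZ by (auto simp: Hx_simps)
    have lZ: "length z + c \<le> length Z" using l(3) by (auto split: if_splits)
    consider "i \<le> c" | "length z - 1 + c < i" using i(2) im_iff[OF st] by force
    thus ?thesis
    proof cases
      case 1
      hence nl: "\<not> lpunct Q z" using l(2) i(1) vt by (auto split: if_splits)
      show ?thesis
      proof (cases "i = 1")
        case True
        thus ?thesis using boundary_ends(1)[OF wZ stZ] nl punct by simp
      next
        case False
        define k where "k = i - 1"
        have k: "i = Suc k" "0 < k" "k < c" using 1 i(1) False unfolding vt k_def by auto
        have kk: "Nu k \<in> ordarr H'" using k lZ l(1) unfolding ordn by linarith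
        have "cen (Z ! k) = s" using p nl k by simp
        hence "hdv s H' (Nu k) = i \<and> tlv s H' (Nu k) = k" using head_nu(1)[OF wZ kk s] hn k by simp
        moreover have "\<mu> k < \<mu> i" using k 1 by (simp add: \<mu>_def)
        moreover have "k \<in> verts H' - im" using k lZ im_iff[OF st] vt l(1) by auto
        ultimately show ?thesis using kk by metis
      qed
    next
      case 2
      have nl: "\<not> rpunct Q z" using l(1,3) i(1) 2 vt by (auto split: if_splits)
      show ?thesis
      proof (cases "i = length Z - 1")
        case True
        thus ?thesis using boundary_ends(2)[OF wZ stZ] nl punct by simp
      next
        case False
        hence k: "0 < i" "i < length Z - 1" using i(1) unfolding vt by auto
        hence kk: "Nu i \<in> ordarr H'" unfolding ordn by simp
        have "cen (Z ! i) = - s" using p nl k 2 by simp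
        hence "hdv s H' (Nu i) = i \<and> tlv s H' (Nu i) = Suc i" using head_nu(2)[OF wZ kk s] hn by simp
        moreover have "\<mu> (Suc i) < \<mu> i"
        proof -
          have "c < i" using 2 l(1) by linarith
          thus ?thesis using k by (simp add: \<mu>_def)
        qed
        moreover have "Suc i \<in> verts H' - im" using k im_iff[OF st] vt 2 by auto
        ultimately show ?thesis using kk by metis
      qed
    qed
  qed
  thus ?thesis unfolding drains_def by blast
qed

text \<open>An unpunctured end has been prolonged, and a punctured end carries a special loop that
  fills the second slot.\<close>

lemma im_inner: "i \<in> im ==> \<not> boundary H' i"
proof (cases "is_string (hat Q) z")
  case True
  assume i: "i \<in> im"
  have v: "i \<in> verts H'" using i vert by blast
  show ?thesis using i boundary_ends(3)[OF wZ _ v] True string_iff len[OF True] unfolding im_iff[OF True] punct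
    by (auto split: if_splits)
next
  case False
  hence "is_band (hat Qf) Z" using band_case[OF False] hat_word_sub by (auto simp: is_band_def)
  thus ?thesis by (rule band_not_boundary[OF wZ])
qed

end

context fringed
begin

lemma embedded_prolongs: "s = 1 \<or> s = -1 ==> prolongs s Q Qf z Z c ==> embedded Q Qf s z Z c"
  by unfold_locales (auto simp: walk_def prolongs_def Q Qf)

lemma embedded_closed:
  assumes s: "s = 1 \<or> s = -1" and z: "adm_string Q z \<or> adm_band Q z" and cl: "closed_type Q z"
  shows "embedded Q Qf s z z 0" "closed_type Qf z"
proof -
  have "embedded Q Qf s z z 0 \<and> closed_type Qf z"
  proof (cases "is_band (hat Q) z")
    case True
    hence "is_band (hat Qf) z" using hat_word_sub by (simp add: is_band_def)
    thus ?thesis using True s by (auto intro!: embedded.intro embedded_axioms.intro fringed.intro fr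
      simp: walk_def Q Qf closed_type_def)
  next
    case False
    hence st: "is_string (hat Q) z" and p: "lpunct Q z" "rpunct Q z"
      using z cl by (auto simp: adm_string_def adm_band_def closed_type_def)
    have "prolongs s Q Qf z z 0" using st p hat_string_sub[OF st] by (simp add: prolongs_def)
    thus ?thesis using embedded_prolongs[OF s] p by (simp add: closed_type_def)
  qed
  thus "embedded Q Qf s z z 0" "closed_type Qf z" by blast+
qed

lemma pi_embedded:
  assumes x: "x \<in> Adm Q"
  obtains c where "pi_emb Qf x = shift c" "embedded Q Qf 1 x (tau Qf x) c"
proof (cases "closed_type Q x")
  case True
  have "embedded Q Qf 1 x x 0" "closed_type Qf x" using embedded_closed[OF _ _ True, of 1] x by (auto simp: Adm_def)
  thus ?thesis using that[of 0] by (simp add: pi_emb_def tau_def)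
next
  case False
  hence "adm_string Q x" "\<not> (lpunct Q x \<and> rpunct Q x)" using x by (auto simp: Adm_def adm_band_def closed_type_def)
  thus ?thesis using tau_f_prolongs[of x] embedded_prolongs[of 1] that by blast
qed

lemma sigma_embedded:
  assumes y: "y \<in> Adm Q" and np: "\<not> projective Q y"
  obtains c where "sigma_emb Q y = shift c" "embedded Q Qf (-1) (tau Q y) (tau Qf y) c"
proof (cases "closed_type Q y")
  case True
  have "embedded Q Qf (-1) y y 0" "closed_type Qf y" using embedded_closed[OF _ _ True, of "-1"] y by (auto simp: Adm_def)
  thus ?thesis using that[of 0] True by (simp add: sigma_emb_def tau_def)
next
  case False
  hence "adm_string Q y" "\<not> (lpunct Q y \<and> rpunct Q y)" using y by (auto simp: Adm_def adm_band_def closed_type_def)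
  thus ?thesis using tau_prolongs[of y] np embedded_prolongs[of "-1"] that by blast
qed

lemma projective_drains:
  assumes y: "y \<in> Adm Q" and p: "projective Q y"
  shows "walk Qf (tau Qf y)" "drains (-1) (Hx Qf (tau Qf y)) {}"
proof -
  have "adm_string Q y" "\<not> (lpunct Q y \<and> rpunct Q y)"
    using y p by (auto simp: Adm_def adm_band_def closed_type_def projective_def)
  hence o: "outward Qf (tau Qf y)" using tau_outward p by blast
  thus w: "walk Qf (tau Qf y)" by (auto simp: walk_def Qf outward_def)
  show "drains (-1) (Hx Qf (tau Qf y)) {}" by (rule outward_drains[OF w o])
qed

end

subsection \<open>Isomorphisms and windings\<close>

lemma qcomp_simps [simp]: "fst (qcomp g f) i = fst g (fst f i)" "snd (qcomp g f) a = snd g (snd f a)"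
  by (simp_all add: qcomp_def)

lemma pq_hom_qmap_eq:
  assumes "pq_hom H Q f" "qmap_eq H f g" "skewed_gentle H"
  shows "pq_hom H Q g"
proof -
  have e: "\<And>i. i \<in> verts H ==> fst g i = fst f i" "\<And>a. a \<in> arrs H ==> snd g a = snd f a"
    using assms(2) by (auto simp: qmap_eq_def)
  have v: "src H a \<in> verts H" "tgt H a \<in> verts H" if "a \<in> arrs H" for a
    using pso_range[OF assms(3) that] pta_range[OF assms(3) that] by (simp_all add: src_def tgt_def)
  have "fst g ` verts H = fst f ` verts H" "snd g ` arrs H = snd f ` arrs H" "snd g ` sparr H = snd f ` sparr H"
    using e e(2)[OF sparr_arrs[of _ H]] by (auto intro!: image_cong)
  thus ?thesis using assms(1) e v unfolding pq_hom_def by simp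
qed

lemma pq_hom_comp: "pq_hom H H' f ==> pq_hom H' Q g ==> skewed_gentle H ==> pq_hom H Q (qcomp g f)"
  unfolding pq_hom_def qcomp_def by (auto simp: image_subset_iff)

lemma strict_hom_comp:
  "strict_hom H H' f ==> strict_hom H' Q g ==> skewed_gentle H ==> strict_hom H Q (qcomp g f)"
  unfolding strict_hom_def using pq_hom_comp[of H H' f Q g] by (auto simp: image_subset_iff)

lemma strict_hom_simps:
  assumes "strict_hom H H' f"
  shows "i \<in> verts H ==> fst f i \<in> verts H'" "a \<in> arrs H ==> snd f a \<in> arrs H'"
    "a \<in> ordarr H ==> snd f a \<in> ordarr H'" "a \<in> sparr H ==> snd f a \<in> sparr H'"
    "a \<in> arrs H ==> src H' (snd f a) = fst f (src H a)" "a \<in> arrs H ==> tgt H' (snd f a) = fst f (tgt H a)"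
    "a \<in> arrs H ==> spol H' (snd f a) = spol H a" "a \<in> arrs H ==> tpol H' (snd f a) = tpol H a"
  using assms unfolding strict_hom_def pq_hom_def by auto

lemma is_iso_refl: "is_iso H G H G (id, id)"
proof -
  have "is_mor H G H G (id, id)"
    by (auto simp: is_mor_def strict_hom_def pq_hom_def qmap_eq_def)
  thus ?thesis unfolding is_iso_def by (intro conjI exI[of _ "(id, id)"]) (auto simp: qmap_eq_def)
qed

lemma is_mor_comp:
  assumes "is_mor H G H' G' f" "is_mor H' G' H'' G'' f'" "skewed_gentle H"
  shows "is_mor H G H'' G'' (qcomp f' f)"
  using assms strict_hom_comp[of H H' f H'' f'] strict_hom_simps(1,2)[of H H' f]
  unfolding is_mor_def by (auto simp: qmap_eq_def)

lemma is_isoE: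
  assumes "is_iso H G H' G' f"
  obtains g where "is_mor H G H' G' f" "is_mor H' G' H G g" "is_iso H' G' H G g"
    "\<And>i. i \<in> verts H ==> fst g (fst f i) = i" "\<And>a. a \<in> arrs H ==> snd g (snd f a) = a"
    "\<And>i. i \<in> verts H' ==> fst f (fst g i) = i" "\<And>a. a \<in> arrs H' ==> snd f (snd g a) = a"
    "strict_hom H H' f" "strict_hom H' H g"
proof -
  obtain g where g: "is_mor H G H' G' f" "is_mor H' G' H G g" "qmap_eq H (qcomp g f) (id, id)"
    "qmap_eq H' (qcomp f g) (id, id)" using assms unfolding is_iso_def by blast
  hence "is_iso H' G' H G g" unfolding is_iso_def by blast
  thus ?thesis using that[of g] g by (auto simp: qmap_eq_def is_mor_def)
qed

lemma triple_equiv_refl: "triple_equiv T T"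
  unfolding triple_equiv_def by (intro exI[of _ "(id, id)"]) (auto simp: is_iso_refl qmap_eq_def)

lemma triple_equiv_sym: "triple_equiv T T' ==> triple_equiv T' T"
proof -
  assume "triple_equiv T T'"
  then obtain f where f: "is_iso (hquiv T) (wind T) (hquiv T') (wind T') f"
    "qmap_eq (hquiv T) (phiq T) (qcomp (phiq T') f)" "qmap_eq (hquiv T) (phis T) (qcomp (phis T') f)"
    unfolding triple_equiv_def by blast
  from f(1) obtain g where g: "is_iso (hquiv T') (wind T') (hquiv T) (wind T) g"
    "\<And>i. i \<in> verts (hquiv T') ==> fst f (fst g i) = i" "\<And>a. a \<in> arrs (hquiv T') ==> snd f (snd g a) = a"
    "strict_hom (hquiv T') (hquiv T) g" by (rule is_isoE) blast
  note s = strict_hom_simps(1,2)[OF g(4)]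
  have "qmap_eq (hquiv T') (phiq T') (qcomp (phiq T) g)" "qmap_eq (hquiv T') (phis T') (qcomp (phis T) g)"
    using f(2,3) g(2,3) s by (simp_all add: qmap_eq_def)
  thus ?thesis unfolding triple_equiv_def using g(1) by blast
qed

lemma triple_equiv_trans:
  assumes "triple_equiv T T'" "triple_equiv T' T''" "skewed_gentle (hquiv T)" "skewed_gentle (hquiv T'')"
  shows "triple_equiv T T''"
proof -
  obtain f where f: "is_iso (hquiv T) (wind T) (hquiv T') (wind T') f"
    "qmap_eq (hquiv T) (phiq T) (qcomp (phiq T') f)" "qmap_eq (hquiv T) (phis T) (qcomp (phis T') f)"
    using assms(1) unfolding triple_equiv_def by blast
  obtain h where h: "is_iso (hquiv T') (wind T') (hquiv T'') (wind T'') h"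
    "qmap_eq (hquiv T') (phiq T') (qcomp (phiq T'') h)" "qmap_eq (hquiv T') (phis T') (qcomp (phis T'') h)"
    using assms(2) unfolding triple_equiv_def by blast
  from f(1) obtain g where g: "is_mor (hquiv T) (wind T) (hquiv T') (wind T') f" "is_mor (hquiv T') (wind T') (hquiv T) (wind T) g"
    "\<And>i. i \<in> verts (hquiv T) ==> fst g (fst f i) = i" "\<And>a. a \<in> arrs (hquiv T) ==> snd g (snd f a) = a"
    "\<And>i. i \<in> verts (hquiv T') ==> fst f (fst g i) = i" "\<And>a. a \<in> arrs (hquiv T') ==> snd f (snd g a) = a"
    "strict_hom (hquiv T) (hquiv T') f" by (rule is_isoE) blast
  from h(1) obtain k where k: "is_mor (hquiv T') (wind T') (hquiv T'') (wind T'') h" "is_mor (hquiv T'') (wind T'') (hquiv T') (wind T') k"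
    "\<And>i. i \<in> verts (hquiv T') ==> fst k (fst h i) = i" "\<And>a. a \<in> arrs (hquiv T') ==> snd k (snd h a) = a"
    "\<And>i. i \<in> verts (hquiv T'') ==> fst h (fst k i) = i" "\<And>a. a \<in> arrs (hquiv T'') ==> snd h (snd k a) = a"
    "strict_hom (hquiv T'') (hquiv T') k" by (rule is_isoE) blast
  note sf = strict_hom_simps(1,2)[OF g(7)] and sk = strict_hom_simps(1,2)[OF k(7)]
  have "is_iso (hquiv T) (wind T) (hquiv T'') (wind T'') (qcomp h f)" unfolding is_iso_def
  proof (intro conjI exI[of _ "qcomp g k"])
    show "is_mor (hquiv T) (wind T) (hquiv T'') (wind T'') (qcomp h f)" by (rule is_mor_comp[OF g(1) k(1) assms(3)])
    show "is_mor (hquiv T'') (wind T'') (hquiv T) (wind T) (qcomp g k)" by (rule is_mor_comp[OF k(2) g(2) assms(4)])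
    show "qmap_eq (hquiv T) (qcomp (qcomp g k) (qcomp h f)) (id, id)" using sf g(3,4) k(3,4) by (simp add: qmap_eq_def)
    show "qmap_eq (hquiv T'') (qcomp (qcomp h f) (qcomp g k)) (id, id)" using sk g(5,6) k(5,6) by (simp add: qmap_eq_def)
  qed
  moreover have "qmap_eq (hquiv T) (phiq T) (qcomp (phiq T'') (qcomp h f))" "qmap_eq (hquiv T) (phis T) (qcomp (phis T'') (qcomp h f))"
    using f(2,3) h(2,3) sf by (simp_all add: qmap_eq_def)
  ultimately show ?thesis unfolding triple_equiv_def by blast
qed

lemma has_gtype_iso:
  assumes i: "is_iso H G H' G' f" and t: "has_gtype H ty"
  shows "has_gtype H' ty"
proof -
  from i obtain g where g: "\<And>i. i \<in> verts H ==> fst g (fst f i) = i" "\<And>a. a \<in> arrs H ==> snd g (snd f a) = a"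
    "\<And>i. i \<in> verts H' ==> fst f (fst g i) = i" "\<And>a. a \<in> arrs H' ==> snd f (snd g a) = a"
    and sf: "strict_hom H H' f" and sg: "strict_hom H' H g" by (rule is_isoE) blast
  have bv: "bij_betw (fst f) (verts H) (verts H')" and ba: "bij_betw (snd f) (arrs H) (arrs H')"
    using g strict_hom_simps(1,2)[OF sf] strict_hom_simps(1,2)[OF sg] by (auto intro!: bij_betw_byWitness[where f' = "fst g"]
        bij_betw_byWitness[where f' = "snd g"])
  have j: "joins H a u w ==> a \<in> arrs H ==> joins H' (snd f a) (fst f u) (fst f w)" for a u w
    using strict_hom_simps(5,6)[OF sf, of a] unfolding joins_def by (metis image_empty image_insert)
  have lin: "linear_on H' n (fst f \<circ> v) (snd f \<circ> e)" if l: "linear_on H n v e" and ar: "e ` {1..<n} \<subseteq> arrs H" for n v e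
  proof -
    have "inj_on (snd f \<circ> e) {1..<n}" using l ar ba
      by (intro comp_inj_on) (auto simp: linear_on_def bij_betw_def intro: inj_on_subset)
    moreover have "bij_betw (fst f \<circ> v) {1..n} (verts H')" using l bv by (auto simp: linear_on_def intro: bij_betw_trans)
    moreover have "joins H' (snd f (e k)) (fst f (v k)) (fst f (v (Suc k)))" if "k \<in> {1..<n}" for k
      by (rule j) (use l ar that in "auto simp: linear_on_def")
    ultimately show ?thesis using l by (simp add: linear_on_def)
  qed
  have im: "arrs H' = snd f ` arrs H" using ba by (simp add: bij_betw_def)
  note st = strict_hom_simps(5,6)[OF sf]
  show ?thesis
  proof (cases ty)
    case (TyA n)
    then obtain v e where v: "linear_on H n v e" "arrs H = e ` {1..<n}" using t by auto
    have "arrs H' = (snd f \<circ> e) ` {1..<n}" unfolding im v(2) by (simp add: image_comp)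
    thus ?thesis unfolding TyA has_gtype.simps using lin[OF v(1)] v(2) by blast
  next
    case (TyD n)
    then obtain v e l where v: "linear_on H n v e" "arrs H = e ` {1..<n} \<union> {l}" "src H l = v n" "tgt H l = v n"
      using t by auto
    have "arrs H' = (snd f \<circ> e) ` {1..<n} \<union> {snd f l}" unfolding im v(2) by (simp add: image_Un image_comp)
    moreover have "src H' (snd f l) = (fst f \<circ> v) n" "tgt H' (snd f l) = (fst f \<circ> v) n" using st[of l] v by simp_all
    moreover have "linear_on H' n (fst f \<circ> v) (snd f \<circ> e)" by (rule lin[OF v(1)]) (use v(2) in auto)
    ultimately show ?thesis unfolding TyD has_gtype.simps by blast
  next
    case (TyAt n)
    then obtain v e where v: "n \<ge> 2" "bij_betw v {1..n} (verts H)" "bij_betw e {1..n} (arrs H)"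
      "\<forall>k\<in>{1..n}. joins H (e k) (v k) (v (if k < n then Suc k else 1))" using t by auto
    have "joins H' ((snd f \<circ> e) k) ((fst f \<circ> v) k) ((fst f \<circ> v) (if k < n then Suc k else 1))" if "k \<in> {1..n}" for k
      unfolding comp_apply by (rule j) (use v that in "auto simp: bij_betw_def")
    moreover have "bij_betw (fst f \<circ> v) {1..n} (verts H')" "bij_betw (snd f \<circ> e) {1..n} (arrs H')"
      using v(2,3) bv ba bij_betw_trans by blast+
    ultimately show ?thesis unfolding TyAt has_gtype.simps using v(1) by blast
  next
    case (TyDt n)
    then obtain v e l l' where v: "n \<ge> 2" "linear_on H n v e" "arrs H = e ` {1..<n} \<union> {l, l'}"
      "src H l = v 1" "tgt H l = v 1" "src H l' = v n" "tgt H l' = v n" using t by auto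
    have "arrs H' = (snd f \<circ> e) ` {1..<n} \<union> {snd f l, snd f l'}" unfolding im v(3) by (simp add: image_Un image_comp)
    moreover have "src H' (snd f l) = (fst f \<circ> v) 1" "tgt H' (snd f l) = (fst f \<circ> v) 1"
      "src H' (snd f l') = (fst f \<circ> v) n" "tgt H' (snd f l') = (fst f \<circ> v) n" using st[of l] st[of l'] v by simp_all
    moreover have "linear_on H' n (fst f \<circ> v) (snd f \<circ> e)" by (rule lin[OF v(2)]) (use v(3) in auto)
    ultimately show ?thesis unfolding TyDt has_gtype.simps using v(1) by blast
  qed
qed

lemma has_gtype_path:
  assumes "has_gtype H ty"
  obtains n :: nat and v where "1 \<le> n" "bij_betw v {1..n} (verts H)"
    "\<And>k. k \<in> {1..<n} ==> \<exists>a\<in>arrs H. joins H a (v k) (v (Suc k))"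
proof -
  have lin: "\<exists>n v. 1 \<le> n \<and> bij_betw v {1..n} (verts H) \<and> (\<forall>k\<in>{1..<n}. \<exists>a\<in>arrs H. joins H a (v k) (v (Suc k)))"
    if "linear_on H n v e" "e ` {1..<n} \<subseteq> arrs H" for n v e
    using that by (intro exI[of _ n] exI[of _ v]) (auto simp: linear_on_def)
  have "\<exists>n v. 1 \<le> n \<and> bij_betw v {1..n} (verts H) \<and> (\<forall>k\<in>{1..<n}. \<exists>a\<in>arrs H. joins H a (v k) (v (Suc k)))"
  proof (cases ty)
    case (TyAt n)
    then obtain v e where v: "n \<ge> 2" "bij_betw v {1..n} (verts H)" "bij_betw e {1..n} (arrs H)"
      "\<forall>k\<in>{1..n}. joins H (e k) (v k) (v (if k < n then Suc k else 1))" using assms by auto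
    have "\<exists>a\<in>arrs H. joins H a (v k) (v (Suc k))" if k: "k \<in> {1..<n}" for k
    proof
      show "joins H (e k) (v k) (v (Suc k))" using v(4) k by (auto dest: bspec[of _ _ k])
      show "e k \<in> arrs H" using v(3) k by (auto simp: bij_betw_def)
    qed
    thus ?thesis using v(1,2) by (intro exI[of _ n] exI[of _ v]) auto
  next
    case (TyA n)
    then obtain v e where "linear_on H n v e" "arrs H = e ` {1..<n}" using assms by auto
    thus ?thesis using lin[of n v e] by blast
  next
    case (TyD n)
    then obtain v e l where "linear_on H n v e" "arrs H = e ` {1..<n} \<union> {l}" using assms by auto
    thus ?thesis using lin[of n v e] by blast
  next
    case (TyDt n)
    then obtain v e l l' where "linear_on H n v e" "arrs H = e ` {1..<n} \<union> {l, l'}" using assms by auto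
    thus ?thesis using lin[of n v e] by blast
  qed
  thus ?thesis using that by blast
qed

lemma has_gtype_connected:
  assumes t: "has_gtype H ty" and S: "S \<subseteq> verts H" "S \<noteq> {}"
    and cl: "\<And>a. a \<in> arrs H ==> src H a \<in> S \<longleftrightarrow> tgt H a \<in> S"
  shows "S = verts H"
proof -
  from t obtain n :: nat and v where v: "1 \<le> n" "bij_betw v {1..n} (verts H)"
    "\<And>k. k \<in> {1..<n} ==> \<exists>a\<in>arrs H. joins H a (v k) (v (Suc k))" by (rule has_gtype_path) blast
  have step: "v k \<in> S \<longleftrightarrow> v (Suc k) \<in> S" if k: "k \<in> {1..<n}" for k
  proof -
    obtain a where a: "a \<in> arrs H" "{src H a, tgt H a} = {v k, v (Suc k)}" using v(3)[OF k] by (auto simp: joins_def)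
    thus ?thesis using cl[OF a(1)] by (metis doubleton_eq_iff)
  qed
  have all: "v k \<in> S \<longleftrightarrow> v 1 \<in> S" if "1 \<le> k" "k \<le> n" for k
    using that
  proof (induction k rule: dec_induct)
    case (step k)
    thus ?case using \<open>\<And>k. k \<in> {1..<n} ==> v k \<in> S \<longleftrightarrow> v (Suc k) \<in> S\<close>[of k] by auto
  qed simp
  have im: "verts H = v ` {1..n}" using v(2) by (simp add: bij_betw_def)
  obtain i where "i \<in> S" using S(2) by blast
  moreover hence "i \<in> v ` {1..n}" using S(1) im by blast
  ultimately obtain k where "k \<in> {1..n}" "v k \<in> S" by blast
  hence "v 1 \<in> S" using all[of k] by simp
  thus ?thesis using all S(1) im by auto
qed

lemma closed_no_boundary:
  assumes t: "has_gtype H (TyAt n) \<or> has_gtype H (TyDt n)" and fin: "finite (arrs H)"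
  shows "\<not> boundary H i"
proof
  assume b: "boundary H i"
  have two: False if "a \<in> arrs H" "b \<in> arrs H" "a \<noteq> b" "src H a = i \<or> tgt H a = i" "src H b = i \<or> tgt H b = i" for a b
  proof -
    have "{a, b} \<subseteq> {a \<in> arrs H. src H a = i \<or> tgt H a = i}" using that by blast
    hence "card {a, b} \<le> card {a \<in> arrs H. src H a = i \<or> tgt H a = i}" using fin by (intro card_mono) auto
    thus False using b that(3) by (simp add: boundary_def)
  qed
  have jn: "joins H a u w ==> (src H a = u \<or> tgt H a = u) \<and> (src H a = w \<or> tgt H a = w)" for a u w
    by (auto simp: joins_def doubleton_eq_iff)
  have iv: "i \<in> verts H" using b by (simp add: boundary_def)
  show False using t
  proof
    assume "has_gtype H (TyAt n)"
    then obtain v e where v: "n \<ge> 2" "bij_betw v {1..n} (verts H)" "bij_betw e {1..n} (arrs H)"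
      "\<forall>k\<in>{1..n}. joins H (e k) (v k) (v (if k < n then Suc k else 1))" by auto
    have "i \<in> v ` {1..n}" using iv v(2) by (simp add: bij_betw_def)
    then obtain k where k: "k \<in> {1..n}" "i = v k" by blast
    define k' where "k' = (if k = 1 then n else k - 1)"
    have k': "k' \<in> {1..n}" "(if k' < n then Suc k' else 1) = k" "k' \<noteq> k" using k v(1) by (auto simp: k'_def)
    have "joins H (e k) (v k) (v (if k < n then Suc k else 1))" "joins H (e k') (v k') (v k)"
      using v(4) k(1) k'(1,2) by metis+
    moreover have "e k \<in> arrs H" "e k' \<in> arrs H" "e k \<noteq> e k'"
      using v(3) k(1) k'(1,3) unfolding bij_betw_def by (blast, blast, metis inj_on_eq_iff)
    ultimately show False using two[of "e k" "e k'"] jn k(2) by blast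
  next
    assume "has_gtype H (TyDt n)"
    then obtain v e l l' where v: "n \<ge> 2" "linear_on H n v e" "arrs H = e ` {1..<n} \<union> {l, l'}"
      "src H l = v 1" "tgt H l = v 1" "src H l' = v n" "tgt H l' = v n" by auto
    have lin: "bij_betw v {1..n} (verts H)" "inj_on e {1..<n}" "\<And>k. k \<in> {1..<n} ==> joins H (e k) (v k) (v (Suc k))"
      using v(2) by (auto simp: linear_on_def)
    have "i \<in> v ` {1..n}" using iv lin(1) by (simp add: bij_betw_def)
    then obtain k where k: "k \<in> {1..n}" "i = v k" by blast
    have dif: "v p \<noteq> v q" if "p \<in> {1..n}" "q \<in> {1..n}" "p \<noteq> q" for p q
      using lin(1) that by (auto simp: bij_betw_def inj_on_eq_iff)
    have nl: "src H (e p) \<noteq> tgt H (e p)" if "p \<in> {1..<n}" for p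
      using lin(3)[OF that] dif[of p "Suc p"] that by (auto simp: joins_def)
    have ea: "e p \<in> arrs H" if "p \<in> {1..<n}" for p using that v(3) by blast
    consider "k = 1" | "k = n" | "1 < k" "k < n" using k by force
    thus False
    proof cases
      case 1
      have p: "1 \<in> {1..<n}" using v(1) by simp
      have "l \<noteq> e 1" using nl[OF p] v(4,5) by metis
      moreover have "l \<in> arrs H" using v(3) by blast
      ultimately show False using two[of l "e 1"] v(4) 1 k jn[OF lin(3)[OF p]] ea[OF p] by simp
    next
      case 2
      have p: "n - 1 \<in> {1..<n}" "Suc (n - 1) = n" using v(1) by auto
      have "l' \<noteq> e (n - 1)" using nl[OF p(1)] v(6,7) by metis
      moreover have "l' \<in> arrs H" using v(3) by blast
      moreover have "src H (e (n - 1)) = i \<or> tgt H (e (n - 1)) = i" using jn[OF lin(3)[OF p(1)]] p(2) 2 k by metis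
      ultimately show False using two[of l' "e (n - 1)"] v(6) 2 k ea[OF p(1)] by simp
    next
      case 3
      have p: "k - 1 \<in> {1..<n}" "Suc (k - 1) = k" "k \<in> {1..<n}" "k - 1 \<noteq> k" using 3 by auto
      have "e (k - 1) \<noteq> e k" using lin(2) p by (metis inj_on_eq_iff)
      thus False using two[of "e (k - 1)" "e k"] k jn[OF lin(3)[OF p(1)]] jn[OF lin(3)[OF p(3)]] ea p by auto
    qed
  qed
qed

section \<open>Windings over \<open>Q\<close> and over \<open>Qf\<close>\<close>

context fringed
begin

lemma pq_hom_Qf: "pq_hom H Q G ==> pq_hom H Qf G"
  using verts_sub arrs_sub sparr_eq pso_eq pta_eq
  unfolding pq_hom_def src_def tgt_def spol_def tpol_def by (auto simp: image_subset_iff)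

lemma pq_hom_Q:
  assumes G: "pq_hom H Qf G" and v: "\<And>i. i \<in> verts H ==> fst G i \<in> verts Q"
    and a: "\<And>a. a \<in> arrs H ==> snd G a \<in> arrs Q"
  shows "pq_hom H Q G"
  using G v a pso_eq pta_eq unfolding pq_hom_def src_def tgt_def spol_def tpol_def sparr_eq by (auto simp: image_subset_iff)

text \<open>A test morphism for the winding condition might end in a quiver whose image leaves
  \<open>Q\<close>. But for the types \<open>TyAt\<close> and \<open>TyDt\<close> there are no
  boundary vertices, so the morphism hits every arrow that meets its image. By connectedness it is
  onto, and the second homomorphism takes its values in \<open>Q\<close> after all.\<close>

lemma winding_Qf:
  assumes w: "winding Q H G"
  shows "winding Qf H G"
proof -
  have H: "hereditary H" and G: "pq_hom H Q G" using w by (auto simp: winding_def)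
  have "is_iso H G H' G' f" if ty: "has_gtype H (TyAt n) \<or> has_gtype H (TyDt n)"
    and H': "hereditary H'" "pq_hom H' Qf G'" "is_mor H G H' G' f"
    for n and H' :: "(nat, nat) pquiver" and G' f
  proof -
    have pH: "polar H" "polar H'" using H H'(1) hereditary_polar by auto
    have f: "pq_hom H H' f" "strict_hom H H' f" using H'(3) by (auto simp: is_mor_def strict_hom_def)
    have nb: "\<not> boundary H i" for i by (rule closed_no_boundary[OF ty]) (use pH in "simp add: polar_def")
    have cov: "\<exists>a\<in>arrs H. snd f a = a'" if h: "a' \<in> arrs H'" "src H' a' \<in> fst f ` verts H \<or> tgt H' a' \<in> fst f ` verts H" for a'
    proof -
      obtain j where j: "j \<in> verts H" "src H' a' = fst f j \<or> tgt H' a' = fst f j" using h(2) by blast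
      obtain a r where "half H j r a" "snd f a = a'" using hom_cover[OF pH f(1) nb j(1) h(1) j(2)] by blast
      thus ?thesis by (auto simp: half_def)
    qed
    obtain t' where t': "has_gtype H' t'" using H'(1) by (auto simp: hereditary_def)
    obtain t where t: "has_gtype H t" using H by (auto simp: hereditary_def)
    have inc: "src H' (snd f a) \<in> fst f ` verts H \<and> tgt H' (snd f a) \<in> fst f ` verts H" if "a \<in> arrs H" for a
      using strict_hom_simps(5,6)[OF f(2) that] polar_range[OF pH(1) half_src[OF that]] polar_range[OF pH(1) half_tgt[OF that]]
      by auto
    have ne: "verts H \<noteq> {}" using t by (rule has_gtype_path) (auto simp: bij_betw_def)
    have sv: "fst f ` verts H = verts H'"
    proof (rule has_gtype_connected[OF t'])
      show "fst f ` verts H \<subseteq> verts H'" using strict_hom_simps(1)[OF f(2)] by blast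
      show "fst f ` verts H \<noteq> {}" using ne by simp
      show "src H' a \<in> fst f ` verts H \<longleftrightarrow> tgt H' a \<in> fst f ` verts H" if "a \<in> arrs H'" for a
        using cov[OF that] inc by blast
    qed
    have sa: "\<exists>a\<in>arrs H. snd f a = a'" if "a' \<in> arrs H'" for a'
      using cov[OF that] polar_range[OF pH(2) half_src[OF that]] sv by simp
    have eq: "\<And>i. i \<in> verts H ==> fst G' (fst f i) = fst G i" "\<And>a. a \<in> arrs H ==> snd G' (snd f a) = snd G a"
      using H'(3) by (auto simp: is_mor_def qmap_eq_def)
    have "pq_hom H' Q G'"
    proof (rule pq_hom_Q[OF H'(2)])
      show "fst G' i \<in> verts Q" if i: "i \<in> verts H'" for i
      proof -
        obtain i0 where "i0 \<in> verts H" "i = fst f i0" using i sv by blast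
        thus ?thesis using eq(1) G by (auto simp: pq_hom_def)
      qed
      show "snd G' a \<in> arrs Q" if a: "a \<in> arrs H'" for a
      proof -
        obtain a0 where "a0 \<in> arrs H" "a = snd f a0" using sa[OF a] by blast
        thus ?thesis using eq(2) G by (auto simp: pq_hom_def)
      qed
    qed
    thus ?thesis using w ty H' unfolding winding_def by blast
  qed
  thus ?thesis unfolding winding_def using H pq_hom_Qf[OF G] by blast
qed

lemma winding_Q: "winding Qf H G ==> pq_hom H Q G ==> winding Q H G"
  unfolding winding_def using pq_hom_Qf by blast

end

subsection \<open>Triples\<close>

definition lifts_heads :: "int \<Rightarrow> ('v, 'a) pquiver \<Rightarrow> ('w, 'b) pquiver \<Rightarrow> ('v, 'a, 'w, 'b) qmap \<Rightarrow> bool" where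
  "lifts_heads s H H' f \<longleftrightarrow> (\<forall>j a'. boundary H j \<and> a' \<in> ordarr H' \<and> hdv s H' a' = fst f j -->
     (\<exists>a\<in>arrs H. a' = snd f a))"

lemma prop_q_iff: "prop_q H H' f \<longleftrightarrow> lifts_heads 1 H H' f" and prop_s_iff: "prop_s H H' f \<longleftrightarrow> lifts_heads (-1) H H' f"
  by (simp_all add: prop_q_def prop_s_def lifts_heads_def hdv_def)

lemma strict_hom_hdv:
  assumes "strict_hom H H' f" "a \<in> arrs H"
  shows "hdv s H' (snd f a) = fst f (hdv s H a)" "tlv s H' (snd f a) = fst f (tlv s H a)"
  using strict_hom_simps(5,6)[OF assms] by (simp_all add: hdv_def tlv_def)

lemma hdv_verts:
  assumes "polar H" "a \<in> arrs H"
  shows "hdv s H a \<in> verts H" "tlv s H a \<in> verts H"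
  using polar_range[OF assms(1) half_src[OF assms(2)]] polar_range[OF assms(1) half_tgt[OF assms(2)]]
  by (auto simp: hdv_def tlv_def)

text \<open>A vertex mapped outside of \<open>I\<close> can be moved towards a boundary vertex of \<open>H'\<close>, which contradicts (K).\<close>

lemma lands_inside:
  assumes H: "polar H" and H': "polar H'" and f: "strict_hom H H' f" and d: "drains s H' I"
    and l: "lifts_heads s H H' f" and K: "prop_K H H' f" and j: "j \<in> verts H"
  shows "fst f j \<in> I"
proof -
  obtain \<mu> :: "nat \<Rightarrow> nat" where \<mu>: "\<And>i. i \<in> verts H' - I ==> boundary H' i \<or>
     (\<exists>a\<in>ordarr H'. hdv s H' a = i \<and> tlv s H' a \<in> verts H' - I \<and> \<mu> (tlv s H' a) < \<mu> i)"
    using d unfolding drains_def by blast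
  have hf: "pq_hom H H' f" using f by (simp add: strict_hom_def)
  have False if "n = \<mu> (fst f j)" "fst f j \<notin> I" "j \<in> verts H" for n j
    using that
  proof (induction n arbitrary: j rule: less_induct)
    case (less n)
    have v: "fst f j \<in> verts H' - I" using less.prems strict_hom_simps(1)[OF f] by blast
    \<comment> \<open>For a boundary vertex \<open>j\<close> this is (K). Any other vertex has both
      slots filled, and then so has its image.\<close>
    have "\<not> boundary H' (fst f j)"
      using K hom_not_boundary[OF H H' hf _ less.prems(3)] by (auto simp: prop_K_def)
    then obtain a' where a': "a' \<in> ordarr H'" "hdv s H' a' = fst f j" "tlv s H' a' \<in> verts H' - I"
      "\<mu> (tlv s H' a') < \<mu> (fst f j)" using \<mu>[OF v] by blast
    have "\<exists>a\<in>arrs H. a' = snd f a"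
    proof (cases "boundary H j")
      case True
      thus ?thesis using l a' by (auto simp: lifts_heads_def)
    next
      case False
      have "src H' a' = fst f j \<or> tgt H' a' = fst f j" using a'(2) by (auto simp: hdv_def split: if_splits)
      then obtain a r where "half H j r a" "snd f a = a'"
        using hom_cover[OF H H' hf False less.prems(3) ordarr_arrs[of a' H', OF a'(1)]] by blast
      thus ?thesis by (auto simp: half_def)
    qed
    then obtain a where a: "a \<in> arrs H" "a' = snd f a" by blast
    have "tlv s H' a' = fst f (tlv s H a)" using strict_hom_hdv(2)[OF f a(1)] a(2) by simp
    thus False using less.IH[of "\<mu> (tlv s H' a')" "tlv s H a"] a' less.prems(1) hdv_verts(2)[OF H a(1)] by simp
  qed
  thus ?thesis using j by blast
qed

lemma hereditary_nonempty: "hereditary H ==> verts H \<noteq> {}"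
proof -
  assume "hereditary H"
  then obtain t where t: "has_gtype H t" by (auto simp: hereditary_def)
  thus ?thesis by (rule has_gtype_path) (auto simp: bij_betw_def)
qed

lemma Gx_hom:
  assumes z: "walk Q z"
  shows "pq_hom (Hx Q z) Q (Gx Q z)"
  using ltv_range(3)[OF z] Gx_pso[OF z] unfolding pq_hom_def src_def tgt_def spol_def tpol_def
  by (auto simp: Gx_simps(1) sparr_arrs)

lemma shift_simps [simp]: "fst (shift c) i = i + c" "snd (shift c) a = shift_arrow c a"
  by (simp_all add: shift_def)

lemma shift_arrow_inj [simp]: "shift_arrow c a = shift_arrow c b \<longleftrightarrow> a = b"
  by (cases a; cases b) auto

context embedded
begin

lemma polars: "polar H" "polar H'"
  by (rule Hx_polar[OF wz]) (rule Hx_polar[OF wZ])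

lemma shift_src: "a \<in> arrs H ==> src H' (shift_arrow c a) = src H a + c"
  and shift_tgt: "a \<in> arrs H ==> tgt H' (shift_arrow c a) = tgt H a + c"
  and shift_spol: "a \<in> arrs H ==> spol H' (shift_arrow c a) = spol H a"
  and shift_tpol: "a \<in> arrs H ==> tpol H' (shift_arrow c a) = tpol H a"
  and shift_hdv: "a \<in> arrs H ==> hdv s H' (shift_arrow c a) = hdv s H a + c"
  using shift_pso by (simp_all add: src_def tgt_def spol_def tpol_def hdv_def)

lemma spverts_shift: "i + c \<in> spverts H' \<longleftrightarrow> i \<in> spverts H"
proof -
  have "src H' a = src H a + c" if "a \<in> sparr H" for a
    using shift_src[of a] sparr_fix[OF that] that by (simp add: arrs_def)
  thus ?thesis unfolding spverts_def sparr by auto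
qed

text \<open>Outside arrows have their heads outside the image by \<open>extra_head\<close>, so
  enlarging the quiver creates no new arrow to be lifted; (K) holds because the vertices of the
  image are not boundary vertices.\<close>

lemma push_mor:
  assumes f: "is_mor K W H G f" and K: "skewed_gentle K" and l: "lifts_heads s K H f"
  shows "is_mor K W H' G' (qcomp (shift c) f)" (is ?A) "lifts_heads s K H' (qcomp (shift c) f)" (is ?B) "prop_K K H' (qcomp (shift c) f)"
proof -
  have sf: "strict_hom K H f" and eq: "qmap_eq K (qcomp G f) W" using f by (auto simp: is_mor_def)
  note st = strict_hom_simps[OF sf]
  have "strict_hom H H' (shift c)"
    using vert arr ord shift_src shift_tgt shift_spol shift_tpol sparr_fix sparr by (auto simp: strict_hom_def pq_hom_def)
  hence "strict_hom K H' (qcomp (shift c) f)" using sf K by (intro strict_hom_comp)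
  moreover have "qmap_eq K (qcomp G' (qcomp (shift c) f)) W"
    using eq st(1,2) fst_G shift_pso(3) by (simp add: qmap_eq_def)
  ultimately show ?A by (simp add: is_mor_def)
  show ?B unfolding lifts_heads_def
  proof (intro allI impI, elim conjE)
    fix j a'
    assume j: "boundary K j" and a': "a' \<in> ordarr H'" "hdv s H' a' = fst (qcomp (shift c) f) j"
    have "fst f j \<in> verts H" using st(1) j by (simp add: boundary_def)
    hence "hdv s H' a' \<in> im" using a'(2) by simp
    then obtain b where b: "b \<in> ordarr H" "a' = shift_arrow c b" using extra_head(1)[OF a'(1)] by blast
    hence "hdv s H b = fst f j" using shift_hdv[of b] a'(2) by (simp add: arrs_def)
    then obtain a where "a \<in> arrs K" "b = snd f a" using l j b(1) unfolding lifts_heads_def by blast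
    thus "\<exists>a\<in>arrs K. a' = snd (qcomp (shift c) f) a" using b(2) by auto
  qed
  show "prop_K K H' (qcomp (shift c) f)" unfolding prop_K_def
    using im_inner st(1) by (auto simp: boundary_def[of K])
qed

fun unshift :: "harrow \<Rightarrow> harrow" where
  "unshift (Nu k) = Nu (k - c)" | "unshift Eta0 = Eta0" | "unshift Eta1 = Eta1"

lemma unshift_shift [simp]: "unshift (shift_arrow c a) = a"
  by (cases a) auto

text \<open>By \<open>lands_inside\<close> all vertices are mapped into the image. An ordinary arrow
  then has its head there and comes from \<open>H\<close> by \<open>extra_head\<close>, while the
  special loops are those of \<open>H\<close> anyway. It follows that the homomorphism
  \<open>W\<close> takes its values in \<open>Q\<close>.\<close>

lemma pull_mor:
  assumes f: "is_mor K W H' G' f" and K: "hereditary K" and l: "lifts_heads s K H' f" and pK: "prop_K K H' f"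
  obtains g where "is_mor K W H G g" "lifts_heads s K H g" "qmap_eq K (qcomp (shift c) g) f" "pq_hom K Q W"
proof -
  have sf: "strict_hom K H' f" and eq: "qmap_eq K (qcomp G' f) W" using f by (auto simp: is_mor_def)
  have pol: "polar K" by (rule hereditary_polar[OF K])
  have sgK: "skewed_gentle K" using K by (simp add: hereditary_def)
  note st = strict_hom_simps[OF sf]
  have in_im: "fst f j \<in> im" if "j \<in> verts K" for j
    by (rule lands_inside[OF pol polars(2) sf drain l pK that])
  have ain: "\<exists>b\<in>ordarr H. snd f a = shift_arrow c b" if a: "a \<in> ordarr K" for a
  proof -
    have aK: "a \<in> arrs K" using a by (simp add: arrs_def)
    have "hdv s H' (snd f a) \<in> im" using in_im[OF hdv_verts(1)[OF pol aK]] strict_hom_hdv(1)[OF sf aK] by metis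
    thus ?thesis using extra_head(1)[OF st(3)[OF a]] by blast
  qed
  have sin: "snd f a \<in> sparr H \<and> snd f a = shift_arrow c (snd f a)" if a: "a \<in> sparr K" for a
    using st(4)[OF a] sparr sparr_fix by simp
  define g where "g = (\<lambda>j. fst f j - c, \<lambda>a. unshift (snd f a))"
  have gv: "fst g j \<in> verts H \<and> fst g j + c = fst f j" if "j \<in> verts K" for j
    using in_im[OF that] by (auto simp: g_def)
  have go: "snd g a \<in> ordarr H \<and> shift_arrow c (snd g a) = snd f a" if "a \<in> ordarr K" for a
    using ain[OF that] by (auto simp: g_def)
  have gs: "snd g a \<in> sparr H \<and> shift_arrow c (snd g a) = snd f a" if "a \<in> sparr K" for a
    using sin[OF that] unshift_shift[of "snd f a"] by (simp add: g_def)
  have ga: "snd g a \<in> arrs H \<and> shift_arrow c (snd g a) = snd f a" if "a \<in> arrs K" for a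
    using that go gs by (auto simp: arrs_def)
  have inc: "src H (snd g a) = fst g (src K a) \<and> tgt H (snd g a) = fst g (tgt K a) \<and>
      spol H (snd g a) = spol K a \<and> tpol H (snd g a) = tpol K a" if a: "a \<in> arrs K" for a
  proof -
    have b: "snd g a \<in> arrs H" "shift_arrow c (snd g a) = snd f a" using ga[OF a] by blast+
    have v: "src K a \<in> verts K" "tgt K a \<in> verts K"
      using pso_range[OF sgK a] pta_range[OF sgK a] by (simp_all add: src_def tgt_def)
    show ?thesis using shift_src[OF b(1)] shift_tgt[OF b(1)] shift_spol[OF b(1)] shift_tpol[OF b(1)] b(2)
      st(5-8)[OF a] gv[OF v(1)] gv[OF v(2)] by simp
  qed
  have sg: "strict_hom K H g" unfolding strict_hom_def pq_hom_def using gv ga gs go inc by (auto simp: image_subset_iff)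
  have gf: "qmap_eq K (qcomp (shift c) g) f" using gv ga by (simp add: qmap_eq_def)
  have gW: "qmap_eq K (qcomp G g) W" unfolding qmap_eq_def
  proof (intro conjI ballI)
    show "fst (qcomp G g) i = fst W i" if i: "i \<in> verts K" for i
      using eq i gv[OF i] fst_G[of "fst g i"] by (simp add: qmap_eq_def)
    show "snd (qcomp G g) a = snd W a" if a: "a \<in> arrs K" for a
      using eq a ga[OF a] shift_pso(3)[of "snd g a"] by (simp add: qmap_eq_def)
  qed
  have W: "pq_hom K Q W"
  proof (rule pq_hom_qmap_eq[OF _ gW sgK])
    show "pq_hom K Q (qcomp G g)" by (rule pq_hom_comp[OF _ Gx_hom[OF wz] sgK]) (use sg in "simp add: strict_hom_def")
  qed
  have "lifts_heads s K H g" unfolding lifts_heads_def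
  proof (intro allI impI, elim conjE)
    fix j b
    assume j: "boundary K j" and b: "b \<in> ordarr H" "hdv s H b = fst g j"
    have "hdv s H' (shift_arrow c b) = fst f j" using shift_hdv[of b] b gv[of j] j by (simp add: arrs_def boundary_def)
    then obtain a where "a \<in> arrs K" "shift_arrow c b = snd f a" using l j ord[OF b(1)] unfolding lifts_heads_def by blast
    thus "\<exists>a\<in>arrs K. b = snd g a" using ga[of a] by (metis shift_arrow_inj)
  qed
  thus ?thesis using that[of g] sg gW gf W by (simp add: is_mor_def)
qed

end

section \<open>Equivalence classes of triples\<close>

lemma bij_betw_quotient:
  assumes A: "equiv A RA" and B: "equiv B RB" and f: "f ` A \<subseteq> B"
    and rel: "\<And>a a'. a \<in> A ==> a' \<in> A ==> (a, a') \<in> RA \<longleftrightarrow> (f a, f a') \<in> RB"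
    and surj: "\<And>b. b \<in> B ==> \<exists>a\<in>A. (f a, b) \<in> RB"
  shows "bij_betw (\<lambda>C. RB `` (f ` C)) (A // RA) (B // RB)"
proof -
  have cls: "RB `` (f ` (RA `` {a})) = RB `` {f a}" if a: "a \<in> A" for a
  proof
    show "RB `` (f ` (RA `` {a})) \<subseteq> RB `` {f a}"
    proof
      fix b assume "b \<in> RB `` (f ` (RA `` {a}))"
      then obtain a' where a': "(a, a') \<in> RA" "(f a', b) \<in> RB" by blast
      hence "a' \<in> A" using A equiv_class_eq_iff by metis
      hence "(f a, f a') \<in> RB" using rel a a'(1) by blast
      thus "b \<in> RB `` {f a}" using a'(2) B by (meson Image_singleton_iff equivE transE)
    qed
    have "a \<in> RA `` {a}" by (rule equiv_class_self[OF A a])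
    thus "RB `` {f a} \<subseteq> RB `` (f ` (RA `` {a}))" by blast
  qed
  show ?thesis
  proof (rule bij_betw_imageI)
    show "inj_on (\<lambda>C. RB `` (f ` C)) (A // RA)"
    proof (rule inj_onI)
      fix C D assume C: "C \<in> A // RA" "D \<in> A // RA" "RB `` (f ` C) = RB `` (f ` D)"
      then obtain a d where a: "a \<in> A" "C = RA `` {a}" "d \<in> A" "D = RA `` {d}" by (auto elim!: quotientE)
      hence "RB `` {f a} = RB `` {f d}" using C(3) cls by simp
      moreover have "f a \<in> B" "f d \<in> B" using f a by auto
      ultimately have "(f a, f d) \<in> RB" using eq_equiv_class_iff[OF B] by blast
      hence "(a, d) \<in> RA" using rel a by blast
      thus "C = D" using a equiv_class_eq[OF A] by blast
    qed
    show "(\<lambda>C. RB `` (f ` C)) ` (A // RA) = B // RB"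
    proof
      show "(\<lambda>C. RB `` (f ` C)) ` (A // RA) \<subseteq> B // RB"
      proof
        fix D assume "D \<in> (\<lambda>C. RB `` (f ` C)) ` (A // RA)"
        then obtain a where a: "a \<in> A" "D = RB `` (f ` (RA `` {a}))" by (auto elim!: quotientE)
        thus "D \<in> B // RB" using cls f by (auto intro!: quotientI)
      qed
      show "B // RB \<subseteq> (\<lambda>C. RB `` (f ` C)) ` (A // RA)"
      proof
        fix D assume "D \<in> B // RB"
        then obtain b where b: "b \<in> B" "D = RB `` {b}" by (auto elim!: quotientE)
        obtain a where a: "a \<in> A" "(f a, b) \<in> RB" using surj[OF b(1)] by blast
        have "D = RB `` (f ` (RA `` {a}))" using cls[OF a(1)] b(2) equiv_class_eq[OF B a(2)] by simp
        thus "D \<in> (\<lambda>C. RB `` (f ` C)) ` (A // RA)" using quotientI[OF a(1)] by blast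
      qed
    qed
  qed
qed

lemma H_triples_iff:
  "T \<in> H_triples Q x y \<longleftrightarrow> winding Q (hquiv T) (wind T) \<and>
     is_mor (hquiv T) (wind T) (Hx Q x) (Gx Q x) (phiq T) \<and> lifts_heads 1 (hquiv T) (Hx Q x) (phiq T) \<and>
     is_mor (hquiv T) (wind T) (Hx Q y) (Gx Q y) (phis T) \<and> lifts_heads (-1) (hquiv T) (Hx Q y) (phis T) \<and>
     (\<forall>j\<in>verts (hquiv T). fst (phiq T) j \<in> spverts (Hx Q x) \<and> fst (phis T) j \<in> spverts (Hx Q y) -->
        j \<in> spverts (hquiv T))"
  by (simp add: H_triples_def prop_q_iff prop_s_iff)

lemma K_triples_iff:
  "T \<in> K_triples Q x y \<longleftrightarrow> T \<in> H_triples Q x y \<and>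
     prop_K (hquiv T) (Hx Q x) (phiq T) \<and> prop_K (hquiv T) (Hx Q y) (phis T)"
  by (simp add: K_triples_def)

lemma H_triples_sg: "T \<in> H_triples Q x y ==> hereditary (hquiv T) \<and> skewed_gentle (hquiv T)"
  by (simp add: H_triples_iff winding_def hereditary_def)

lemma equiv_on_equiv:
  assumes "S \<subseteq> H_triples Q x y"
  shows "equiv S (equiv_on S)"
proof (rule equivI)
  show "equiv_on S \<subseteq> S \<times> S" by (auto simp: equiv_on_def)
  show "refl_on S (equiv_on S)" by (auto simp: refl_on_def equiv_on_def triple_equiv_refl)
  show "sym (equiv_on S)" by (auto simp: sym_def equiv_on_def triple_equiv_sym)
  show "trans (equiv_on S)"
  proof (rule transI)
    fix T T' T'' assume "(T, T') \<in> equiv_on S" "(T', T'') \<in> equiv_on S"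
    thus "(T, T'') \<in> equiv_on S" using triple_equiv_trans[of T T' T''] H_triples_sg assms
      unfolding equiv_on_def by blast
  qed
qed

text \<open>Both \<open>x \<mapsto> X\<close> and \<open>y \<mapsto> Y\<close> are embeddings of words of \<open>Q\<close> into words of \<open>Qf\<close>: in the application
  \<open>X\<close>, \<open>y\<close>, \<open>Y\<close> are \<open>\<tau>\<^sub>f x\<close>, \<open>\<tau> y\<close>, \<open>\<tau>\<^sub>f y\<close>.\<close>

locale embedded_pair = X: embedded Q Qf 1 x X cx + Y: embedded Q Qf "-1" y Y cy
  for Q Qf :: "('v, 'a) pquiver" and x X cx y Y cy
begin

definition push :: "('v, 'a) triple \<Rightarrow> ('v, 'a) triple" where
  "push T = \<lparr>hquiv = hquiv T, wind = wind T, phiq = qcomp (shift cx) (phiq T), phis = qcomp (shift cy) (phis T)\<rparr>"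

lemma push_simps [simp]: "hquiv (push T) = hquiv T" "wind (push T) = wind T"
  "phiq (push T) = qcomp (shift cx) (phiq T)" "phis (push T) = qcomp (shift cy) (phis T)"
  by (simp_all add: push_def)

lemma push_K_triple:
  assumes T: "T \<in> H_triples Q x y"
  shows "push T \<in> K_triples Qf X Y"
proof -
  note H = T[unfolded H_triples_iff]
  have sg: "skewed_gentle (hquiv T)" using H_triples_sg[OF T] by blast
  have "winding Qf (hquiv T) (wind T)" using H X.winding_Qf by blast
  thus ?thesis using H X.push_mor[of "hquiv T" "wind T" "phiq T"] Y.push_mor[of "hquiv T" "wind T" "phis T"] sg
    by (simp add: K_triples_iff H_triples_iff X.spverts_shift Y.spverts_shift)
qed

text \<open>The preimage has the same quiver and the same winding. Equality with \<open>T\<close>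
  holds only up to equivalence, because the pulled-back maps are determined only on the vertices and
  arrows of the quiver.\<close>

lemma push_surj:
  assumes T: "T \<in> K_triples Qf X Y"
  shows "\<exists>T0\<in>H_triples Q x y. triple_equiv (push T0) T"
proof -
  have TH: "T \<in> H_triples Qf X Y" and K: "prop_K (hquiv T) (Hx Qf X) (phiq T)" "prop_K (hquiv T) (Hx Qf Y) (phis T)"
    using T by (auto simp: K_triples_iff)
  note H = TH[unfolded H_triples_iff]
  have her: "hereditary (hquiv T)" using H_triples_sg[OF TH] by blast
  obtain p where p: "is_mor (hquiv T) (wind T) (Hx Q x) (Gx Q x) p" "lifts_heads 1 (hquiv T) (Hx Q x) p"
    "qmap_eq (hquiv T) (qcomp (shift cx) p) (phiq T)" "pq_hom (hquiv T) Q (wind T)"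
    using X.pull_mor[of "hquiv T" "wind T" "phiq T"] H her K by blast
  obtain q where q: "is_mor (hquiv T) (wind T) (Hx Q y) (Gx Q y) q" "lifts_heads (-1) (hquiv T) (Hx Q y) q"
    "qmap_eq (hquiv T) (qcomp (shift cy) q) (phis T)"
    using Y.pull_mor[of "hquiv T" "wind T" "phis T"] H her K by blast
  define T0 where "T0 = \<lparr>hquiv = hquiv T, wind = wind T, phiq = p, phis = q\<rparr>"
  have "winding Q (hquiv T) (wind T)" using H X.winding_Q p(4) by blast
  moreover have "j \<in> spverts (hquiv T)"
    if j: "j \<in> verts (hquiv T)" "fst p j \<in> spverts (Hx Q x)" "fst q j \<in> spverts (Hx Q y)" for j
  proof -
    have "fst (phiq T) j = fst p j + cx" "fst (phis T) j = fst q j + cy" using p(3) q(3) j(1) by (simp_all add: qmap_eq_def)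
    hence "fst (phiq T) j \<in> spverts (Hx Qf X)" "fst (phis T) j \<in> spverts (Hx Qf Y)"
      using j X.spverts_shift Y.spverts_shift by simp_all
    thus ?thesis using H j(1) by blast
  qed
  ultimately have "T0 \<in> H_triples Q x y" using p q by (simp add: H_triples_iff T0_def)
  moreover have "triple_equiv (push T0) T" unfolding triple_equiv_def
    by (rule exI[of _ "(id, id)"]) (use p(3) q(3) in "simp add: T0_def is_iso_refl qmap_eq_def")
  ultimately show ?thesis by blast
qed

lemma push_equiv: "triple_equiv (push T) (push T') \<longleftrightarrow> triple_equiv T T'"
  unfolding triple_equiv_def by (simp add: qmap_eq_def)

lemma push_bij:
  "bij_betw (\<lambda>C. equiv_on (K_triples Qf X Y) `` (push ` C)) (H_classes Q x y) (K_classes Qf X Y)"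
  unfolding H_classes_def K_classes_def
proof (rule bij_betw_quotient)
  show "equiv (H_triples Q x y) (equiv_on (H_triples Q x y))" by (rule equiv_on_equiv[of _ Q x y]) simp
  show "equiv (K_triples Qf X Y) (equiv_on (K_triples Qf X Y))" by (rule equiv_on_equiv[of _ Qf X Y]) (auto simp: K_triples_iff)
  show "push ` H_triples Q x y \<subseteq> K_triples Qf X Y" using push_K_triple by blast
  show "(T, T') \<in> equiv_on (H_triples Q x y) \<longleftrightarrow> (push T, push T') \<in> equiv_on (K_triples Qf X Y)"
    if "T \<in> H_triples Q x y" "T' \<in> H_triples Q x y" for T T'
    using that push_K_triple push_equiv by (simp add: equiv_on_def)
  show "\<exists>T0\<in>H_triples Q x y. (push T0, T) \<in> equiv_on (K_triples Qf X Y)" if "T \<in> K_triples Qf X Y" for T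
    using push_surj[OF that] push_K_triple that by (auto simp: equiv_on_def)
qed

lemma push_gtype:
  assumes C: "C \<in> H_classes Q x y"
  shows "class_has_gtype (equiv_on (K_triples Qf X Y) `` (push ` C)) ty \<longleftrightarrow> class_has_gtype C ty"
proof
  assume "class_has_gtype C ty"
  then obtain T where T: "T \<in> C" "has_gtype (hquiv T) ty" by (auto simp: class_has_gtype_def)
  hence "T \<in> H_triples Q x y" using C by (auto simp: H_classes_def equiv_on_def elim!: quotientE)
  hence "(push T, push T) \<in> equiv_on (K_triples Qf X Y)" using push_K_triple triple_equiv_refl by (simp add: equiv_on_def)
  hence "push T \<in> equiv_on (K_triples Qf X Y) `` (push ` C)" using T(1) by blast
  thus "class_has_gtype (equiv_on (K_triples Qf X Y) `` (push ` C)) ty"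
    using T(2) push_simps(1)[of T] unfolding class_has_gtype_def by metis
next
  assume "class_has_gtype (equiv_on (K_triples Qf X Y) `` (push ` C)) ty"
  then obtain S T where S: "T \<in> C" "triple_equiv (push T) S" "has_gtype (hquiv S) ty"
    by (auto simp: class_has_gtype_def equiv_on_def)
  then obtain f where "is_iso (hquiv S) (wind S) (hquiv T) (wind T) f"
    using triple_equiv_sym[OF S(2)] by (auto simp: triple_equiv_def)
  hence "has_gtype (hquiv T) ty" using has_gtype_iso S(3) by blast
  thus "class_has_gtype C ty" using S(1) by (auto simp: class_has_gtype_def)
qed

end

text \<open>With the empty set for \<open>I\<close>, \<open>lands_inside\<close> leaves no place for
  the image of any vertex, but hereditary quivers have vertices.\<close>

lemma drains_no_K_triples:
  assumes w: "walk Q Y" and d: "drains (-1) (Hx Q Y) {}"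
  shows "K_triples Q X Y = {}"
proof -
  have False if T: "T \<in> K_triples Q X Y" for T
  proof -
    have TH: "T \<in> H_triples Q X Y" and K: "prop_K (hquiv T) (Hx Q Y) (phis T)" using T by (auto simp: K_triples_iff)
    have her: "hereditary (hquiv T)" using H_triples_sg[OF TH] by blast
    obtain j where j: "j \<in> verts (hquiv T)" using hereditary_nonempty[OF her] by blast
    have "fst (phis T) j \<in> {}"
      by (rule lands_inside[OF hereditary_polar[OF her] Hx_polar[OF w] _ d _ K j])
        (use TH in "auto simp: H_triples_iff is_mor_def")
    thus False by simp
  qed
  thus ?thesis by blast
qed

subsection \<open>Red vertices\<close>

text \<open>Arrows over special loops are left out: \<open>Flet\<close> turns their letters into
  special ones, which are alone with their polarized target and have rank \<open>1\<close>.\<close>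

definition enters :: "('v, 'a) pquiver \<Rightarrow> ('v, 'a) word \<Rightarrow> nat \<Rightarrow> int \<Rightarrow> bool" where
  "enters Q z i r \<longleftrightarrow> (\<exists>a\<in>ordarr (Hx Q z). pta (Hx Q z) a = (i, r) \<and> snd (Gx Q z) a \<notin> sparr Q)"

definition leaves :: "('v, 'a) pquiver \<Rightarrow> ('v, 'a) word \<Rightarrow> nat \<Rightarrow> int \<Rightarrow> bool" where
  "leaves Q z i r \<longleftrightarrow> (\<exists>a\<in>ordarr (Hx Q z). pso (Hx Q z) a = (i, r) \<and> snd (Gx Q z) a \<notin> sparr Q)"

lemma bbar_string:
  assumes z: "is_string (hat Q) z" and k: "k < length z"
  shows "bbar Q z (int k) = Some (Flet Q (z ! k))"
proof -
  have cl: "closed_type Q z \<longleftrightarrow> lpunct Q z \<and> rpunct Q z" by (rule string_closed_type[OF z])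
  let ?w = "completion Q z"
  show ?thesis
  proof (cases "lpunct Q z")
    case l: True
    show ?thesis
    proof (cases "rpunct Q z")
      case True
      have w: "?w = Fword Q z @ Fword Q (winv (butlast (tl z)))" using l True by (simp add: completion_def)
      hence "length z \<le> length ?w" by (simp add: Fword_def)
      hence "nat (int k mod int (length ?w)) = k" using k by simp
      thus ?thesis unfolding bbar_def Let_def using cl l True w k by (simp add: Fword_def nth_append)
    next
      case False
      define n where "n = length z - 1"
      have n: "int (length z) - 1 = int n" using k by (simp add: n_def)
      have w: "?w = Fword Q (winv (tl z)) @ Fword Q z" using l False by (simp add: completion_def)
      have lw: "length (Fword Q (winv (tl z))) = n" by (simp add: Fword_def winv_def n_def)
      have "k + n < length ?w" using w lw k by (simp add: Fword_def)
      moreover have "?w ! (k + n) = Flet Q (z ! k)" using w lw k by (simp add: Fword_def nth_append)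
      moreover have "nat (int k + int n) = k + n" by linarith
      ultimately show ?thesis unfolding bbar_def Let_def n using cl l False by simp
    qed
  next
    case False
    have "\<exists>u. ?w = Fword Q z @ u" using False by (auto simp: completion_def)
    then obtain u where w: "?w = Fword Q z @ u" by blast
    have "k < length ?w" "?w ! k = Flet Q (z ! k)" using w k by (simp_all add: Fword_def nth_append)
    thus ?thesis unfolding bbar_def Let_def using cl False by simp
  qed
qed

text \<open>The second form reads the letter before the vertex \<open>Suc j mod length z\<close>.
  For the vertex \<open>0\<close> this is index \<open>-1\<close>, where the periodicity of the word
  matters.\<close>

lemma bbar_band:
  assumes z: "walk Q z" and b: "is_band (hat Q) z" and j: "j < length z"
  shows "bbar Q z (int j) = Some (Flet Q (z ! j))" (is ?A) "bbar Q z (int (Suc j mod length z) - 1) = Some (Flet Q (z ! j))" (is ?B)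
proof -
  have "\<not> lpunct Q z" "\<not> rpunct Q z" using punct_string[OF z] b string_not_band by blast+
  hence w: "completion Q z = Fword Q z" by (simp add: completion_def)
  have cl: "closed_type Q z" using b by (simp add: closed_type_def)
  have "nat (int j mod int (length z)) = j" using j by simp
  thus ?A unfolding bbar_def Let_def using cl w j by (simp add: Fword_def)
  have "(int (Suc j mod length z) - 1) mod int (length z) = int j"
  proof (cases "Suc j < length z")
    case True
    thus ?thesis by simp
  next
    case False
    hence n: "length z = Suc j" using j by simp
    have "(- 1 :: int) mod int (Suc j) = int j" by (simp add: zmod_minus1)
    thus ?thesis unfolding n by simp
  qed
  thus ?B
    unfolding bbar_def Let_def using cl w j by (simp add: Fword_def)
qed

lemma Flet_rank:
  "l = Dir a \<or> l = Inv a ==> lrank (Flet Q l) = 0 \<longleftrightarrow> l = Dir a \<and> a \<notin> sparr Q"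
  "l = Dir a \<or> l = Inv a ==> lrank (Flet Q l) = 2 \<longleftrightarrow> l = Inv a \<and> a \<notin> sparr Q"
  "lrank l \<le> 2"
  by (auto split: if_splits) (cases l; simp)

text \<open>Reading in direction \<open>r\<close> starts with the half-edge at
  \<open>(i, r)\<close>: rank \<open>0\<close> is an arrow into \<open>i\<close>, rank
  \<open>2\<close> an arrow out of \<open>i\<close>, and rank \<open>1\<close> covers special
  letters as well as the trivial letter at an end.\<close>

lemma reading_rank:
  assumes z: "walk Q z" and i: "i \<in> verts (Hx Q z)" and r: "r = 1 \<or> r = -1"
  obtains l where "reading Q z i r 0 = Some l" "lta Q l = Some (fst (Gx Q z) i, r)"
    "lrank l = 0 \<longleftrightarrow> enters Q z i r" "lrank l = 2 \<longleftrightarrow> leaves Q z i r" "lrank l \<le> 2"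
proof -
  have Q: "skewed_gentle Q" using z by (simp add: walk_def)
  note lr = ltv_range[OF z i]
  have il: "i < length z" using i by (auto simp: Hx_simps split: if_splits)
  have bi: "bbar Q z (int i) = Some (Flet Q (z ! i))"
    using z il bbar_string[of Q z i] bbar_band(1)[OF z, of i] by (auto simp: walk_def)
  have li: "lta Q (Flet Q (z ! i)) = Some (ltv Q z i)" by (rule lta_Flet[OF Q lr(1)])
  have halves: "half (Hx Q z) i q a ==> q = snd (ltv Q z i) ==> a \<in> ordarr (Hx Q z) ==> a = Nu i"
    "half (Hx Q z) i q a ==> q = - snd (ltv Q z i) ==> a \<in> ordarr (Hx Q z) ==> \<exists>k. a = Nu k \<and> hnext Q z k = i" for q a
  proof -
    have "Eta0 \<notin> ordarr (Hx Q z)" "Eta1 \<notin> ordarr (Hx Q z)" by (auto simp: Hx_simps)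
    moreover have "snd (ltv Q z i) \<noteq> - snd (ltv Q z i)" using lr(2) by auto
    ultimately show "half (Hx Q z) i q a ==> q = snd (ltv Q z i) ==> a \<in> ordarr (Hx Q z) ==> a = Nu i"
      "half (Hx Q z) i q a ==> q = - snd (ltv Q z i) ==> a \<in> ordarr (Hx Q z) ==> \<exists>k. a = Nu k \<and> hnext Q z k = i"
      unfolding half_Hx[OF z] by auto
  qed
  have ih: "enters Q z i r ==> \<exists>a\<in>ordarr (Hx Q z). half (Hx Q z) i r a"
    "leaves Q z i r ==> \<exists>a\<in>ordarr (Hx Q z). half (Hx Q z) i r a"
    unfolding enters_def leaves_def half_def arrs_def by blast+
  have ent: "enters Q z i r \<longleftrightarrow> pta (Hx Q z) (Nu k) = (i, r) \<and> snd (Gx Q z) (Nu k) \<notin> sparr Q"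
    and lea: "leaves Q z i r \<longleftrightarrow> pso (Hx Q z) (Nu k) = (i, r) \<and> snd (Gx Q z) (Nu k) \<notin> sparr Q"
    if k: "Nu k \<in> ordarr (Hx Q z)" and h: "half (Hx Q z) i r (Nu k)" for k
  proof -
    have "a = Nu k" if "a \<in> ordarr (Hx Q z)" "pta (Hx Q z) a = (i, r) \<or> pso (Hx Q z) a = (i, r)" for a
      using that polar_unique[OF Hx_polar[OF z] h, of a] by (auto simp: half_def arrs_def)
    thus "enters Q z i r \<longleftrightarrow> pta (Hx Q z) (Nu k) = (i, r) \<and> snd (Gx Q z) (Nu k) \<notin> sparr Q"
      "leaves Q z i r \<longleftrightarrow> pso (Hx Q z) (Nu k) = (i, r) \<and> snd (Gx Q z) (Nu k) \<notin> sparr Q"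
      unfolding enters_def leaves_def using k by blast+
  qed
  have G: "fst (Gx Q z) i = fst (ltv Q z i)" by (rule Gx_simps(1))
  show ?thesis
  proof (cases "r = snd (ltv Q z i)")
    case rr: True
    define l where "l = Flet Q (z ! i)"
    have rd: "reading Q z i r 0 = Some l" using bi li rr by (simp add: reading_def l_def)
    have lt: "lta Q l = Some (fst (Gx Q z) i, r)" using li rr by (simp add: l_def G)
    show ?thesis
    proof (cases "Nu i \<in> ordarr (Hx Q z)")
      case True
      have h: "half (Hx Q z) i r (Nu i)" using half_Hx[OF z] True rr by blast
      obtain a where a: "z ! i = Dir a \<or> z ! i = Inv a" using walk_nu(1)[OF z True] by blast
      have nh: "hnext Q z i \<noteq> i" by (rule walk_nu(6)[OF z True])
      have sa: "snd (Gx Q z) (Nu i) = a" using a by (auto simp: Gx_simps)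
      have pd: "is_dir (z ! i) ==> pta (Hx Q z) (Nu i) = (i, r) \<and> pso (Hx Q z) (Nu i) \<noteq> (i, r)"
        using Hx_nu(1)[OF z True] nh unfolding rr by simp
      have pi: "\<not> is_dir (z ! i) ==> pso (Hx Q z) (Nu i) = (i, r) \<and> pta (Hx Q z) (Nu i) \<noteq> (i, r)"
        using Hx_nu(2)[OF z True] nh unfolding rr by simp
      have "enters Q z i r \<longleftrightarrow> z ! i = Dir a \<and> a \<notin> sparr Q" "leaves Q z i r \<longleftrightarrow> z ! i = Inv a \<and> a \<notin> sparr Q"
        unfolding ent[OF True h] lea[OF True h] sa using a pd pi by (metis is_dir_def letter.distinct(1))+
      thus ?thesis using that[OF rd lt] Flet_rank(1,2)[of "z ! i" a Q] Flet_rank(3)[of l] a by (simp add: l_def)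
    next
      case False
      have st: "is_string (hat Q) z"
      proof (rule ccontr)
        assume "\<not> is_string (hat Q) z"
        thus False using False il by (simp add: Hx_simps)
      qed
      have "i = length z - 1" using False st i by (auto simp: Hx_simps)
      hence "\<exists>v q. z ! i = Tr v q" using st by (auto simp: is_string_def last_conv_nth)
      hence "lrank l = 1" by (auto simp: l_def)
      moreover have "\<not> enters Q z i r" "\<not> leaves Q z i r" using ih halves(1)[OF _ rr] False by blast+
      ultimately show ?thesis using that[OF rd lt] by simp
    qed
  next
    case False
    hence rr: "r = - snd (ltv Q z i)" using r lr(2) by auto
    show ?thesis
    proof (cases "\<exists>k. Nu k \<in> ordarr (Hx Q z) \<and> hnext Q z k = i")
      case True
      then obtain k where k: "Nu k \<in> ordarr (Hx Q z)" "hnext Q z k = i" by blast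
      define l where "l = Flet Q (linv (z ! k))"
      have kl: "k < length z" using k by (auto simp: Hx_simps split: if_splits)
      have bk: "bbar Q z (int i - 1) = Some (Flet Q (z ! k))"
      proof (cases "is_string (hat Q) z")
        case True
        hence "int i - 1 = int k" using k(2) by (auto simp: hnext_def)
        thus ?thesis using bbar_string[OF True kl] by simp
      next
        case n: False
        hence "is_band (hat Q) z" "i = Suc k mod length z" using z k(2) by (auto simp: walk_def hnext_def)
        thus ?thesis using bbar_band(2)[OF z _ kl] by simp
      qed
      have rd: "reading Q z i r 0 = Some l" using bi bk li False by (auto simp: reading_def l_def Flet_linv)
      have "lta Q (linv (z ! k)) = Some (opp (ltv Q z i))" using walk_nu(5)[OF z k(1)] k(2) by simp
      hence "lta Q l = Some (opp (ltv Q z i))" unfolding l_def using lta_Flet[OF Q] by blast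
      hence lt: "lta Q l = Some (fst (Gx Q z) i, r)" using rr by (simp add: G opp_def)
      have h: "half (Hx Q z) i r (Nu k)" using half_Hx[OF z] k rr by blast
      obtain a where a: "z ! k = Dir a \<or> z ! k = Inv a" using walk_nu(1)[OF z k(1)] by blast
      have nh: "k \<noteq> i" using walk_nu(6)[OF z k(1)] k(2) by simp
      have sa: "snd (Gx Q z) (Nu k) = a" using a by (auto simp: Gx_simps)
      have pd: "is_dir (z ! k) ==> pso (Hx Q z) (Nu k) = (i, r) \<and> pta (Hx Q z) (Nu k) \<noteq> (i, r)"
        using Hx_nu(1)[OF z k(1)] nh k(2) unfolding rr by simp
      have pi: "\<not> is_dir (z ! k) ==> pta (Hx Q z) (Nu k) = (i, r) \<and> pso (Hx Q z) (Nu k) \<noteq> (i, r)"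
        using Hx_nu(2)[OF z k(1)] nh k(2) unfolding rr by simp
      have "enters Q z i r \<longleftrightarrow> z ! k = Inv a \<and> a \<notin> sparr Q" "leaves Q z i r \<longleftrightarrow> z ! k = Dir a \<and> a \<notin> sparr Q"
        unfolding ent[OF k(1) h] lea[OF k(1) h] sa using a pd pi by (metis is_dir_def letter.distinct(1))+
      thus ?thesis using that[OF rd lt] Flet_rank(1,2)[of "linv (z ! k)" a Q] Flet_rank(3)[of l] a by (auto simp: l_def)
    next
      case nk: False
      have st: "is_string (hat Q) z"
      proof (rule ccontr)
        assume n: "\<not> is_string (hat Q) z"
        hence b: "is_band (hat Q) z" using z by (simp add: walk_def)
        obtain j where "j < length z" "Suc j mod length z = i" using band_nth(3)[OF b il] by blast
        thus False using nk n by (auto simp: Hx_simps hnext_def)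
      qed
      have i1: "i = 1"
      proof (rule ccontr)
        assume "i \<noteq> 1"
        hence "0 < i - 1" "i - 1 < length z - 1" "Suc (i - 1) = i" using i st by (auto simp: Hx_simps)
        moreover have "Nu k \<in> ordarr (Hx Q z) \<longleftrightarrow> 0 < k \<and> k < length z - 1" for k using st by (auto simp: Hx_simps)
        ultimately have "Nu (i - 1) \<in> ordarr (Hx Q z)" "hnext Q z (i - 1) = i" using st by (simp_all add: hnext_def)
        thus False using nk by blast
      qed
      define l where "l = Flet Q (linv (z ! 0))"
      have z0: "0 < length z" using il by linarith
      have b0: "bbar Q z (int i - 1) = Some (Flet Q (z ! 0))" using bbar_string[OF st z0] i1 by simp
      have rd: "reading Q z i r 0 = Some l" using bi b0 li False by (auto simp: reading_def l_def Flet_linv)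
      have "follows (hat Q) (z ! 0) (z ! 1)" using word_nth[of "hat Q" z 0] st il i1 by (simp add: is_string_def)
      hence "lta Q (linv (z ! 0)) = Some (opp (ltv Q z i))" using i1 by (auto simp: follows_def ltv_def)
      hence "lta Q l = Some (opp (ltv Q z i))" unfolding l_def using lta_Flet[OF Q] by blast
      hence lt: "lta Q l = Some (fst (Gx Q z) i, r)" using rr by (simp add: G opp_def)
      have "\<exists>v q. z ! 0 = TrI v q" using st z0 by (auto simp: is_string_def hd_conv_nth)
      hence "lrank l = 1" by (auto simp: l_def)
      moreover have "\<not> enters Q z i r" "\<not> leaves Q z i r" using ih halves(2)[OF _ rr] nk by blast+
      ultimately show ?thesis using that[OF rd lt] by simp
    qed
  qed
qed

text \<open>With ranks \<open>0\<close>, \<open>1\<close>, \<open>2\<close> only, a first letter of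
  \<open>x\<close> is smaller than that of \<open>y\<close> exactly if the smaller one has rank
  \<open>0\<close> and the other not, or the larger one has rank \<open>2\<close> and the other
  not.\<close>

lemma red_iff:
  assumes x: "walk Q x" and y: "walk Q y" and p: "(j, i) \<in> hl_verts Q x y"
  shows "red Q x y (j, i) \<longleftrightarrow> (\<exists>r. enters Q x i r \<and> \<not> enters Q y j r \<or> leaves Q y j r \<and> \<not> leaves Q x i r)"
proof -
  have v: "i \<in> verts (Hx Q x)" "j \<in> verts (Hx Q y)" "fst (Gx Q y) j = fst (Gx Q x) i" using p by (auto simp: hl_verts_def)
  have one: "lless Q (the (reading Q x i r 0)) (the (reading Q y j r 0)) \<longleftrightarrow>
      enters Q x i r \<and> \<not> enters Q y j r \<or> leaves Q y j r \<and> \<not> leaves Q x i r" if r: "r = 1 \<or> r = -1" for r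
  proof -
    obtain l where l: "reading Q x i r 0 = Some l" "lta Q l = Some (fst (Gx Q x) i, r)"
      "lrank l = 0 \<longleftrightarrow> enters Q x i r" "lrank l = 2 \<longleftrightarrow> leaves Q x i r" "lrank l \<le> 2" by (rule reading_rank[OF x v(1) r])
    obtain m where m: "reading Q y j r 0 = Some m" "lta Q m = Some (fst (Gx Q y) j, r)"
      "lrank m = 0 \<longleftrightarrow> enters Q y j r" "lrank m = 2 \<longleftrightarrow> leaves Q y j r" "lrank m \<le> 2" by (rule reading_rank[OF y v(2) r])
    have "lless Q l m \<longleftrightarrow> lrank l < lrank m" using l(2) m(2) v(3) by (simp add: lless_def)
    thus ?thesis unfolding l(3)[symmetric] l(4)[symmetric] m(3)[symmetric] m(4)[symmetric] using l(1,5) m(1,5) by auto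
  qed
  have rng: "r = 1 \<or> r = -1" if h: "enters Q x i r \<or> leaves Q y j r" for r
  proof -
    have "(\<exists>a. half (Hx Q x) i r a) \<or> (\<exists>a. half (Hx Q y) j r a)" using h by (auto simp: enters_def leaves_def half_def arrs_def)
    thus ?thesis using polar_range[OF Hx_polar[OF x]] polar_range[OF Hx_polar[OF y]] by blast
  qed
  show ?thesis
  proof
    assume "red Q x y (j, i)"
    then obtain r where "r = 1 \<or> r = -1" "lless Q (the (reading Q x i r 0)) (the (reading Q y j r 0))" by (auto simp: red_def)
    thus "\<exists>r. enters Q x i r \<and> \<not> enters Q y j r \<or> leaves Q y j r \<and> \<not> leaves Q x i r" using one by blast
  next
    assume "\<exists>r. enters Q x i r \<and> \<not> enters Q y j r \<or> leaves Q y j r \<and> \<not> leaves Q x i r"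
    then obtain r where r: "enters Q x i r \<and> \<not> enters Q y j r \<or> leaves Q y j r \<and> \<not> leaves Q x i r" by blast
    hence "r = 1 \<or> r = -1" using rng by blast
    thus "red Q x y (j, i)" using one[of r] r by (auto simp: red_def)
  qed
qed

subsection \<open>Real h-lines and kisses\<close>

lemma half_special:
  assumes z: "walk Q z" and v: "fst (Gx Q z) i \<in> spverts Q" and h: "half (Hx Q z) i (-1) a"
  shows "snd (Gx Q z) a = sploop Q (fst (Gx Q z) i)"
proof -
  have Q: "skewed_gentle Q" using z by (simp add: walk_def)
  have a: "a \<in> arrs (Hx Q z)" using h by (simp add: half_def)
  note s = sploop[OF Q v]
  have "pso Q (snd (Gx Q z) a) = pso Q (sploop Q (fst (Gx Q z) i)) \<or> pta Q (snd (Gx Q z) a) = pta Q (sploop Q (fst (Gx Q z) i))"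
    using h Gx_pso(2,3)[OF z a] s(3,4) by (auto simp: half_def src_def spol_def tgt_def tpol_def)
  thus ?thesis using pso_inj[OF Q Gx_pso(1)[OF z a] sparr_arrs[OF s(1)]] pta_inj[OF Q Gx_pso(1)[OF z a] sparr_arrs[OF s(1)]]
    by blast
qed

text \<open>Over a special vertex the slot of polarity \<open>-1\<close> is always filled: a string
  that stops there is punctured at this end and has a special loop.\<close>

lemma special_half:
  assumes z: "walk Q z" and i: "i \<in> verts (Hx Q z)" and v: "fst (Gx Q z) i \<in> spverts Q"
  shows "\<exists>a. half (Hx Q z) i (-1) a"
proof (cases "is_string (hat Q) z")
  case False
  hence "is_band (hat Q) z" using z by (simp add: walk_def)
  thus ?thesis using band_not_boundary[OF z] polar_not_boundary[OF Hx_polar[OF z], of i] i by blast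
next
  case st: True
  have ir: "0 < i" "i \<le> length z - 1" using i st by (auto simp: Hx_simps)
  have ord: "Nu k \<in> ordarr (Hx Q z) \<longleftrightarrow> 0 < k \<and> k < length z - 1" for k using st by (auto simp: Hx_simps)
  have hn: "hnext Q z k = Suc k" for k using st by (simp add: hnext_def)
  have g: "fst (ltv Q z i) \<in> spverts Q" using v by (simp add: Gx_simps)
  consider "snd (ltv Q z i) = -1" | "snd (ltv Q z i) = 1" using ltv_range(2)[OF z i] by blast
  thus ?thesis
  proof cases
    case 1
    show ?thesis
    proof (cases "i < length z - 1")
      case True
      hence "Nu i \<in> ordarr (Hx Q z)" using ord ir by blast
      thus ?thesis unfolding half_Hx[OF z] using 1 by auto
    next
      case False
      hence il: "i = length z - 1" using ir by simp
      obtain v q where "last z = Tr v q" using st by (auto simp: is_string_def)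
      moreover have "z ! i = last z" using st il by (simp add: is_string_def last_conv_nth)
      ultimately have "last z = Tr v q" "ltv Q z i = (v, q)" by (simp_all add: ltv_def)
      hence "rpunct Q z" using 1 g by (auto simp: rpunct_def)
      thus ?thesis unfolding half_Hx[OF z] using 1 il by auto
    qed
  next
    case 2
    show ?thesis
    proof (cases "1 < i")
      case True
      hence "Nu (i - 1) \<in> ordarr (Hx Q z)" "hnext Q z (i - 1) = i" using ord ir hn by auto
      thus ?thesis unfolding half_Hx[OF z] using 2 by auto
    next
      case False
      hence il: "i = 1" using ir by simp
      obtain v q where vq: "hd z = TrI v q" using st by (auto simp: is_string_def)
      have "z ! 0 = hd z" using st by (simp add: is_string_def hd_conv_nth)
      moreover have "follows (hat Q) (z ! 0) (z ! 1)" using word_nth[of "hat Q" z 0] st ir il by (simp add: is_string_def)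
      ultimately have "opp (ltv Q z i) = (v, q)" using vq il by (auto simp: follows_def ltv_def)
      hence "lpunct Q z" using vq 2 g by (auto simp: lpunct_def opp_def)
      thus ?thesis unfolding half_Hx[OF z] using 2 il by auto
    qed
  qed
qed

definition hl_adj :: "('v, 'a) pquiver \<Rightarrow> ('v, 'a) word \<Rightarrow> ('v, 'a) word \<Rightarrow> ((nat \<times> nat) \<times> (nat \<times> nat)) set" where
  "hl_adj Q x y = (\<lambda>c. (plus_src Q x y c, plus_tgt Q x y c)) ` hl_plus Q x y \<union>
     ((\<lambda>c. (plus_src Q x y c, plus_tgt Q x y c)) ` hl_plus Q x y)\<inverse>"

lemma hl_adj_iff:
  "(p, q) \<in> hl_adj Q x y \<longleftrightarrow> (\<exists>c\<in>hl_plus Q x y. p = plus_src Q x y c \<and> q = plus_tgt Q x y c \<or>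
     q = plus_src Q x y c \<and> p = plus_tgt Q x y c)"
  by (auto simp: hl_adj_def)

definition plain :: "('v, 'a) pquiver \<Rightarrow> ('v, 'a) word \<Rightarrow> ('v, 'a) word \<Rightarrow> nat \<times> nat \<Rightarrow> bool" where
  "plain Q x y p \<longleftrightarrow> \<not> red Q x y p \<and> \<not> orange Q x y p \<and> \<not> purple Q x y p"

lemma rtrancl_image_eq:
  assumes "\<And>q q'. (p, q) \<in> R\<^sup>* ==> (F q, q') \<in> R' \<longleftrightarrow> (\<exists>r. q' = F r \<and> (q, r) \<in> R)"
  shows "R'\<^sup>* `` {F p} = F ` (R\<^sup>* `` {p})"
proof
  show "R'\<^sup>* `` {F p} \<subseteq> F ` (R\<^sup>* `` {p})"
  proof
    fix q' assume "q' \<in> R'\<^sup>* `` {F p}"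
    hence "(F p, q') \<in> R'\<^sup>*" by simp
    thus "q' \<in> F ` (R\<^sup>* `` {p})"
    proof (induction rule: rtrancl_induct)
      case (step q' s')
      then obtain q where q: "(p, q) \<in> R\<^sup>*" "q' = F q" by blast
      then obtain r where "s' = F r" "(q, r) \<in> R" using assms[OF q(1)] step.hyps(2) by blast
      thus ?case using q(1) by (meson Image_singleton_iff image_eqI rtrancl.rtrancl_into_rtrancl)
    qed blast
  qed
  show "F ` (R\<^sup>* `` {p}) \<subseteq> R'\<^sup>* `` {F p}"
  proof
    fix q' assume "q' \<in> F ` (R\<^sup>* `` {p})"
    then obtain q where q: "(p, q) \<in> R\<^sup>*" "q' = F q" by blast
    from q(1) have "(F p, F q) \<in> R'\<^sup>*"
    proof (induction rule: rtrancl_induct)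
      case (step q r)
      hence "(F q, F r) \<in> R'" using assms[OF step.hyps(1)] by blast
      thus ?case by (rule rtrancl_into_rtrancl[OF step.IH])
    qed blast
    thus "q' \<in> R'\<^sup>* `` {F p}" using q(2) by simp
  qed
qed

section \<open>H-lines for a pair of words over one quiver\<close>

locale walk_pair =
  fixes Q :: "('v, 'a) pquiver" and x y
  assumes wx: "walk Q x" and wy: "walk Q y"
begin

lemma Qsg: "skewed_gentle Q"
  using wx by (simp add: walk_def)

lemma hv: "(j, i) \<in> hl_verts Q x y ==> j \<in> verts (Hx Q y) \<and> i \<in> verts (Hx Q x) \<and> fst (Gx Q y) j = fst (Gx Q x) i"
  by (auto simp: hl_verts_def)

lemma same_arrow:
  assumes p: "(j, i) \<in> hl_verts Q x y" and a: "a \<in> arrs (Hx Q x)" and b: "b \<in> arrs (Hx Q y)"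
    and e: "pta (Hx Q x) a = (i, r) \<and> pta (Hx Q y) b = (j, r) \<or> pso (Hx Q x) a = (i, r) \<and> pso (Hx Q y) b = (j, r)"
  shows "snd (Gx Q y) b = snd (Gx Q x) a"
proof -
  note ga = Gx_pso[OF wx a] and gb = Gx_pso[OF wy b]
  have "pta Q (snd (Gx Q y) b) = pta Q (snd (Gx Q x) a) \<or> pso Q (snd (Gx Q y) b) = pso Q (snd (Gx Q x) a)"
    using e hv[OF p] ga(2,3) gb(2,3) by (auto simp: src_def tgt_def spol_def tpol_def)
  thus ?thesis using pso_inj[OF Qsg gb(1) ga(1)] pta_inj[OF Qsg gb(1) ga(1)] by blast
qed

lemma plus_arr:
  assumes c: "(b, a) \<in> hl_plus Q x y"
  shows "b \<in> arrs (Hx Q y)" "a \<in> arrs (Hx Q x)" "spol (Hx Q y) b = spol (Hx Q x) a" "tpol (Hx Q y) b = tpol (Hx Q x) a"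
    "plus_src Q x y (b, a) \<in> hl_verts Q x y" (is ?A) "plus_tgt Q x y (b, a) \<in> hl_verts Q x y" (is ?B)
proof -
  show b: "b \<in> arrs (Hx Q y)" and a: "a \<in> arrs (Hx Q x)" using c by (auto simp: hl_plus_def arrs_def)
  have e: "snd (Gx Q y) b = snd (Gx Q x) a" using c by (simp add: hl_plus_def)
  note ga = Gx_pso[OF wx a] and gb = Gx_pso[OF wy b]
  note va = hdv_verts[OF Hx_polar[OF wx] a, of 1] and vb = hdv_verts[OF Hx_polar[OF wy] b, of 1]
  show "spol (Hx Q y) b = spol (Hx Q x) a" "tpol (Hx Q y) b = tpol (Hx Q x) a" using ga(2,3) gb(2,3) e by simp_all
  show ?A ?B
    using va vb ga(2,3) gb(2,3) e by (simp_all add: hl_verts_def plus_src_def plus_tgt_def hdv_def tlv_def)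
qed

lemma adj_verts: "(p, q) \<in> hl_adj Q x y ==> p \<in> hl_verts Q x y \<and> q \<in> hl_verts Q x y"
  using plus_arr(5,6) unfolding hl_adj_iff by (metis surj_pair)

lemma reach_verts: "(p, q) \<in> (hl_adj Q x y)\<^sup>* ==> p \<in> hl_verts Q x y ==> q \<in> hl_verts Q x y"
  by (induction rule: rtrancl_induct) (use adj_verts in blast)+

lemma real_hlines_iff:
  "C \<in> real_hlines Q x y \<longleftrightarrow> (\<exists>p\<in>hl_verts Q x y. C = (hl_adj Q x y)\<^sup>* `` {p}) \<and> (\<forall>q\<in>C. plain Q x y q)"
proof -
  have c: "hl_conn Q x y `` {p} = (hl_adj Q x y)\<^sup>* `` {p}" if "p \<in> hl_verts Q x y" for p
    using that reach_verts[of p] unfolding hl_conn_def hl_adj_def Let_def by auto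
  have "C \<in> hl_verts Q x y // hl_conn Q x y \<longleftrightarrow> (\<exists>p\<in>hl_verts Q x y. C = (hl_adj Q x y)\<^sup>* `` {p})"
    unfolding quotient_def using c by auto
  thus ?thesis unfolding real_hlines_def plain_def by blast
qed

lemma incident_halves:
  assumes c: "(b, a) \<in> hl_plus Q x y" and p: "plus_src Q x y (b, a) = (j, i) \<or> plus_tgt Q x y (b, a) = (j, i)"
  obtains r where "half (Hx Q y) j r b" "half (Hx Q x) i r a"
  using p
proof
  note P = plus_arr[OF c]
  assume "plus_src Q x y (b, a) = (j, i)"
  thus thesis using that[of "spol (Hx Q x) a"] half_src[OF P(1)] half_src[OF P(2)] P(3) by (simp add: plus_src_def)
next
  note P = plus_arr[OF c]
  assume "plus_tgt Q x y (b, a) = (j, i)"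
  thus thesis using that[of "tpol (Hx Q x) a"] half_tgt[OF P(1)] half_tgt[OF P(2)] P(4) by (simp add: plus_tgt_def)
qed

lemma boundary_endpoint:
  assumes bd: "boundary (Hx Q y) j \<or> boundary (Hx Q x) i"
  shows "hl_endpoint Q x y (j, i)"
proof -
  let ?P = "{c \<in> hl_plus Q x y. plus_src Q x y c = (j, i) \<or> plus_tgt Q x y c = (j, i)}"
  note px = Hx_polar[OF wx] and py = Hx_polar[OF wy]
  have hs: "\<exists>r. half (Hx Q y) j r (fst c) \<and> half (Hx Q x) i r (snd c)" if "c \<in> ?P" for c
    using that incident_halves[of "fst c" "snd c" j i] by auto
  have eq: "c = d" if c: "c \<in> ?P" and d: "d \<in> ?P" and e: "fst c = fst d \<or> snd c = snd d" for c d
  proof -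
    obtain r where r: "half (Hx Q y) j r (fst c)" "half (Hx Q x) i r (snd c)" using hs[OF c] by blast
    obtain q where q: "half (Hx Q y) j q (fst d)" "half (Hx Q x) i q (snd d)" using hs[OF d] by blast
    have "r = q"
    proof (cases "fst c = fst d")
      case True
      thus ?thesis using polar_half_pol[OF py r(1)] q(1) by simp
    next
      case False
      thus ?thesis using e polar_half_pol[OF px r(2)] q(2) by simp
    qed
    thus ?thesis using polar_unique[OF py r(1)] polar_unique[OF px r(2)] q by (simp add: prod_eq_iff)
  qed
  have inc: "fst ` ?P \<subseteq> {a \<in> arrs (Hx Q y). src (Hx Q y) a = j \<or> tgt (Hx Q y) a = j}"
    "snd ` ?P \<subseteq> {a \<in> arrs (Hx Q x). src (Hx Q x) a = i \<or> tgt (Hx Q x) a = i}"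
    using hs half_incident by fastforce+
  have inj: "inj_on fst ?P" "inj_on snd ?P" using eq by (meson inj_onI)+
  have fin: "finite (arrs (Hx Q y))" "finite (arrs (Hx Q x))" using px py by (simp_all add: polar_def)
  from bd show ?thesis unfolding hl_endpoint_def
  proof
    assume "boundary (Hx Q y) j"
    hence le: "card {a \<in> arrs (Hx Q y). src (Hx Q y) a = j \<or> tgt (Hx Q y) a = j} \<le> 1" by (simp add: boundary_def)
    have "card ?P = card (fst ` ?P)" using card_image[OF inj(1)] by simp
    also have "\<dots> \<le> card {a \<in> arrs (Hx Q y). src (Hx Q y) a = j \<or> tgt (Hx Q y) a = j}"
      by (rule card_mono[OF _ inc(1)]) (use fin(1) in simp)
    finally show "card ?P \<le> 1" using le by simp
  next
    assume "boundary (Hx Q x) i"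
    hence le: "card {a \<in> arrs (Hx Q x). src (Hx Q x) a = i \<or> tgt (Hx Q x) a = i} \<le> 1" by (simp add: boundary_def)
    have "card ?P = card (snd ` ?P)" using card_image[OF inj(2)] by simp
    also have "\<dots> \<le> card {a \<in> arrs (Hx Q x). src (Hx Q x) a = i \<or> tgt (Hx Q x) a = i}"
      by (rule card_mono[OF _ inc(2)]) (use fin(2) in simp)
    finally show "card ?P \<le> 1" using le by simp
  qed
qed

lemma kisses_iff:
  "C \<in> kisses Q x y \<longleftrightarrow> C \<in> real_hlines Q x y \<and> (\<forall>(j, i)\<in>C. \<not> boundary (Hx Q y) j \<and> \<not> boundary (Hx Q x) i)"
  unfolding kisses_def using boundary_endpoint by auto

text \<open>For an arrow not over a special loop the partner in \<open>H(y)\<close> exists because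
  the vertex is not red. Over a special loop the slot in \<open>H(y)\<close> is filled in any case
  by \<open>special_half\<close>; there, an ordinary arrow of the wrong direction would make the
  vertex orange, and a special loop would make it purple.\<close>

lemma plain_enter:
  assumes p: "(j, i) \<in> hl_verts Q x y" "plain Q x y (j, i)" and a: "a \<in> ordarr (Hx Q x)" "tgt (Hx Q x) a = i"
  shows "\<exists>b. (b, a) \<in> hl_plus Q x y \<and> plus_tgt Q x y (b, a) = (j, i)"
proof -
  note v = hv[OF p(1)]
  have aa: "a \<in> arrs (Hx Q x)" using a by (simp add: arrs_def)
  obtain r where r: "pta (Hx Q x) a = (i, r)" using a(2) by (cases "pta (Hx Q x) a") (simp add: tgt_def)
  have main: "(b, a) \<in> hl_plus Q x y \<and> plus_tgt Q x y (b, a) = (j, i)"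
    if b: "b \<in> ordarr (Hx Q y)" "pta (Hx Q y) b = (j, r)" for b
    using same_arrow[OF p(1) aa, of b r] b r a by (simp add: hl_plus_def plus_tgt_def tgt_def arrs_def)
  show ?thesis
  proof (cases "snd (Gx Q x) a \<in> sparr Q")
    case False
    hence "enters Q x i r" using a r by (auto simp: enters_def)
    hence "enters Q y j r" using red_iff[OF wx wy p(1)] p(2) unfolding plain_def by blast
    thus ?thesis using main by (auto simp: enters_def)
  next
    case True
    have "r = -1" using Gx_pso(3)[OF wx aa] pso_special[OF Qsg True] True Qsg r
      by (auto simp: skewed_gentle_def tpol_def)
    have sp: "fst (Gx Q x) i \<in> spverts Q"
    proof -
      have "src Q (snd (Gx Q x) a) = tgt Q (snd (Gx Q x) a)" using True Qsg by (simp add: skewed_gentle_def)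
      hence "src Q (snd (Gx Q x) a) = fst (Gx Q x) i" using Gx_pso(3)[OF wx aa] a(2) by (simp add: tgt_def)
      thus ?thesis using True unfolding spverts_def by (metis image_eqI)
    qed
    obtain b where b: "half (Hx Q y) j (-1) b" using special_half[OF wy, of j] v sp by auto
    have ha: "half (Hx Q x) i (-1) a" using aa r \<open>r = -1\<close> by (simp add: half_def)
    have G: "snd (Gx Q y) b = snd (Gx Q x) a"
      using half_special[OF wy _ b] half_special[OF wx sp ha] v sp by simp
    have bb: "b \<in> arrs (Hx Q y)" using b by (simp add: half_def)
    have "b \<in> ordarr (Hx Q y) \<and> pta (Hx Q y) b = (j, -1)"
    proof (rule ccontr)
      assume n: "\<not> (b \<in> ordarr (Hx Q y) \<and> pta (Hx Q y) b = (j, -1))"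
      consider "b \<in> sparr (Hx Q y)" | "b \<in> ordarr (Hx Q y)" "pso (Hx Q y) b = (j, -1)"
        using n b bb by (auto simp: half_def arrs_def)
      thus False
      proof cases
        case 1
        hence "(b, a) \<in> hl_oplus Q x y" using G a by (simp add: hl_oplus_def)
        moreover have "tgt (Hx Q y) b = j"
          using b Hx_polar[OF wy] 1 by (auto simp: half_def tgt_def polar_def)
        ultimately show False using p(2) a(2) unfolding plain_def purple_def by force
      next
        case 2
        hence "(b, a) \<in> hl_cross Q x y" using G a True by (simp add: hl_cross_def)
        moreover have "src (Hx Q y) b = j" using 2 by (simp add: src_def)
        ultimately show False using p(2) a(2) unfolding plain_def orange_def by force
      qed
    qed
    thus ?thesis using main \<open>r = -1\<close> by blast
  qed
qed

text \<open>The dual of \<open>plain_enter\<close> under exchange of sources with targets and of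
  \<open>H(x)\<close> with \<open>H(y)\<close>; the other kind of purple vertex is used.\<close>

lemma plain_leave:
  assumes p: "(j, i) \<in> hl_verts Q x y" "plain Q x y (j, i)" and b: "b \<in> ordarr (Hx Q y)" "src (Hx Q y) b = j"
  shows "\<exists>a. (b, a) \<in> hl_plus Q x y \<and> plus_src Q x y (b, a) = (j, i)"
proof -
  note v = hv[OF p(1)]
  have bb: "b \<in> arrs (Hx Q y)" using b by (simp add: arrs_def)
  obtain r where r: "pso (Hx Q y) b = (j, r)" using b(2) by (cases "pso (Hx Q y) b") (simp add: src_def)
  have main: "(b, a) \<in> hl_plus Q x y \<and> plus_src Q x y (b, a) = (j, i)"
    if a: "a \<in> ordarr (Hx Q x)" "pso (Hx Q x) a = (i, r)" for a
    using same_arrow[OF p(1) _ bb, of a r] a r b by (simp add: hl_plus_def plus_src_def src_def arrs_def)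
  show ?thesis
  proof (cases "snd (Gx Q y) b \<in> sparr Q")
    case False
    hence "leaves Q y j r" using b r by (auto simp: leaves_def)
    hence "leaves Q x i r" using red_iff[OF wx wy p(1)] p(2) unfolding plain_def by blast
    thus ?thesis using main by (auto simp: leaves_def)
  next
    case True
    have "r = -1" using Gx_pso(2)[OF wy bb] True Qsg r by (auto simp: skewed_gentle_def spol_def)
    have sp: "fst (Gx Q y) j \<in> spverts Q"
    proof -
      have "src Q (snd (Gx Q y) b) = fst (Gx Q y) j" using Gx_pso(2)[OF wy bb] b(2) by (simp add: src_def)
      thus ?thesis using True unfolding spverts_def by (metis image_eqI)
    qed
    obtain a where a: "half (Hx Q x) i (-1) a" using special_half[OF wx, of i] v sp by auto
    have hb: "half (Hx Q y) j (-1) b" using bb r \<open>r = -1\<close> by (simp add: half_def)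
    have G: "snd (Gx Q y) b = snd (Gx Q x) a"
      using half_special[OF wy sp hb] half_special[OF wx _ a] v sp by simp
    have aa: "a \<in> arrs (Hx Q x)" using a by (simp add: half_def)
    have "a \<in> ordarr (Hx Q x) \<and> pso (Hx Q x) a = (i, -1)"
    proof (rule ccontr)
      assume n: "\<not> (a \<in> ordarr (Hx Q x) \<and> pso (Hx Q x) a = (i, -1))"
      consider "a \<in> sparr (Hx Q x)" | "a \<in> ordarr (Hx Q x)" "pta (Hx Q x) a = (i, -1)"
        using n a aa by (auto simp: half_def arrs_def)
      thus False
      proof cases
        case 1
        hence "(b, a) \<in> hl_ominus Q x y" using G b by (simp add: hl_ominus_def)
        moreover have "tgt (Hx Q x) a = i"
          using a Hx_polar[OF wx] 1 by (auto simp: half_def tgt_def polar_def)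
        ultimately show False using p(2) b(2) unfolding plain_def purple_def by force
      next
        case 2
        hence "(b, a) \<in> hl_cross Q x y" using G b True by (simp add: hl_cross_def)
        moreover have "tgt (Hx Q x) a = i" using 2 by (simp add: tgt_def)
        ultimately show False using p(2) b(2) unfolding plain_def orange_def by force
      qed
    qed
    thus ?thesis using main \<open>r = -1\<close> by blast
  qed
qed

end

context embedded
begin

lemma from_shift:
  assumes a: "a \<in> arrs H'" "hdv s H' a \<in> im"
  obtains a0 where "a = shift_arrow c a0" "a0 \<in> arrs H" "a \<in> ordarr H' \<longleftrightarrow> a0 \<in> ordarr H" "a \<in> sparr H' \<longleftrightarrow> a0 \<in> sparr H"
proof (cases "a \<in> ordarr H'")
  case True
  then obtain a0 where "a0 \<in> ordarr H" "a = shift_arrow c a0" using extra_head(1)[OF True] a(2) by blast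
  moreover have "a \<notin> sparr H'" "a0 \<notin> sparr H" using True calculation polars by (auto simp: polar_def)
  ultimately show ?thesis using that[of a0] True by (simp add: arrs_def)
next
  case False
  hence "a \<in> sparr H" using a(1) sparr by (simp add: arrs_def)
  moreover have "a \<notin> ordarr H" using calculation polars(1) by (auto simp: polar_def)
  ultimately show ?thesis using that[of a] False sparr sparr_fix[of a] by (simp add: arrs_def)
qed

lemma shift_enters: "enters Q z i r ==> enters Qf Z (i + c) r"
  and shift_leaves: "leaves Q z i r ==> leaves Qf Z (i + c) r"
proof -
  have *: "shift_arrow c a \<in> ordarr H' \<and> pta H' (shift_arrow c a) = (fst (pta H a) + c, snd (pta H a)) \<and>
      pso H' (shift_arrow c a) = (fst (pso H a) + c, snd (pso H a)) \<and> snd G' (shift_arrow c a) = snd G a" if "a \<in> ordarr H" for a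
    using ord[OF that] shift_pso[of a] that by (simp add: arrs_def src_def tgt_def spol_def tpol_def)
  show "enters Q z i r ==> enters Qf Z (i + c) r" unfolding enters_def sparr_eq using * by (metis fst_conv snd_conv)
  show "leaves Q z i r ==> leaves Qf Z (i + c) r" unfolding leaves_def sparr_eq using * by (metis fst_conv snd_conv)
qed

lemma shift_half: "half H i r a ==> half H' (i + c) r (shift_arrow c a)"
  using arr[of a] shift_pso(1,2)[of a] by (auto simp: half_def src_def tgt_def spol_def tpol_def)

lemma outgoing:
  assumes a: "a \<in> arrs H'" "hdv s H' a \<notin> im" "tlv s H' a \<in> im"
  shows "a \<in> ordarr H'" "a \<notin> shift_arrow c ` ordarr H" "snd G' a \<notin> sparr Qf"
proof -
  have "hdv s H' a = tlv s H' a" if "a \<in> sparr H'"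
    using that polars(2) by (simp add: polar_def hdv_def tlv_def src_def tgt_def)
  thus o: "a \<in> ordarr H'" using a by (auto simp: arrs_def)
  have "hdv s H' (shift_arrow c b) \<in> im" if "b \<in> ordarr H" for b
    using shift_hdv[of b] hdv_verts(1)[OF polars(1), of b s] that by (simp add: arrs_def)
  thus n: "a \<notin> shift_arrow c ` ordarr H" using a(2) by blast
  show "snd G' a \<notin> sparr Qf" by (rule extra_head(2)[OF o n a(3)])
qed

lemma unshift_pso:
  assumes a: "a0 \<in> arrs H"
  shows "pso H' (shift_arrow c a0) = (i + c, r) \<longleftrightarrow> pso H a0 = (i, r)"
    "pta H' (shift_arrow c a0) = (i + c, r) \<longleftrightarrow> pta H a0 = (i, r)"
  using shift_pso(1,2)[OF a] by (auto simp: src_def tgt_def spol_def tpol_def prod_eq_iff)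

end

section \<open>Comparison of h-lines over \<open>Q\<close> and over \<open>Qf\<close>\<close>

context embedded_pair
begin

sublocale A: walk_pair Q x y
  by unfold_locales (rule X.wz Y.wz)+

sublocale B: walk_pair Qf X Y
  by unfold_locales (rule X.wZ Y.wZ)+

abbreviation "V \<equiv> hl_verts Q x y"
abbreviation "V' \<equiv> hl_verts Qf X Y"
abbreviation "R \<equiv> hl_adj Q x y"
abbreviation "R' \<equiv> hl_adj Qf X Y"

definition F :: "nat \<times> nat \<Rightarrow> nat \<times> nat" where
  "F p = (fst p + cy, snd p + cx)"

lemma F_simp [simp]: "F (j, i) = (j + cy, i + cx)"
  by (simp add: F_def)

lemma F_inj [simp]: "F p = F q \<longleftrightarrow> p = q"
  by (auto simp: F_def prod_eq_iff)

lemma F_image: "p' \<in> F ` V \<longleftrightarrow> p' \<in> V' \<and> fst p' \<in> Y.im \<and> snd p' \<in> X.im"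
proof -
  have "(j + cy, i + cx) \<in> V' \<longleftrightarrow> (j, i) \<in> V" if "j \<in> verts Y.H" "i \<in> verts X.H" for j i
    using that X.vert Y.vert X.fst_G Y.fst_G by (simp add: hl_verts_def)
  thus ?thesis by (cases p') (force simp: hl_verts_def)
qed

lemma F_verts: "p \<in> V ==> F p \<in> V' \<and> fst (F p) \<in> Y.im \<and> snd (F p) \<in> X.im"
  using F_image by blast

lemma plus_shift:
  assumes b: "b \<in> arrs Y.H" and a: "a \<in> arrs X.H"
  shows "plus_src Qf X Y (shift_arrow cy b, shift_arrow cx a) = F (plus_src Q x y (b, a))"
    "plus_tgt Qf X Y (shift_arrow cy b, shift_arrow cx a) = F (plus_tgt Q x y (b, a))"
  using X.shift_src[OF a] X.shift_tgt[OF a] Y.shift_src[OF b] Y.shift_tgt[OF b]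
  by (simp_all add: plus_src_def plus_tgt_def)

lemma plus_push:
  assumes "(b, a) \<in> hl_plus Q x y"
  shows "(shift_arrow cy b, shift_arrow cx a) \<in> hl_plus Qf X Y"
  using assms X.ord Y.ord X.sparr Y.sparr X.sparr_fix[of a] Y.sparr_fix[of b]
    X.shift_pso(3)[of a] Y.shift_pso(3)[of b] by (auto simp: hl_plus_def arrs_def)

text \<open>Sources for \<open>Y\<close> and targets for \<open>X\<close> are the heads in the sense
  of \<open>s = -1\<close> and \<open>s = 1\<close>, so both arrows come from \<open>Q\<close>. Red,
  orange and purple vertices are described through exactly these ends, for a special loop because
  its two ends coincide.\<close>

lemma arrow_pull:
  assumes b: "b' \<in> arrs Y.H'" "src Y.H' b' \<in> Y.im" and a: "a' \<in> arrs X.H'" "tgt X.H' a' \<in> X.im"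
  obtains b a where "b' = shift_arrow cy b" "a' = shift_arrow cx a" "b \<in> arrs Y.H" "a \<in> arrs X.H"
    "b' \<in> ordarr Y.H' \<longleftrightarrow> b \<in> ordarr Y.H" "b' \<in> sparr Y.H' \<longleftrightarrow> b \<in> sparr Y.H"
    "a' \<in> ordarr X.H' \<longleftrightarrow> a \<in> ordarr X.H" "a' \<in> sparr X.H' \<longleftrightarrow> a \<in> sparr X.H"
    "snd Y.G' b' = snd Y.G b" "snd X.G' a' = snd X.G a"
proof -
  obtain b0 where b0: "b' = shift_arrow cy b0" "b0 \<in> arrs Y.H" "b' \<in> ordarr Y.H' \<longleftrightarrow> b0 \<in> ordarr Y.H"
    "b' \<in> sparr Y.H' \<longleftrightarrow> b0 \<in> sparr Y.H" by (rule Y.from_shift[OF b(1)]) (use b(2) in "auto simp: hdv_def")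
  obtain a0 where a0: "a' = shift_arrow cx a0" "a0 \<in> arrs X.H" "a' \<in> ordarr X.H' \<longleftrightarrow> a0 \<in> ordarr X.H"
    "a' \<in> sparr X.H' \<longleftrightarrow> a0 \<in> sparr X.H" by (rule X.from_shift[OF a(1)]) (use a(2) in "auto simp: hdv_def")
  show ?thesis using that[of b0 a0] b0 a0 X.shift_pso(3) Y.shift_pso(3) by simp
qed

lemma plus_pull:
  assumes c: "(b', a') \<in> hl_plus Qf X Y" and b: "src Y.H' b' \<in> Y.im" and a: "tgt X.H' a' \<in> X.im"
  obtains b a where "(b, a) \<in> hl_plus Q x y" "b' = shift_arrow cy b" "a' = shift_arrow cx a"
proof -
  obtain b0 a0 where "b' = shift_arrow cy b0" "a' = shift_arrow cx a0" "b0 \<in> arrs Y.H" "a0 \<in> arrs X.H"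
    "b' \<in> ordarr Y.H' \<longleftrightarrow> b0 \<in> ordarr Y.H" "b' \<in> sparr Y.H' \<longleftrightarrow> b0 \<in> sparr Y.H"
    "a' \<in> ordarr X.H' \<longleftrightarrow> a0 \<in> ordarr X.H" "a' \<in> sparr X.H' \<longleftrightarrow> a0 \<in> sparr X.H"
    "snd Y.G' b' = snd Y.G b0" "snd X.G' a' = snd X.G a0" by (rule arrow_pull[OF B.plus_arr(1)[OF c] b B.plus_arr(2)[OF c] a])
  thus ?thesis using that[of b0 a0] c by (simp add: hl_plus_def)
qed

lemma adj_push: "(p, q) \<in> R ==> (F p, F q) \<in> R'"
  using plus_push plus_shift A.plus_arr(1,2) unfolding hl_adj_iff by (metis surj_pair)

lemma adj_pull:
  assumes "p \<in> V" "q \<in> V" "(F p, F q) \<in> R'"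
  shows "(p, q) \<in> R"
proof -
  obtain b' a' where c: "(b', a') \<in> hl_plus Qf X Y"
    "F p = plus_src Qf X Y (b', a') \<and> F q = plus_tgt Qf X Y (b', a') \<or>
     F q = plus_src Qf X Y (b', a') \<and> F p = plus_tgt Qf X Y (b', a')" using assms(3) unfolding hl_adj_iff by auto
  have "src Y.H' b' \<in> Y.im" "tgt X.H' a' \<in> X.im"
    using c(2) F_verts[OF assms(1)] F_verts[OF assms(2)] by (auto simp: plus_src_def plus_tgt_def)
  then obtain b a where "(b, a) \<in> hl_plus Q x y" "b' = shift_arrow cy b" "a' = shift_arrow cx a"
    using plus_pull[OF c(1)] by blast
  thus ?thesis using c(2) plus_shift[OF A.plus_arr(1,2)] unfolding hl_adj_iff by auto
qed

lemma head_pull: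
  assumes "i \<in> verts X.H" "j \<in> verts Y.H"
  shows "enters Qf X (i + cx) r ==> enters Q x i r" (is "PROP ?A") "leaves Qf Y (j + cy) r ==> leaves Q y j r" (is "PROP ?B")
proof -
  show "PROP ?A"
  proof -
    assume "enters Qf X (i + cx) r"
    then obtain a' where a': "a' \<in> ordarr X.H'" "pta X.H' a' = (i + cx, r)" "snd X.G' a' \<notin> sparr Qf" by (auto simp: enters_def)
    have h: "a' \<in> arrs X.H'" "hdv 1 X.H' a' \<in> X.im" using a' assms by (auto simp: arrs_def hdv_def tgt_def)
    obtain a where "a' = shift_arrow cx a" "a \<in> arrs X.H" "a' \<in> ordarr X.H' \<longleftrightarrow> a \<in> ordarr X.H" by (rule X.from_shift[OF h])
    thus ?thesis using a' X.unshift_pso(2)[of a i r] X.shift_pso(3)[of a] X.sparr_eq unfolding enters_def by metis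
  qed
  show "PROP ?B"
  proof -
    assume "leaves Qf Y (j + cy) r"
    then obtain b' where b': "b' \<in> ordarr Y.H'" "pso Y.H' b' = (j + cy, r)" "snd Y.G' b' \<notin> sparr Qf" by (auto simp: leaves_def)
    have h: "b' \<in> arrs Y.H'" "hdv (-1) Y.H' b' \<in> Y.im" using b' assms by (auto simp: arrs_def hdv_def src_def)
    obtain b where "b' = shift_arrow cy b" "b \<in> arrs Y.H" "b' \<in> ordarr Y.H' \<longleftrightarrow> b \<in> ordarr Y.H" by (rule Y.from_shift[OF h])
    thus ?thesis using b' Y.unshift_pso(1)[of b j r] Y.shift_pso(3)[of b] X.sparr_eq unfolding leaves_def by metis
  qed
qed

text \<open>An arrow of an h-line over \<open>Qf\<close> that leaves the image of \<open>V\<close> in exactly one of the two components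
  makes its endpoint in the image red over \<open>Q\<close>.\<close>

lemma no_exit:
  assumes p: "p \<in> V" "\<not> red Q x y p" and e: "(F p, q') \<in> R'"
  shows "q' \<in> F ` V"
proof -
  obtain j i where ji: "p = (j, i)" by (cases p)
  note v = A.hv[OF p(1)[unfolded ji]]
  have im: "j + cy \<in> Y.im" "i + cx \<in> X.im" using v by auto
  have nr: "\<And>r. enters Q x i r ==> enters Q y j r" "\<And>r. leaves Q y j r ==> leaves Q x i r"
    using red_iff[OF A.wx A.wy p(1)[unfolded ji]] p(2) ji by blast+
  obtain b' a' where c: "(b', a') \<in> hl_plus Qf X Y"
    "(j + cy, i + cx) = plus_src Qf X Y (b', a') \<and> q' = plus_tgt Qf X Y (b', a') \<or>
     q' = plus_src Qf X Y (b', a') \<and> (j + cy, i + cx) = plus_tgt Qf X Y (b', a')"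
    using e unfolding hl_adj_iff ji F_simp by auto
  note P = B.plus_arr[OF c(1)]
  have G: "snd Y.G' b' = snd X.G' a'" using c(1) by (simp add: hl_plus_def)
  have sp: "b' \<in> ordarr Y.H' \<longleftrightarrow> a' \<in> ordarr X.H'"
    using c(1) X.polars(2) Y.polars(2) by (auto simp: hl_plus_def polar_def)
  have inside: "src Y.H' b' \<in> Y.im \<and> tgt X.H' a' \<in> X.im"
    using c(2)
  proof
    assume "(j + cy, i + cx) = plus_src Qf X Y (b', a') \<and> q' = plus_tgt Qf X Y (b', a')"
    hence sb: "src Y.H' b' = j + cy" "src X.H' a' = i + cx" by (auto simp: plus_src_def)
    have "tgt X.H' a' \<in> X.im"
    proof (rule ccontr)
      assume "tgt X.H' a' \<notin> X.im"
      hence o: "a' \<in> ordarr X.H'" "a' \<notin> shift_arrow cx ` ordarr X.H" "snd X.G' a' \<notin> sparr Qf"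
        using X.outgoing[OF P(2)] sb im by (auto simp: hdv_def tlv_def)
      \<comment> \<open>The arrow \<open>b'\<close> leaves the vertex already over \<open>Q\<close>.
        As the vertex is not red, some arrow of \<open>H(x)\<close> fills the slot of
        \<open>a'\<close> at \<open>i\<close>, so \<open>a'\<close> would not be an outside
        arrow.\<close>
      have "pso Y.H' b' = (j + cy, spol X.H' a')" using sb P(3) by (simp add: src_def spol_def prod_eq_iff)
      hence "leaves Qf Y (j + cy) (spol X.H' a')" using o sp G by (auto simp: leaves_def)
      hence "leaves Q x i (spol X.H' a')" using head_pull(2) v nr by blast
      then obtain a where "a \<in> ordarr X.H" "half X.H i (spol X.H' a') a" by (auto simp: leaves_def half_def arrs_def)
      thus False using polar_unique[OF X.polars(2) half_src[OF P(2)]] X.shift_half sb(2) o(2) by (metis image_eqI)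
    qed
    thus ?thesis using sb im by simp
  next
    assume "q' = plus_src Qf X Y (b', a') \<and> (j + cy, i + cx) = plus_tgt Qf X Y (b', a')"
    hence sb: "tgt Y.H' b' = j + cy" "tgt X.H' a' = i + cx" by (auto simp: plus_tgt_def)
    have "src Y.H' b' \<in> Y.im"
    proof (rule ccontr)
      assume "src Y.H' b' \<notin> Y.im"
      hence o: "b' \<in> ordarr Y.H'" "b' \<notin> shift_arrow cy ` ordarr Y.H" "snd Y.G' b' \<notin> sparr Qf"
        using Y.outgoing[OF P(1)] sb im by (auto simp: hdv_def tlv_def)
      have "pta X.H' a' = (i + cx, tpol Y.H' b')" using sb P(4) by (simp add: tgt_def tpol_def prod_eq_iff)
      hence "enters Qf X (i + cx) (tpol Y.H' b')" using o sp G by (auto simp: enters_def)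
      hence "enters Q y j (tpol Y.H' b')" using head_pull(1) v nr by blast
      then obtain b where "b \<in> ordarr Y.H" "half Y.H j (tpol Y.H' b') b" by (auto simp: enters_def half_def arrs_def)
      thus False using polar_unique[OF Y.polars(2) half_tgt[OF P(1)]] Y.shift_half sb(1) o(2) by (metis image_eqI)
    qed
    thus ?thesis using sb im by simp
  qed
  obtain b a where ba: "(b, a) \<in> hl_plus Q x y" "b' = shift_arrow cy b" "a' = shift_arrow cx a"
    using plus_pull[OF c(1)] inside by blast
  thus ?thesis using c(2) plus_shift[OF A.plus_arr(1,2)[OF ba(1)]] A.plus_arr(5,6)[OF ba(1)] by auto
qed

text \<open>Prolongation adds no arrow into \<open>i\<close> on the side of \<open>x\<close> and
  none out of \<open>j\<close> on the side of \<open>y\<close>, so it can only remove reasons for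
  being red.\<close>

lemma red_push: "p \<in> V ==> red Qf X Y (F p) ==> red Q x y p"
proof -
  assume p: "p \<in> V" "red Qf X Y (F p)"
  obtain j i where ji: "p = (j, i)" by (cases p)
  note v = A.hv[OF p(1)[unfolded ji]]
  have FV: "(j + cy, i + cx) \<in> V'" using F_verts[OF p(1)] ji by simp
  show ?thesis unfolding ji red_iff[OF A.wx A.wy p(1)[unfolded ji]]
    using p(2) unfolding ji F_simp red_iff[OF B.wx B.wy FV]
    using head_pull[of i j] v X.shift_leaves[of i] Y.shift_enters[of j] by blast
qed

text \<open>Such a vertex has lost its colour through an outside arrow in one of the two components,
  and along this arrow the h-line leaves the image.\<close>

lemma red_exit:
  assumes p: "p \<in> V" "red Q x y p" and pl: "plain Qf X Y (F p)"
  shows "\<exists>q'. (F p, q') \<in> R' \<and> q' \<notin> F ` V"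
proof -
  obtain j i where ji: "p = (j, i)" by (cases p)
  note v = A.hv[OF p(1)[unfolded ji]]
  have FV: "(j + cy, i + cx) \<in> V'" using F_verts[OF p(1)] ji by simp
  note pl' = pl[unfolded ji F_simp]
  obtain r where "enters Q x i r \<and> \<not> enters Q y j r \<or> leaves Q y j r \<and> \<not> leaves Q x i r"
    using p(2) red_iff[OF A.wx A.wy p(1)[unfolded ji]] ji by blast
  thus ?thesis
  proof (elim disjE conjE)
    assume e: "enters Q x i r" "\<not> enters Q y j r"
    then obtain a where a: "a \<in> ordarr X.H" "pta X.H a = (i, r)" "snd X.G a \<notin> sparr Q" by (auto simp: enters_def)
    have aa: "a \<in> arrs X.H" using a by (simp add: arrs_def)
    have ta: "tgt X.H' (shift_arrow cx a) = i + cx" using X.shift_tgt[OF aa] a(2) by (simp add: tgt_def)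
    obtain b' where b': "(b', shift_arrow cx a) \<in> hl_plus Qf X Y" "plus_tgt Qf X Y (b', shift_arrow cx a) = (j + cy, i + cx)"
      using B.plain_enter[OF FV pl' X.ord[OF a(1)] ta] by blast
    note P = B.plus_arr[OF b'(1)]
    have adj: "(F p, plus_src Qf X Y (b', shift_arrow cx a)) \<in> R'" unfolding hl_adj_iff ji F_simp using b' by metis
    have "src Y.H' b' \<notin> Y.im"
    proof
      assume s: "src Y.H' b' \<in> Y.im"
      have "tgt X.H' (shift_arrow cx a) \<in> X.im" using ta v by auto
      then obtain b a1 where b: "(b, a1) \<in> hl_plus Q x y" "b' = shift_arrow cy b" "shift_arrow cx a = shift_arrow cx a1"
        using plus_pull[OF b'(1) s] by blast
      have a1: "a1 = a" using b(3) by simp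
      have bo: "b \<in> ordarr Y.H" using b(1) a(1) X.polars(1) unfolding a1 by (auto simp: hl_plus_def polar_def)
      have "tgt Y.H b = j" using b'(2) Y.shift_tgt[of b] b(2) bo by (simp add: plus_tgt_def arrs_def)
      moreover have "tpol Y.H b = r" using A.plus_arr(4)[OF b(1)] a(2) a1 by (simp add: tpol_def)
      moreover have "snd Y.G b \<notin> sparr Q" using b(1) a(3) a1 by (simp add: hl_plus_def)
      ultimately have "enters Q y j r" using bo unfolding enters_def tgt_def tpol_def by (metis prod.collapse)
      thus False using e(2) by simp
    qed
    thus ?thesis using adj F_image by (auto simp: plus_src_def)
  next
    assume e: "leaves Q y j r" "\<not> leaves Q x i r"
    then obtain b where b: "b \<in> ordarr Y.H" "pso Y.H b = (j, r)" "snd Y.G b \<notin> sparr Q" by (auto simp: leaves_def)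
    have bb: "b \<in> arrs Y.H" using b by (simp add: arrs_def)
    have sb: "src Y.H' (shift_arrow cy b) = j + cy" using Y.shift_src[OF bb] b(2) by (simp add: src_def)
    obtain a' where a': "(shift_arrow cy b, a') \<in> hl_plus Qf X Y" "plus_src Qf X Y (shift_arrow cy b, a') = (j + cy, i + cx)"
      using B.plain_leave[OF FV pl' Y.ord[OF b(1)] sb] by blast
    have adj: "(F p, plus_tgt Qf X Y (shift_arrow cy b, a')) \<in> R'" unfolding hl_adj_iff ji F_simp using a' by metis
    have "tgt X.H' a' \<notin> X.im"
    proof
      assume s: "tgt X.H' a' \<in> X.im"
      have "src Y.H' (shift_arrow cy b) \<in> Y.im" using sb v by auto
      then obtain b1 a where a: "(b1, a) \<in> hl_plus Q x y" "shift_arrow cy b = shift_arrow cy b1" "a' = shift_arrow cx a"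
        using plus_pull[OF a'(1) _ s] by blast
      have b1: "b1 = b" using a(2) by simp
      have ao: "a \<in> ordarr X.H" using a(1) b(1) Y.polars(1) unfolding b1 by (auto simp: hl_plus_def polar_def)
      have "src X.H a = i" using a'(2) X.shift_src[of a] a(3) ao by (simp add: plus_src_def arrs_def)
      moreover have "spol X.H a = r" using A.plus_arr(3)[OF a(1)] b(2) b1 by (simp add: spol_def)
      moreover have "snd X.G a \<notin> sparr Q" using a(1) b(3) b1 by (simp add: hl_plus_def)
      ultimately have "leaves Q x i r" using ao unfolding leaves_def src_def spol_def by (metis prod.collapse)
      thus False using e(2) by simp
    qed
    thus ?thesis using adj F_image by (auto simp: plus_tgt_def)
  qed
qed

lemma orange_iff: "p \<in> V ==> orange Qf X Y (F p) \<longleftrightarrow> orange Q x y p"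
proof
  assume p: "p \<in> V" and o: "orange Qf X Y (F p)"
  then obtain b' a' where c: "(b', a') \<in> hl_cross Qf X Y" "F p = (src Y.H' b', tgt X.H' a')" by (auto simp: orange_def)
  have b: "b' \<in> arrs Y.H'" "src Y.H' b' \<in> Y.im" and a: "a' \<in> arrs X.H'" "tgt X.H' a' \<in> X.im"
    using c F_verts[OF p] by (auto simp: hl_cross_def arrs_def)
  obtain b0 a0 where r: "b' = shift_arrow cy b0" "a' = shift_arrow cx a0" "b0 \<in> arrs Y.H" "a0 \<in> arrs X.H"
    "b' \<in> ordarr Y.H' \<longleftrightarrow> b0 \<in> ordarr Y.H" "b' \<in> sparr Y.H' \<longleftrightarrow> b0 \<in> sparr Y.H"
    "a' \<in> ordarr X.H' \<longleftrightarrow> a0 \<in> ordarr X.H" "a' \<in> sparr X.H' \<longleftrightarrow> a0 \<in> sparr X.H"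
    "snd Y.G' b' = snd Y.G b0" "snd X.G' a' = snd X.G a0" by (rule arrow_pull[OF b a])
  have "(b0, a0) \<in> hl_cross Q x y" using c(1) r X.sparr_eq by (simp add: hl_cross_def)
  moreover have "p = (src Y.H b0, tgt X.H a0)"
    using c(2) r(1,2) Y.shift_src[OF r(3)] X.shift_tgt[OF r(4)] by (simp add: F_def prod_eq_iff)
  ultimately show "orange Q x y p" by (auto simp: orange_def)
next
  assume "orange Q x y p"
  then obtain b a where c: "(b, a) \<in> hl_cross Q x y" "p = (src Y.H b, tgt X.H a)" by (auto simp: orange_def)
  have aa: "a \<in> arrs X.H" "b \<in> arrs Y.H" using c by (auto simp: hl_cross_def arrs_def)
  have "(shift_arrow cy b, shift_arrow cx a) \<in> hl_cross Qf X Y"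
    using c(1) X.ord[of a] Y.ord[of b] X.shift_pso(3)[OF aa(1)] Y.shift_pso(3)[OF aa(2)] X.sparr_eq by (auto simp: hl_cross_def)
  moreover have "F p = (src Y.H' (shift_arrow cy b), tgt X.H' (shift_arrow cx a))"
    using c(2) Y.shift_src[OF aa(2)] X.shift_tgt[OF aa(1)] by simp
  ultimately show "orange Qf X Y (F p)" by (auto simp: orange_def)
qed

lemma purple_iff: "p \<in> V ==> purple Qf X Y (F p) \<longleftrightarrow> purple Q x y p"
proof
  assume p: "p \<in> V" and o: "purple Qf X Y (F p)"
  \<comment> \<open>With this, both kinds of purple vertices are given by a source in
    \<open>Y\<close> and a target in \<open>X\<close>, as \<open>arrow_pull\<close>
    requires.\<close>
  have tl: "tgt Y.H' b = src Y.H' b" if "b \<in> sparr Y.H'" for b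
    using that Y.polars(2) by (simp add: polar_def src_def tgt_def)
  from o obtain b' a' where c: "(b', a') \<in> hl_ominus Qf X Y \<or> (b', a') \<in> hl_oplus Qf X Y" "F p = (src Y.H' b', tgt X.H' a')"
  proof -
    show ?thesis
    proof (cases "\<exists>c\<in>hl_ominus Qf X Y. F p = (src Y.H' (fst c), tgt X.H' (snd c))")
      case True
      then obtain c where "c \<in> hl_ominus Qf X Y" "F p = (src Y.H' (fst c), tgt X.H' (snd c))" by blast
      thus ?thesis using that[of "fst c" "snd c"] by simp
    next
      case False
      then obtain c where c: "c \<in> hl_oplus Qf X Y" "F p = (tgt Y.H' (fst c), tgt X.H' (snd c))"
        using o unfolding purple_def by auto
      hence "fst c \<in> sparr Y.H'" by (auto simp: hl_oplus_def)
      thus ?thesis using that[of "fst c" "snd c"] c tl by simp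
    qed
  qed
  have b: "b' \<in> arrs Y.H'" "src Y.H' b' \<in> Y.im" and a: "a' \<in> arrs X.H'" "tgt X.H' a' \<in> X.im"
    using c F_verts[OF p] by (auto simp: hl_ominus_def hl_oplus_def arrs_def)
  obtain b0 a0 where r: "b' = shift_arrow cy b0" "a' = shift_arrow cx a0" "b0 \<in> arrs Y.H" "a0 \<in> arrs X.H"
    "b' \<in> ordarr Y.H' \<longleftrightarrow> b0 \<in> ordarr Y.H" "b' \<in> sparr Y.H' \<longleftrightarrow> b0 \<in> sparr Y.H"
    "a' \<in> ordarr X.H' \<longleftrightarrow> a0 \<in> ordarr X.H" "a' \<in> sparr X.H' \<longleftrightarrow> a0 \<in> sparr X.H"
    "snd Y.G' b' = snd Y.G b0" "snd X.G' a' = snd X.G a0" by (rule arrow_pull[OF b a])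
  have pe: "p = (src Y.H b0, tgt X.H a0)"
    using c(2) r(1,2) Y.shift_src[OF r(3)] X.shift_tgt[OF r(4)] by (simp add: F_def prod_eq_iff)
  from c(1) show "purple Q x y p"
  proof
    assume "(b', a') \<in> hl_ominus Qf X Y"
    hence "(b0, a0) \<in> hl_ominus Q x y" using r by (simp add: hl_ominus_def)
    thus ?thesis using pe by (auto simp: purple_def)
  next
    assume "(b', a') \<in> hl_oplus Qf X Y"
    hence "(b0, a0) \<in> hl_oplus Q x y" using r by (simp add: hl_oplus_def)
    moreover hence "tgt Y.H b0 = src Y.H b0" using Y.polars(1) by (simp add: hl_oplus_def polar_def src_def tgt_def)
    ultimately show ?thesis using pe unfolding purple_def by (intro disjI2 bexI[of _ "(b0, a0)"]) simp_all
  qed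
next
  assume "purple Q x y p"
  then consider b a where "(b, a) \<in> hl_ominus Q x y" "p = (src Y.H b, tgt X.H a)"
    | b a where "(b, a) \<in> hl_oplus Q x y" "p = (tgt Y.H b, tgt X.H a)" by (auto simp: purple_def)
  thus "purple Qf X Y (F p)"
  proof cases
    case (1 b a)
    have aa: "a \<in> arrs X.H" "b \<in> arrs Y.H" using 1 by (auto simp: hl_ominus_def arrs_def)
    have "(shift_arrow cy b, shift_arrow cx a) \<in> hl_ominus Qf X Y"
      using 1(1) X.sparr_fix[of a] X.sparr Y.ord[of b] X.shift_pso(3)[OF aa(1)] Y.shift_pso(3)[OF aa(2)] by (auto simp: hl_ominus_def)
    moreover have "F p = (src Y.H' (shift_arrow cy b), tgt X.H' (shift_arrow cx a))"
      using 1(2) Y.shift_src[OF aa(2)] X.shift_tgt[OF aa(1)] by simp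
    ultimately show ?thesis by (auto simp: purple_def)
  next
    case (2 b a)
    have aa: "a \<in> arrs X.H" "b \<in> arrs Y.H" using 2 by (auto simp: hl_oplus_def arrs_def)
    have "(shift_arrow cy b, shift_arrow cx a) \<in> hl_oplus Qf X Y"
      using 2(1) Y.sparr_fix[of b] Y.sparr X.ord[of a] X.shift_pso(3)[OF aa(1)] Y.shift_pso(3)[OF aa(2)] by (auto simp: hl_oplus_def)
    moreover have "F p = (tgt Y.H' (shift_arrow cy b), tgt X.H' (shift_arrow cx a))"
      using 2(2) Y.shift_tgt[OF aa(2)] X.shift_tgt[OF aa(1)] by simp
    ultimately show ?thesis by (auto simp: purple_def)
  qed
qed

text \<open>The analogue of \<open>lands_inside\<close> for h-lines: \<open>plain_enter\<close> and
  \<open>plain_leave\<close> take the role of lifting heads, and the absence of boundary vertices in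
  a kiss takes the role of (K).\<close>

lemma kiss_inside:
  assumes K: "C \<in> kisses Qf X Y"
  shows "C \<subseteq> F ` V"
proof
  have Kp: "\<And>q. q \<in> C ==> plain Qf X Y q" and Kb: "\<And>j i. (j, i) \<in> C ==> \<not> boundary Y.H' j \<and> \<not> boundary X.H' i"
    using K unfolding B.kisses_iff B.real_hlines_iff by auto
  obtain p where p: "p \<in> V'" "C = R'\<^sup>* `` {p}" using K unfolding B.kisses_iff B.real_hlines_iff by blast
  have CV: "C \<subseteq> V'" using B.reach_verts p by blast
  have cl: "q \<in> C ==> (q, q') \<in> R' ==> q' \<in> C" for q q' using p(2) by (auto intro: rtrancl_into_rtrancl)
  obtain \<mu> :: "nat \<Rightarrow> nat" where \<mu>: "\<And>i. i \<in> verts X.H' - X.im ==> boundary X.H' i \<or>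
     (\<exists>a\<in>ordarr X.H'. hdv 1 X.H' a = i \<and> tlv 1 X.H' a \<in> verts X.H' - X.im \<and> \<mu> (tlv 1 X.H' a) < \<mu> i)"
    using X.drain unfolding drains_def by blast
  obtain \<nu> :: "nat \<Rightarrow> nat" where \<nu>: "\<And>j. j \<in> verts Y.H' - Y.im ==> boundary Y.H' j \<or>
     (\<exists>b\<in>ordarr Y.H'. hdv (-1) Y.H' b = j \<and> tlv (-1) Y.H' b \<in> verts Y.H' - Y.im \<and> \<nu> (tlv (-1) Y.H' b) < \<nu> j)"
    using Y.drain unfolding drains_def by blast
  have ix: False if "n = \<mu> i" "(j, i) \<in> C" "i \<notin> X.im" for n j i
    using that
  proof (induction n arbitrary: j i rule: less_induct)
    case (less n)
    have v: "(j, i) \<in> V'" using less.prems CV by blast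
    have "i \<in> verts X.H' - X.im" using B.hv[OF v] less.prems by blast
    then obtain a where a: "a \<in> ordarr X.H'" "tgt X.H' a = i" "src X.H' a \<notin> X.im" "\<mu> (src X.H' a) < \<mu> i"
      using \<mu>[of i] Kb[OF less.prems(2)] unfolding hdv_def tlv_def by auto
    obtain b where b: "(b, a) \<in> hl_plus Qf X Y" "plus_tgt Qf X Y (b, a) = (j, i)"
      using B.plain_enter[OF v Kp[OF less.prems(2)] a(1,2)] by blast
    have "((j, i), plus_src Qf X Y (b, a)) \<in> R'" unfolding hl_adj_iff using b by metis
    hence "(src Y.H' b, src X.H' a) \<in> C" using cl[OF less.prems(2)] by (simp add: plus_src_def)
    thus False using less.IH[of "\<mu> (src X.H' a)"] a(3,4) less.prems(1) by blast
  qed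
  have jy: False if "n = \<nu> j" "(j, i) \<in> C" "j \<notin> Y.im" for n j i
    using that
  proof (induction n arbitrary: j i rule: less_induct)
    case (less n)
    have v: "(j, i) \<in> V'" using less.prems CV by blast
    have "j \<in> verts Y.H' - Y.im" using B.hv[OF v] less.prems by blast
    then obtain b where b: "b \<in> ordarr Y.H'" "src Y.H' b = j" "tgt Y.H' b \<notin> Y.im" "\<nu> (tgt Y.H' b) < \<nu> j"
      using \<nu>[of j] Kb[OF less.prems(2)] unfolding hdv_def tlv_def by auto
    obtain a where a: "(b, a) \<in> hl_plus Qf X Y" "plus_src Qf X Y (b, a) = (j, i)"
      using B.plain_leave[OF v Kp[OF less.prems(2)] b(1,2)] by blast
    have "((j, i), plus_tgt Qf X Y (b, a)) \<in> R'" unfolding hl_adj_iff using a by metis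
    hence "(tgt Y.H' b, tgt X.H' a) \<in> C" using cl[OF less.prems(2)] by (simp add: plus_tgt_def)
    thus False using less.IH[of "\<nu> (tgt Y.H' b)"] b(3,4) less.prems(1) by blast
  qed
  fix q assume q: "q \<in> C"
  obtain j i where ji: "q = (j, i)" by (cases q)
  have "fst q \<in> Y.im" "snd q \<in> X.im" using ix[OF refl, of j i] jy[OF refl, of j i] q ji by auto
  thus "q \<in> F ` V" using F_image q CV by blast
qed

text \<open>Components correspond by \<open>rtrancl_image_eq\<close>. The component above a real
  h-line stays in the image by \<open>no_exit\<close>, and a kiss stays there by
  \<open>kiss_inside\<close>. Below a kiss there is no red vertex, since by \<open>red_exit\<close>
  the kiss would otherwise leave the image.\<close>

theorem kisses_bij: "bij_betw ((`) F) (real_hlines Q x y) (kisses Qf X Y)"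
proof (rule bij_betw_imageI)
  have "inj F" by (rule injI) simp
  thus "inj_on ((`) F) (real_hlines Q x y)" by (meson inj_image_eq_iff inj_onI)
  show "(`) F ` real_hlines Q x y = kisses Qf X Y"
  proof
    show "(`) F ` real_hlines Q x y \<subseteq> kisses Qf X Y"
    proof
      fix C' assume "C' \<in> (`) F ` real_hlines Q x y"
      then obtain p C where C: "C' = F ` C" "p \<in> V" "C = R\<^sup>* `` {p}" "\<And>q. q \<in> C ==> plain Q x y q"
        unfolding A.real_hlines_iff by (metis (no_types, lifting) A.real_hlines_iff imageE)
      have CV: "C \<subseteq> V" using A.reach_verts C by blast
      have "R'\<^sup>* `` {F p} = F ` (R\<^sup>* `` {p})"
      proof (rule rtrancl_image_eq)
        fix q q' assume "(p, q) \<in> R\<^sup>*"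
        hence q: "q \<in> C" "q \<in> V" "\<not> red Q x y q" using C CV by (auto simp: plain_def)
        show "(F q, q') \<in> R' \<longleftrightarrow> (\<exists>r. q' = F r \<and> (q, r) \<in> R)"
        proof
          assume e: "(F q, q') \<in> R'"
          then obtain r where "r \<in> V" "q' = F r" using no_exit[OF q(2,3)] by blast
          thus "\<exists>r. q' = F r \<and> (q, r) \<in> R" using adj_pull[OF q(2)] e by blast
        qed (use adj_push in blast)
      qed
      hence C'R: "C' = R'\<^sup>* `` {F p}" using C by simp
      moreover have "plain Qf X Y q'" if "q' \<in> C'" for q'
        using that C CV red_push orange_iff purple_iff unfolding plain_def by blast
      ultimately have "C' \<in> real_hlines Qf X Y" unfolding B.real_hlines_iff using F_verts[OF C(2)] by blast
      moreover have "\<not> boundary Y.H' j \<and> \<not> boundary X.H' i" if "(j, i) \<in> C'" for j i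
      proof -
        have "(j, i) \<in> F ` V" using that C(1) CV by blast
        thus ?thesis using F_image[of "(j, i)"] X.im_inner[of i] Y.im_inner[of j] by simp
      qed
      ultimately show "C' \<in> kisses Qf X Y" unfolding B.kisses_iff by blast
    qed
    show "kisses Qf X Y \<subseteq> (`) F ` real_hlines Q x y"
    proof
      fix C' assume K: "C' \<in> kisses Qf X Y"
      obtain p' where p': "p' \<in> V'" "C' = R'\<^sup>* `` {p'}" using K unfolding B.kisses_iff B.real_hlines_iff by blast
      have pl: "\<And>q. q \<in> C' ==> plain Qf X Y q" using K unfolding B.kisses_iff B.real_hlines_iff by blast
      have ins: "C' \<subseteq> F ` V" by (rule kiss_inside[OF K])
      have "p' \<in> C'" using p'(2) by blast
      then obtain p where p: "p \<in> V" "p' = F p" using ins by blast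
      have cl: "q \<in> C' ==> (q, q') \<in> R' ==> q' \<in> C'" for q q' using p'(2) by (auto intro: rtrancl_into_rtrancl)
      have mem: "F q \<in> C' \<and> q \<in> V" if "(p, q) \<in> R\<^sup>*" for q
        using that
      proof (induction rule: rtrancl_induct)
        case base
        thus ?case using \<open>p' \<in> C'\<close> p by simp
      next
        case (step q r)
        thus ?case using cl adj_push A.adj_verts by blast
      qed
      have "R'\<^sup>* `` {F p} = F ` (R\<^sup>* `` {p})"
      proof (rule rtrancl_image_eq)
        fix q q' assume q: "(p, q) \<in> R\<^sup>*"
        show "(F q, q') \<in> R' \<longleftrightarrow> (\<exists>r. q' = F r \<and> (q, r) \<in> R)"
        proof
          assume e: "(F q, q') \<in> R'"
          hence "q' \<in> C'" using cl mem[OF q] by blast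
          then obtain r where "r \<in> V" "q' = F r" using ins by blast
          thus "\<exists>r. q' = F r \<and> (q, r) \<in> R" using adj_pull[of q r] mem[OF q] e by blast
        qed (use adj_push in blast)
      qed
      hence "C' = F ` (R\<^sup>* `` {p})" using p'(2) p(2) by simp
      moreover have "plain Q x y q" if "q \<in> R\<^sup>* `` {p}" for q
      proof -
        have q: "F q \<in> C'" "q \<in> V" using mem that by blast+
        have "\<not> red Q x y q" using red_exit[OF q(2) _ pl[OF q(1)]] cl[OF q(1)] ins by blast
        thus ?thesis using pl[OF q(1)] orange_iff[OF q(2)] purple_iff[OF q(2)] by (simp add: plain_def)
      qed
      ultimately show "C' \<in> (`) F ` real_hlines Q x y" unfolding A.real_hlines_iff using p(1)
        by (metis (mono_tags, lifting) A.real_hlines_iff image_eqI)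
    qed
  qed
qed

end

theorem proposition4p18:
  fixes Q Qf :: "('v, 'a) pquiver" and x y :: "('v, 'a) word"
  assumes "fringing Q Qf" and "x \<in> Adm Q" and "y \<in> Adm Q"
  shows
    "(\<not> projective Q y \<longrightarrow>
       (\<forall>T\<in>H_triples Q x (tau Q y). triple_map Q Qf x y T \<in> K_triples Qf (tau Qf x) (tau Qf y)) \<and>
       (\<forall>T\<in>H_triples Q x (tau Q y). \<forall>T'\<in>H_triples Q x (tau Q y).
          triple_equiv T T' \<longrightarrow> triple_equiv (triple_map Q Qf x y T) (triple_map Q Qf x y T')) \<and>
       bij_betw (class_map Q Qf x y)
         (H_classes Q x (tau Q y)) (K_classes Qf (tau Qf x) (tau Qf y)) \<and>
       (\<forall>C\<in>H_classes Q x (tau Q y). \<forall>ty.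
          class_has_gtype (class_map Q Qf x y C) ty \<longleftrightarrow> class_has_gtype C ty)) \<and>
     (projective Q y \<longrightarrow> K_classes Qf (tau Qf x) (tau Qf y) = {}) \<and>
     (\<not> projective Q y \<longrightarrow>
       bij_betw (hline_map Q Qf x y)
         (real_hlines Q x (tau Q y)) (kisses Qf (tau Qf x) (tau Qf y)))"
proof -
  interpret fringed Q Qf by unfold_locales (rule assms(1))
  show ?thesis
  proof (cases "projective Q y")
    case True
    have "K_triples Qf (tau Qf x) (tau Qf y) = {}"
      by (rule drains_no_K_triples[OF projective_drains[OF assms(3) True]])
    thus ?thesis using True by (simp add: K_classes_def)
  next
    case False
    obtain cx where cx: "pi_emb Qf x = shift cx" "embedded Q Qf 1 x (tau Qf x) cx" by (rule pi_embedded[OF assms(2)])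
    obtain cy where cy: "sigma_emb Q y = shift cy" "embedded Q Qf (-1) (tau Q y) (tau Qf y) cy"
      by (rule sigma_embedded[OF assms(3) False])
    interpret P: embedded_pair Q Qf x "tau Qf x" cx "tau Q y" "tau Qf y" cy
      by (intro embedded_pair.intro cx(2) cy(2))
    have tm: "triple_map Q Qf x y = P.push" by (rule ext) (simp add: triple_map_def P.push_def cx cy)
    have cm: "class_map Q Qf x y = (\<lambda>C. equiv_on (K_triples Qf (tau Qf x) (tau Qf y)) `` (P.push ` C))"
      by (rule ext) (simp add: class_map_def tm)
    have hm: "hline_map Q Qf x y = (`) P.F"
      by (rule ext) (auto simp: hline_map_def cx cy P.F_def map_prod_def intro!: image_cong)
    show ?thesis unfolding tm cm hm
      using False P.push_K_triple P.push_equiv P.push_bij P.push_gtype P.kisses_bij by blast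
  qed
qed

end
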